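(* Let $S$ be a $d$-set in $\mathbb{R}^n$ with $n-1<d<n$. Let $1<p<\infty$, $k\in\mathbb{N}$ and $0<\alpha<k$. Then, for every function $f\in L^p(S)$, the extension $\tilde f=\mathrm{Ext}_{k,S}f$ (constructed with parameter $\Delta=16000$) satisfies $$\bigg\|\sum_{j=0}^\infty2^{j\alpha}\mathcal{E}_k(\tilde f,Q(\cdot,2^{-j}))_{L^1(\mathbb{R}^n)}\bigg\|_{L^p(\mathbb{R}^n)}+\|\tilde f\|_{L^p(\mathbb{R}^n)}$$ $$\le c\bigg\{\bigg(\sum_{j=0}^\infty\big(2^{j(\alpha-(n-d)/p)}\|\mathcal{E}_k(f,Q(\cdot,2^{-j}))_{L^1(S)}\|_{L^p(S)}\big)^p\bigg)^{1/p}+\|f\|_{L^p(S)}\bigg\}.$$ Here the constant $c$ depends on $S,n,k,p$ and $\alpha$ (not on $f$).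
   Context: $Q(x,r)=\{y\in\mathbb{R}^n:\|y-x\|_\infty\le r\}$ is the closed cube with center $x$ and side length $2r$; for a cube $Q=Q(x_Q,r_Q)$, $tQ=Q(x_Q,tr_Q)$. $\mathrm{dist}$ and $\mathrm{diam}$ are taken in the supremum metric. $\mathcal{H}^d$ is the $d$-dimensional Hausdorff measure. A (nonempty) closed set $S\subset\mathbb{R}^n$ is a $d$-set if there are constants $c_1,c_2>0$ such that $c_1r^d\le\mathcal{H}^d(Q(w,r)\cap S)\le c_2r^d$ for all $w\in S$, $0<r\le1$. $L^p(S)$ is taken with respect to $\mathcal{H}^d|_S$. $\mathcal{P}_m$ is the space of polynomials on $\mathbb{R}^n$ of degree at most $m$ ($\mathcal{P}_{-1}=\{0\}$). For a cube $Q$, $$\mathcal{E}_k(g,Q)_{L^1(\mathbb{R}^n)}:=\inf_{P\in\mathcal{P}_{k-1}}\frac1{|Q|}\int_Q|g-P|\,dx,$$ and for a cube $Q$ centered in $S$, $$\mathcal{E}_k(f,Q)_{L^1(S)}:=\inf_{P\in\mathcal{P}_{k-1}}\frac{1}{\mathcal{H}^d(Q\cap S)}\int_{Q\cap S}|f-P|\,d\mathcal{H}^d.$$ Norms of $\mathcal{E}_k(\cdot,Q(\cdot,t))$ are taken with respect to the center of the cube. Extension operator (with parameter $\Delta>0$). Let $\mathcal{W}_S$ be a Whitney decomposition of $\mathbb{R}^n\setminus S$: a family of closed dyadic cubes with pairwise disjoint interiors, $\mathbb{R}^n\setminus S=\bigcup_{Q\in\mathcal{W}_S}Q$, and $\mathrm{diam}\,Q\le\mathrm{dist}(Q,S)\le4\,\mathrm{diam}\,Q$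 for $Q\in\mathcal{W}_S$. Let $\{\varphi_Q\}_{Q\in\mathcal{W}_S}$ be a standard smooth partition of unity subordinate to it: $0\le\varphi_Q\le1$, $\sum_Q\varphi_Q=\chi_{\mathbb{R}^n\setminus S}$, $\mathrm{supp}\,\varphi_Q\subset\frac98Q$, and $|\partial^\beta\varphi_Q|\le c_{n,\beta}(\mathrm{diam}\,Q)^{-|\beta|}$. For $Q=Q(x_Q,r_Q)\in\mathcal{W}_S$ choose $a_Q\in S$ with $\|x_Q-a_Q\|_\infty=\mathrm{dist}(x_Q,S)$ and let $a(Q):=Q(a_Q,r_Q/2)$. For a cube $K$ centered in $S$ and $m\ge0$ let $P_{m,K}:L^1(K\cap S)\to\mathcal{P}_m$ be the projection $P_{m,K}f=\sum_{|\beta|\le m}\big(\int_{K\cap S}fP_\beta\,d\mathcal{H}^d\big)P_\beta$, where $\{P_\beta\}_{|\beta|\le m}$ is an orthonormal basis of $\mathcal{P}_m$ for the inner product $\langle g,h\rangle=\int_{K\cap S}gh\,d\mathcal{H}^d$ (this is an inner product on $\mathcal{P}_m$ since $d>n-1$). For $Q\in\mathcal{W}_S$ let $P_{m,Q}:=P_{m,a(Q)}$ if $\mathrm{diam}\,Q\le\Delta$ and $P_{m,Q}:=0$ if $\mathrm{diam}\,Q>\Delta$. For $f\in L^1_{\mathrm{loc}}(S)$ and $k\in\mathbb{N}$ define $$\mathrm{Ext}_{k,S}f(x):=\begin{cases}f(x),&x\in S,\\ \sum_{Q\in\mathcal{W}_S}\varphi_Q(x)\,P_{k-1,Q}f(x),&x\in\mathbb{R}^n\setminus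 S.\end{cases}$$ *)

theory Defs
  imports "HOL-Analysis.Analysis"
begin

section \<open>The supremum metric\<close>

definition cube :: "real ^ 'n \<Rightarrow> real \<Rightarrow> (real ^ 'n) set" where
  "cube x r = {y. infnorm (y - x) \<le> r}"

definition sup_diam :: "(real ^ 'n) set \<Rightarrow> ennreal" where
  "sup_diam A = (SUP x\<in>A. SUP y\<in>A. ennreal (infnorm (x - y)))"

definition sup_dist :: "(real ^ 'n) set \<Rightarrow> (real ^ 'n) set \<Rightarrow> ennreal" where
  "sup_dist A B = (INF x\<in>A. INF y\<in>B. ennreal (infnorm (x - y)))"

section \<open>Hausdorff measure and d-sets\<close>

text \<open>Powers of extended nonnegative reals; only meant for exponents \<open>p > 0\<close>.\<close>

definition ennreal_powr :: "ennreal \<Rightarrow> real \<Rightarrow> ennreal" where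
  "ennreal_powr x p = (if x = \<infinity> then \<infinity> else ennreal (enn2real x powr p))"

text \<open>
  Diameters of the covering sets are taken in the supremum metric, and no normalising factor is
  used. Only meant for \<open>d > 0\<close>.
\<close>

definition hausdorff_outer :: "real \<Rightarrow> (real ^ 'n) set \<Rightarrow> ennreal" where
  "hausdorff_outer d A =
     (SUP \<delta>\<in>{0<..}. INF U\<in>{U :: nat \<Rightarrow> (real ^ 'n) set.
        A \<subseteq> (\<Union>i. U i) \<and> (\<forall>i. sup_diam (U i) \<le> ennreal \<delta>)}.
        \<Sum>i. ennreal_powr (sup_diam (U i)) d)"

text \<open>The measure lives on the sigma-algebra of all Caratheodory-measurable sets.\<close>

definition hausdorff_measure :: "real \<Rightarrow> (real ^ 'n) measure" where
  "hausdorff_measure d =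
     measure_of UNIV (lambda_system UNIV UNIV (hausdorff_outer d)) (hausdorff_outer d)"

definition d_set :: "real \<Rightarrow> (real ^ 'n) set \<Rightarrow> bool" where
  "d_set d S \<longleftrightarrow> S \<noteq> {} \<and> closed S \<and>
     (\<exists>c1>0. \<exists>c2>0. \<forall>w\<in>S. \<forall>r. 0 < r \<and> r \<le> 1 \<longrightarrow>
        ennreal (c1 * r powr d) \<le> emeasure (hausdorff_measure d) (cube w r \<inter> S) \<and>
        emeasure (hausdorff_measure d) (cube w r \<inter> S) \<le> ennreal (c2 * r powr d))"

section \<open>Lebesgue norms\<close>

definition Lp_norm :: "real \<Rightarrow> 'a measure \<Rightarrow> 'a set \<Rightarrow> ('a \<Rightarrow> ennreal) \<Rightarrow> ennreal" where
  "Lp_norm p \<mu> A F = ennreal_powr (\<integral>\<^sup>+x\<in>A. ennreal_powr (F x) p \<partial>\<mu>) (1 / p)"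

text \<open>Functions on \<open>A\<close> are represented by total functions whose values off \<open>A\<close> are irrelevant.\<close>

definition Lp_space :: "real \<Rightarrow> 'a measure \<Rightarrow> 'a set \<Rightarrow> ('a \<Rightarrow> real) set" where
  "Lp_space p \<mu> A = {f. f \<in> borel_measurable (restrict_space \<mu> A) \<and>
     Lp_norm p \<mu> A (\<lambda>x. ennreal \<bar>f x\<bar>) < \<infinity>}"

section \<open>Polynomials and local approximation\<close>

definition multi_index_order :: "('n::finite \<Rightarrow> nat) \<Rightarrow> nat" where
  "multi_index_order \<beta> = (\<Sum>i\<in>UNIV. \<beta> i)"

text \<open>An integer degree bound, so that the space for \<open>m = -1\<close> is the zero space.\<close>

definition poly_space :: "int \<Rightarrow> (real ^ 'n \<Rightarrow> real) set" where
  "poly_space m = {P. \<exists>c :: ('n \<Rightarrow> nat) \<Rightarrow> real. \<forall>x.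
     P x = (\<Sum>\<beta> | int (multi_index_order \<beta>) \<le> m. c \<beta> * (\<Prod>i\<in>UNIV. (x $ i) ^ \<beta> i))}"

text \<open>
  With \<open>\<mu> = lebesgue\<close> and \<open>A = Q\<close> this is the local approximation on the whole space, with
  \<open>\<mu> = hausdorff_measure d\<close> and \<open>A = Q \<inter> S\<close> it is the one on \<open>S\<close>.
\<close>

definition local_approx ::
    "nat \<Rightarrow> (real ^ 'n) measure \<Rightarrow> (real ^ 'n \<Rightarrow> real) \<Rightarrow> (real ^ 'n) set \<Rightarrow> ennreal" where
  "local_approx k \<mu> g A =
     (INF P\<in>poly_space (int k - 1). (\<integral>\<^sup>+x\<in>A. ennreal \<bar>g x - P x\<bar> \<partial>\<mu>) / emeasure \<mu> A)"

definition orthonormal_poly_basis ::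
    "(real ^ 'n) measure \<Rightarrow> (real ^ 'n) set \<Rightarrow> int \<Rightarrow>
     (('n \<Rightarrow> nat) \<Rightarrow> real ^ 'n \<Rightarrow> real) \<Rightarrow> bool" where
  "orthonormal_poly_basis \<mu> A m B \<longleftrightarrow>
     (\<forall>\<beta>. int (multi_index_order \<beta>) \<le> m \<longrightarrow> B \<beta> \<in> poly_space m) \<and>
     (\<forall>\<beta> \<gamma>. int (multi_index_order \<beta>) \<le> m \<and> int (multi_index_order \<gamma>) \<le> m \<longrightarrow>
        (LINT x:A|\<mu>. B \<beta> x * B \<gamma> x) = (if \<beta> = \<gamma> then 1 else 0)) \<and>
     (\<forall>P\<in>poly_space m. \<exists>c. \<forall>x. P x = (\<Sum>\<beta> | int (multi_index_order \<beta>) \<le> m. c \<beta> * B \<beta> x))"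

text \<open>The projection does not depend on the orthonormal basis that is chosen.\<close>

definition poly_proj ::
    "(real ^ 'n) measure \<Rightarrow> (real ^ 'n) set \<Rightarrow> int \<Rightarrow> (real ^ 'n \<Rightarrow> real) \<Rightarrow> real ^ 'n \<Rightarrow> real" where
  "poly_proj \<mu> A m f x =
     (let B = (SOME B. orthonormal_poly_basis \<mu> A m B)
      in \<Sum>\<beta> | int (multi_index_order \<beta>) \<le> m. (LINT y:A|\<mu>. f y * B \<beta> y) * B \<beta> x)"

section \<open>Whitney decompositions and the extension operator\<close>

text \<open>Whitney cubes are given as pairs of centre and radius (half the side length).\<close>

definition dyadic_cube :: "(real ^ 'n) \<times> real \<Rightarrow> bool" where
  "dyadic_cube Q \<longleftrightarrow> (\<exists>(j::int) (m :: 'n \<Rightarrow> int).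
     fst Q = (\<chi> i. (real_of_int (m i) + 1 / 2) * 2 powi (- j)) \<and> snd Q = 2 powi (- j) / 2)"

definition whitney_decomposition :: "(real ^ 'n) set \<Rightarrow> ((real ^ 'n) \<times> real) set \<Rightarrow> bool" where
  "whitney_decomposition S W \<longleftrightarrow>
     (\<forall>Q\<in>W. dyadic_cube Q) \<and>
     pairwise (\<lambda>Q R. interior (cube (fst Q) (snd Q)) \<inter> interior (cube (fst R) (snd R)) = {}) W \<and>
     - S = (\<Union>Q\<in>W. cube (fst Q) (snd Q)) \<and>
     (\<forall>Q\<in>W. sup_diam (cube (fst Q) (snd Q)) \<le> sup_dist (cube (fst Q) (snd Q)) S \<and>
            sup_dist (cube (fst Q) (snd Q)) S \<le> 4 * sup_diam (cube (fst Q) (snd Q)))"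

definition partial_deriv :: "'n \<Rightarrow> (real ^ 'n \<Rightarrow> real) \<Rightarrow> real ^ 'n \<Rightarrow> real" where
  "partial_deriv i g x = deriv (\<lambda>t. g (x + t *\<^sub>R axis i 1)) 0"

text \<open>
  Mixed partial derivatives are indexed by lists of coordinate directions; the multi-index belonging
  to a list \<open>is\<close> is \<open>count_list is\<close>, and its order is \<open>length is\<close>.
\<close>

definition mixed_partial :: "'n list \<Rightarrow> (real ^ 'n \<Rightarrow> real) \<Rightarrow> real ^ 'n \<Rightarrow> real" where
  "mixed_partial is g = foldr partial_deriv is g"

definition smooth :: "(real ^ 'n \<Rightarrow> real) \<Rightarrow> bool" where
  "smooth g \<longleftrightarrow> (\<forall>is x. mixed_partial is g differentiable (at x))"

text \<open>\<open>C \<beta>\<close> is the constant in the bound for the derivative with multi-index \<open>\<beta>\<close>.\<close>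

definition whitney_partition_of_unity ::
    "(('n \<Rightarrow> nat) \<Rightarrow> real) \<Rightarrow> (real ^ 'n) set \<Rightarrow> ((real ^ 'n) \<times> real) set \<Rightarrow>
     ((real ^ 'n) \<times> real \<Rightarrow> real ^ 'n \<Rightarrow> real) \<Rightarrow> bool" where
  "whitney_partition_of_unity C S W \<phi> \<longleftrightarrow>
     (\<forall>Q\<in>W. smooth (\<phi> Q) \<and> (\<forall>x. 0 \<le> \<phi> Q x \<and> \<phi> Q x \<le> 1) \<and>
        closure {x. \<phi> Q x \<noteq> 0} \<subseteq> cube (fst Q) (9 / 8 * snd Q) \<and>
        (\<forall>is x. ennreal \<bar>mixed_partial is (\<phi> Q) x\<bar>
           \<le> ennreal (C (count_list is)) / sup_diam (cube (fst Q) (snd Q)) ^ length is)) \<and>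
     (\<forall>x. ((\<lambda>Q. \<phi> Q x) has_sum indicat_real (- S) x) W)"

definition nearest_points ::
    "(real ^ 'n) set \<Rightarrow> ((real ^ 'n) \<times> real) set \<Rightarrow> ((real ^ 'n) \<times> real \<Rightarrow> real ^ 'n) \<Rightarrow> bool" where
  "nearest_points S W a \<longleftrightarrow>
     (\<forall>Q\<in>W. a Q \<in> S \<and> ennreal (infnorm (fst Q - a Q)) = sup_dist {fst Q} S)"

definition whitney_proj ::
    "real \<Rightarrow> real \<Rightarrow> (real ^ 'n) set \<Rightarrow> ((real ^ 'n) \<times> real \<Rightarrow> real ^ 'n) \<Rightarrow> int \<Rightarrow>
     (real ^ 'n) \<times> real \<Rightarrow> (real ^ 'n \<Rightarrow> real) \<Rightarrow> real ^ 'n \<Rightarrow> real" where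
  "whitney_proj \<Delta> d S a m Q f x =
     (if sup_diam (cube (fst Q) (snd Q)) \<le> ennreal \<Delta>
      then poly_proj (hausdorff_measure d) (cube (a Q) (snd Q / 2) \<inter> S) m f x
      else 0)"

definition whitney_ext ::
    "real \<Rightarrow> real \<Rightarrow> (real ^ 'n) set \<Rightarrow> ((real ^ 'n) \<times> real) set \<Rightarrow>
     ((real ^ 'n) \<times> real \<Rightarrow> real ^ 'n \<Rightarrow> real) \<Rightarrow> ((real ^ 'n) \<times> real \<Rightarrow> real ^ 'n) \<Rightarrow> nat \<Rightarrow>
     (real ^ 'n \<Rightarrow> real) \<Rightarrow> real ^ 'n \<Rightarrow> real" where
  "whitney_ext \<Delta> d S W \<phi> a k f x =
     (if x \<in> S then f x
      else (\<Sum>\<^sub>\<infinity>Q\<in>W. \<phi> Q x * whitney_proj \<Delta> d S a (int k - 1) Q f x))"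

end

theory Submission
  imports Defs
begin

text \<open>
  Of the Hausdorff measure only the two-sided \<open>d\<close>-regularity on \<open>S\<close> is used; positivity of the lower bound
  already makes all relatively open subsets of \<open>S\<close> measurable.

  Since \<open>d > n - 1\<close>, sublevel sets of a normalised polynomial have small \<open>d\<close>-dimensional content: either
  some first derivative is large, and then the set is close to a Lipschitz graph, or all of them are small, and
  one inducts on the degree. This gives a Remez-type inequality on \<open>S\<close>, and with it the coefficients of the
  projection of \<open>f - P\<close> are bounded by the mean of \<open>\<bar>f - P\<bar>\<close> for every polynomial \<open>P\<close>. Consequently, near
  \<open>S\<close> the oscillation of the extension on a cube is bounded by that of \<open>f\<close> on a larger cube of comparable size,
  and at distance about \<open>2 powr (- i)\<close> from \<open>S\<close> Taylor's theorem gives the additional factor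
  \<open>2 powr (- (l - i) * k)\<close> for cubes of radius \<open>2 powr (- l)\<close> with \<open>l > i\<close>; the terms with \<open>l > i\<close> are thus
  summable because \<open>\<alpha> < k\<close>.

  The part of a cube of radius \<open>2 powr (- j)\<close> within distance \<open>2 powr (- (j + l))\<close> of \<open>S\<close> has
  volume at most a constant times \<open>2 powr (- (j + l) * (n - d) - j * d)\<close>. Half of this gain \<open>n - d\<close> is spent on
  replacing the sum over the scales by its largest term, weighted by a geometric factor, the other half on
  summing the strips; the factor \<open>2 powr (- j * (n - d))\<close> that remains is the one in the theorem.
\<close>

text \<open>\<open>nn_integral\<close> of an arbitrary function is the supremum over the simple
  functions below it, and the local approximation errors are not shown to be measurable in the
  centre of the cube. Therefore both sides of the estimate are tied to a grid: the integrand on the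
  left is dominated by a countable sum of multiples of indicators, and on the right such a sum is
  placed below the integrand. A cube with arbitrary centre is first enlarged to one centred at a
  grid point in \<open>S\<close>, and the infimum over polynomials is taken there.

  The regularity of \<open>S\<close> is given for radii up to 1, but the comparison cubes exceed
  those of the extension by the factor \<open>21 * (131073 + 1)\<close>. This is below
  \<open>4194304 = 2 ^ 22\<close>, so the bounds are first extended to that radius, at the price of
  worse constants. The number \<open>131072 = 2 ^ 17\<close> is a power of 2 above the distance at
  which the parameter \<Delta> = 16000 makes the extension vanish on a whole unit cube.\<close>

lemma infnorm_le_iff: "infnorm x \<le> r \<longleftrightarrow> (\<forall>i. \<bar>x $ i\<bar> \<le> r)" for x :: "real ^ 'n"
proof
  assume "infnorm x \<le> r"
  then show "\<forall>i. \<bar>x $ i\<bar> \<le> r" using component_le_infnorm_cart order_trans by blast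
next
  assume "\<forall>i. \<bar>x $ i\<bar> \<le> r"
  then show "infnorm x \<le> r" unfolding infnorm_cart by (intro cSup_least) auto
qed

lemma mem_cube: "y \<in> cube x r \<longleftrightarrow> (\<forall>i. \<bar>y $ i - x $ i\<bar> \<le> r)"
  by (simp add: cube_def infnorm_le_iff)

lemma cube_eq_cbox: "cube x r = cbox (x - (\<chi> i. r)) (x + (\<chi> i. r))"
  by (auto simp: mem_cube mem_box_cart abs_le_iff algebra_simps)

lemma cube_borel [measurable]: "cube x r \<in> sets borel"
  unfolding cube_eq_cbox by simp

lemma compact_cube: "compact (cube x r)"
  unfolding cube_eq_cbox by simp

lemma infnorm_triangle_sub: "infnorm (x - z) \<le> infnorm (x - y) + infnorm (y - z)"
  using infnorm_triangle[of "x - y" "y - z"] by simp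

lemma cube_mono: "infnorm (x - y) + r \<le> s \<Longrightarrow> cube x r \<subseteq> cube y s"
  unfolding cube_def using infnorm_triangle_sub order_trans add_right_mono
  by (smt (verit, best) mem_Collect_eq subsetI)

lemma emeasure_cube:
  fixes x :: "real ^ 'n"
  assumes "0 \<le> r"
  shows "emeasure lebesgue (cube x r) = ennreal ((2 * r) ^ CARD('n))"
proof -
  have "emeasure lebesgue (cube x r) = emeasure lborel (cbox (x - (\<chi> i. r)) (x + (\<chi> i. r)))"
    by (simp add: cube_eq_cbox)
  also have "\<dots> = ennreal (\<Prod>b\<in>Basis. ((x + (\<chi> i. r)) - (x - (\<chi> i. r))) \<bullet> b)"
    using assms by (intro emeasure_lborel_cbox) (auto simp: Basis_vec_def algebra_simps inner_axis)
  also have "(\<Prod>b\<in>Basis. ((x + (\<chi> i. r)) - (x - (\<chi> i. r))) \<bullet> b) = (\<Prod>b\<in>(Basis::(real^'n) set). 2 * r)"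
    by (intro prod.cong) (auto simp: Basis_vec_def algebra_simps inner_axis)
  finally show ?thesis by simp
qed

text \<open>In each coordinate the admissible integers fill an interval of length
  \<open>2 * C\<close>, whatever h is; this scale invariance makes all overlap counts below depend
  on the dimension and on ratios of lengths only.\<close>

lemma
  fixes h C :: real and y :: "'n::finite \<Rightarrow> real"
  assumes that: "0 < h" "0 \<le> C"
  shows finite_int_box: "finite {z :: 'n \<Rightarrow> int. \<forall>i. \<bar>h * real_of_int (z i) - y i\<bar> \<le> C * h}"
  and card_int_box: "card {z :: 'n \<Rightarrow> int. \<forall>i. \<bar>h * real_of_int (z i) - y i\<bar> \<le> C * h}
         \<le> (nat \<lfloor>2 * C\<rfloor> + 1) ^ CARD('n)"
proof -
  define A where "A = (\<lambda>i. {k::int. \<bar>h * real_of_int k - y i\<bar> \<le> C * h})"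
  have A: "A i \<subseteq> {\<lceil>y i / h - C\<rceil>..\<lceil>y i / h - C\<rceil> + \<lfloor>2 * C\<rfloor>}" for i
  proof
    fix k assume "k \<in> A i"
    then have k: "\<bar>h * real_of_int k - y i\<bar> \<le> C * h" by (simp add: A_def)
    have "h * \<bar>real_of_int k - y i / h\<bar> = \<bar>h * (real_of_int k - y i / h)\<bar>"
      using that by (simp add: abs_mult)
    also have "h * (real_of_int k - y i / h) = h * real_of_int k - y i" using that by (simp add: right_diff_distrib)
    finally have "h * \<bar>real_of_int k - y i / h\<bar> \<le> h * C" using k by (simp add: mult.commute)
    then have k': "\<bar>real_of_int k - y i / h\<bar> \<le> C" using that by simp
    then have "y i / h - C \<le> real_of_int k" by linarith
    then have 1: "\<lceil>y i / h - C\<rceil> \<le> k" by (simp only: ceiling_le_iff)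
    have "real_of_int (k - \<lceil>y i / h - C\<rceil>) \<le> 2 * C"
      using k' le_of_int_ceiling[of "y i / h - C"] unfolding of_int_diff by linarith
    then have "k - \<lceil>y i / h - C\<rceil> \<le> \<lfloor>2 * C\<rfloor>" by (simp only: le_floor_iff)
    then show "k \<in> {\<lceil>y i / h - C\<rceil>..\<lceil>y i / h - C\<rceil> + \<lfloor>2 * C\<rfloor>}" using 1 by simp
  qed
  have fin: "finite (A i)" for i by (rule finite_subset[OF A]) simp
  have cd: "card (A i) \<le> nat \<lfloor>2 * C\<rfloor> + 1" for i
  proof -
    have "card (A i) \<le> card {\<lceil>y i / h - C\<rceil>..\<lceil>y i / h - C\<rceil> + \<lfloor>2 * C\<rfloor>}"
      by (rule card_mono) (use A in auto)
    also have "\<dots> = nat \<lfloor>2 * C\<rfloor> + 1" using that by (simp add: nat_add_distrib)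
    finally show ?thesis .
  qed
  have eq: "{z :: 'n \<Rightarrow> int. \<forall>i. \<bar>h * real_of_int (z i) - y i\<bar> \<le> C * h} = Pi\<^sub>E UNIV A"
    by (auto simp: A_def PiE_UNIV_domain)
  show "finite {z :: 'n \<Rightarrow> int. \<forall>i. \<bar>h * real_of_int (z i) - y i\<bar> \<le> C * h}"
    unfolding eq by (rule finite_PiE) (simp, rule fin)
  have "card (Pi\<^sub>E UNIV A) = (\<Prod>i\<in>UNIV. card (A i))" by (simp add: card_PiE)
  also have "\<dots> \<le> (\<Prod>i\<in>(UNIV::'n set). nat \<lfloor>2 * C\<rfloor> + 1)" using cd by (intro prod_mono) auto
  finally show "card {z :: 'n \<Rightarrow> int. \<forall>i. \<bar>h * real_of_int (z i) - y i\<bar> \<le> C * h}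
         \<le> (nat \<lfloor>2 * C\<rfloor> + 1) ^ CARD('n)" unfolding eq by simp
qed

section \<open>Polynomials\<close>

definition monomial :: "('n::finite \<Rightarrow> nat) \<Rightarrow> real ^ 'n \<Rightarrow> real" where
  "monomial \<beta> x = (\<Prod>i\<in>UNIV. (x $ i) ^ \<beta> i)"

definition midx :: "nat \<Rightarrow> ('n::finite \<Rightarrow> nat) set" where
  "midx m = {\<beta>. multi_index_order \<beta> \<le> m}"

lemma finite_midx [simp]: "finite (midx m :: ('n::finite \<Rightarrow> nat) set)"
proof (rule finite_subset)
  have *: "\<beta> i \<le> multi_index_order \<beta>" for \<beta> :: "'n \<Rightarrow> nat" and i
    unfolding multi_index_order_def by (rule member_le_sum) simp_all
  show "midx m \<subseteq> Pi\<^sub>E UNIV (\<lambda>i::'n. {..m})"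
  proof
    fix \<beta> :: "'n \<Rightarrow> nat" assume "\<beta> \<in> midx m"
    then have "\<beta> i \<le> m" for i using *[of \<beta> i] by (simp add: midx_def)
    then show "\<beta> \<in> Pi\<^sub>E UNIV (\<lambda>i::'n. {..m})" by (simp add: PiE_UNIV_domain)
  qed
  show "finite (Pi\<^sub>E UNIV (\<lambda>i::'n. {..m}))" by (rule finite_PiE) simp_all
qed

lemma midx_int: "{\<beta>. int (multi_index_order \<beta>) \<le> int m} = midx m"
  by (simp add: midx_def)

lemma poly_space_iff: "P \<in> poly_space (int m) \<longleftrightarrow> (\<exists>c. \<forall>x. P x = (\<Sum>\<beta>\<in>midx m. c \<beta> * monomial \<beta> x))"
  unfolding poly_space_def monomial_def midx_int by simp

lemma poly_spaceI: "(\<And>x. P x = (\<Sum>\<beta>\<in>midx m. c \<beta> * monomial \<beta> x)) \<Longrightarrow> P \<in> poly_space (int m)"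
  unfolding poly_space_iff by auto

lemma poly_space_add:
  assumes "P \<in> poly_space (int m)" "Q \<in> poly_space (int m)"
  shows "(\<lambda>x. P x + Q x) \<in> poly_space (int m)"
proof -
  obtain c e where "\<And>x. P x = (\<Sum>\<beta>\<in>midx m. c \<beta> * monomial \<beta> x)" "\<And>x. Q x = (\<Sum>\<beta>\<in>midx m. e \<beta> * monomial \<beta> x)"
    using assms unfolding poly_space_iff by metis
  then show ?thesis
    by (intro poly_spaceI[where c = "\<lambda>\<beta>. c \<beta> + e \<beta>"]) (simp add: algebra_simps sum.distrib)
qed

lemma poly_space_cmult:
  assumes "P \<in> poly_space (int m)"
  shows "(\<lambda>x. a * P x) \<in> poly_space (int m)"
proof -
  obtain c where "\<And>x. P x = (\<Sum>\<beta>\<in>midx m. c \<beta> * monomial \<beta> x)"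
    using assms unfolding poly_space_iff by metis
  then show ?thesis
    by (intro poly_spaceI[where c = "\<lambda>\<beta>. a * c \<beta>"]) (simp add: algebra_simps sum_distrib_left)
qed

lemma poly_space_zero: "(\<lambda>x. 0) \<in> poly_space (int m)"
  by (rule poly_spaceI[where c = "\<lambda>_. 0"]) simp

lemma poly_space_diff:
  assumes "P \<in> poly_space (int m)" "Q \<in> poly_space (int m)"
  shows "(\<lambda>x. P x - Q x) \<in> poly_space (int m)"
  using poly_space_add[OF assms(1) poly_space_cmult[OF assms(2), of "-1"]] by simp

lemma poly_space_sum:
  "(\<And>a. a \<in> A \<Longrightarrow> P a \<in> poly_space (int m)) \<Longrightarrow> (\<lambda>x. \<Sum>a\<in>A. P a x) \<in> poly_space (int m)"
  by (induction A rule: infinite_finite_induct) (auto intro: poly_space_zero poly_space_add)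

lemma monomial_in_poly_space:
  assumes "multi_index_order \<beta> \<le> m" shows "monomial \<beta> \<in> poly_space (int m)"
proof (rule poly_spaceI)
  fix x
  have "(\<Sum>\<gamma>\<in>midx m. (if \<gamma> = \<beta> then 1 else 0) * monomial \<gamma> x) = (\<Sum>\<gamma>\<in>midx m. if \<gamma> = \<beta> then monomial \<gamma> x else 0)"
    by (rule sum.cong) auto
  also have "\<dots> = monomial \<beta> x" using assms by (subst sum.delta[OF finite_midx]) (auto simp: midx_def)
  finally show "monomial \<beta> x = (\<Sum>\<gamma>\<in>midx m. (if \<gamma> = \<beta> then 1 else 0) * monomial \<gamma> x)" by simp
qed

lemma mono_add: "monomial (\<lambda>i. \<beta> i + \<gamma> i) x = monomial \<beta> x * monomial \<gamma> x"
  by (simp add: monomial_def power_add prod.distrib)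

lemma order_add: "multi_index_order (\<lambda>i. \<beta> i + \<gamma> i) = multi_index_order \<beta> + multi_index_order \<gamma>"
  by (simp add: multi_index_order_def sum.distrib)

lemma poly_space_mult:
  assumes "P \<in> poly_space (int m)" "Q \<in> poly_space (int l)"
  shows "(\<lambda>x. P x * Q x) \<in> poly_space (int (m + l))"
proof -
  obtain c e where P: "\<And>x. P x = (\<Sum>\<beta>\<in>midx m. c \<beta> * monomial \<beta> x)" and Q: "\<And>x. Q x = (\<Sum>\<beta>\<in>midx l. e \<beta> * monomial \<beta> x)"
    using assms unfolding poly_space_iff by metis
  have "(\<lambda>x. P x * Q x) = (\<lambda>x. \<Sum>\<beta>\<in>midx m. \<Sum>\<gamma>\<in>midx l. (c \<beta> * e \<gamma>) * monomial (\<lambda>i. \<beta> i + \<gamma> i) x)"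
    unfolding P Q mono_add by (auto simp: sum_product algebra_simps)
  also have "\<dots> \<in> poly_space (int (m + l))"
    by (intro poly_space_sum poly_space_cmult monomial_in_poly_space) (auto simp: order_add midx_def)
  finally show ?thesis .
qed

lemma poly_space_const: "(\<lambda>x. a) \<in> poly_space (int m)"
proof -
  have "monomial (\<lambda>_. 0) \<in> poly_space (int m)" by (rule monomial_in_poly_space) (simp add: multi_index_order_def)
  from poly_space_cmult[OF this, of a] show ?thesis by (simp add: monomial_def)
qed

lemma poly_space_coord: "(\<lambda>x. x $ i) \<in> poly_space (int 1)"
proof -
  have o: "multi_index_order (\<lambda>j. if j = i then 1 else 0) \<le> 1" by (simp add: multi_index_order_def)
  have "monomial (\<lambda>j. if j = i then 1 else 0) = (\<lambda>x. x $ i)"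
    by (rule ext) (simp add: monomial_def if_distrib[of "\<lambda>k. _ ^ k"] prod.delta cong: if_cong)
  with monomial_in_poly_space[OF o] show ?thesis by simp
qed

lemma poly_space_power:
  assumes "P \<in> poly_space (int m)" shows "(\<lambda>x. P x ^ k) \<in> poly_space (int (k * m))"
proof (induction k)
  case 0 show ?case using poly_space_const[of 1 0] by simp
next
  case (Suc k) show ?case using poly_space_mult[OF assms Suc] by simp
qed

lemma poly_space_prod:
  "finite A \<Longrightarrow> (\<And>a. a \<in> A \<Longrightarrow> P a \<in> poly_space (int (m a)))
    \<Longrightarrow> (\<lambda>x. \<Prod>a\<in>A. P a x) \<in> poly_space (int (\<Sum>a\<in>A. m a))"
proof (induction A rule: finite_induct)
  case empty show ?case using poly_space_const[of 1 0] by simp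
next
  case (insert a A) then show ?case using poly_space_mult[of "P a" "m a" "\<lambda>x. \<Prod>a\<in>A. P a x" "sum m A"] by simp
qed

lemma poly_space_mono:
  assumes "P \<in> poly_space (int m)" "m \<le> l" shows "P \<in> poly_space (int l)"
proof -
  obtain c where "\<And>x. P x = (\<Sum>\<beta>\<in>midx m. c \<beta> * monomial \<beta> x)"
    using assms unfolding poly_space_iff by metis
  then have "P = (\<lambda>x. \<Sum>\<beta>\<in>midx m. c \<beta> * monomial \<beta> x)" by auto
  also have "\<dots> \<in> poly_space (int l)"
    by (intro poly_space_sum poly_space_cmult monomial_in_poly_space) (use assms in \<open>auto simp: midx_def\<close>)
  finally show ?thesis .
qed

lemma mono_affine_in_poly_space:
  assumes "\<beta> \<in> midx m"
  shows "(\<lambda>x. monomial \<beta> (a *\<^sub>R x + b)) \<in> poly_space (int m)"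
proof -
  have "(\<lambda>x. a * x $ i + b $ i) \<in> poly_space (int 1)" for i
    using poly_space_add[OF poly_space_cmult[OF poly_space_coord] poly_space_const, of a i "b $ i"] by simp
  then have "(\<lambda>x. \<Prod>i\<in>UNIV. (a * x $ i + b $ i) ^ \<beta> i) \<in> poly_space (int (\<Sum>i\<in>UNIV. \<beta> i * 1))"
    by (intro poly_space_prod poly_space_power) auto
  then have "(\<lambda>x. monomial \<beta> (a *\<^sub>R x + b)) \<in> poly_space (int (multi_index_order \<beta>))"
    by (simp add: monomial_def multi_index_order_def)
  then show ?thesis by (rule poly_space_mono) (use assms in \<open>simp add: midx_def\<close>)
qed

lemma poly_space_affine:
  assumes "P \<in> poly_space (int m)"
  shows "(\<lambda>x. P (a *\<^sub>R x + b)) \<in> poly_space (int m)"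
proof -
  obtain c where "\<And>x. P x = (\<Sum>\<beta>\<in>midx m. c \<beta> * monomial \<beta> x)"
    using assms unfolding poly_space_iff by metis
  then have "(\<lambda>x. P (a *\<^sub>R x + b)) = (\<lambda>x. \<Sum>\<beta>\<in>midx m. c \<beta> * monomial \<beta> (a *\<^sub>R x + b))" by auto
  also have "\<dots> \<in> poly_space (int m)"
    by (intro poly_space_sum poly_space_cmult mono_affine_in_poly_space) auto
  finally show ?thesis .
qed

text \<open>The monomials adapted to \<open>cube w r\<close>: there they are bounded by 1 in
  absolute value, so coefficients with respect to them are comparable on all scales.\<close>

definition smono :: "real ^ 'n \<Rightarrow> real \<Rightarrow> ('n \<Rightarrow> nat) \<Rightarrow> real ^ 'n \<Rightarrow> real" where
  "smono w r \<beta> x = monomial \<beta> ((1 / r) *\<^sub>R (x - w))"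

lemma smonomial_in_poly_space:
  assumes "\<beta> \<in> midx m" shows "smono w r \<beta> \<in> poly_space (int m)"
  using mono_affine_in_poly_space[OF assms, of "1 / r" "- (1 / r) *\<^sub>R w"]
  by (simp add: smono_def[abs_def] algebra_simps)

lemma poly_space_smono:
  assumes "P \<in> poly_space (int m)" "r \<noteq> 0"
  obtains c where "\<And>x. P x = (\<Sum>\<beta>\<in>midx m. c \<beta> * smono w r \<beta> x)"
proof -
  obtain c where c: "\<And>x. P (r *\<^sub>R x + w) = (\<Sum>\<beta>\<in>midx m. c \<beta> * monomial \<beta> x)"
    using poly_space_affine[OF assms(1), of r w] unfolding poly_space_iff by metis
  have "P x = (\<Sum>\<beta>\<in>midx m. c \<beta> * smono w r \<beta> x)" for x
    using c[of "(1 / r) *\<^sub>R (x - w)"] assms(2) by (simp add: smono_def)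
  then show ?thesis using that by blast
qed

lemma abs_mono_le:
  assumes "\<beta> \<in> midx m" "1 \<le> L" "\<And>i. \<bar>x $ i\<bar> \<le> L"
  shows "\<bar>monomial \<beta> x\<bar> \<le> L ^ m"
proof -
  have "\<bar>monomial \<beta> x\<bar> \<le> (\<Prod>i\<in>UNIV. L ^ \<beta> i)"
    unfolding monomial_def abs_prod power_abs by (intro prod_mono) (auto intro: power_mono assms)
  also have "\<dots> = L ^ multi_index_order \<beta>" by (simp add: multi_index_order_def power_sum)
  also have "\<dots> \<le> L ^ m" using assms by (intro power_increasing) (auto simp: midx_def)
  finally show ?thesis .
qed

lemma abs_smono_le:
  assumes "\<beta> \<in> midx m" "1 \<le> L" "0 < r" "x \<in> cube w (L * r)"
  shows "\<bar>smono w r \<beta> x\<bar> \<le> L ^ m"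
  unfolding smono_def
proof (rule abs_mono_le[OF assms(1,2)])
  fix i
  have "\<bar>x $ i - w $ i\<bar> \<le> L * r" using assms by (simp add: mem_cube)
  then show "\<bar>((1 / r) *\<^sub>R (x - w)) $ i\<bar> \<le> L" using \<open>0 < r\<close> by (simp add: pos_divide_le_eq)
qed

lemma continuous_on_mono: "continuous_on A (monomial \<beta>)"
  unfolding monomial_def[abs_def] by (intro continuous_intros)

lemma continuous_on_poly_space:
  assumes "P \<in> poly_space (int m)" shows "continuous_on A P"
proof -
  obtain c where "\<And>x. P x = (\<Sum>\<beta>\<in>midx m. c \<beta> * monomial \<beta> x)"
    using assms unfolding poly_space_iff by metis
  then have P: "P = (\<lambda>x. \<Sum>\<beta>\<in>midx m. c \<beta> * monomial \<beta> x)" by auto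
  show ?thesis unfolding P by (intro continuous_on_sum continuous_on_mult continuous_on_const continuous_on_mono)
qed

lemma poly_space_borel: "P \<in> poly_space (int m) \<Longrightarrow> P \<in> borel_measurable borel"
  by (intro borel_measurable_continuous_onI continuous_on_poly_space)

section \<open>Covering sublevel sets of polynomials\<close>

definition pol :: "nat \<Rightarrow> (('n::finite \<Rightarrow> nat) \<Rightarrow> real) \<Rightarrow> real ^ 'n \<Rightarrow> real" where
  "pol m c x = (\<Sum>\<beta>\<in>midx m. c \<beta> * monomial \<beta> x)"

definition cnorm :: "nat \<Rightarrow> (('n::finite \<Rightarrow> nat) \<Rightarrow> real) \<Rightarrow> real" where
  "cnorm m c = (\<Sum>\<beta>\<in>midx m. \<bar>c \<beta>\<bar>)"

text \<open>Formal differentiation: the coefficients of the i-th partial derivative of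
  \<open>pol\<close>, see \<open>DERIV_pol\<close>. Working with coefficients keeps
  \<open>cnorm\<close> at hand in every degree.\<close>

definition cderiv :: "'n \<Rightarrow> (('n::finite \<Rightarrow> nat) \<Rightarrow> real) \<Rightarrow> ('n \<Rightarrow> nat) \<Rightarrow> real" where
  "cderiv i c \<beta> = real (Suc (\<beta> i)) * c (\<beta>(i := Suc (\<beta> i)))"

lemma cnorm_nonneg: "0 \<le> cnorm m c"
  unfolding cnorm_def by (intro sum_nonneg) auto

lemma multi_index_order_upd: "multi_index_order (\<beta>(i := k)) + \<beta> i = multi_index_order \<beta> + k"
proof -
  have "multi_index_order (\<beta>(i := k)) = k + (\<Sum>j\<in>UNIV - {i}. (\<beta>(i := k)) j)"
    unfolding multi_index_order_def by (subst sum.remove[of _ i]) auto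
  also have "(\<Sum>j\<in>UNIV - {i}. (\<beta>(i := k)) j) = (\<Sum>j\<in>UNIV - {i}. \<beta> j)" by (rule sum.cong) auto
  finally have 1: "multi_index_order (\<beta>(i := k)) = k + (\<Sum>j\<in>UNIV - {i}. \<beta> j)" .
  have 2: "multi_index_order \<beta> = \<beta> i + (\<Sum>j\<in>UNIV - {i}. \<beta> j)"
    unfolding multi_index_order_def by (subst sum.remove[of _ i]) auto
  show ?thesis unfolding 1 2 by simp
qed

text \<open>Raising the i-th exponent maps the indices of order at most m bijectively onto those of
  order at most \<open>Suc m\<close> with positive i-th exponent; the remaining indices contribute
  0. This is the reindexing behind \<open>cderiv\<close>.\<close>

lemma sum_midx_shift:
  fixes f :: "('n::finite \<Rightarrow> nat) \<Rightarrow> real"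
  assumes "\<And>\<beta>. \<beta> i = 0 \<Longrightarrow> f \<beta> = 0"
  shows "(\<Sum>\<beta>\<in>midx (Suc m). f \<beta>) = (\<Sum>\<beta>\<in>midx m. f (\<beta>(i := Suc (\<beta> i))))"
proof -
  have "(\<Sum>\<beta>\<in>midx (Suc m). f \<beta>) = (\<Sum>\<beta>\<in>{\<beta> \<in> midx (Suc m). 0 < \<beta> i}. f \<beta>)"
    by (rule sum.mono_neutral_right) (use assms in auto)
  also have "\<dots> = (\<Sum>\<beta>\<in>midx m. f (\<beta>(i := Suc (\<beta> i))))"
  proof (rule sum.reindex_bij_witness[where j = "\<lambda>\<beta>. \<beta>(i := \<beta> i - 1)" and i = "\<lambda>\<beta>. \<beta>(i := Suc (\<beta> i))"])
    fix \<beta> assume "\<beta> \<in> {\<beta> \<in> midx (Suc m). 0 < \<beta> i}"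
    then have b: "multi_index_order \<beta> \<le> Suc m" "0 < \<beta> i" by (auto simp: midx_def)
    show "(\<beta>(i := \<beta> i - 1))(i := Suc ((\<beta>(i := \<beta> i - 1)) i)) = \<beta>" using b by (auto simp: fun_eq_iff)
    then show "f ((\<beta>(i := \<beta> i - 1))(i := Suc ((\<beta>(i := \<beta> i - 1)) i))) = f \<beta>" by simp
    show "\<beta>(i := \<beta> i - 1) \<in> midx m"
      using multi_index_order_upd[of \<beta> i "\<beta> i - 1"] b by (simp add: midx_def)
  next
    fix \<beta> assume "\<beta> \<in> (midx m :: ('n \<Rightarrow> nat) set)"
    then have b: "multi_index_order \<beta> \<le> m" by (auto simp: midx_def)
    show "(\<beta>(i := Suc (\<beta> i)))(i := (\<beta>(i := Suc (\<beta> i))) i - 1) = \<beta>" by simp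
    show "\<beta>(i := Suc (\<beta> i)) \<in> {\<beta> \<in> midx (Suc m). 0 < \<beta> i}"
      using multi_index_order_upd[of \<beta> i "Suc (\<beta> i)"] b by (simp add: midx_def)
  qed
  finally show ?thesis .
qed

lemma DERIV_mono:
  "((\<lambda>t. monomial \<beta> (x + t *\<^sub>R v)) has_real_derivative
     (\<Sum>i\<in>UNIV. v $ i * (real (\<beta> i) * monomial (\<beta>(i := \<beta> i - 1)) (x + t *\<^sub>R v)))) (at t)"
proof -
  have 1: "((\<lambda>t. (x $ i + t * v $ i) ^ \<beta> i) has_real_derivative
      real (\<beta> i) * (v $ i * (x $ i + t * v $ i) ^ (\<beta> i - 1))) (at t)" for i
    by (auto intro!: derivative_eq_intros)
  have 2: "v $ i * (real (\<beta> i) * monomial (\<beta>(i := \<beta> i - 1)) (x + t *\<^sub>R v))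
      = real (\<beta> i) * (v $ i * (x $ i + t * v $ i) ^ (\<beta> i - 1)) * (\<Prod>j\<in>UNIV - {i}. (x $ j + t * v $ j) ^ \<beta> j)" for i
  proof -
    have "monomial (\<beta>(i := \<beta> i - 1)) (x + t *\<^sub>R v)
       = (x $ i + t * v $ i) ^ (\<beta> i - 1) * (\<Prod>j\<in>UNIV - {i}. (x $ j + t * v $ j) ^ ((\<beta>(i := \<beta> i - 1)) j))"
      unfolding monomial_def by (subst prod.remove[of _ i]) auto
    also have "(\<Prod>j\<in>UNIV - {i}. (x $ j + t * v $ j) ^ ((\<beta>(i := \<beta> i - 1)) j)) = (\<Prod>j\<in>UNIV - {i}. (x $ j + t * v $ j) ^ \<beta> j)"
      by (rule prod.cong) auto
    finally have e: "monomial (\<beta>(i := \<beta> i - 1)) (x + t *\<^sub>R v)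
       = (x $ i + t * v $ i) ^ (\<beta> i - 1) * (\<Prod>j\<in>UNIV - {i}. (x $ j + t * v $ j) ^ \<beta> j)" .
    show ?thesis unfolding e by (simp only: mult_ac)
  qed
  show ?thesis unfolding 2 using has_field_derivative_prod[OF 1, where A = UNIV] by (simp add: monomial_def)
qed

lemma DERIV_pol:
  "((\<lambda>t. pol (Suc m) c (x + t *\<^sub>R v)) has_real_derivative
     (\<Sum>i\<in>UNIV. v $ i * pol m (cderiv i c) (x + t *\<^sub>R v))) (at t)"
proof -
  let ?z = "x + t *\<^sub>R v"
  have "((\<lambda>t. pol (Suc m) c (x + t *\<^sub>R v)) has_real_derivative
     (\<Sum>\<beta>\<in>midx (Suc m). c \<beta> * (\<Sum>i\<in>UNIV. v $ i * (real (\<beta> i) * monomial (\<beta>(i := \<beta> i - 1)) ?z)))) (at t)"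
    unfolding pol_def by (intro DERIV_sum DERIV_cmult DERIV_mono)
  also have "(\<Sum>\<beta>\<in>midx (Suc m). c \<beta> * (\<Sum>i\<in>UNIV. v $ i * (real (\<beta> i) * monomial (\<beta>(i := \<beta> i - 1)) ?z)))
     = (\<Sum>i\<in>UNIV. v $ i * (\<Sum>\<beta>\<in>midx (Suc m). c \<beta> * (real (\<beta> i) * monomial (\<beta>(i := \<beta> i - 1)) ?z)))"
    unfolding sum_distrib_left by (subst sum.swap) (simp add: mult_ac)
  also have "\<dots> = (\<Sum>i\<in>UNIV. v $ i * pol m (cderiv i c) ?z)"
  proof (rule sum.cong[OF refl])
    fix i :: 'a
    have "(\<Sum>\<beta>\<in>midx (Suc m). c \<beta> * (real (\<beta> i) * monomial (\<beta>(i := \<beta> i - 1)) ?z)) = pol m (cderiv i c) ?z"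
      by (subst sum_midx_shift[where i = i]) (simp_all add: pol_def cderiv_def mult_ac)
    then show "v $ i * (\<Sum>\<beta>\<in>midx (Suc m). c \<beta> * (real (\<beta> i) * monomial (\<beta>(i := \<beta> i - 1)) ?z)) = v $ i * pol m (cderiv i c) ?z"
      by simp
  qed
  finally show ?thesis .
qed

lemma cnorm_cderiv_eq: "cnorm m (cderiv i c) = (\<Sum>\<beta>\<in>midx (Suc m). real (\<beta> i) * \<bar>c \<beta>\<bar>)"
  by (subst sum_midx_shift[where i = i]) (simp_all add: cnorm_def cderiv_def abs_mult)

lemma multi_index_order_real: "(\<Sum>i\<in>UNIV. real (\<beta> i)) = real (multi_index_order \<beta>)"
  by (simp add: multi_index_order_def)

lemma sum_cnorm_cderiv:
  "(\<Sum>i\<in>UNIV. cnorm m (cderiv i c)) = (\<Sum>\<beta>\<in>midx (Suc m). real (multi_index_order \<beta>) * \<bar>c \<beta>\<bar>)"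
  unfolding cnorm_cderiv_eq multi_index_order_real[symmetric] sum_distrib_right by (rule sum.swap)

lemma sum_cnorm_cderiv_le: "(\<Sum>i\<in>UNIV. cnorm m (cderiv i c)) \<le> real (Suc m) * cnorm (Suc m) c"
  unfolding sum_cnorm_cderiv cnorm_def[of "Suc m"] sum_distrib_left
  by (intro sum_mono mult_right_mono) (auto simp: midx_def)

lemma cnorm_cderiv_le: "cnorm m (cderiv i c) \<le> real (Suc m) * cnorm (Suc m) c"
  using sum_cnorm_cderiv_le[of m c] member_le_sum[of i UNIV "\<lambda>i. cnorm m (cderiv i c)"]
  by (simp add: cnorm_nonneg)

lemma order_zero: "multi_index_order \<beta> = 0 \<longleftrightarrow> \<beta> = (\<lambda>_. 0)"
  by (auto simp: multi_index_order_def)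

lemma zero_in_midx: "(\<lambda>_. 0) \<in> midx m"
  by (simp add: midx_def multi_index_order_def)

lemma cnorm_split: "cnorm m c = \<bar>c (\<lambda>_. 0)\<bar> + (\<Sum>\<beta>\<in>midx m - {\<lambda>_. 0}. \<bar>c \<beta>\<bar>)"
  unfolding cnorm_def by (rule sum.remove[OF finite_midx zero_in_midx])

lemma pol_split: "pol m c x = c (\<lambda>_. 0) + (\<Sum>\<beta>\<in>midx m - {\<lambda>_. 0}. c \<beta> * monomial \<beta> x)"
proof -
  have "pol m c x = c (\<lambda>_. 0) * monomial (\<lambda>_. 0) x + (\<Sum>\<beta>\<in>midx m - {\<lambda>_. 0}. c \<beta> * monomial \<beta> x)"
    unfolding pol_def by (rule sum.remove[OF finite_midx zero_in_midx])
  then show ?thesis by (simp add: monomial_def)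
qed

text \<open>Every index other than 0 has order at least 1, so its coefficient survives in some
  derivative. Thus a polynomial that is not dominated by its constant term has a derivative of
  comparable norm.\<close>

lemma sum_cnorm_cderiv_ge: "cnorm (Suc m) c - \<bar>c (\<lambda>_. 0)\<bar> \<le> (\<Sum>i\<in>UNIV. cnorm m (cderiv i c))"
proof -
  have "(\<Sum>\<beta>\<in>midx (Suc m) - {\<lambda>_. 0}. \<bar>c \<beta>\<bar>) \<le> (\<Sum>\<beta>\<in>midx (Suc m) - {\<lambda>_. 0}. real (multi_index_order \<beta>) * \<bar>c \<beta>\<bar>)"
  proof (rule sum_mono)
    fix \<beta> assume "\<beta> \<in> midx (Suc m) - {\<lambda>_::'a. 0::nat}"
    then have "1 \<le> multi_index_order \<beta>" using order_zero[of \<beta>] by auto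
    then have "1 * \<bar>c \<beta>\<bar> \<le> real (multi_index_order \<beta>) * \<bar>c \<beta>\<bar>" by (intro mult_right_mono) auto
    then show "\<bar>c \<beta>\<bar> \<le> real (multi_index_order \<beta>) * \<bar>c \<beta>\<bar>" by simp
  qed
  also have "\<dots> \<le> (\<Sum>\<beta>\<in>midx (Suc m). real (multi_index_order \<beta>) * \<bar>c \<beta>\<bar>)"
    by (rule sum_mono2) auto
  finally show ?thesis unfolding sum_cnorm_cderiv cnorm_split[of "Suc m" c] by simp
qed

lemma abs_mono_le_1: "x \<in> cube 0 1 \<Longrightarrow> \<beta> \<in> midx m \<Longrightarrow> \<bar>monomial \<beta> x\<bar> \<le> 1"
  using abs_mono_le[of \<beta> m 1 x] by (simp add: mem_cube)

lemma abs_pol_le: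
  assumes "x \<in> cube 0 1" shows "\<bar>pol m c x\<bar> \<le> cnorm m c"
proof -
  have "\<bar>pol m c x\<bar> \<le> (\<Sum>\<beta>\<in>midx m. \<bar>c \<beta> * monomial \<beta> x\<bar>)" unfolding pol_def by (rule sum_abs)
  also have "\<dots> \<le> (\<Sum>\<beta>\<in>midx m. \<bar>c \<beta>\<bar>)"
    unfolding abs_mult using abs_mono_le_1[OF assms] by (intro sum_mono mult_left_le) auto
  finally show ?thesis unfolding cnorm_def .
qed

text \<open>That z is also coordinatewise as close to x as y is lets \<open>poly_graph_close\<close>
  compare a derivative at z with its value at x.\<close>

lemma pol_mvt:
  fixes x y :: "real ^ 'n"
  assumes "x \<in> cube 0 1" "y \<in> cube 0 1"
  obtains z where "z \<in> cube 0 1" "\<And>i. \<bar>z $ i - x $ i\<bar> \<le> \<bar>y $ i - x $ i\<bar>"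
    "pol (Suc m) c y - pol (Suc m) c x = (\<Sum>i\<in>UNIV. (y $ i - x $ i) * pol m (cderiv i c) z)"
proof -
  obtain t where t: "0 < t" "t < 1" and eq: "pol (Suc m) c (x + 1 *\<^sub>R (y - x)) - pol (Suc m) c (x + 0 *\<^sub>R (y - x))
      = (1 - 0) * (\<Sum>i\<in>UNIV. (y - x) $ i * pol m (cderiv i c) (x + t *\<^sub>R (y - x)))"
    using MVT2[of 0 1 "\<lambda>t. pol (Suc m) c (x + t *\<^sub>R (y - x))", OF _ DERIV_pol] by auto
  have le: "\<bar>(x + t *\<^sub>R (y - x)) $ i - x $ i\<bar> \<le> \<bar>y $ i - x $ i\<bar>" for i
    using t by (simp add: abs_mult mult_left_le_one_le)
  have "\<bar>(x + t *\<^sub>R (y - x)) $ i\<bar> \<le> 1" for i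
  proof -
    have a: "\<bar>x $ i\<bar> \<le> 1" "\<bar>y $ i\<bar> \<le> 1" using assms by (auto simp: mem_cube)
    have "(x + t *\<^sub>R (y - x)) $ i = (1 - t) * x $ i + t * y $ i" by (simp add: algebra_simps)
    also have "\<bar>\<dots>\<bar> \<le> (1 - t) * \<bar>x $ i\<bar> + t * \<bar>y $ i\<bar>"
      using t by (intro order_trans[OF abs_triangle_ineq]) (simp add: abs_mult)
    also have "\<dots> \<le> (1 - t) * 1 + t * 1" using t a by (intro add_mono mult_left_mono) auto
    finally show ?thesis by simp
  qed
  then have "x + t *\<^sub>R (y - x) \<in> cube 0 1" by (simp add: mem_cube)
  then show ?thesis using that[of "x + t *\<^sub>R (y - x)"] le eq by simp
qed

lemma pol_lipschitz:
  fixes x y :: "real ^ 'n"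
  assumes "x \<in> cube 0 1" "y \<in> cube 0 1" "\<And>i. \<bar>y $ i - x $ i\<bar> \<le> r" "0 \<le> r"
  shows "\<bar>pol m c y - pol m c x\<bar> \<le> r * (real m * cnorm m c)"
proof (cases m)
  case 0
  have "midx 0 = {\<lambda>_::'n. 0::nat}" by (auto simp: midx_def order_zero)
  then show ?thesis using 0 by (simp add: pol_def monomial_def)
next
  case (Suc k)
  obtain z where z: "z \<in> cube 0 1"
    "pol (Suc k) c y - pol (Suc k) c x = (\<Sum>i\<in>UNIV. (y $ i - x $ i) * pol k (cderiv i c) z)"
    using pol_mvt[OF assms(1,2), of k c] by metis
  have "\<bar>pol m c y - pol m c x\<bar> \<le> (\<Sum>i\<in>UNIV. \<bar>y $ i - x $ i\<bar> * \<bar>pol k (cderiv i c) z\<bar>)"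
    unfolding Suc z abs_mult[symmetric] by (rule sum_abs)
  also have "\<dots> \<le> (\<Sum>i\<in>UNIV. r * cnorm k (cderiv i c))"
    using assms abs_pol_le[OF z(1)] by (intro sum_mono mult_mono) auto
  also have "\<dots> = r * (\<Sum>i\<in>UNIV. cnorm k (cderiv i c))" by (simp add: sum_distrib_left)
  also have "\<dots> \<le> r * (real m * cnorm m c)"
    using sum_cnorm_cderiv_le[of k c] assms Suc by (intro mult_left_mono) auto
  finally show ?thesis .
qed

text \<open>A finite form of the bound \<eta> for the d-dimensional Hausdorff content. Lists make
  the sums add under unions; radii at most 1 keep the cubes, after rescaling, within the range where
  the measure is regular.\<close>

definition cube_cover :: "real \<Rightarrow> real \<Rightarrow> (real ^ 'n) set \<Rightarrow> bool" where
  "cube_cover d \<eta> A \<longleftrightarrow> (\<exists>xs. (\<forall>(y, \<rho>)\<in>set xs. 0 < \<rho> \<and> \<rho> \<le> 1) \<and>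
     A \<subseteq> (\<Union>(y, \<rho>)\<in>set xs. cube y \<rho>) \<and> (\<Sum>(y, \<rho>)\<leftarrow>xs. \<rho> powr d) \<le> \<eta>)"

lemma cube_cover_empty: "0 \<le> \<eta> \<Longrightarrow> cube_cover d \<eta> {}"
  unfolding cube_cover_def by (intro exI[of _ "[]"]) auto

lemma cube_cover_mono: "cube_cover d \<eta> A \<Longrightarrow> B \<subseteq> A \<Longrightarrow> cube_cover d \<eta> B"
  unfolding cube_cover_def by (meson subset_trans)

lemma cube_cover_Un:
  assumes "cube_cover d \<eta> A" "cube_cover d \<theta> B" shows "cube_cover d (\<eta> + \<theta>) (A \<union> B)"
proof -
  obtain xs where x: "\<forall>(y, \<rho>)\<in>set xs. 0 < \<rho> \<and> \<rho> \<le> 1" "A \<subseteq> (\<Union>(y, \<rho>)\<in>set xs. cube y \<rho>)"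
    "(\<Sum>(y, \<rho>)\<leftarrow>xs. \<rho> powr d) \<le> \<eta>"
    using assms(1) unfolding cube_cover_def by (elim exE conjE) (rule that)
  obtain ys where y: "\<forall>(y, \<rho>)\<in>set ys. 0 < \<rho> \<and> \<rho> \<le> 1" "B \<subseteq> (\<Union>(y, \<rho>)\<in>set ys. cube y \<rho>)"
    "(\<Sum>(y, \<rho>)\<leftarrow>ys. \<rho> powr d) \<le> \<theta>"
    using assms(2) unfolding cube_cover_def by (elim exE conjE) (rule that)
  show ?thesis unfolding cube_cover_def
  proof (intro exI[of _ "xs @ ys"] conjI)
    show "\<forall>(y, \<rho>)\<in>set (xs @ ys). 0 < \<rho> \<and> \<rho> \<le> 1" using x(1) y(1) unfolding set_append by blast
    show "A \<union> B \<subseteq> (\<Union>(y, \<rho>)\<in>set (xs @ ys). cube y \<rho>)" using x(2) y(2) unfolding set_append UN_Un by blast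
    show "(\<Sum>(y, \<rho>)\<leftarrow>xs @ ys. \<rho> powr d) \<le> \<eta> + \<theta>" using x(3) y(3) by simp
  qed
qed

text \<open>Points of \<open>A\<close> with equal labels lie within \<rho> of each other, so one
  cube per label around a representative from \<open>A\<close> suffices. The shape of the cells is
  left to the caller, who needs anisotropic ones.\<close>

lemma cube_cover_grid:
  fixes A :: "(real ^ 'n) set" and g :: "real ^ 'n \<Rightarrow> 'b"
  assumes "finite Z" "\<And>x. x \<in> A \<Longrightarrow> g x \<in> Z"
    and near: "\<And>x y. x \<in> A \<Longrightarrow> y \<in> A \<Longrightarrow> g x = g y \<Longrightarrow> infnorm (y - x) \<le> \<rho>"
    and "0 < \<rho>" "\<rho> \<le> 1" "real (card Z) * \<rho> powr d \<le> \<eta>"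
  shows "cube_cover d \<eta> A"
proof -
  obtain zs where zs: "set zs = Z" "distinct zs" using finite_distinct_list[OF assms(1)] by metis
  define rep where "rep z = (SOME x. x \<in> A \<and> g x = z)" for z
  define xs where "xs = map (\<lambda>z. (rep z, \<rho>)) zs"
  have "A \<subseteq> (\<Union>(y, \<rho>)\<in>set xs. cube y \<rho>)"
  proof
    fix x assume x: "x \<in> A"
    have "\<exists>y. y \<in> A \<and> g y = g x" using x by blast
    then have r: "rep (g x) \<in> A \<and> g (rep (g x)) = g x" unfolding rep_def by (rule someI_ex)
    then have "infnorm (x - rep (g x)) \<le> \<rho>" using near x by simp
    moreover have "(rep (g x), \<rho>) \<in> set xs" using assms(2)[OF x] by (simp add: xs_def zs)
    ultimately show "x \<in> (\<Union>(y, \<rho>)\<in>set xs. cube y \<rho>)"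
      by (intro UN_I[of "(rep (g x), \<rho>)"]) (simp_all add: cube_def)
  qed
  moreover have "(\<Sum>(y, \<rho>)\<leftarrow>xs. \<rho> powr d) = real (card Z) * \<rho> powr d"
    using zs by (simp add: xs_def o_def sum_list_triv distinct_card[symmetric])
  moreover have "\<forall>(y, \<rho>)\<in>set xs. 0 < \<rho> \<and> \<rho> \<le> 1" using assms by (auto simp: xs_def)
  ultimately show ?thesis using assms unfolding cube_cover_def by (intro exI[of _ xs]) simp
qed

lemma powr_small_exists:
  fixes e K \<eta> :: real
  assumes "0 < e" "0 < K" "0 < \<eta>" "0 < \<rho>0"
  obtains \<rho> where "0 < \<rho>" "\<rho> \<le> \<rho>0" "K * \<rho> powr e \<le> \<eta>"
proof -
  define \<rho> where "\<rho> = min \<rho>0 ((\<eta> / K) powr (1 / e))"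
  have "0 < \<rho>" using assms by (simp add: \<rho>_def)
  moreover have "\<rho> powr e \<le> ((\<eta> / K) powr (1 / e)) powr e"
    using assms calculation by (intro powr_mono2) (auto simp: \<rho>_def)
  then have "\<rho> powr e \<le> \<eta> / K" using assms by (simp add: powr_powr)
  then have "K * \<rho> powr e \<le> \<eta>" using assms by (simp add: field_simps)
  ultimately show ?thesis using that[of \<rho>] by (simp add: \<rho>_def)
qed

text \<open>The mean value theorem expresses the difference of the two values, at most
  \<open>2 * \<rho> * M\<close>, through the derivatives at an intermediate point. The coordinates
  other than i contribute at most \<open>K * \<rho> * M\<close>, and within \<rho>1 of x the i-th
  derivative keeps half of its lower bound \<open>\<kappa> * M\<close>; solving for the i-th
  coordinate leaves a displacement of order \<rho> instead of \<rho>1.\<close>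

lemma poly_graph_close:
  fixes x y :: "real ^ 'n"
  assumes M: "M = cnorm (Suc m) c" "0 < M"
    and K: "real (Suc m) \<le> K" "real CARD('n) * real (Suc m) \<le> K" "1 \<le> K"
    and \<kappa>: "0 < \<kappa>" and \<rho>1: "0 \<le> \<rho>1" "K * K * \<rho>1 \<le> \<kappa> / 2" and \<rho>: "0 \<le> \<rho>" "\<rho> \<le> \<rho>1"
    and x: "x \<in> cube 0 1" "\<bar>pol (Suc m) c x\<bar> \<le> \<rho> * M" "\<kappa> * M < \<bar>pol m (cderiv i c) x\<bar>"
    and y: "y \<in> cube 0 1" "\<bar>pol (Suc m) c y\<bar> \<le> \<rho> * M"
    and i: "\<bar>y $ i - x $ i\<bar> \<le> \<rho>1" and j: "\<And>j. j \<noteq> i \<Longrightarrow> \<bar>y $ j - x $ j\<bar> \<le> \<rho>"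
  shows "\<bar>y $ i - x $ i\<bar> \<le> 2 / \<kappa> * (2 + K) * \<rho>"
proof -
  obtain z where z: "z \<in> cube 0 1" "\<And>i. \<bar>z $ i - x $ i\<bar> \<le> \<bar>y $ i - x $ i\<bar>"
    "pol (Suc m) c y - pol (Suc m) c x = (\<Sum>i\<in>UNIV. (y $ i - x $ i) * pol m (cderiv i c) z)"
    by (rule pol_mvt[OF x(1) y(1), of m c]) (rule that, assumption+)
  have all: "\<bar>y $ l - x $ l\<bar> \<le> \<rho>1" for l using i j[of l] \<rho> by (cases "l = i") auto
  have "\<bar>pol m (cderiv i c) z - pol m (cderiv i c) x\<bar> \<le> \<rho>1 * (real m * cnorm m (cderiv i c))"
    by (rule pol_lipschitz[OF x(1) z(1)]) (use z(2) all \<rho>1 order_trans in blast)+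
  also have "\<dots> \<le> \<rho>1 * (K * (K * M))"
    using cnorm_cderiv_le[of m i c] K M \<rho>1
    by (intro mult_left_mono mult_mono order_trans[OF cnorm_cderiv_le] mult_right_mono) (auto simp: cnorm_nonneg)
  also have "\<dots> = (K * K * \<rho>1) * M" by simp
  also have "\<dots> \<le> \<kappa> / 2 * M" using \<rho>1 M by (intro mult_right_mono) auto
  finally have dz: "\<kappa> / 2 * M \<le> \<bar>pol m (cderiv i c) z\<bar>" using x(3) by linarith
  have "(y $ i - x $ i) * pol m (cderiv i c) z
      = pol (Suc m) c y - pol (Suc m) c x - (\<Sum>l\<in>UNIV - {i}. (y $ l - x $ l) * pol m (cderiv l c) z)"
    unfolding z(3) by (subst sum.remove[of UNIV i]) auto
  moreover have "\<bar>\<Sum>l\<in>UNIV - {i}. (y $ l - x $ l) * pol m (cderiv l c) z\<bar> \<le> K * \<rho> * M"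
  proof -
    have "\<bar>\<Sum>l\<in>UNIV - {i}. (y $ l - x $ l) * pol m (cderiv l c) z\<bar>
        \<le> (\<Sum>l\<in>UNIV - {i}. \<bar>(y $ l - x $ l) * pol m (cderiv l c) z\<bar>)" by (rule sum_abs)
    also have "\<dots> \<le> (\<Sum>l\<in>UNIV - {i}. \<rho> * cnorm m (cderiv l c))"
      unfolding abs_mult using j abs_pol_le[OF z(1)] \<rho> by (intro sum_mono mult_mono) auto
    also have "\<dots> \<le> (\<Sum>l\<in>UNIV. \<rho> * cnorm m (cderiv l c))"
      by (intro sum_mono2) (use \<rho> cnorm_nonneg in \<open>auto intro: mult_nonneg_nonneg\<close>)
    also have "\<dots> = \<rho> * (\<Sum>l\<in>UNIV. cnorm m (cderiv l c))" by (simp add: sum_distrib_left)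
    also have "\<dots> \<le> \<rho> * (K * M)"
      using \<rho> sum_cnorm_cderiv_le[of m c] K M
      by (intro mult_left_mono order_trans[OF sum_cnorm_cderiv_le] mult_right_mono) auto
    finally show ?thesis by (simp add: mult_ac)
  qed
  ultimately have "\<bar>(y $ i - x $ i) * pol m (cderiv i c) z\<bar> \<le> \<rho> * M + \<rho> * M + K * \<rho> * M"
    using x(2) y(2) by linarith
  moreover have "\<bar>y $ i - x $ i\<bar> * (\<kappa> / 2 * M) \<le> \<bar>(y $ i - x $ i) * pol m (cderiv i c) z\<bar>"
    unfolding abs_mult using dz by (intro mult_left_mono) auto
  ultimately have "(\<bar>y $ i - x $ i\<bar> * (\<kappa> / 2)) * M \<le> ((2 + K) * \<rho>) * M" by (simp add: algebra_simps)
  then have "\<bar>y $ i - x $ i\<bar> * (\<kappa> / 2) \<le> (2 + K) * \<rho>" using M by simp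
  then show ?thesis using \<kappa> by (simp add: field_simps)
qed

lemma card_floor_box:
  assumes "\<And>j. 0 < h j" "\<And>j. h j \<le> 1"
  defines "Z \<equiv> Pi\<^sub>E (UNIV :: 'n::finite set) (\<lambda>j. {\<lfloor>- 1 / h j\<rfloor>..\<lfloor>1 / h j\<rfloor>})"
  shows "finite Z" "real (card Z) \<le> (\<Prod>j\<in>UNIV. 4 / h j)"
proof -
  show "finite Z" unfolding Z_def by (rule finite_PiE) simp_all
  have "real (card Z) = (\<Prod>j\<in>UNIV. real (card {\<lfloor>- 1 / h j\<rfloor>..\<lfloor>1 / h j\<rfloor>}))"
    unfolding Z_def by (simp add: card_PiE)
  also have "\<dots> \<le> (\<Prod>j\<in>UNIV. 4 / h j)"
  proof (rule prod_mono, intro conjI)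
    fix j
    have 1: "1 \<le> 1 / h j" using assms(1,2)[of j] by simp
    have "real (card {\<lfloor>- 1 / h j\<rfloor>..\<lfloor>1 / h j\<rfloor>}) = real_of_int (max 0 (\<lfloor>1 / h j\<rfloor> - \<lfloor>- 1 / h j\<rfloor> + 1))"
      by simp
    also have "\<dots> \<le> 2 * (1 / h j) + 2"
      using 1 of_int_floor_le[of "1 / h j"] floor_correct[of "- 1 / h j"] by (auto simp: max_def) linarith
    also have "\<dots> \<le> 4 / h j" using 1 by simp
    finally show "real (card {\<lfloor>- 1 / h j\<rfloor>..\<lfloor>1 / h j\<rfloor>}) \<le> 4 / h j" .
  qed auto
  finally show "real (card Z) \<le> (\<Prod>j\<in>UNIV. 4 / h j)" .
qed

lemma abs_diff_le_of_floor_eq: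
  fixes a b h :: real
  assumes "\<lfloor>a / h\<rfloor> = \<lfloor>b / h\<rfloor>" "0 < h" shows "\<bar>a - b\<bar> \<le> h"
proof -
  have "\<bar>a / h - b / h\<bar> \<le> 1" using assms(1) by linarith
  then have "\<bar>(a - b) / h\<bar> \<le> 1" by (simp add: diff_divide_distrib)
  then show ?thesis using assms(2) by (simp add: abs_divide)
qed

text \<open>Near its zero set, a polynomial with a large \<open>i\<close>-th derivative is close to a Lipschitz graph
  over the hyperplane orthogonal to the \<open>i\<close>-th axis; hence the exponent \<open>d > n - 1\<close>.\<close>

lemma poly_graph_cover:
  fixes d \<kappa> \<eta> :: real
  assumes d: "real CARD('n) - 1 < d" and \<kappa>: "0 < \<kappa>" and \<eta>: "0 < \<eta>"
  obtains \<epsilon> where "0 < \<epsilon>" "\<And>c (i::'n::finite). 0 < cnorm (Suc m) c \<Longrightarrow>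
     cube_cover d \<eta> {x \<in> cube 0 1. \<bar>pol (Suc m) c x\<bar> \<le> \<epsilon> * cnorm (Suc m) c \<and>
        \<kappa> * cnorm (Suc m) c < \<bar>pol m (cderiv i c) x\<bar>}"
proof -
  define n where "n = CARD('n)"
  have n: "1 \<le> n" by (simp add: n_def Suc_leI)
  define K where "K = real n * real (Suc m)"
  have nm: "1 * 1 \<le> real n * real (Suc m)" "1 * real (Suc m) \<le> real n * real (Suc m)"
    using n by (intro mult_mono; simp)+
  then have K: "real (Suc m) \<le> K" "real CARD('n) * real (Suc m) \<le> K" "1 \<le> K"
    by (auto simp: K_def n_def)
  \<comment> \<open>\<open>2 / \<kappa> * (2 + K)\<close> is the displacement factor of
    \<open>poly_graph_close\<close>; the maximum with 1 lets cubes of radius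
    \<open>D * \<rho>\<close> absorb the other coordinates too.\<close>
  define D where "D = max 1 (2 / \<kappa> * (2 + K))"
  \<comment> \<open>The width in direction i: small enough for the i-th derivative to keep half of
    its size, and independent of the \<rho> chosen later.\<close>
  define \<rho>1 where "\<rho>1 = min 1 (\<kappa> / (2 * K * K))"
  have \<rho>1: "0 < \<rho>1" "\<rho>1 \<le> 1" using \<kappa> K by (auto simp: \<rho>1_def)
  have "K * K * \<rho>1 \<le> K * K * (\<kappa> / (2 * K * K))" using K by (intro mult_left_mono) (auto simp: \<rho>1_def)
  also have "\<dots> = \<kappa> / 2" using K by simp
  finally have \<rho>1': "K * K * \<rho>1 \<le> \<kappa> / 2" .
  have D: "1 \<le> D" by (simp add: D_def)
  \<comment> \<open>The cells number at most a constant times \<rho> to the power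
    \<open>- (n - 1)\<close>, each costing \<open>(D * \<rho>) powr d\<close>; the total is small
    because the exponent \<open>d - (real n - 1)\<close> is positive.\<close>
  obtain \<rho> where \<rho>: "0 < \<rho>" "\<rho> \<le> \<rho>1 / D" "(4 / \<rho>1 * 4 ^ (n - 1) * D powr d) * \<rho> powr (d - (real n - 1)) \<le> \<eta>"
  proof (rule powr_small_exists[of "d - (real n - 1)" "4 / \<rho>1 * 4 ^ (n - 1) * D powr d" \<eta> "\<rho>1 / D"])
    show "0 < d - (real n - 1)" using d by (simp add: n_def)
    show "0 < 4 / \<rho>1 * 4 ^ (n - 1) * D powr d" using \<rho>1 D by (intro mult_pos_pos divide_pos_pos) auto
    show "0 < \<rho>1 / D" using \<rho>1 D by auto
  qed (use \<eta> in auto)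
  have "D * \<rho> \<le> \<rho>1" using \<rho> D by (simp add: field_simps)
  moreover have "1 * \<rho> \<le> D * \<rho>" using D \<rho> by (intro mult_right_mono) auto
  ultimately have \<rho>': "\<rho> \<le> \<rho>1" "D * \<rho> \<le> 1" "\<rho> \<le> 1" "\<rho> \<le> D * \<rho>" using \<rho>1 by auto
  show ?thesis
  proof (rule that[OF \<rho>(1)])
    fix c :: "('n \<Rightarrow> nat) \<Rightarrow> real" and i :: 'n
    assume M: "0 < cnorm (Suc m) c"
    let ?A = "{x \<in> cube 0 1. \<bar>pol (Suc m) c x\<bar> \<le> \<rho> * cnorm (Suc m) c \<and>
        \<kappa> * cnorm (Suc m) c < \<bar>pol m (cderiv i c) x\<bar>}"
    \<comment> \<open>Slabs that are long in direction i: there the graph property, not the cell,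
      keeps points together, so only the other \<open>n - 1\<close> directions need to be resolved
      at width \<rho>.\<close>
    define h where "h = (\<lambda>j::'n. if j = i then \<rho>1 else \<rho>)"
    have h: "0 < h j" "h j \<le> 1" for j using \<rho>1 \<rho> \<rho>' by (auto simp: h_def)
    define Z where "Z = Pi\<^sub>E (UNIV :: 'n set) (\<lambda>j. {\<lfloor>- 1 / h j\<rfloor>..\<lfloor>1 / h j\<rfloor>})"
    have Z: "finite Z" "real (card Z) \<le> (\<Prod>j\<in>UNIV. 4 / h j)"
      unfolding Z_def using card_floor_box[of h] h by auto
    show "cube_cover d \<eta> ?A"
    proof (rule cube_cover_grid[where Z = Z and g = "\<lambda>x j. \<lfloor>x $ j / h j\<rfloor>" and \<rho> = "D * \<rho>"])
      fix x assume "x \<in> ?A"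
      then have x: "\<bar>x $ j\<bar> \<le> 1" for j by (simp add: mem_cube)
      have "- 1 / h j \<le> x $ j / h j" "x $ j / h j \<le> 1 / h j" for j
        using x[of j] h[of j] by (auto intro!: divide_right_mono simp: abs_le_iff simp del: divide_minus_left)
      then show "(\<lambda>j. \<lfloor>x $ j / h j\<rfloor>) \<in> Z" unfolding Z_def by (auto intro!: floor_mono)
    next
      fix x y assume x: "x \<in> ?A" and y: "y \<in> ?A" and eq: "(\<lambda>j. \<lfloor>x $ j / h j\<rfloor>) = (\<lambda>j. \<lfloor>y $ j / h j\<rfloor>)"
      have le: "\<bar>y $ j - x $ j\<bar> \<le> h j" for j
        by (rule abs_diff_le_of_floor_eq[OF _ h(1)]) (use fun_cong[OF eq, of j] in simp)
      have "\<bar>y $ i - x $ i\<bar> \<le> 2 / \<kappa> * (2 + K) * \<rho>"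
      proof (rule poly_graph_close[OF refl M K \<kappa> less_imp_le[OF \<rho>1(1)] \<rho>1' less_imp_le[OF \<rho>(1)] \<rho>'(1)])
        show "\<bar>y $ i - x $ i\<bar> \<le> \<rho>1" using le[of i] by (simp add: h_def)
        show "\<bar>y $ j - x $ j\<bar> \<le> \<rho>" if "j \<noteq> i" for j using le[of j] that by (simp add: h_def)
      qed (use x y in auto)
      also have "\<dots> \<le> D * \<rho>" using \<rho> by (intro mult_right_mono) (auto simp: D_def)
      finally have "\<bar>y $ i - x $ i\<bar> \<le> D * \<rho>" .
      moreover have "\<bar>y $ j - x $ j\<bar> \<le> D * \<rho>" if "j \<noteq> i" for j
        using le[of j] that \<rho>' by (simp add: h_def)
      ultimately have "\<bar>y $ j - x $ j\<bar> \<le> D * \<rho>" for j by (cases "j = i") auto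
      then show "infnorm (y - x) \<le> D * \<rho>" by (simp add: infnorm_le_iff)
    next
      have "(\<Prod>j\<in>UNIV. 4 / h j) = 4 / \<rho>1 * (\<Prod>j\<in>UNIV - {i}. 4 / h j)"
        by (subst prod.remove[of _ i]) (auto simp: h_def)
      also have "(\<Prod>j\<in>UNIV - {i}. 4 / h j) = (\<Prod>j\<in>UNIV - {i}. 4 / \<rho>)"
        by (rule prod.cong) (auto simp: h_def)
      also have "\<dots> = (4 / \<rho>) ^ (n - 1)" by (simp add: n_def card_Diff_singleton)
      finally have prd: "(\<Prod>j\<in>UNIV. 4 / h j) = 4 / \<rho>1 * (4 / \<rho>) ^ (n - 1)" .
      have "real (card Z) * (D * \<rho>) powr d \<le> (4 / \<rho>1 * (4 / \<rho>) ^ (n - 1)) * (D * \<rho>) powr d"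
        using Z(2) unfolding prd by (intro mult_right_mono) auto
      also have "\<dots> = (4 / \<rho>1 * 4 ^ (n - 1) * D powr d) * (\<rho> powr d / \<rho> ^ (n - 1))"
        using D \<rho> by (simp add: powr_mult power_divide)
      also have "\<rho> powr d / \<rho> ^ (n - 1) = \<rho> powr (d - (real n - 1))"
        using \<rho> n by (simp add: powr_diff powr_realpow[symmetric] of_nat_diff)
      also have "(4 / \<rho>1 * 4 ^ (n - 1) * D powr d) * \<rho> powr (d - (real n - 1)) \<le> \<eta>" by (rule \<rho>)
      finally show "real (card Z) * (D * \<rho>) powr d \<le> \<eta>" .
    qed (use Z \<rho> D \<rho>' in auto)
  qed
qed

text \<open>The \<epsilon> has to be uniform in the coefficients, since it is applied to polynomials
  rescaled from arbitrary cubes. Which derivative is large is decided by coefficient norms, for the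
  polynomial as a whole; only then is the set split pointwise, the induction hypothesis covering the
  points where that derivative is small and \<open>poly_graph_cover\<close> the others.\<close>

lemma poly_sublevel_cover:
  fixes d \<eta> :: real
  assumes d: "real CARD('n) - 1 < d" and "0 < \<eta>"
  shows "\<exists>\<epsilon>>0. \<forall>c :: ('n::finite \<Rightarrow> nat) \<Rightarrow> real. 0 < cnorm m c \<longrightarrow>
     cube_cover d \<eta> {x \<in> cube 0 1. \<bar>pol m c x\<bar> \<le> \<epsilon> * cnorm m c}"
  using \<open>0 < \<eta>\<close>
proof (induction m arbitrary: \<eta>)
  case 0
  have m: "midx 0 = {\<lambda>_::'n. 0::nat}" by (auto simp: midx_def order_zero)
  have "{x \<in> cube 0 1. \<bar>pol 0 c x\<bar> \<le> 1 / 2 * cnorm 0 c} = {}" if "0 < cnorm 0 c" for c :: "('n \<Rightarrow> nat) \<Rightarrow> real"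
    using that by (auto simp: pol_def cnorm_def m monomial_def)
  then have "cube_cover d \<eta> {x \<in> cube 0 1. \<bar>pol 0 c x\<bar> \<le> 1 / 2 * cnorm 0 c}" if "0 < cnorm 0 c" for c :: "('n \<Rightarrow> nat) \<Rightarrow> real"
    using that cube_cover_empty[OF less_imp_le[OF 0], of d] by (simp only:)
  then show ?case by (intro exI[of _ "1 / 2"]) simp
next
  case (Suc m)
  define n where "n = CARD('n)"
  have n: "0 < n" by (simp add: n_def)
  have \<eta>2: "0 < \<eta> / 2" using Suc.prems by simp
  obtain \<epsilon>1 where \<epsilon>1: "0 < \<epsilon>1" "\<And>c :: ('n \<Rightarrow> nat) \<Rightarrow> real. 0 < cnorm m c \<Longrightarrow>
     cube_cover d (\<eta> / 2) {x \<in> cube 0 1. \<bar>pol m c x\<bar> \<le> \<epsilon>1 * cnorm m c}"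
    using Suc.IH[OF \<eta>2] by blast
  \<comment> \<open>If the non-constant coefficients carry a third of the norm, one of the n
    derivatives has norm at least \<open>cnorm (Suc m) c / (3 * real n)\<close>. With this \<kappa>
    the set covered by \<open>poly_graph_cover\<close> then reaches down to the threshold of the
    induction hypothesis.\<close>
  define \<kappa> where "\<kappa> = \<epsilon>1 / (3 * real n)"
  have \<kappa>: "0 < \<kappa>" using \<epsilon>1 n by (simp add: \<kappa>_def)
  obtain \<epsilon>2 where \<epsilon>2: "0 < \<epsilon>2" "\<And>c (i::'n). 0 < cnorm (Suc m) c \<Longrightarrow>
     cube_cover d (\<eta> / 2) {x \<in> cube 0 1. \<bar>pol (Suc m) c x\<bar> \<le> \<epsilon>2 * cnorm (Suc m) c \<and>
        \<kappa> * cnorm (Suc m) c < \<bar>pol m (cderiv i c) x\<bar>}"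
    by (rule poly_graph_cover[OF d \<kappa> \<eta>2, where m = m]) (rule that, assumption+)
  define \<epsilon> where "\<epsilon> = min \<epsilon>2 (1 / 4)"
  have "cube_cover d \<eta> {x \<in> cube 0 1. \<bar>pol (Suc m) c x\<bar> \<le> \<epsilon> * cnorm (Suc m) c}"
    if M: "0 < cnorm (Suc m) c" for c :: "('n \<Rightarrow> nat) \<Rightarrow> real"
  proof (cases "cnorm (Suc m) c - \<bar>c (\<lambda>_. 0)\<bar> < cnorm (Suc m) c / 3")
    case True
    \<comment> \<open>The constant term exceeds two thirds of the norm and the rest stays below one
      third, so for \<epsilon> at most 1/4 the sublevel set is empty.\<close>
    have "\<epsilon> * cnorm (Suc m) c < \<bar>pol (Suc m) c x\<bar>" if "x \<in> cube 0 1" for x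
    proof -
      have "\<bar>\<Sum>\<beta>\<in>midx (Suc m) - {\<lambda>_. 0}. c \<beta> * monomial \<beta> x\<bar> \<le> (\<Sum>\<beta>\<in>midx (Suc m) - {\<lambda>_. 0}. \<bar>c \<beta> * monomial \<beta> x\<bar>)"
        by (rule sum_abs)
      also have "\<dots> \<le> (\<Sum>\<beta>\<in>midx (Suc m) - {\<lambda>_. 0}. \<bar>c \<beta>\<bar>)"
        unfolding abs_mult using abs_mono_le_1[OF that] by (intro sum_mono mult_left_le) auto
      also have "\<dots> = cnorm (Suc m) c - \<bar>c (\<lambda>_. 0)\<bar>" by (simp add: cnorm_split)
      finally have "\<bar>pol (Suc m) c x\<bar> > cnorm (Suc m) c / 3"
        using True unfolding pol_split[of "Suc m" c x] by linarith
      moreover have "\<epsilon> * cnorm (Suc m) c \<le> 1 / 4 * cnorm (Suc m) c"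
        using M by (intro mult_right_mono) (auto simp: \<epsilon>_def)
      ultimately show ?thesis using M by linarith
    qed
    then have "{x \<in> cube 0 1. \<bar>pol (Suc m) c x\<bar> \<le> \<epsilon> * cnorm (Suc m) c} = {}" by (auto simp: not_le)
    then show ?thesis using cube_cover_empty[OF less_imp_le[OF Suc.prems], of d] by (simp only:)
  next
    case False
    have "\<exists>i. cnorm (Suc m) c / (3 * real n) \<le> cnorm m (cderiv i c)"
    proof (rule ccontr)
      assume "\<not> (\<exists>i. cnorm (Suc m) c / (3 * real n) \<le> cnorm m (cderiv i c))"
      then have "(\<Sum>i\<in>UNIV. cnorm m (cderiv i c)) < (\<Sum>i\<in>(UNIV::'n set). cnorm (Suc m) c / (3 * real n))"
        by (intro sum_strict_mono) (auto simp: not_le)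
      also have "\<dots> = cnorm (Suc m) c / 3" using n by (simp add: n_def)
      finally show False using sum_cnorm_cderiv_ge[of m c] False by linarith
    qed
    then obtain i where i: "cnorm (Suc m) c / (3 * real n) \<le> cnorm m (cderiv i c)" by blast
    have "0 < cnorm (Suc m) c / (3 * real n)" using M n by simp
    then have i0: "0 < cnorm m (cderiv i c)" using i by linarith
    have le: "\<kappa> * cnorm (Suc m) c \<le> \<epsilon>1 * cnorm m (cderiv i c)"
      using mult_left_mono[OF i less_imp_le[OF \<epsilon>1(1)]] by (simp add: \<kappa>_def)
    have le2: "\<epsilon> * cnorm (Suc m) c \<le> \<epsilon>2 * cnorm (Suc m) c"
      using M by (intro mult_right_mono) (auto simp: \<epsilon>_def)
    have "cube_cover d (\<eta> / 2 + \<eta> / 2)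
       ({x \<in> cube 0 1. \<bar>pol m (cderiv i c) x\<bar> \<le> \<epsilon>1 * cnorm m (cderiv i c)} \<union>
        {x \<in> cube 0 1. \<bar>pol (Suc m) c x\<bar> \<le> \<epsilon>2 * cnorm (Suc m) c \<and>
        \<kappa> * cnorm (Suc m) c < \<bar>pol m (cderiv i c) x\<bar>})"
      by (rule cube_cover_Un[OF \<epsilon>1(2)[OF i0] \<epsilon>2(2)[OF M]])
    then have "cube_cover d \<eta>
       ({x \<in> cube 0 1. \<bar>pol m (cderiv i c) x\<bar> \<le> \<epsilon>1 * cnorm m (cderiv i c)} \<union>
        {x \<in> cube 0 1. \<bar>pol (Suc m) c x\<bar> \<le> \<epsilon>2 * cnorm (Suc m) c \<and>
        \<kappa> * cnorm (Suc m) c < \<bar>pol m (cderiv i c) x\<bar>})" by simp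
    then show ?thesis
    proof (rule cube_cover_mono, intro subsetI)
      fix x assume "x \<in> {x \<in> cube 0 1. \<bar>pol (Suc m) c x\<bar> \<le> \<epsilon> * cnorm (Suc m) c}"
      then have "x \<in> cube 0 1" "\<bar>pol (Suc m) c x\<bar> \<le> \<epsilon>2 * cnorm (Suc m) c" using le2 by auto
      moreover have "\<bar>pol m (cderiv i c) x\<bar> \<le> \<epsilon>1 * cnorm m (cderiv i c) \<or> \<kappa> * cnorm (Suc m) c < \<bar>pol m (cderiv i c) x\<bar>"
        using le by linarith
      ultimately show "x \<in> {x \<in> cube 0 1. \<bar>pol m (cderiv i c) x\<bar> \<le> \<epsilon>1 * cnorm m (cderiv i c)} \<union>
        {x \<in> cube 0 1. \<bar>pol (Suc m) c x\<bar> \<le> \<epsilon>2 * cnorm (Suc m) c \<and>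
        \<kappa> * cnorm (Suc m) c < \<bar>pol m (cderiv i c) x\<bar>}" by blast
    qed
  qed
  moreover have "0 < \<epsilon>" using \<epsilon>2 by (simp add: \<epsilon>_def)
  ultimately show ?case by blast
qed

section \<open>Polynomials on a regular set\<close>

lemma emeasure_Union_list_le:
  assumes "\<And>p. p \<in> set xs \<Longrightarrow> A p \<in> sets M" "\<And>p. p \<in> set xs \<Longrightarrow> emeasure M (A p) \<le> ennreal (f p)" "\<And>p. 0 \<le> f p"
  shows "emeasure M (\<Union>p\<in>set xs. A p) \<le> ennreal (\<Sum>p\<leftarrow>xs. f p)"
  using assms(1,2)
proof (induction xs)
  case (Cons p xs)
  have "emeasure M (\<Union>q\<in>set (p # xs). A q) = emeasure M (A p \<union> (\<Union>q\<in>set xs. A q))" by simp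
  also have "\<dots> \<le> emeasure M (A p) + emeasure M (\<Union>q\<in>set xs. A q)"
    using Cons.prems(1) by (intro emeasure_subadditive sets.finite_UN) auto
  also have "\<dots> \<le> ennreal (f p) + ennreal (\<Sum>p\<leftarrow>xs. f p)"
    using Cons by (intro add_mono) auto
  also have "\<dots> = ennreal (\<Sum>q\<leftarrow>p # xs. f q)"
    by (subst ennreal_plus[symmetric]) (auto intro!: sum_list_nonneg simp: assms(3))
  finally show ?case .
qed simp

lemma poly_bounded_on_cube:
  assumes "P \<in> poly_space (int m)"
  obtains B where "0 < B" "\<And>x. x \<in> cube w r \<Longrightarrow> \<bar>P x\<bar> \<le> B"
proof -
  have "bounded (P ` cube w r)"
    by (intro compact_imp_bounded compact_continuous_image continuous_on_poly_space[OF assms] compact_cube)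
  then obtain B where "0 < B" "\<forall>y\<in>P ` cube w r. norm y \<le> B" unfolding bounded_pos by blast
  then show ?thesis using that[of B] by simp
qed

text \<open>The measure lives on \<open>S\<close> itself, so integrals over cubes automatically mean
  integrals over their traces on \<open>S\<close>; \<open>id_borel\<close> makes traces of Borel
  sets measurable. The radius bound \<open>R\<close> is a parameter because the comparison cubes on
  \<open>S\<close> are much larger than the unit cube.\<close>

locale regular_measure =
  fixes N :: "(real ^ 'n) measure" and S :: "(real ^ 'n) set" and d c1 c2 R :: real
  assumes space_N: "space N = S"
    and id_borel: "(\<lambda>x. x) \<in> borel_measurable N"
    and closed_S: "closed S" and S_nonempty: "S \<noteq> {}"
    and d_gt: "real CARD('n) - 1 < d" and d_lt: "d < real CARD('n)"
    and R_ge: "1 \<le> R" and c1_pos: "0 < c1" and c2_pos: "0 < c2"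
    and lower: "\<And>w r. w \<in> S \<Longrightarrow> 0 < r \<Longrightarrow> r \<le> R \<Longrightarrow> ennreal (c1 * r powr d) \<le> emeasure N (cube w r \<inter> S)"
    and upper: "\<And>w r. w \<in> S \<Longrightarrow> 0 < r \<Longrightarrow> r \<le> R \<Longrightarrow> emeasure N (cube w r \<inter> S) \<le> ennreal (c2 * r powr d)"
begin

lemma d_pos: "0 < d"
proof -
  have "1 \<le> real CARD('n)" by (simp add: Suc_leI)
  then show ?thesis using d_gt by linarith
qed

lemma sets_N: "A \<in> sets borel \<Longrightarrow> A \<inter> S \<in> sets N"
  using measurable_sets[OF id_borel, of A] by (simp add: space_N vimage_def Int_def)

lemma poly_borel_N: "P \<in> poly_space (int m) \<Longrightarrow> P \<in> borel_measurable N"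
  using measurable_compose[OF id_borel poly_space_borel] by simp

lemma set_integrable_mult_poly:
  assumes "set_integrable N (cube w r) g" "P \<in> poly_space (int m)"
  shows "set_integrable N (cube w r) (\<lambda>x. g x * P x)"
proof -
  obtain B where B: "0 < B" "\<And>x. x \<in> cube w r \<Longrightarrow> \<bar>P x\<bar> \<le> B"
    using poly_bounded_on_cube[OF assms(2)] by blast
  have "set_integrable N (cube w r) (\<lambda>x. B * g x)" using assms(1) by simp
  then show ?thesis
  proof (rule set_integrable_bound)
    have "(\<lambda>x. indicator (cube w r) x *\<^sub>R g x) \<in> borel_measurable N"
      using assms(1) unfolding set_integrable_def by (rule borel_measurable_integrable)
    then have "(\<lambda>x. (indicator (cube w r) x *\<^sub>R g x) * P x) \<in> borel_measurable N"
      by (intro borel_measurable_times poly_borel_N[OF assms(2)])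
    then show "set_borel_measurable N (cube w r) (\<lambda>x. g x * P x)"
      unfolding set_borel_measurable_def by (simp add: mult_ac)
    show "AE x in N. x \<in> cube w r \<longrightarrow> norm (g x * P x) \<le> norm (B * g x)"
      using B by (intro AE_I2 impI) (simp add: abs_mult mult.commute mult_right_mono)
  qed
qed

lemma set_integrable_const:
  assumes "w \<in> S" "0 < r" "r \<le> R"
  shows "set_integrable N (cube w r) (\<lambda>x. a :: real)"
proof -
  have "emeasure N (cube w r \<inter> S) < \<infinity>"
    using upper[OF assms] by (rule order.strict_trans1) simp
  then have "integrable N (\<lambda>x. indicator (cube w r \<inter> S) x *\<^sub>R a)"
    by (intro integrable_scaleR_left integrable_real_indicator sets_N) auto
  also have "?this \<longleftrightarrow> integrable N (\<lambda>x. indicator (cube w r) x *\<^sub>R a)"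
    by (rule Bochner_Integration.integrable_cong) (auto simp: space_N indicator_def)
  finally show ?thesis unfolding set_integrable_def .
qed

lemma set_integrable_poly:
  assumes "w \<in> S" "0 < r" "r \<le> R" "P \<in> poly_space (int m)"
  shows "set_integrable N (cube w r) P"
  using set_integrable_mult_poly[OF set_integrable_const[OF assms(1-3), of 1] assms(4)] by simp

lemma LINT_const_le:
  assumes "w \<in> S" "0 < r" "r \<le> R" "0 \<le> a"
  shows "(LINT x:cube w r|N. a) \<le> a * (c2 * r powr d)"
proof -
  have "(LINT x:cube w r|N. a) = (LINT x|N. a * indicator (cube w r \<inter> S) x)"
    unfolding set_lebesgue_integral_def
    by (rule Bochner_Integration.integral_cong) (auto simp: space_N indicator_def)
  also have "\<dots> = a * measure N (cube w r \<inter> S)"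
    by (simp add: space_N Int_assoc)
  also have "measure N (cube w r \<inter> S) \<le> c2 * r powr d"
    unfolding measure_def using upper[OF assms(1-3)] c2_pos by (intro enn2real_leI) auto
  finally show ?thesis using assms by (simp add: mult_left_mono)
qed

lemma LINT_nonneg: "(\<And>x. x \<in> A \<Longrightarrow> 0 \<le> g x) \<Longrightarrow> 0 \<le> (LINT x:A|N. g x :: real)"
  unfolding set_lebesgue_integral_def by (intro Bochner_Integration.integral_nonneg) (auto simp: indicator_def)

lemma abs_LINT_le:
  assumes "set_integrable N A g"
  shows "\<bar>LINT x:A|N. g x :: real\<bar> \<le> (LINT x:A|N. \<bar>g x\<bar>)"
proof -
  have "\<bar>LINT x:A|N. g x\<bar> \<le> (LINT x|N. \<bar>indicator A x *\<^sub>R g x\<bar>)"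
    unfolding set_lebesgue_integral_def by (rule integral_abs_bound)
  then show ?thesis by (simp add: set_lebesgue_integral_def abs_mult)
qed

text \<open>A Remez-type inequality: the sublevel set has small content, hence small \<open>d\<close>-dimensional
  measure, and so cannot fill the cube.\<close>

lemma remez_nn:
  shows "\<exists>C>0. \<forall>w\<in>S. \<forall>r. 0 < r \<and> 2 * r \<le> R \<longrightarrow> (\<forall>c.
    ennreal (C * r powr d * cnorm m c) \<le> (\<integral>\<^sup>+x\<in>cube w r. ennreal \<bar>\<Sum>\<beta>\<in>midx m. c \<beta> * smono w r \<beta> x\<bar> \<partial>N))"
proof -
  \<comment> \<open>A cover of content \<eta>, blown up to radius r and recentred on
    \<open>S\<close>, has measure at most \<open>c2 * (2 * r) powr d * \<eta>\<close>, which is half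
    of the lower bound \<open>c1 * r powr d\<close>.\<close>
  define \<eta> where "\<eta> = c1 / (2 * c2 * 2 powr d)"
  have \<eta>: "0 < \<eta>" using c1_pos c2_pos by (simp add: \<eta>_def)
  obtain \<epsilon> where \<epsilon>: "0 < \<epsilon>" and cov: "\<And>c :: ('n \<Rightarrow> nat) \<Rightarrow> real. 0 < cnorm m c \<Longrightarrow>
     cube_cover d \<eta> {x \<in> cube 0 1. \<bar>pol m c x\<bar> \<le> \<epsilon> * cnorm m c}"
    using poly_sublevel_cover[OF d_gt \<eta>] by blast
  define C where "C = \<epsilon> * c1 / 2"
  have "ennreal (C * r powr d * cnorm m c) \<le> (\<integral>\<^sup>+x\<in>cube w r. ennreal \<bar>\<Sum>\<beta>\<in>midx m. c \<beta> * smono w r \<beta> x\<bar> \<partial>N)"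
    if w: "w \<in> S" and r: "0 < r" "2 * r \<le> R" for w r c
  proof (cases "0 < cnorm m c")
    case False
    then have "cnorm m c = 0" using cnorm_nonneg[of m c] by linarith
    then show ?thesis by simp
  next
    case True
    define t where "t = c1 * r powr d / 2"
    have t: "0 < t" using c1_pos r by (simp add: t_def)
    define P where "P = (\<lambda>x. \<Sum>\<beta>\<in>midx m. c \<beta> * smono w r \<beta> x)"
    have P_pol: "P x = pol m c ((1 / r) *\<^sub>R (x - w))" for x by (simp add: P_def pol_def smono_def)
    have "P \<in> poly_space (int m)"
      unfolding P_def by (intro poly_space_sum poly_space_cmult smonomial_in_poly_space)
    then have Pb [measurable]: "P \<in> borel_measurable borel" by (rule poly_space_borel)
    define B where "B = {x \<in> cube w r. \<bar>P x\<bar> \<le> \<epsilon> * cnorm m c}"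
    have "{x \<in> space borel. \<bar>P x\<bar> \<le> \<epsilon> * cnorm m c} \<in> sets borel" by measurable
    then have Bb: "B \<in> sets borel" unfolding B_def using sets.Int[OF cube_borel] by (simp add: Int_def)
    obtain xs where xs: "\<forall>(y, \<rho>)\<in>set xs. 0 < \<rho> \<and> \<rho> \<le> 1"
      "{x \<in> cube 0 1. \<bar>pol m c x\<bar> \<le> \<epsilon> * cnorm m c} \<subseteq> (\<Union>(y, \<rho>)\<in>set xs. cube y \<rho>)"
      "(\<Sum>(y, \<rho>)\<leftarrow>xs. \<rho> powr d) \<le> \<eta>"
      using cov[OF True] unfolding cube_cover_def by (elim exE conjE) (rule that)
    define A where "A p = cube (w + r *\<^sub>R fst p) (r * snd p) \<inter> S" for p :: "(real^'n) \<times> real"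
    define f where "f p = c2 * (2 * r) powr d * snd p powr d" for p :: "(real^'n) \<times> real"
    have A: "A p \<in> sets N" for p unfolding A_def by (intro sets_N cube_borel)
    have fA: "emeasure N (A p) \<le> ennreal (f p)" if p: "p \<in> set xs" for p
    proof (cases "A p = {}")
      case False
      then obtain s where s: "s \<in> S" "s \<in> cube (w + r *\<^sub>R fst p) (r * snd p)" unfolding A_def by blast
      have \<rho>: "0 < snd p" "snd p \<le> 1" using xs(1) p by auto
      \<comment> \<open>The upper bound is available for cubes centred in \<open>S\<close> only;
        moving the centre to a point s of the trace doubles the radius. The condition
        \<open>2 * r \<le> R\<close> comes from here.\<close>
      have "infnorm ((w + r *\<^sub>R fst p) - s) \<le> r * snd p" using s(2) unfolding cube_def by (simp add: infnorm_sub)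
      then have "cube (w + r *\<^sub>R fst p) (r * snd p) \<subseteq> cube s (2 * r * snd p)"
        by (intro cube_mono) simp
      then have "emeasure N (A p) \<le> emeasure N (cube s (2 * r * snd p) \<inter> S)"
        unfolding A_def by (intro emeasure_mono sets_N cube_borel) auto
      also have "\<dots> \<le> ennreal (c2 * (2 * r * snd p) powr d)"
      proof (rule upper[OF s(1)])
        show "0 < 2 * r * snd p" using r \<rho> by simp
        have "2 * r * snd p \<le> 2 * r * 1" using r \<rho> by (intro mult_left_mono) auto
        then show "2 * r * snd p \<le> R" using r by linarith
      qed
      also have "c2 * (2 * r * snd p) powr d = f p" using r \<rho> by (simp add: f_def powr_mult)
      finally show ?thesis .
    qed simp
    have "B \<inter> S \<subseteq> (\<Union>p\<in>set xs. A p)"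
    proof
      fix x assume x: "x \<in> B \<inter> S"
      have "(1 / r) *\<^sub>R (x - w) \<in> {x \<in> cube 0 1. \<bar>pol m c x\<bar> \<le> \<epsilon> * cnorm m c}"
        using x r by (auto simp: B_def mem_cube P_pol pos_divide_le_eq)
      then obtain p where p: "p \<in> set xs" "(1 / r) *\<^sub>R (x - w) \<in> cube (fst p) (snd p)"
        using xs(2) by (auto simp: split_beta)
      have "x \<in> cube (w + r *\<^sub>R fst p) (r * snd p)"
        unfolding mem_cube
      proof
        fix i
        have "\<bar>(x $ i - w $ i) / r - fst p $ i\<bar> \<le> snd p" using p(2) by (simp add: mem_cube)
        then have "r * \<bar>(x $ i - w $ i) / r - fst p $ i\<bar> \<le> r * snd p" using r by (intro mult_left_mono) auto
        also have "r * \<bar>(x $ i - w $ i) / r - fst p $ i\<bar> = \<bar>r * ((x $ i - w $ i) / r - fst p $ i)\<bar>"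
          using r by (simp add: abs_mult)
        also have "r * ((x $ i - w $ i) / r - fst p $ i) = x $ i - (w + r *\<^sub>R fst p) $ i"
          using r unfolding right_diff_distrib[of r "(x $ i - w $ i) / r"] by simp
        finally show "\<bar>x $ i - (w + r *\<^sub>R fst p) $ i\<bar> \<le> r * snd p" .
      qed
      then show "x \<in> (\<Union>p\<in>set xs. A p)" using p x by (auto simp: A_def)
    qed
    then have "emeasure N (B \<inter> S) \<le> emeasure N (\<Union>p\<in>set xs. A p)"
      using A by (intro emeasure_mono sets.finite_UN) auto
    also have "\<dots> \<le> ennreal (\<Sum>p\<leftarrow>xs. f p)"
      using A fA c2_pos by (intro emeasure_Union_list_le) (auto simp: f_def)
    finally have e1: "emeasure N (B \<inter> S) \<le> ennreal (\<Sum>p\<leftarrow>xs. f p)" .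
    have "(\<Sum>p\<leftarrow>xs. f p) = c2 * (2 * r) powr d * (\<Sum>(y, \<rho>)\<leftarrow>xs. \<rho> powr d)"
      by (simp add: f_def[abs_def] sum_list_const_mult case_prod_unfold)
    also have "\<dots> \<le> c2 * (2 * r) powr d * \<eta>" using xs(3) c2_pos by (intro mult_left_mono) auto
    also have "\<dots> = t" using c2_pos r by (simp add: \<eta>_def t_def powr_mult)
    finally have eB: "emeasure N (B \<inter> S) \<le> ennreal t" using order_trans[OF e1 ennreal_leI] by blast
    \<comment> \<open>On G the polynomial exceeds \<open>\<epsilon> * cnorm m c\<close>; removing
      the sublevel set takes away at most t from a measure of at least \<open>t + t\<close>.\<close>
    define G where "G = (cube w r - B) \<inter> S"
    have GN: "G \<in> sets N" unfolding G_def by (intro sets_N sets.Diff cube_borel Bb)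
    have "ennreal (t + t) \<le> emeasure N (cube w r \<inter> S)" using lower[OF w r(1)] r by (simp add: t_def)
    also have "cube w r \<inter> S = (B \<inter> S) \<union> G" by (auto simp: B_def G_def)
    also have "emeasure N \<dots> \<le> emeasure N (B \<inter> S) + emeasure N G"
      using GN sets_N[OF Bb] by (intro emeasure_subadditive) auto
    also have "\<dots> \<le> ennreal t + emeasure N G" using eB by (intro add_right_mono)
    finally have "ennreal t + ennreal t \<le> ennreal t + emeasure N G" using ennreal_plus[of t t] t by simp
    then have tG: "ennreal t \<le> emeasure N G" unfolding ennreal_add_left_cancel_le by simp
    have "ennreal (C * r powr d * cnorm m c) = ennreal (\<epsilon> * cnorm m c) * ennreal t"
      using \<epsilon> t by (subst ennreal_mult'[symmetric]) (auto simp: C_def t_def mult_ac cnorm_nonneg)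
    also have "\<dots> \<le> ennreal (\<epsilon> * cnorm m c) * emeasure N G" using tG by (intro mult_left_mono) auto
    also have "\<dots> = (\<integral>\<^sup>+x. ennreal (\<epsilon> * cnorm m c) * indicator G x \<partial>N)"
      by (rule nn_integral_cmult_indicator[OF GN, symmetric])
    also have "\<dots> \<le> (\<integral>\<^sup>+x\<in>cube w r. ennreal \<bar>P x\<bar> \<partial>N)"
      by (intro nn_integral_mono) (auto simp: G_def B_def indicator_def not_le intro: ennreal_leI)
    finally show ?thesis unfolding P_def .
  qed
  moreover have "0 < C" using \<epsilon> c1_pos by (simp add: C_def)
  ultimately show ?thesis by blast
qed

lemma nn_integral_eq_LINT:
  assumes "set_integrable N A g"
  shows "(\<integral>\<^sup>+x\<in>A. ennreal \<bar>g x\<bar> \<partial>N) = ennreal (LINT x:A|N. \<bar>g x :: real\<bar>)"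
proof -
  have i: "integrable N (\<lambda>x. indicator A x *\<^sub>R \<bar>g x\<bar>)"
    using set_integrable_abs[OF assms] unfolding set_integrable_def .
  have "(\<integral>\<^sup>+x\<in>A. ennreal \<bar>g x\<bar> \<partial>N) = (\<integral>\<^sup>+x. ennreal (indicator A x *\<^sub>R \<bar>g x\<bar>) \<partial>N)"
    by (intro nn_integral_cong) (auto simp: indicator_def)
  also have "\<dots> = ennreal (LINT x:A|N. \<bar>g x\<bar>)"
    unfolding set_lebesgue_integral_def by (intro nn_integral_eq_integral[OF i] AE_I2) (auto simp: indicator_def)
  finally show ?thesis .
qed

lemma remez:
  obtains C where "0 < C" "\<And>w r c. w \<in> S \<Longrightarrow> 0 < r \<Longrightarrow> 2 * r \<le> R \<Longrightarrow>
    r powr d * cnorm m c \<le> C * (LINT x:cube w r|N. \<bar>\<Sum>\<beta>\<in>midx m. c \<beta> * smono w r \<beta> x\<bar>)"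
proof -
  obtain C where C: "0 < C" "\<And>w r c. w \<in> S \<Longrightarrow> 0 < r \<Longrightarrow> 2 * r \<le> R \<Longrightarrow>
    ennreal (C * r powr d * cnorm m c) \<le> (\<integral>\<^sup>+x\<in>cube w r. ennreal \<bar>\<Sum>\<beta>\<in>midx m. c \<beta> * smono w r \<beta> x\<bar> \<partial>N)"
    using remez_nn[of m] by blast
  have "r powr d * cnorm m c \<le> 1 / C * (LINT x:cube w r|N. \<bar>\<Sum>\<beta>\<in>midx m. c \<beta> * smono w r \<beta> x\<bar>)"
    if w: "w \<in> S" "0 < r" "2 * r \<le> R" for w r c
  proof -
    have "set_integrable N (cube w r) (\<lambda>x. \<Sum>\<beta>\<in>midx m. c \<beta> * smono w r \<beta> x)"
      using w by (intro set_integrable_poly[where m = m] poly_space_sum poly_space_cmult smonomial_in_poly_space) auto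
    then have "ennreal (C * r powr d * cnorm m c) \<le> ennreal (LINT x:cube w r|N. \<bar>\<Sum>\<beta>\<in>midx m. c \<beta> * smono w r \<beta> x\<bar>)"
      using C(2)[OF w, of c] by (simp add: nn_integral_eq_LINT)
    then have "C * r powr d * cnorm m c \<le> (LINT x:cube w r|N. \<bar>\<Sum>\<beta>\<in>midx m. c \<beta> * smono w r \<beta> x\<bar>)"
      by (subst (asm) ennreal_le_iff) (auto intro: LINT_nonneg)
    then show ?thesis using C(1) by (simp add: field_simps)
  qed
  then show ?thesis using that[of "1 / C"] C(1) by simp
qed

lemma LINT_mult_sum:
  assumes "set_integrable N (cube w r) g" "finite A" "\<And>\<beta>. \<beta> \<in> A \<Longrightarrow> B \<beta> \<in> poly_space (int m)"
  shows "(LINT x:cube w r|N. g x * (\<Sum>\<beta>\<in>A. c \<beta> * B \<beta> x)) = (\<Sum>\<beta>\<in>A. c \<beta> * (LINT x:cube w r|N. g x * B \<beta> x))"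
  using assms(2,3)
proof (induction A rule: finite_induct)
  case (insert \<alpha> A)
  have i1: "set_integrable N (cube w r) (\<lambda>x. c \<alpha> * (g x * B \<alpha> x))"
    by (intro set_integrable_mult_right set_integrable_mult_poly[OF assms(1), of _ m] insert.prems insertI1)
  have i2: "set_integrable N (cube w r) (\<lambda>x. g x * (\<Sum>\<beta>\<in>A. c \<beta> * B \<beta> x))"
    using insert.prems by (intro set_integrable_mult_poly[OF assms(1), of _ m] poly_space_sum poly_space_cmult) auto
  have "(LINT x:cube w r|N. g x * (\<Sum>\<beta>\<in>insert \<alpha> A. c \<beta> * B \<beta> x))
     = (LINT x:cube w r|N. c \<alpha> * (g x * B \<alpha> x) + g x * (\<Sum>\<beta>\<in>A. c \<beta> * B \<beta> x))"
    using insert.hyps by (simp add: algebra_simps)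
  also have "\<dots> = c \<alpha> * (LINT x:cube w r|N. g x * B \<alpha> x) + (LINT x:cube w r|N. g x * (\<Sum>\<beta>\<in>A. c \<beta> * B \<beta> x))"
    using set_integral_add(2)[OF i1 i2] by simp
  finally show ?case using insert by simp
qed simp

section \<open>Orthonormal polynomial bases on a cube\<close>

context
  fixes w :: "real ^ 'n" and r :: real and m :: nat
  assumes w: "w \<in> S" and r: "0 < r" "2 * r \<le> R"
begin

abbreviation (input) ip where "ip f g \<equiv> (LINT x:cube w r|N. f x * g x)"

lemma r_le_R: "r \<le> R"
  using r by simp

lemmas poly_int = set_integrable_poly[OF w r(1) r_le_R]

text \<open>Young's inequality with a free parameter in place of Cauchy-Schwarz; each use inserts
  the t that balances the two summands.\<close>

lemma L1_le_L2:
  assumes P: "P \<in> poly_space (int m)" and t: "0 < t"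
  shows "(LINT x:cube w r|N. \<bar>P x\<bar>) \<le> (t * (c2 * r powr d) + ip P P / t) / 2"
proof -
  have le: "\<bar>P x\<bar> \<le> t / 2 + 1 / (2 * t) * (P x * P x)" for x
  proof -
    have "0 \<le> (\<bar>P x\<bar> - t)\<^sup>2" by simp
    then have "2 * t * \<bar>P x\<bar> \<le> t * t + P x * P x" by (simp add: power2_eq_square algebra_simps)
    then show ?thesis using t by (simp add: field_simps)
  qed
  have i: "set_integrable N (cube w r) (\<lambda>x. t / 2)" by (rule set_integrable_const[OF w r(1) r_le_R])
  have i2: "set_integrable N (cube w r) (\<lambda>x. 1 / (2 * t) * (P x * P x))"
    by (intro set_integrable_mult_right set_integrable_mult_poly[OF poly_int[OF P] P])
  have "(LINT x:cube w r|N. \<bar>P x\<bar>) \<le> (LINT x:cube w r|N. t / 2 + 1 / (2 * t) * (P x * P x))"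
    by (intro set_integral_mono set_integrable_abs poly_int[OF P] set_integral_add(1) i i2 le)
  also have "\<dots> = (LINT x:cube w r|N. t / 2) + 1 / (2 * t) * ip P P"
    using set_integral_add(2)[OF i i2] unfolding set_integral_mult_right .
  also have "\<dots> \<le> t / 2 * (c2 * r powr d) + 1 / (2 * t) * ip P P"
    using LINT_const_le[OF w r(1) r_le_R, of "t / 2"] t by simp
  also have "\<dots> = (t * (c2 * r powr d) + ip P P / t) / 2" by (simp add: field_simps)
  finally show ?thesis .
qed

text \<open>Linear independence of the scaled monomials in L2 of the cube. The coefficient 1 makes
  the L1 norm positive through \<open>remez\<close>, and \<open>L1_le_L2\<close> carries this over
  to the quadratic form.\<close>

lemma smono_comb_pos:
  assumes A: "A \<subseteq> midx m" "\<alpha> \<in> A" "c \<alpha> = 1" and u: "\<And>x. u x = (\<Sum>\<gamma>\<in>A. c \<gamma> * smono w r \<gamma> x)"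
  shows "0 < ip u u"
proof -
  obtain C where C: "0 < C" "\<And>w r c. w \<in> S \<Longrightarrow> 0 < r \<Longrightarrow> 2 * r \<le> R \<Longrightarrow>
    r powr d * cnorm m c \<le> C * (LINT x:cube w r|N. \<bar>\<Sum>\<beta>\<in>midx m. c \<beta> * smono w r \<beta> x\<bar>)"
    using remez[of m] by blast
  define c0 where "c0 \<gamma> = (if \<gamma> \<in> A then c \<gamma> else 0)" for \<gamma>
  have u0: "u x = (\<Sum>\<gamma>\<in>midx m. c0 \<gamma> * smono w r \<gamma> x)" for x
    unfolding u c0_def by (rule sum.mono_neutral_cong_left) (use A in auto)
  have "\<bar>c0 \<alpha>\<bar> \<le> cnorm m c0" unfolding cnorm_def by (rule member_le_sum) (use A in auto)
  then have c0: "1 \<le> cnorm m c0" using A by (simp add: c0_def)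
  define J where "J = (LINT x:cube w r|N. \<bar>u x\<bar>)"
  have "r powr d * 1 \<le> r powr d * cnorm m c0" using c0 by (intro mult_left_mono) auto
  also have "\<dots> \<le> C * J" using C(2)[OF w r, of c0] by (simp add: J_def u0)
  finally have "0 < C * J" using r by (smt (verit) powr_gt_zero)
  then have J: "0 < J" using C by (simp add: zero_less_mult_iff)
  have up: "u \<in> poly_space (int m)"
    unfolding u0[abs_def] by (intro poly_space_sum poly_space_cmult smonomial_in_poly_space)
  \<comment> \<open>With this t the first summand in \<open>L1_le_L2\<close> is half of
    \<open>J\<close> and can be absorbed on the left.\<close>
  define t where "t = J / (c2 * r powr d)"
  have t: "0 < t" using J c2_pos r by (simp add: t_def)
  have "t * (c2 * r powr d) = J" using c2_pos r by (simp add: t_def)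
  then have "J \<le> (J + ip u u / t) / 2" using L1_le_L2[OF up t] by (simp add: J_def)
  then have "J \<le> ip u u / t" by simp
  then have "0 < ip u u / t" using J by linarith
  then show ?thesis using t by (simp add: zero_less_divide_iff)
qed

text \<open>Gram-Schmidt on the scaled monomials, one index at a time. Besides orthonormality the
  induction carries both inclusions of spans: the new elements are combinations of monomials, hence
  polynomials, and every combination of monomials is recovered, which
  \<open>orthonormal_poly_basis\<close> requires.\<close>

lemma gram_schmidt:
  assumes "A \<subseteq> midx m"
  shows "\<exists>B. (\<forall>\<beta>\<in>A. \<exists>b. \<forall>x. B \<beta> x = (\<Sum>\<gamma>\<in>A. b \<gamma> * smono w r \<gamma> x)) \<and>
    (\<forall>\<beta>\<in>A. \<forall>\<gamma>\<in>A. ip (B \<beta>) (B \<gamma>) = (if \<beta> = \<gamma> then 1 else 0)) \<and>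
    (\<forall>c. \<exists>c'. \<forall>x. (\<Sum>\<gamma>\<in>A. c \<gamma> * smono w r \<gamma> x) = (\<Sum>\<gamma>\<in>A. c' \<gamma> * B \<gamma> x))"
proof -
  have "finite A" by (rule finite_subset[OF assms finite_midx])
  then show ?thesis using assms
  proof (induction A rule: finite_induct)
    case empty show ?case by simp
  next
    case (insert \<alpha> A)
    have A: "A \<subseteq> midx m" "\<alpha> \<in> midx m" using insert.prems by auto
    obtain B where all: "(\<forall>\<beta>\<in>A. \<exists>b. \<forall>x. B \<beta> x = (\<Sum>\<gamma>\<in>A. b \<gamma> * smono w r \<gamma> x)) \<and>
        (\<forall>\<beta>\<in>A. \<forall>\<gamma>\<in>A. ip (B \<beta>) (B \<gamma>) = (if \<beta> = \<gamma> then 1 else 0)) \<and>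
        (\<forall>c. \<exists>c'. \<forall>x. (\<Sum>\<gamma>\<in>A. c \<gamma> * smono w r \<gamma> x) = (\<Sum>\<gamma>\<in>A. c' \<gamma> * B \<gamma> x))"
      using insert.IH[OF A(1)] ..
    note B = all[THEN conjunct1] and on = all[THEN conjunct2, THEN conjunct1, rule_format]
      and sp = all[THEN conjunct2, THEN conjunct2, rule_format]
    obtain b where b: "\<And>\<beta> x. \<beta> \<in> A \<Longrightarrow> B \<beta> x = (\<Sum>\<gamma>\<in>A. b \<beta> \<gamma> * smono w r \<gamma> x)"
      using bchoice[OF B] by blast
    have Bp: "B \<beta> \<in> poly_space (int m)" if "\<beta> \<in> A" for \<beta>
    proof -
      have "B \<beta> = (\<lambda>x. \<Sum>\<gamma>\<in>A. b \<beta> \<gamma> * smono w r \<gamma> x)" using b[OF that] by blast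
      then show ?thesis
        using A by (simp only:) (intro poly_space_sum poly_space_cmult smonomial_in_poly_space, auto)
    qed
    have vp: "smono w r \<alpha> \<in> poly_space (int m)" by (rule smonomial_in_poly_space[OF A(2)])
    define p where "p \<beta> = ip (smono w r \<alpha>) (B \<beta>)" for \<beta>
    define u where "u x = smono w r \<alpha> x - (\<Sum>\<beta>\<in>A. p \<beta> * B \<beta> x)" for x
    have up: "u \<in> poly_space (int m)"
      unfolding u_def[abs_def] using Bp by (intro poly_space_diff vp poly_space_sum poly_space_cmult) auto
    \<comment> \<open>The coefficients of the residue u in scaled monomials; the entry at the new
      index is 1, since the earlier basis elements do not involve it, and so
      \<open>smono_comb_pos\<close> applies.\<close>
    define e where "e \<gamma> = (if \<gamma> = \<alpha> then 1 else - (\<Sum>\<beta>\<in>A. p \<beta> * b \<beta> \<gamma>))" for \<gamma>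
    have ue: "u x = (\<Sum>\<gamma>\<in>insert \<alpha> A. e \<gamma> * smono w r \<gamma> x)" for x
    proof -
      have "(\<Sum>\<beta>\<in>A. p \<beta> * B \<beta> x) = (\<Sum>\<beta>\<in>A. \<Sum>\<gamma>\<in>A. p \<beta> * b \<beta> \<gamma> * smono w r \<gamma> x)"
        by (rule sum.cong) (simp_all add: b sum_distrib_left mult_ac)
      also have "\<dots> = (\<Sum>\<gamma>\<in>A. \<Sum>\<beta>\<in>A. p \<beta> * b \<beta> \<gamma> * smono w r \<gamma> x)" by (rule sum.swap)
      also have "\<dots> = (\<Sum>\<gamma>\<in>A. - (e \<gamma> * smono w r \<gamma> x))"
        by (rule sum.cong) (use insert.hyps in \<open>auto simp: e_def sum_distrib_right\<close>)
      finally show ?thesis using insert.hyps by (simp add: u_def e_def sum_negf)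
    qed
    have pos: "0 < ip u u"
      by (rule smono_comb_pos[of "insert \<alpha> A" \<alpha> e]) (use insert.prems ue in \<open>auto simp: e_def\<close>)
    have uB: "ip u (B \<beta>) = 0" if "\<beta> \<in> A" for \<beta>
    proof -
      have i1: "set_integrable N (cube w r) (\<lambda>x. smono w r \<alpha> x * B \<beta> x)"
        by (rule set_integrable_mult_poly[OF poly_int[OF vp] Bp[OF that]])
      have i2: "set_integrable N (cube w r) (\<lambda>x. B \<beta> x * (\<Sum>\<gamma>\<in>A. p \<gamma> * B \<gamma> x))"
        using Bp by (intro set_integrable_mult_poly[OF poly_int[OF Bp[OF that]], of _ m] poly_space_sum poly_space_cmult) auto
      have "ip u (B \<beta>) = (LINT x:cube w r|N. smono w r \<alpha> x * B \<beta> x - B \<beta> x * (\<Sum>\<gamma>\<in>A. p \<gamma> * B \<gamma> x))"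
        by (simp add: u_def algebra_simps)
      also have "\<dots> = p \<beta> - (LINT x:cube w r|N. B \<beta> x * (\<Sum>\<gamma>\<in>A. p \<gamma> * B \<gamma> x))"
        using set_integral_diff(2)[OF i1 i2] by (simp add: p_def)
      also have "(LINT x:cube w r|N. B \<beta> x * (\<Sum>\<gamma>\<in>A. p \<gamma> * B \<gamma> x)) = (\<Sum>\<gamma>\<in>A. p \<gamma> * ip (B \<beta>) (B \<gamma>))"
        by (rule LINT_mult_sum[OF poly_int[OF Bp[OF that]] insert.hyps(1) Bp])
      also have "\<dots> = (\<Sum>\<gamma>\<in>A. if \<gamma> = \<beta> then p \<gamma> else 0)"
        by (rule sum.cong) (use on that in auto)
      also have "\<dots> = p \<beta>" using insert.hyps(1) that by simp
      finally show ?thesis by simp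
    qed
    define s where "s = sqrt (ip u u)"
    have s: "0 < s" "s * s = ip u u" using pos by (auto simp: s_def)
    define B' where "B' = B(\<alpha> := \<lambda>x. 1 / s * u x)"
    have B'A: "B' \<beta> = B \<beta>" if "\<beta> \<in> A" for \<beta> using that insert.hyps by (auto simp: B'_def)
    have B'\<alpha>: "B' \<alpha> x = 1 / s * u x" for x by (simp add: B'_def)
    have 1: "\<exists>b. \<forall>x. B' \<beta> x = (\<Sum>\<gamma>\<in>insert \<alpha> A. b \<gamma> * smono w r \<gamma> x)" if "\<beta> \<in> insert \<alpha> A" for \<beta>
    proof (cases "\<beta> = \<alpha>")
      case True
      have "B' \<alpha> x = (\<Sum>\<gamma>\<in>insert \<alpha> A. (1 / s * e \<gamma>) * smono w r \<gamma> x)" for x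
        unfolding B'\<alpha> ue sum_distrib_left by (simp only: mult.assoc)
      then show ?thesis unfolding True by (intro exI[of _ "\<lambda>\<gamma>. 1 / s * e \<gamma>"] allI)
    next
      case False
      then have \<beta>: "\<beta> \<in> A" using that by simp
      have "B' \<beta> x = (\<Sum>\<gamma>\<in>insert \<alpha> A. (if \<gamma> = \<alpha> then 0 else b \<beta> \<gamma>) * smono w r \<gamma> x)" for x
      proof -
        have "(\<Sum>\<gamma>\<in>A. (if \<gamma> = \<alpha> then 0 else b \<beta> \<gamma>) * smono w r \<gamma> x) = (\<Sum>\<gamma>\<in>A. b \<beta> \<gamma> * smono w r \<gamma> x)"
          by (rule sum.cong) (use insert.hyps in auto)
        then show ?thesis using insert.hyps by (simp add: B'A[OF \<beta>] b[OF \<beta>])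
      qed
      then show ?thesis by (intro exI[of _ "\<lambda>\<gamma>. if \<gamma> = \<alpha> then 0 else b \<beta> \<gamma>"]) blast
    qed
    have m1: "ip (\<lambda>x. 1 / s * u x) f = 1 / s * ip u f" for f
      unfolding mult.assoc by (rule set_integral_mult_right)
    have m2: "ip f (\<lambda>x. 1 / s * u x) = 1 / s * ip u f" for f
    proof -
      have "ip f (\<lambda>x. 1 / s * u x) = (LINT x:cube w r|N. 1 / s * (u x * f x))" by (simp add: mult_ac)
      then show ?thesis by (simp only: set_integral_mult_right)
    qed
    have 2: "ip (B' \<beta>) (B' \<gamma>) = (if \<beta> = \<gamma> then 1 else 0)" if bg: "\<beta> \<in> insert \<alpha> A" "\<gamma> \<in> insert \<alpha> A" for \<beta> \<gamma>
    proof -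
      consider "\<beta> = \<alpha>" "\<gamma> = \<alpha>" | "\<beta> = \<alpha>" "\<gamma> \<in> A" | "\<beta> \<in> A" "\<gamma> = \<alpha>" | "\<beta> \<in> A" "\<gamma> \<in> A" using bg by blast
      then show ?thesis
      proof cases
        case 1
        have "ip (B' \<alpha>) (B' \<alpha>) = 1 / s * (1 / s * ip u u)" unfolding B'\<alpha> m1 m2 ..
        also have "\<dots> = 1" using s by (simp add: s(2)[symmetric])
        finally show ?thesis using 1 by simp
      next
        case 2
        then have "ip (B' \<beta>) (B' \<gamma>) = 1 / s * ip u (B \<gamma>)" unfolding 2(1) B'\<alpha> m1 B'A[OF 2(2)] by simp
        then show ?thesis using 2 uB[of \<gamma>] insert.hyps by auto
      next
        case 3
        then have "ip (B' \<beta>) (B' \<gamma>) = 1 / s * ip u (B \<beta>)" unfolding 3(2) B'\<alpha> m2 B'A[OF 3(1)] by simp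
        then show ?thesis using 3 uB[of \<beta>] insert.hyps by auto
      next
        case 4
        then show ?thesis using on by (simp add: B'A)
      qed
    qed
    have 3: "\<exists>c'. \<forall>x. (\<Sum>\<gamma>\<in>insert \<alpha> A. c \<gamma> * smono w r \<gamma> x) = (\<Sum>\<gamma>\<in>insert \<alpha> A. c' \<gamma> * B' \<gamma> x)" for c
    proof -
      obtain c' where c': "\<And>x. (\<Sum>\<gamma>\<in>A. c \<gamma> * smono w r \<gamma> x) = (\<Sum>\<gamma>\<in>A. c' \<gamma> * B \<gamma> x)" using sp[of c] by blast
      \<comment> \<open>Read \<open>s * B' \<alpha> = u\<close> as a formula for the new monomial
        and substitute it. Locally \<open>c2\<close> denotes the resulting coefficients.\<close>
      define c2 where "c2 \<gamma> = (if \<gamma> = \<alpha> then c \<alpha> * s else c \<alpha> * p \<gamma> + c' \<gamma>)" for \<gamma>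
      have "(\<Sum>\<gamma>\<in>insert \<alpha> A. c \<gamma> * smono w r \<gamma> x) = (\<Sum>\<gamma>\<in>insert \<alpha> A. c2 \<gamma> * B' \<gamma> x)" for x
      proof -
        have "(\<Sum>\<gamma>\<in>A. c2 \<gamma> * B' \<gamma> x) = (\<Sum>\<gamma>\<in>A. c \<alpha> * (p \<gamma> * B \<gamma> x) + c' \<gamma> * B \<gamma> x)"
          by (rule sum.cong) (use insert.hyps in \<open>auto simp: c2_def B'A algebra_simps\<close>)
        also have "\<dots> = c \<alpha> * (\<Sum>\<gamma>\<in>A. p \<gamma> * B \<gamma> x) + (\<Sum>\<gamma>\<in>A. c \<gamma> * smono w r \<gamma> x)"
          by (simp add: sum.distrib sum_distrib_left c')
        finally have 1: "(\<Sum>\<gamma>\<in>A. c2 \<gamma> * B' \<gamma> x) = c \<alpha> * (\<Sum>\<gamma>\<in>A. p \<gamma> * B \<gamma> x) + (\<Sum>\<gamma>\<in>A. c \<gamma> * smono w r \<gamma> x)" .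
        have "c2 \<alpha> * B' \<alpha> x = c \<alpha> * u x" using s by (simp add: c2_def B'\<alpha>)
        then show ?thesis using 1 insert.hyps by (simp add: u_def algebra_simps)
      qed
      then show ?thesis by blast
    qed
    show ?case by (rule exI[of _ B']) (use 1 2 3 in blast)
  qed
qed

text \<open>\<open>poly_proj\<close> takes its basis by \<open>SOME\<close>, so nothing is known
  about the projection until one basis exists.\<close>

lemma orthonormal_poly_basis_exists: "\<exists>B. orthonormal_poly_basis N (cube w r) (int m) B"
proof -
  obtain B :: "('n \<Rightarrow> nat) \<Rightarrow> real ^ 'n \<Rightarrow> real" where all: "(\<forall>\<beta>\<in>midx m. \<exists>b. \<forall>x. B \<beta> x = (\<Sum>\<gamma>\<in>midx m. b \<gamma> * smono w r \<gamma> x)) \<and>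
      (\<forall>\<beta>\<in>midx m. \<forall>\<gamma>\<in>midx m. ip (B \<beta>) (B \<gamma>) = (if \<beta> = \<gamma> then 1 else 0)) \<and>
      (\<forall>c. \<exists>c'. \<forall>x. (\<Sum>\<gamma>\<in>midx m. c \<gamma> * smono w r \<gamma> x) = (\<Sum>\<gamma>\<in>midx m. c' \<gamma> * B \<gamma> x))"
    using gram_schmidt[OF subset_refl] ..
  note B = all[THEN conjunct1] and on = all[THEN conjunct2, THEN conjunct1]
    and sp = all[THEN conjunct2, THEN conjunct2]
  have "B \<beta> \<in> poly_space (int m)" if \<beta>: "\<beta> \<in> midx m" for \<beta>
  proof -
    obtain b where "\<And>x. B \<beta> x = (\<Sum>\<gamma>\<in>midx m. b \<gamma> * smono w r \<gamma> x)" using B \<beta> by blast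
    then have "B \<beta> = (\<lambda>x. \<Sum>\<gamma>\<in>midx m. b \<gamma> * smono w r \<gamma> x)" by blast
    then show ?thesis by (simp only:) (intro poly_space_sum poly_space_cmult smonomial_in_poly_space)
  qed
  moreover have "\<exists>c. \<forall>x. P x = (\<Sum>\<beta>\<in>midx m. c \<beta> * B \<beta> x)" if P: "P \<in> poly_space (int m)" for P
  proof -
    obtain c where c: "\<And>x. P x = (\<Sum>\<beta>\<in>midx m. c \<beta> * smono w r \<beta> x)"
      using poly_space_smono[OF P, of r w] r by blast
    obtain c' where "\<forall>x. (\<Sum>\<gamma>\<in>midx m. c \<gamma> * smono w r \<gamma> x) = (\<Sum>\<gamma>\<in>midx m. c' \<gamma> * B \<gamma> x)" using sp by blast
    then show ?thesis using c by auto
  qed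
  ultimately have "orthonormal_poly_basis N (cube w r) (int m) B"
    unfolding orthonormal_poly_basis_def midx_int using on by (auto simp: midx_def)
  then show ?thesis by blast
qed

end

text \<open>The projection reproduces P, hence the difference is the projection of
  \<open>f - P\<close>. In scaled monomials a normalised basis element has coefficients of size
  \<open>r powr (- d / 2)\<close>, by \<open>remez\<close>; this factor enters once through the
  inner products with \<open>f - P\<close> and once through the expansion of the result.\<close>

lemma poly_proj_bound:
  obtains C where "0 < C" "\<And>w r f P. w \<in> S \<Longrightarrow> 0 < r \<Longrightarrow> 2 * r \<le> R \<Longrightarrow> set_integrable N (cube w r) f \<Longrightarrow>
    P \<in> poly_space (int m) \<Longrightarrow>
    \<exists>c. (\<forall>x. poly_proj N (cube w r) (int m) f x - P x = (\<Sum>\<beta>\<in>midx m. c \<beta> * smono w r \<beta> x)) \<and>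
      r powr d * cnorm m c \<le> C * (LINT x:cube w r|N. \<bar>f x - P x\<bar>)"
proof -
  obtain C1 where C1: "0 < C1" "\<And>w r c. w \<in> S \<Longrightarrow> 0 < r \<Longrightarrow> 2 * r \<le> R \<Longrightarrow>
    r powr d * cnorm m c \<le> C1 * (LINT x:cube w r|N. \<bar>\<Sum>\<beta>\<in>midx m. c \<beta> * smono w r \<beta> x\<bar>)"
    using remez[of m] by blast
  define C2 where "C2 = C1 * (c2 + 1) / 2"
  have C2: "0 < C2" using C1 c2_pos by (simp add: C2_def)
  define C where "C = real (card (midx m :: ('n \<Rightarrow> nat) set)) * (C2 * C2)"
  have "0 < card (midx m :: ('n \<Rightarrow> nat) set)" using zero_in_midx[of m] by (subst card_gt_0_iff) auto
  then have C: "0 < C" using C2 unfolding C_def by (intro mult_pos_pos) (simp_all only: of_nat_0_less_iff)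
  show ?thesis
  proof (rule that[OF C])
    fix w r and f P :: "real ^ 'n \<Rightarrow> real"
    assume w: "w \<in> S" and r: "0 < r" "2 * r \<le> R" and f: "set_integrable N (cube w r) f" and P: "P \<in> poly_space (int m)"
    let ?K = "cube w r"
    define B where "B = (SOME B. orthonormal_poly_basis N ?K (int m) B)"
    have "orthonormal_poly_basis N ?K (int m) B"
      unfolding B_def by (rule someI_ex[OF orthonormal_poly_basis_exists[OF w r]])
    then have Bp: "\<And>\<beta>. \<beta> \<in> midx m \<Longrightarrow> B \<beta> \<in> poly_space (int m)"
      and on: "\<And>\<beta> \<gamma>. \<beta> \<in> midx m \<Longrightarrow> \<gamma> \<in> midx m \<Longrightarrow> (LINT x:?K|N. B \<beta> x * B \<gamma> x) = (if \<beta> = \<gamma> then 1 else 0)"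
      and sp: "\<exists>c. \<forall>x. P x = (\<Sum>\<beta>\<in>midx m. c \<beta> * B \<beta> x)"
      using P unfolding orthonormal_poly_basis_def midx_int by (auto simp: midx_def)
    have Pi: "set_integrable N ?K P" using w r P by (intro set_integrable_poly) auto
    obtain e where e: "\<And>x. P x = (\<Sum>\<beta>\<in>midx m. e \<beta> * B \<beta> x)" using sp by blast
    define h where "h x = f x - P x" for x
    have hi: "set_integrable N ?K h" unfolding h_def[abs_def] using f Pi by (rule set_integral_diff(1))
    define J where "J = (LINT x:?K|N. \<bar>h x\<bar>)"
    define q where "q \<beta> = (LINT x:?K|N. h x * B \<beta> x)" for \<beta>
    have q: "(LINT y:?K|N. f y * B \<beta> y) = q \<beta> + e \<beta>" if \<beta>: "\<beta> \<in> midx m" for \<beta>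
    proof -
      have Bi: "set_integrable N ?K (B \<beta>)" using w r Bp[OF \<beta>] by (intro set_integrable_poly) auto
      have i1: "set_integrable N ?K (\<lambda>x. h x * B \<beta> x)" by (rule set_integrable_mult_poly[OF hi Bp[OF \<beta>]])
      have i2: "set_integrable N ?K (\<lambda>x. B \<beta> x * P x)" by (rule set_integrable_mult_poly[OF Bi P])
      have "(LINT y:?K|N. f y * B \<beta> y) = (LINT y:?K|N. h y * B \<beta> y + B \<beta> y * P y)"
        by (simp add: h_def algebra_simps)
      also have "\<dots> = q \<beta> + (LINT y:?K|N. B \<beta> y * P y)" using set_integral_add(2)[OF i1 i2] by (simp add: q_def)
      also have "(LINT y:?K|N. B \<beta> y * P y) = (\<Sum>\<gamma>\<in>midx m. e \<gamma> * (LINT y:?K|N. B \<beta> y * B \<gamma> y))"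
        unfolding e by (rule LINT_mult_sum[OF Bi finite_midx Bp])
      also have "\<dots> = (\<Sum>\<gamma>\<in>midx m. if \<gamma> = \<beta> then e \<gamma> else 0)"
        by (rule sum.cong) (use on \<beta> in auto)
      also have "\<dots> = e \<beta>" using \<beta> by simp
      finally show ?thesis .
    qed
    have "\<forall>\<beta>\<in>midx m. \<exists>b. \<forall>x. B \<beta> x = (\<Sum>\<gamma>\<in>midx m. b \<gamma> * smono w r \<gamma> x)"
      using poly_space_smono[OF Bp, of _ r w] r by (metis less_irrefl)
    then obtain b where b: "\<And>\<beta> x. \<beta> \<in> midx m \<Longrightarrow> B \<beta> x = (\<Sum>\<gamma>\<in>midx m. b \<beta> \<gamma> * smono w r \<gamma> x)"
      using bchoice by metis
    \<comment> \<open>The natural size of an L2 norm on the cube, whose measure is of order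
      \<open>r powr d\<close>.\<close>
    define R' where "R' = r powr (d / 2)"
    have R': "0 < R'" "R' * R' = r powr d" using r by (auto simp: R'_def powr_add[symmetric])
    have cb: "R' * cnorm m (b \<beta>) \<le> C2" if \<beta>: "\<beta> \<in> midx m" for \<beta>
    proof -
      have "r powr d * cnorm m (b \<beta>) \<le> C1 * (LINT x:?K|N. \<bar>B \<beta> x\<bar>)"
        using C1(2)[OF w r, of "b \<beta>"] by (simp add: b[OF \<beta>])
      \<comment> \<open>The parameter \<open>1 / R'\<close> balances the two summands, both then of
        order \<open>R'\<close>.\<close>
      also have "\<dots> \<le> C1 * ((1 / R' * (c2 * r powr d) + (LINT x:?K|N. B \<beta> x * B \<beta> x) / (1 / R')) / 2)"
        using C1(1) R' by (intro mult_left_mono L1_le_L2[OF w r Bp[OF \<beta>]]) auto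
      also have "(LINT x:?K|N. B \<beta> x * B \<beta> x) = 1" using on[OF \<beta> \<beta>] by simp
      also have "C1 * ((1 / R' * (c2 * r powr d) + 1 / (1 / R')) / 2) = R' * C2"
        using R'(1) unfolding R'(2)[symmetric] by (simp add: C2_def field_simps)
      finally have "R' * (R' * cnorm m (b \<beta>)) \<le> R' * C2" by (simp add: R'(2)[symmetric] mult_ac)
      then show ?thesis using R' by simp
    qed
    have qb: "R' * \<bar>q \<beta>\<bar> \<le> C2 * J" if \<beta>: "\<beta> \<in> midx m" for \<beta>
    proof -
      have i1: "set_integrable N ?K (\<lambda>x. h x * B \<beta> x)" by (rule set_integrable_mult_poly[OF hi Bp[OF \<beta>]])
      have B_le: "\<bar>B \<beta> x\<bar> \<le> cnorm m (b \<beta>)" if x: "x \<in> ?K" for x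
      proof -
        have "\<bar>B \<beta> x\<bar> \<le> (\<Sum>\<gamma>\<in>midx m. \<bar>b \<beta> \<gamma> * smono w r \<gamma> x\<bar>)" unfolding b[OF \<beta>] by (rule sum_abs)
        also have "\<dots> \<le> cnorm m (b \<beta>)"
          unfolding cnorm_def abs_mult using abs_smono_le[of _ m 1 r x w] x r by (intro sum_mono mult_left_le) auto
        finally show ?thesis .
      qed
      have "\<bar>q \<beta>\<bar> \<le> (LINT x:?K|N. \<bar>h x * B \<beta> x\<bar>)" unfolding q_def by (rule abs_LINT_le[OF i1])
      also have "\<dots> \<le> (LINT x:?K|N. cnorm m (b \<beta>) * \<bar>h x\<bar>)"
      proof (rule set_integral_mono)
        show "set_integrable N ?K (\<lambda>x. \<bar>h x * B \<beta> x\<bar>)" using set_integrable_abs[OF i1] .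
        show "set_integrable N ?K (\<lambda>x. cnorm m (b \<beta>) * \<bar>h x\<bar>)"
          using set_integrable_abs[OF hi] by (rule set_integrable_mult_right)
        show "\<bar>h x * B \<beta> x\<bar> \<le> cnorm m (b \<beta>) * \<bar>h x\<bar>" if "x \<in> ?K" for x
          using mult_right_mono[OF B_le[OF that], of "\<bar>h x\<bar>"] by (simp add: abs_mult mult.commute)
      qed
      also have "\<dots> = cnorm m (b \<beta>) * J" by (simp add: J_def)
      finally have "R' * \<bar>q \<beta>\<bar> \<le> R' * (cnorm m (b \<beta>) * J)" using R' by (intro mult_left_mono) auto
      also have "\<dots> = (R' * cnorm m (b \<beta>)) * J" by simp
      also have "\<dots> \<le> C2 * J" using cb[OF \<beta>] by (intro mult_right_mono) (auto simp: J_def intro: LINT_nonneg)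
      finally show ?thesis .
    qed
    define c where "c \<gamma> = (\<Sum>\<beta>\<in>midx m. q \<beta> * b \<beta> \<gamma>)" for \<gamma>
    have 1: "poly_proj N ?K (int m) f x - P x = (\<Sum>\<gamma>\<in>midx m. c \<gamma> * smono w r \<gamma> x)" for x
    proof -
      have "poly_proj N ?K (int m) f x = (\<Sum>\<beta>\<in>midx m. (LINT y:?K|N. f y * B \<beta> y) * B \<beta> x)"
        unfolding poly_proj_def Let_def midx_int B_def[symmetric] ..
      also have "\<dots> = (\<Sum>\<beta>\<in>midx m. q \<beta> * B \<beta> x + e \<beta> * B \<beta> x)"
        by (rule sum.cong) (simp_all add: q algebra_simps)
      also have "\<dots> = (\<Sum>\<beta>\<in>midx m. q \<beta> * B \<beta> x) + P x" by (simp add: sum.distrib e)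
      also have "(\<Sum>\<beta>\<in>midx m. q \<beta> * B \<beta> x) = (\<Sum>\<beta>\<in>midx m. \<Sum>\<gamma>\<in>midx m. q \<beta> * b \<beta> \<gamma> * smono w r \<gamma> x)"
        by (rule sum.cong) (simp_all add: b sum_distrib_left mult_ac)
      also have "\<dots> = (\<Sum>\<gamma>\<in>midx m. c \<gamma> * smono w r \<gamma> x)"
        unfolding c_def sum_distrib_right by (rule sum.swap)
      finally show ?thesis by simp
    qed
    have "r powr d * cnorm m c \<le> r powr d * (\<Sum>\<gamma>\<in>midx m. \<Sum>\<beta>\<in>midx m. \<bar>q \<beta>\<bar> * \<bar>b \<beta> \<gamma>\<bar>)"
      unfolding cnorm_def c_def abs_mult[symmetric] by (intro mult_left_mono sum_mono sum_abs) auto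
    also have "\<dots> = (\<Sum>\<beta>\<in>midx m. (R' * \<bar>q \<beta>\<bar>) * (R' * cnorm m (b \<beta>)))"
      by (subst sum.swap) (simp add: cnorm_def sum_distrib_left R'(2)[symmetric] mult_ac)
    also have "\<dots> \<le> (\<Sum>\<beta>\<in>(midx m :: ('n \<Rightarrow> nat) set). (C2 * J) * C2)"
    proof (rule sum_mono)
      fix \<beta> assume \<beta>: "\<beta> \<in> (midx m :: ('n \<Rightarrow> nat) set)"
      have "0 \<le> J" unfolding J_def by (rule LINT_nonneg) simp
      show "R' * \<bar>q \<beta>\<bar> * (R' * cnorm m (b \<beta>)) \<le> (C2 * J) * C2"
        by (rule mult_mono[OF qb[OF \<beta>] cb[OF \<beta>]]) (use \<open>0 \<le> J\<close> R' C2 cnorm_nonneg[of m "b \<beta>"] in auto)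
    qed
    also have "\<dots> = C * J" by (simp add: C_def)
    finally have "r powr d * cnorm m c \<le> C * (LINT x:?K|N. \<bar>f x - P x\<bar>)" by (simp add: J_def h_def)
    then show "\<exists>c. (\<forall>x. poly_proj N ?K (int m) f x - P x = (\<Sum>\<beta>\<in>midx m. c \<beta> * smono w r \<beta> x)) \<and>
      r powr d * cnorm m c \<le> C * (LINT x:?K|N. \<bar>f x - P x\<bar>)" using 1 by blast
  qed
qed

end

section \<open>Derivative bounds and Taylor polynomials\<close>

text \<open>\<open>partial_deriv\<close> looks along one axis only; total differentiability is what
  makes the derivative in an arbitrary direction a linear combination of partial
  derivatives.\<close>

lemma DERIV_direction:
  fixes g :: "real ^ 'n \<Rightarrow> real"
  assumes "\<And>x. g differentiable (at x)"
  shows "((\<lambda>u. g (x + u *\<^sub>R v)) has_real_derivative (\<Sum>i\<in>UNIV. v $ i * partial_deriv i g (x + u *\<^sub>R v))) (at u)"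
proof -
  define g' where "g' y = frechet_derivative g (at y)" for y
  have g': "(g has_derivative g' y) (at y)" for y
    unfolding g'_def using assms frechet_derivative_works by blast
  have dir: "((\<lambda>u. g (y + u *\<^sub>R z)) has_real_derivative g' (y + u *\<^sub>R z) z) (at u)" for y z u
  proof -
    have "((\<lambda>u. y + u *\<^sub>R z) has_derivative (\<lambda>h. h *\<^sub>R z)) (at u)"
      by (auto intro!: derivative_eq_intros)
    from has_derivative_compose[OF this g']
    have "((\<lambda>u. g (y + u *\<^sub>R z)) has_derivative (\<lambda>h. g' (y + u *\<^sub>R z) (h *\<^sub>R z))) (at u)" .
    also have "(\<lambda>h. g' (y + u *\<^sub>R z) (h *\<^sub>R z)) = (*) (g' (y + u *\<^sub>R z) z)"
      using linear_scale[OF has_derivative_linear[OF g']] by (auto simp: mult.commute)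
    finally show ?thesis by (simp add: has_field_derivative_def)
  qed
  have pd: "partial_deriv i g y = g' y (axis i 1)" for i y
    unfolding partial_deriv_def using DERIV_imp_deriv[OF dir[of y "axis i 1" 0]] by simp
  have "g' y v = (\<Sum>i\<in>UNIV. v $ i * partial_deriv i g y)" for y
  proof -
    have "g' y v = g' y (\<Sum>i\<in>UNIV. v $ i *\<^sub>R axis i 1)" by (simp add: basis_expansion scalar_mult_eq_scaleR[symmetric])
    also have "\<dots> = (\<Sum>i\<in>UNIV. v $ i * partial_deriv i g y)"
      unfolding pd linear_sum[OF has_derivative_linear[OF g']] linear_scale[OF has_derivative_linear[OF g']] by simp
    finally show ?thesis .
  qed
  then show ?thesis using dir[of x v u] by simp
qed

lemma DERIV_axis:
  fixes g :: "real ^ 'n \<Rightarrow> real"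
  assumes "\<And>x. g differentiable (at x)"
  shows "((\<lambda>u. g (x + u *\<^sub>R axis i 1)) has_real_derivative partial_deriv i g x) (at 0)"
proof -
  have "(\<Sum>j\<in>UNIV. axis i 1 $ j * partial_deriv j g x) = (\<Sum>j\<in>UNIV. if j = i then partial_deriv j g x else 0)"
    by (rule sum.cong) (auto simp: axis_def)
  then show ?thesis using DERIV_direction[OF assms, where x = x and v = "axis i 1" and u = 0] by simp
qed

lemma partial_deriv_add:
  fixes f g :: "real ^ 'n \<Rightarrow> real"
  assumes "\<And>x. f differentiable (at x)" "\<And>x. g differentiable (at x)"
  shows "partial_deriv i (\<lambda>x. f x + g x) = (\<lambda>x. partial_deriv i f x + partial_deriv i g x)"
proof
  fix x
  show "partial_deriv i (\<lambda>x. f x + g x) x = partial_deriv i f x + partial_deriv i g x"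
    unfolding partial_deriv_def[of i "\<lambda>x. f x + g x"]
    by (rule DERIV_imp_deriv) (rule DERIV_add[OF DERIV_axis[OF assms(1)] DERIV_axis[OF assms(2)]])
qed

lemma partial_deriv_mult:
  fixes f g :: "real ^ 'n \<Rightarrow> real"
  assumes "\<And>x. f differentiable (at x)" "\<And>x. g differentiable (at x)"
  shows "partial_deriv i (\<lambda>x. f x * g x) = (\<lambda>x. partial_deriv i f x * g x + f x * partial_deriv i g x)"
proof
  fix x
  have "((\<lambda>u. f (x + u *\<^sub>R axis i 1) * g (x + u *\<^sub>R axis i 1)) has_real_derivative
      partial_deriv i f x * g x + f x * partial_deriv i g x) (at 0)"
    using DERIV_mult[OF DERIV_axis[OF assms(1), of x i] DERIV_axis[OF assms(2), of x i]] by (simp add: mult.commute)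
  then show "partial_deriv i (\<lambda>x. f x * g x) x = partial_deriv i f x * g x + f x * partial_deriv i g x"
    unfolding partial_deriv_def[of i "\<lambda>x. f x * g x"] by (rule DERIV_imp_deriv)
qed

lemma partial_deriv_const: "partial_deriv i (\<lambda>x. c) = (\<lambda>x. 0)"
  by (simp add: partial_deriv_def fun_eq_iff)

lemma partial_deriv_coord:
  fixes i j :: "'n::finite"
  assumes "r \<noteq> 0"
  shows "partial_deriv i (\<lambda>x :: real ^ 'n. (x $ j - a) / r) = (\<lambda>x. if i = j then 1 / r else 0)"
proof
  fix x :: "real ^ 'n"
  have "((\<lambda>t. ((x + t *\<^sub>R axis i 1) $ j - a) / r) has_real_derivative (if i = j then 1 / r else 0)) (at 0)"
    using assms by (auto intro!: derivative_eq_intros simp: axis_def)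
  then show "partial_deriv i (\<lambda>x. (x $ j - a) / r) x = (if i = j then 1 / r else 0)"
    unfolding partial_deriv_def by (rule DERIV_imp_deriv)
qed

text \<open>The bound for the partial derivatives of order \<open>j \<le> l\<close> at \<open>y\<close> is \<open>A / s ^ j\<close>.\<close>

primrec dbound :: "nat \<Rightarrow> real \<Rightarrow> real ^ 'n \<Rightarrow> real \<Rightarrow> (real ^ 'n \<Rightarrow> real) \<Rightarrow> bool" where
  "dbound 0 s y A g \<longleftrightarrow> (\<forall>x. g differentiable (at x)) \<and> \<bar>g y\<bar> \<le> A"
| "dbound (Suc l) s y A g \<longleftrightarrow> (\<forall>x. g differentiable (at x)) \<and> \<bar>g y\<bar> \<le> A \<and>
     (\<forall>i. dbound l s y (A / s) (partial_deriv i g))"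

lemma dbound_le: "dbound l s y A g \<Longrightarrow> \<bar>g y\<bar> \<le> A"
  by (cases l) auto

lemma dbound_nonneg: "dbound l s y A g \<Longrightarrow> 0 \<le> A"
  using dbound_le[of l s y A g] by linarith

lemma dbound_Suc: "dbound (Suc l) s y A g \<Longrightarrow> dbound l s y A g"
proof (induction l arbitrary: A g)
  case 0 then show ?case by simp
next
  case (Suc l)
  have "dbound l s y (A / s) (partial_deriv i g)" for i
    using Suc.prems by (intro Suc.IH) simp
  then show ?case using Suc.prems by simp
qed

lemma dbound_mono:
  assumes "dbound l s y A g" "A \<le> B" "0 < s" shows "dbound l s y B g"
  using assms(1,2)
proof (induction l arbitrary: A B g)
  case (Suc l)
  have "dbound l s y (B / s) (partial_deriv i g)" for i
    by (rule Suc.IH[of "A / s"]) (use Suc.prems assms(3) in \<open>auto simp: divide_right_mono\<close>)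
  then show ?case using Suc.prems by auto
qed auto

lemma dbound_add:
  assumes "dbound l s y A f" "dbound l s y B g" shows "dbound l s y (A + B) (\<lambda>x. f x + g x)"
  using assms
proof (induction l arbitrary: A B f g)
  case 0 then show ?case using abs_triangle_ineq[of "f y" "g y"] by auto
next
  case (Suc l)
  have "dbound l s y (A / s + B / s) (\<lambda>x. partial_deriv i f x + partial_deriv i g x)" for i
    using Suc.prems by (intro Suc.IH) auto
  then have "dbound l s y ((A + B) / s) (partial_deriv i (\<lambda>x. f x + g x))" for i
    using Suc.prems by (simp add: partial_deriv_add add_divide_distrib)
  then show ?case using Suc.prems abs_triangle_ineq[of "f y" "g y"] by auto
qed

text \<open>By the Leibniz rule each further order produces two products, so the constant doubles
  per order.\<close>

lemma dbound_mult:
  assumes "dbound l s y A f" "dbound l s y B g" shows "dbound l s y (2 ^ l * A * B) (\<lambda>x. f x * g x)"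
  using assms
proof (induction l arbitrary: A B f g)
  case 0
  then have "\<bar>f y\<bar> * \<bar>g y\<bar> \<le> A * B" by (intro mult_mono) auto
  then show ?case using 0 by (auto simp: abs_mult)
next
  case (Suc l)
  have p: "0 \<le> A" "0 \<le> B" using Suc.prems dbound_nonneg by blast+
  have f: "dbound l s y A f" and g: "dbound l s y B g" using Suc.prems dbound_Suc by blast+
  have "dbound l s y (2 ^ l * (A / s) * B + 2 ^ l * A * (B / s))
      (\<lambda>x. partial_deriv i f x * g x + f x * partial_deriv i g x)" for i
    using Suc.prems f g by (intro dbound_add Suc.IH) auto
  moreover have eq: "2 ^ l * (A / s) * B + 2 ^ l * A * (B / s) = 2 ^ Suc l * A * B / s"
    by (simp add: add_divide_distrib[symmetric])
  moreover have pm: "partial_deriv i (\<lambda>x. f x * g x) = (\<lambda>x. partial_deriv i f x * g x + f x * partial_deriv i g x)" for i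
    by (rule partial_deriv_mult) (use Suc.prems in auto)
  ultimately have "dbound l s y (2 ^ Suc l * A * B / s) (partial_deriv i (\<lambda>x. f x * g x))" for i
    unfolding pm by (simp only:)
  moreover have "\<bar>f y\<bar> * \<bar>g y\<bar> \<le> A * B" using Suc.prems p by (intro mult_mono) auto
  moreover have "A * B \<le> 2 ^ Suc l * A * B"
  proof -
    have "1 * (A * B) \<le> 2 ^ Suc l * (A * B)" using p by (intro mult_right_mono one_le_power) auto
    then show ?thesis by (simp add: mult.assoc)
  qed
  ultimately show ?case using Suc.prems by (auto simp: abs_mult)
qed

lemma dbound_zero: "dbound l s y 0 (\<lambda>x. 0)"
  by (induction l) (auto simp: partial_deriv_const)

lemma dbound_const:
  assumes "0 < s" "\<bar>c\<bar> \<le> A" shows "dbound l s y A (\<lambda>x. c)"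
proof (cases l)
  case (Suc k)
  have "dbound k s y (A / s) (\<lambda>x. 0)"
    by (rule dbound_mono[OF dbound_zero]) (use assms in auto)
  then show ?thesis using assms Suc by (simp add: partial_deriv_const)
qed (use assms in auto)

lemma dbound_sum:
  assumes "finite A" "\<And>a. a \<in> A \<Longrightarrow> dbound l s y (K a) (f a)"
  shows "dbound l s y (\<Sum>a\<in>A. K a) (\<lambda>x. \<Sum>a\<in>A. f a x)"
  using assms by (induction A rule: finite_induct) (auto simp: dbound_zero intro: dbound_add)

lemma dbound_coord:
  fixes y :: "real ^ 'n"
  assumes "0 < r" "1 \<le> L" "y \<in> cube w (L * r)"
  shows "dbound l r y L (\<lambda>x. (x $ j - w $ j) / r)"
proof -
  have y: "\<bar>(y $ j - w $ j) / r\<bar> \<le> L" using assms by (simp add: mem_cube pos_divide_le_eq)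
  have df: "(\<lambda>x. (x $ j - w $ j) / r) differentiable (at x)" for x :: "real ^ 'n"
  proof -
    have "((\<lambda>x. x $ j) has_derivative (\<lambda>h. h $ j)) (at x)"
      by (rule bounded_linear.has_derivative[OF bounded_linear_vec_nth has_derivative_ident])
    then have "((\<lambda>x. (1 / r) * (x $ j - w $ j)) has_derivative (\<lambda>h. (1 / r) * (h $ j - 0))) (at x)"
      by (intro has_derivative_mult_right has_derivative_diff has_derivative_const)
    then show ?thesis by (auto simp: differentiable_def)
  qed
  show ?thesis
  proof (cases l)
    case (Suc k)
    have "dbound k r y (L / r) (\<lambda>x. if i = j then 1 / r else 0)" for i
      by (rule dbound_const) (use assms in \<open>auto simp: divide_right_mono\<close>)
    then show ?thesis using y df Suc assms(1) by (simp add: partial_deriv_coord)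
  qed (use y df in simp)
qed

text \<open>A scaled monomial is a product of scaled coordinates, which on the L-fold cube are
  bounded by L with derivative scale r. So the constant depends on l, m and L but not on the
  cube.\<close>

lemma dbound_smono:
  assumes "1 \<le> L"
  obtains K where "0 \<le> K" "\<And>w r y \<beta>. 0 < r \<Longrightarrow> y \<in> cube w (L * r) \<Longrightarrow> \<beta> \<in> midx m \<Longrightarrow> dbound l r y K (smono w r \<beta> :: real ^ 'n \<Rightarrow> real)"
proof -
  have pow: "\<exists>K. \<forall>w r y. 0 < r \<and> y \<in> cube w (L * r) \<longrightarrow> dbound l r y K (\<lambda>x :: real ^ 'n. ((x $ j - w $ j) / r) ^ k)" for j k
  proof (induction k)
    case 0
    then show ?case by (intro exI[of _ 1]) (auto intro: dbound_const)
  next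
    case (Suc k)
    then obtain K where "\<And>w r y. 0 < r \<Longrightarrow> y \<in> cube w (L * r) \<Longrightarrow> dbound l r y K (\<lambda>x :: real ^ 'n. ((x $ j - w $ j) / r) ^ k)" by blast
    then show ?case unfolding power_Suc
      by (intro exI[of _ "2 ^ l * L * K"] allI impI dbound_mult dbound_coord assms) auto
  qed
  have prod: "\<exists>K. \<forall>w r y. 0 < r \<and> y \<in> cube w (L * r) \<longrightarrow> dbound l r y K (\<lambda>x :: real ^ 'n. \<Prod>j\<in>A. ((x $ j - w $ j) / r) ^ \<beta> j)"
    if "finite A" for A and \<beta> :: "'n \<Rightarrow> nat"
    using that
  proof (induction A rule: finite_induct)
    case empty
    then show ?case by (intro exI[of _ 1]) (auto intro: dbound_const)
  next
    case (insert a A)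
    then obtain K where "\<And>w r y. 0 < r \<Longrightarrow> y \<in> cube w (L * r) \<Longrightarrow> dbound l r y K (\<lambda>x :: real ^ 'n. \<Prod>j\<in>A. ((x $ j - w $ j) / r) ^ \<beta> j)" by blast
    moreover obtain K' where "\<And>w r y. 0 < r \<Longrightarrow> y \<in> cube w (L * r) \<Longrightarrow> dbound l r y K' (\<lambda>x :: real ^ 'n. ((x $ a - w $ a) / r) ^ \<beta> a)"
      using pow by blast
    ultimately show ?case unfolding prod.insert[OF insert.hyps]
      by (intro exI[of _ "2 ^ l * K' * K"] allI impI dbound_mult) auto
  qed
  have "\<exists>K. \<forall>w r y. 0 < r \<and> y \<in> cube w (L * r) \<longrightarrow> dbound l r y K (smono w r \<beta> :: real ^ 'n \<Rightarrow> real)" for \<beta>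
  proof -
    have "(smono w r \<beta> :: real ^ 'n \<Rightarrow> real) = (\<lambda>x. \<Prod>j\<in>UNIV. ((x $ j - w $ j) / r) ^ \<beta> j)" for w r
      by (rule ext) (simp add: smono_def monomial_def)
    then show ?thesis using prod[of UNIV \<beta>] by simp
  qed
  then obtain K where K: "\<And>w r y \<beta>. 0 < r \<Longrightarrow> y \<in> cube w (L * r) \<Longrightarrow> dbound l r y (K \<beta>) (smono w r \<beta> :: real ^ 'n \<Rightarrow> real)"
    by metis
  show ?thesis
  proof (rule that[of "\<Sum>\<beta>\<in>(midx m :: ('n \<Rightarrow> nat) set). \<bar>K \<beta>\<bar>"])
    fix w y :: "real ^ 'n" and r \<beta> assume r: "0 < r" "y \<in> cube w (L * r)" and \<beta>: "\<beta> \<in> (midx m :: ('n \<Rightarrow> nat) set)"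
    have "\<bar>K \<beta>\<bar> \<le> (\<Sum>\<beta>\<in>(midx m :: ('n \<Rightarrow> nat) set). \<bar>K \<beta>\<bar>)" by (rule member_le_sum[OF \<beta>]) auto
    then show "dbound l r y (\<Sum>\<beta>\<in>(midx m :: ('n \<Rightarrow> nat) set). \<bar>K \<beta>\<bar>) (smono w r \<beta>)"
      by (intro dbound_mono[OF K[OF r]] r(1)) linarith
  qed (simp add: sum_nonneg)
qed

text \<open>\<open>foldr\<close> applies the last direction of the list first, and
  \<open>dbound\<close> peels off exactly this innermost derivative.\<close>

lemma mixed_partial_snoc: "mixed_partial (is @ [i]) g = mixed_partial is (partial_deriv i g)"
  by (simp add: mixed_partial_def)

lemma dbound_smooth:
  assumes "smooth g" "\<And>is. length is \<le> l \<Longrightarrow> \<bar>mixed_partial is g y\<bar> \<le> A / s ^ length is"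
  shows "dbound l s y A g"
  using assms
proof (induction l arbitrary: A g)
  case 0
  show ?case using 0(1)[unfolded smooth_def, rule_format, of "[]"] 0(2)[of "[]"] by (simp add: mixed_partial_def)
next
  case (Suc l)
  have "dbound l s y (A / s) (partial_deriv i g)" for i
  proof (rule Suc.IH)
    show "smooth (partial_deriv i g)"
      using Suc.prems(1) unfolding smooth_def by (metis mixed_partial_snoc)
    show "\<bar>mixed_partial is (partial_deriv i g) y\<bar> \<le> A / s / s ^ length is" if "length is \<le> l" for "is"
      using Suc.prems(2)[of "is @ [i]"] that by (simp add: mixed_partial_snoc)
  qed
  then show ?case
    using Suc.prems(1)[unfolded smooth_def, rule_format, of "[]"] Suc.prems(2)[of "[]"] by (simp add: mixed_partial_def)
qed

text \<open>The derivative of order l in the constant direction v, written out through partial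
  derivatives so that it is visibly a polynomial of degree l in v.\<close>

primrec dir_deriv :: "nat \<Rightarrow> real ^ 'n \<Rightarrow> (real ^ 'n \<Rightarrow> real) \<Rightarrow> real ^ 'n \<Rightarrow> real" where
  "dir_deriv 0 v g x = g x"
| "dir_deriv (Suc l) v g x = (\<Sum>i\<in>UNIV. v $ i * dir_deriv l v (partial_deriv i g) x)"

lemma DERIV_dir_deriv:
  assumes "dbound l s y A g"
  shows "((\<lambda>u. dir_deriv l v g (x + u *\<^sub>R v)) has_real_derivative dir_deriv (Suc l) v g (x + u *\<^sub>R v)) (at u)"
  using assms
proof (induction l arbitrary: A g)
  case 0
  then show ?case using DERIV_direction[of g x v u] by simp
next
  case (Suc l)
  have "((\<lambda>u. \<Sum>i\<in>UNIV. v $ i * dir_deriv l v (partial_deriv i g) (x + u *\<^sub>R v)) has_real_derivative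
     (\<Sum>i\<in>UNIV. v $ i * dir_deriv (Suc l) v (partial_deriv i g) (x + u *\<^sub>R v))) (at u)"
    using Suc.prems by (intro DERIV_sum DERIV_cmult Suc.IH[of "A / s"]) simp
  then show ?case by simp
qed

lemma abs_dir_deriv_le:
  fixes v :: "real ^ 'n"
  assumes "dbound l s y A g" "\<And>i. \<bar>v $ i\<bar> \<le> t" "0 \<le> t" "0 < s"
  shows "\<bar>dir_deriv l v g y\<bar> \<le> A * (real CARD('n) * t / s) ^ l"
  using assms(1)
proof (induction l arbitrary: A g)
  case (Suc l)
  have "\<bar>dir_deriv (Suc l) v g y\<bar> \<le> (\<Sum>i\<in>UNIV. \<bar>v $ i\<bar> * \<bar>dir_deriv l v (partial_deriv i g) y\<bar>)"
    unfolding dir_deriv.simps abs_mult[symmetric] by (rule sum_abs)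
  also have "\<dots> \<le> (\<Sum>i\<in>(UNIV :: 'n set). t * (A / s * (real CARD('n) * t / s) ^ l))"
    using Suc assms(2,3) by (intro sum_mono mult_mono Suc.IH) auto
  also have "\<dots> = A * (real CARD('n) * t / s) ^ Suc l" by simp
  finally show ?case .
qed simp

lemma dir_deriv_poly: "(\<lambda>y. dir_deriv l (y - x) g z) \<in> poly_space (int l)"
proof (induction l arbitrary: g)
  case 0 show ?case using poly_space_const[of "g z" 0] by simp
next
  case (Suc l)
  have "(\<lambda>y. (y - x) $ i * dir_deriv l (y - x) (partial_deriv i g) z) \<in> poly_space (int (1 + l))" for i
    by (rule poly_space_mult[OF _ Suc])
       (use poly_space_diff[OF poly_space_coord poly_space_const, of i "x $ i"] in simp)
  then have "(\<lambda>y. \<Sum>i\<in>UNIV. (y - x) $ i * dir_deriv l (y - x) (partial_deriv i g) z) \<in> poly_space (int (1 + l))"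
    by (intro poly_space_sum)
  then show ?case by simp
qed

text \<open>Maclaurin's formula for g along the segment from x to y. As functions of y the terms of
  order below k are polynomials in \<open>y - x\<close>, and the remainder is evaluated at a point
  of the same cube, where the bound on g holds.\<close>

lemma taylor_poly:
  fixes x :: "real ^ 'n"
  assumes "0 < k" "0 < s" "0 \<le> t" and g: "\<And>y. y \<in> cube x t \<Longrightarrow> dbound k s y A g"
  obtains T where "T \<in> poly_space (int (k - 1))"
    "\<And>y. y \<in> cube x t \<Longrightarrow> \<bar>g y - T y\<bar> \<le> A * (real CARD('n) * t / s) ^ k"
proof -
  define T where "T y = (\<Sum>l<k. 1 / fact l * dir_deriv l (y - x) g x)" for y
  have "T \<in> poly_space (int (k - 1))"
    unfolding T_def[abs_def] using assms(1)
    by (intro poly_space_sum poly_space_cmult poly_space_mono[OF dir_deriv_poly]) auto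
  moreover have "\<bar>g y - T y\<bar> \<le> A * (real CARD('n) * t / s) ^ k" if y: "y \<in> cube x t" for y
  proof -
    define v where "v = y - x"
    have v: "\<bar>v $ i\<bar> \<le> t" for i using y by (simp add: v_def mem_cube)
    have dl: "dbound l s y A g" if "l \<le> k" for l
      using that g[OF y] by (induction rule: inc_induct) (auto dest: dbound_Suc simp del: dbound.simps)
    have "\<exists>u>0. u < 1 \<and> g (x + 1 *\<^sub>R v) = (\<Sum>m<k. dir_deriv m v g (x + 0 *\<^sub>R v) / fact m * 1 ^ m)
        + dir_deriv k v g (x + u *\<^sub>R v) / fact k * 1 ^ k"
    proof (rule Maclaurin[of 1 k "\<lambda>m u. dir_deriv m v g (x + u *\<^sub>R v)" "\<lambda>u. g (x + u *\<^sub>R v)"])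
      show "\<forall>m t. m < k \<and> 0 \<le> t \<and> t \<le> 1 \<longrightarrow>
        ((\<lambda>u. dir_deriv m v g (x + u *\<^sub>R v)) has_real_derivative dir_deriv (Suc m) v g (x + t *\<^sub>R v)) (at t)"
        using DERIV_dir_deriv[OF dl] by (simp del: dir_deriv.simps)
    qed (use assms(1) in auto)
    then obtain u where u: "0 < u" "u < 1" and eq: "g (x + 1 *\<^sub>R v) = (\<Sum>m<k. dir_deriv m v g (x + 0 *\<^sub>R v) / fact m * 1 ^ m)
        + dir_deriv k v g (x + u *\<^sub>R v) / fact k * 1 ^ k" by blast
    have "\<bar>(x + u *\<^sub>R v) $ i - x $ i\<bar> \<le> t" for i
    proof -
      have "u * \<bar>v $ i\<bar> \<le> 1 * \<bar>v $ i\<bar>" using u by (intro mult_right_mono) auto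
      then show ?thesis using v[of i] u by (simp add: abs_mult)
    qed
    then have "x + u *\<^sub>R v \<in> cube x t" by (simp add: mem_cube)
    then have le: "\<bar>dir_deriv k v g (x + u *\<^sub>R v)\<bar> \<le> A * (real CARD('n) * t / s) ^ k"
      using v assms by (intro abs_dir_deriv_le g) auto
    have "g y - T y = dir_deriv k v g (x + u *\<^sub>R v) / fact k" using eq by (simp add: v_def T_def)
    then have "\<bar>g y - T y\<bar> = \<bar>dir_deriv k v g (x + u *\<^sub>R v)\<bar> / fact k" by simp
    also have "\<dots> \<le> \<bar>dir_deriv k v g (x + u *\<^sub>R v)\<bar> / 1" by (intro divide_left_mono fact_ge_1) auto
    finally show ?thesis using le by simp
  qed
  ultimately show ?thesis using that by blast
qed

section \<open>Grids\<close>

definition grid_index :: "real \<Rightarrow> real ^ 'n \<Rightarrow> 'n \<Rightarrow> int" where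
  "grid_index \<rho> x = (\<lambda>i. \<lfloor>x $ i / \<rho>\<rfloor>)"

text \<open>A cell is represented by one of its points in \<open>S\<close>, since measure bounds are
  available only for cubes centred in \<open>S\<close>. For cells that miss \<open>S\<close> the
  value is arbitrary.\<close>

definition grid_point :: "(real ^ 'n) set \<Rightarrow> real \<Rightarrow> ('n \<Rightarrow> int) \<Rightarrow> real ^ 'n" where
  "grid_point S \<rho> z = (SOME s. s \<in> S \<and> grid_index \<rho> s = z)"

lemma grid_index_eq_close:
  assumes "grid_index \<rho> x = grid_index \<rho> y" "0 < \<rho>" shows "infnorm (x - y) \<le> \<rho>"
  unfolding infnorm_le_iff
proof
  fix i
  have "\<lfloor>x $ i / \<rho>\<rfloor> = \<lfloor>y $ i / \<rho>\<rfloor>" using fun_cong[OF assms(1), of i] by (simp add: grid_index_def)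
  then show "\<bar>(x - y) $ i\<bar> \<le> \<rho>" using abs_diff_le_of_floor_eq[OF _ assms(2)] by simp
qed

lemma grid_point:
  assumes "z \<in> grid_index \<rho> ` S" shows "grid_point S \<rho> z \<in> S" "grid_index \<rho> (grid_point S \<rho> z) = z"
proof -
  have "\<exists>s. s \<in> S \<and> grid_index \<rho> s = z" using assms by blast
  from someI_ex[OF this] show "grid_point S \<rho> z \<in> S" "grid_index \<rho> (grid_point S \<rho> z) = z" unfolding grid_point_def by auto
qed

lemma grid_point_close:
  assumes "s \<in> S" "0 < \<rho>" shows "infnorm (s - grid_point S \<rho> (grid_index \<rho> s)) \<le> \<rho>"
  using grid_point(2)[of "grid_index \<rho> s" \<rho> S] assms by (intro grid_index_eq_close) auto

text \<open>A representative is within \<rho> of the corner of its cell, so this reduces to counting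
  lattice points with tolerance \<open>C + 1\<close> in place of \<open>C\<close>.\<close>

lemma
  fixes u :: "real ^ 'n"
  assumes \<rho>: "0 < \<rho>" and C: "0 \<le> C"
  shows finite_grid_point: "finite {z \<in> grid_index \<rho> ` S. infnorm (grid_point S \<rho> z - u) \<le> C * \<rho>}"
    and card_grid_point: "card {z \<in> grid_index \<rho> ` S. infnorm (grid_point S \<rho> z - u) \<le> C * \<rho>} \<le> (nat \<lfloor>2 * (C + 1)\<rfloor> + 1) ^ CARD('n)"
proof -
  have sub: "{z \<in> grid_index \<rho> ` S. infnorm (grid_point S \<rho> z - u) \<le> C * \<rho>}
      \<subseteq> {z. \<forall>i. \<bar>\<rho> * real_of_int (z i) - u $ i\<bar> \<le> (C + 1) * \<rho>}"
  proof (intro subsetI CollectI allI)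
    fix z i assume z: "z \<in> {z \<in> grid_index \<rho> ` S. infnorm (grid_point S \<rho> z - u) \<le> C * \<rho>}"
    define s where "s = grid_point S \<rho> z"
    have "grid_index \<rho> s = z" using grid_point(2)[of z \<rho> S] z by (simp add: s_def)
    then have "z i = \<lfloor>s $ i / \<rho>\<rfloor>" by (auto simp: grid_index_def)
    then have "real_of_int (z i) \<le> s $ i / \<rho>" "s $ i / \<rho> < real_of_int (z i) + 1" by (simp_all add: floor_less_iff)
    then have "\<rho> * real_of_int (z i) \<le> s $ i" "s $ i \<le> \<rho> * real_of_int (z i) + \<rho>"
      using \<rho> by (simp_all add: field_simps)
    then have 1: "\<bar>\<rho> * real_of_int (z i) - s $ i\<bar> \<le> \<rho>" by (simp add: abs_le_iff)
    have "infnorm (s - u) \<le> C * \<rho>" using z by (simp add: s_def)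
    then have "\<bar>s $ i - u $ i\<bar> \<le> C * \<rho>" by (simp add: infnorm_le_iff)
    then show "\<bar>\<rho> * real_of_int (z i) - u $ i\<bar> \<le> (C + 1) * \<rho>"
      using 1 by (simp add: algebra_simps abs_le_iff)
  qed
  have C1: "0 \<le> C + 1" using C by simp
  show "finite {z \<in> grid_index \<rho> ` S. infnorm (grid_point S \<rho> z - u) \<le> C * \<rho>}"
    by (rule finite_subset[OF sub finite_int_box[OF \<rho> C1]])
  have "card {z \<in> grid_index \<rho> ` S. infnorm (grid_point S \<rho> z - u) \<le> C * \<rho>}
      \<le> card {z. \<forall>i. \<bar>\<rho> * real_of_int (z i) - u $ i\<bar> \<le> (C + 1) * \<rho>}"
    by (rule card_mono[OF finite_int_box[OF \<rho> C1] sub])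
  also have "\<dots> \<le> (nat \<lfloor>2 * (C + 1)\<rfloor> + 1) ^ CARD('n)" by (rule card_int_box[OF \<rho> C1])
  finally show "card {z \<in> grid_index \<rho> ` S. infnorm (grid_point S \<rho> z - u) \<le> C * \<rho>} \<le> (nat \<lfloor>2 * (C + 1)\<rfloor> + 1) ^ CARD('n)" .
qed

lemma sum_indicator_le_card:
  assumes "finite G" "card {z \<in> G. P z} \<le> m"
  shows "(\<Sum>z\<in>G. if P z then 1 else 0 :: ennreal) \<le> of_nat m"
proof -
  have "(\<Sum>z\<in>G. if P z then 1 else 0 :: ennreal) = (\<Sum>z\<in>{z \<in> G. P z}. 1)"
    using assms(1) by (subst sum.inter_filter) auto
  also have "\<dots> = of_nat (card {z \<in> G. P z})" by simp
  also have "\<dots> \<le> of_nat m" using assms(2) by (rule of_nat_mono)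
  finally show ?thesis .
qed

section \<open>Packing and the volume of neighbourhoods\<close>

context regular_measure begin

text \<open>Double counting with the measure: each cube around a grid point has measure at least
  \<open>c1 * \<rho> powr d\<close>, a point lies in at most \<open>5 ^ CARD('n)\<close> of them,
  and all of them lie in \<open>cube s \<tau>\<close>.\<close>

lemma card_packing:
  assumes G: "finite G" "G \<subseteq> grid_index \<rho> ` S" and s: "s \<in> S" and \<rho>: "0 < \<rho>" "\<rho> \<le> R" and \<tau>: "\<tau> \<le> R"
    and near: "\<And>z. z \<in> G \<Longrightarrow> infnorm (grid_point S \<rho> z - s) + \<rho> \<le> \<tau>"
  shows "real (card G) * \<rho> powr d \<le> 5 ^ CARD('n) * c2 / c1 * \<tau> powr d"
proof (cases "G = {}")
  case False
  then obtain z0 where "z0 \<in> G" by blast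
  then have \<tau>0: "0 < \<tau>" using near[of z0] \<rho> infnorm_pos_le[of "grid_point S \<rho> z0 - s"] by linarith
  have zS: "grid_point S \<rho> z \<in> S" if "z \<in> G" for z using grid_point(1)[of z \<rho> S] G(2) that by blast
  have "of_nat (card G) * ennreal (c1 * \<rho> powr d) = (\<Sum>z\<in>G. ennreal (c1 * \<rho> powr d))" by simp
  also have "\<dots> \<le> (\<Sum>z\<in>G. emeasure N (cube (grid_point S \<rho> z) \<rho> \<inter> S))"
    using zS \<rho> by (intro sum_mono lower) auto
  also have "\<dots> = (\<Sum>z\<in>G. \<integral>\<^sup>+u. indicator (cube (grid_point S \<rho> z) \<rho> \<inter> S) u \<partial>N)"
    by (intro sum.cong refl nn_integral_indicator[symmetric] sets_N cube_borel)
  also have "\<dots> = (\<integral>\<^sup>+u. (\<Sum>z\<in>G. indicator (cube (grid_point S \<rho> z) \<rho> \<inter> S) u) \<partial>N)"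
    by (intro nn_integral_sum[symmetric] borel_measurable_indicator sets_N cube_borel)
  also have "\<dots> \<le> (\<integral>\<^sup>+u. of_nat (5 ^ CARD('n)) * indicator (cube s \<tau> \<inter> S) u \<partial>N)"
  proof (rule nn_integral_mono)
    fix u assume "u \<in> space N"
    then have u: "u \<in> S" by (simp add: space_N)
    have "{z \<in> G. u \<in> cube (grid_point S \<rho> z) \<rho>} \<subseteq> {z \<in> grid_index \<rho> ` S. infnorm (grid_point S \<rho> z - u) \<le> 1 * \<rho>}"
      using G(2) by (auto simp: cube_def infnorm_sub)
    then have "card {z \<in> G. u \<in> cube (grid_point S \<rho> z) \<rho>} \<le> card {z \<in> grid_index \<rho> ` S. infnorm (grid_point S \<rho> z - u) \<le> 1 * \<rho>}"
      by (intro card_mono finite_grid_point \<rho>) auto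
    also have "\<dots> \<le> (nat \<lfloor>2 * (1 + 1) :: real\<rfloor> + 1) ^ CARD('n)" by (rule card_grid_point[OF \<rho>(1)]) simp
    also have "(nat \<lfloor>2 * (1 + 1) :: real\<rfloor> + 1) = 5" by simp
    finally have cd: "card {z \<in> G. u \<in> cube (grid_point S \<rho> z) \<rho>} \<le> 5 ^ CARD('n)" .
    show "(\<Sum>z\<in>G. indicator (cube (grid_point S \<rho> z) \<rho> \<inter> S) u) \<le> (of_nat (5 ^ CARD('n)) * indicator (cube s \<tau> \<inter> S) u :: ennreal)"
    proof (cases "u \<in> cube s \<tau>")
      case True
      have "(\<Sum>z\<in>G. indicator (cube (grid_point S \<rho> z) \<rho> \<inter> S) u :: ennreal) = (\<Sum>z\<in>G. if u \<in> cube (grid_point S \<rho> z) \<rho> then 1 else 0)"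
        using u by (intro sum.cong) (auto simp: indicator_def)
      also have "\<dots> \<le> of_nat (5 ^ CARD('n))" by (rule sum_indicator_le_card[OF G(1) cd])
      finally show ?thesis using True u by simp
    next
      case False
      have "u \<notin> cube (grid_point S \<rho> z) \<rho>" if "z \<in> G" for z using cube_mono[OF near[OF that]] False by blast
      then show ?thesis by simp
    qed
  qed
  also have "\<dots> = of_nat (5 ^ CARD('n)) * emeasure N (cube s \<tau> \<inter> S)"
    by (intro nn_integral_cmult_indicator sets_N cube_borel)
  also have "\<dots> \<le> of_nat (5 ^ CARD('n)) * ennreal (c2 * \<tau> powr d)"
    using s \<tau> \<tau>0 by (intro mult_left_mono upper) auto
  finally have "ennreal (real (card G)) * ennreal (c1 * \<rho> powr d) \<le> ennreal (real (5 ^ CARD('n))) * ennreal (c2 * \<tau> powr d)"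
    by (simp only: ennreal_of_nat_eq_real_of_nat)
  then have "ennreal (real (card G) * (c1 * \<rho> powr d)) \<le> ennreal (5 ^ CARD('n) * (c2 * \<tau> powr d))"
    using c1_pos c2_pos by (simp add: ennreal_mult)
  then have "real (card G) * (c1 * \<rho> powr d) \<le> 5 ^ CARD('n) * (c2 * \<tau> powr d)"
    using c2_pos by (subst (asm) ennreal_le_iff) auto
  then show ?thesis using c1_pos by (simp add: field_simps)
qed (use c1_pos c2_pos in simp)

text \<open>The volume of a neighbourhood of \<open>S\<close>; the gain \<open>\<rho> powr (n - d)\<close> expresses that \<open>S\<close> is porous.\<close>

lemma volume_neighbourhood:
  assumes A: "0 \<le> A" "0 \<le> L" and s: "s \<in> S" and \<rho>: "0 < \<rho>" "\<rho> \<le> \<tau>" and \<tau>: "(A + L + 2) * \<tau> \<le> R"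
  shows "emeasure lebesgue {y \<in> cube s (A * \<tau>). \<exists>s'\<in>S. infnorm (y - s') < L * \<rho>}
     \<le> ennreal ((2 * (L + 1)) ^ CARD('n) * (5 ^ CARD('n) * c2 / c1) * (A + L + 2) powr d * (\<rho> powr (real CARD('n) - d) * \<tau> powr d))"
proof -
  let ?n = "CARD('n)"
  have \<tau>0: "0 < \<tau>" using \<rho> by simp
  have "1 * \<tau> \<le> (A + L + 2) * \<tau>" using A \<tau>0 by (intro mult_right_mono) auto
  then have \<rho>R: "\<rho> \<le> R" using \<rho> \<tau> by linarith
  define G where "G = grid_index \<rho> ` (S \<inter> cube s ((A + L) * \<tau>))"
  have GS: "G \<subseteq> grid_index \<rho> ` S" by (auto simp: G_def)
  have near: "infnorm (grid_point S \<rho> z - s) + \<rho> \<le> (A + L + 2) * \<tau>" if z: "z \<in> G" for z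
  proof -
    obtain s' where s': "s' \<in> S" "s' \<in> cube s ((A + L) * \<tau>)" "z = grid_index \<rho> s'" using z by (auto simp: G_def)
    have "infnorm (grid_point S \<rho> z - s) \<le> infnorm (grid_point S \<rho> z - s') + infnorm (s' - s)" by (rule infnorm_triangle_sub)
    also have "\<dots> \<le> \<rho> + (A + L) * \<tau>"
      using grid_point_close[OF s'(1) \<rho>(1)] s' by (intro add_mono) (auto simp: cube_def infnorm_sub)
    finally show ?thesis using \<rho> by (simp add: algebra_simps)
  qed
  have fin: "finite G"
  proof (rule finite_subset)
    have "infnorm (grid_point S \<rho> z - s) \<le> ((A + L + 2) * \<tau> / \<rho>) * \<rho>" if "z \<in> G" for z
      using near[OF that] \<rho> by simp
    then show "G \<subseteq> {z \<in> grid_index \<rho> ` S. infnorm (grid_point S \<rho> z - s) \<le> ((A + L + 2) * \<tau> / \<rho>) * \<rho>}"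
      using GS by blast
    show "finite \<dots>" using A \<rho> \<tau>0 by (intro finite_grid_point) auto
  qed
  have card: "real (card G) * \<rho> powr d \<le> 5 ^ ?n * c2 / c1 * ((A + L + 2) * \<tau>) powr d"
    by (rule card_packing[OF fin GS s \<rho>(1) \<rho>R \<tau> near])
  have "{y \<in> cube s (A * \<tau>). \<exists>s'\<in>S. infnorm (y - s') < L * \<rho>} \<subseteq> (\<Union>z\<in>G. cube (grid_point S \<rho> z) ((L + 1) * \<rho>))"
  proof
    fix y assume "y \<in> {y \<in> cube s (A * \<tau>). \<exists>s'\<in>S. infnorm (y - s') < L * \<rho>}"
    then obtain s' where y: "infnorm (y - s) \<le> A * \<tau>" and s': "s' \<in> S" "infnorm (y - s') < L * \<rho>" by (auto simp: cube_def)
    have "L * \<rho> \<le> L * \<tau>" using A \<rho> by (intro mult_left_mono) auto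
    then have "infnorm (s' - s) \<le> (A + L) * \<tau>"
      using infnorm_triangle_sub[of s' s y] s' y infnorm_sub[of s' y] by (simp add: algebra_simps)
    then have "grid_index \<rho> s' \<in> G" using s' by (auto simp: G_def cube_def)
    moreover have "infnorm (y - grid_point S \<rho> (grid_index \<rho> s')) \<le> (L + 1) * \<rho>"
      using infnorm_triangle_sub[of y "grid_point S \<rho> (grid_index \<rho> s')" s'] grid_point_close[OF s'(1) \<rho>(1)] s'(2) by (simp add: algebra_simps)
    ultimately show "y \<in> (\<Union>z\<in>G. cube (grid_point S \<rho> z) ((L + 1) * \<rho>))" by (auto simp: cube_def)
  qed
  then have "emeasure lebesgue {y \<in> cube s (A * \<tau>). \<exists>s'\<in>S. infnorm (y - s') < L * \<rho>}
      \<le> emeasure lebesgue (\<Union>z\<in>G. cube (grid_point S \<rho> z) ((L + 1) * \<rho>))"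
    using fin by (intro emeasure_mono sets.finite_UN) auto
  also have "\<dots> \<le> (\<Sum>z\<in>G. emeasure lebesgue (cube (grid_point S \<rho> z) ((L + 1) * \<rho>)))"
    using fin by (intro emeasure_subadditive_finite) auto
  also have "\<dots> = (\<Sum>z\<in>G. ennreal ((2 * ((L + 1) * \<rho>)) ^ ?n))"
    using A \<rho> by (intro sum.cong refl emeasure_cube) auto
  also have "\<dots> = of_nat (card G) * ennreal ((2 * ((L + 1) * \<rho>)) ^ ?n)" by simp
  also have "\<dots> = ennreal (real (card G) * (2 * ((L + 1) * \<rho>)) ^ ?n)"
    using A \<rho> by (simp add: ennreal_mult ennreal_of_nat_eq_real_of_nat)
  also have "\<dots> \<le> ennreal ((2 * (L + 1)) ^ ?n * (5 ^ ?n * c2 / c1) * (A + L + 2) powr d * (\<rho> powr (real ?n - d) * \<tau> powr d))"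
  proof (rule ennreal_leI)
    \<comment> \<open>Of the volume of each small cube the packing bound uses up the factor
      \<open>\<rho> powr d\<close>; what remains is the gain.\<close>
    have "\<rho> ^ ?n = \<rho> powr d * \<rho> powr (real ?n - d)"
      using \<rho> by (simp add: powr_add[symmetric] powr_realpow)
    then have "real (card G) * (2 * ((L + 1) * \<rho>)) ^ ?n
       = (2 * (L + 1)) ^ ?n * \<rho> powr (real ?n - d) * (real (card G) * \<rho> powr d)"
      by (simp only: power_mult_distrib mult_ac)
    also have "\<dots> \<le> (2 * (L + 1)) ^ ?n * \<rho> powr (real ?n - d) * (5 ^ ?n * c2 / c1 * ((A + L + 2) * \<tau>) powr d)"
      using card A by (intro mult_left_mono) auto
    also have "((A + L + 2) * \<tau>) powr d = (A + L + 2) powr d * \<tau> powr d" using A \<tau>0 by (simp add: powr_mult)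
    finally show "real (card G) * (2 * ((L + 1) * \<rho>)) ^ ?n
        \<le> (2 * (L + 1)) ^ ?n * (5 ^ ?n * c2 / c1) * (A + L + 2) powr d * (\<rho> powr (real ?n - d) * \<tau> powr d)"
      by (simp only: mult_ac)
  qed
  finally show ?thesis .
qed

text \<open>Locally the volume of the \<rho>-neighbourhood tends to 0 with \<rho>, and countably
  many grid cubes cover \<open>S\<close>. Hence the values of the extension on \<open>S\<close>,
  which are those of f, do not enter the Lebesgue integrals.\<close>

lemma null_S: "S \<in> null_sets lebesgue"
proof -
  let ?n = "CARD('n)"
  define \<tau> where "\<tau> = R / 4"
  have \<tau>: "0 < \<tau>" "(1 + 1 + 2) * \<tau> \<le> R" using R_ge by (auto simp: \<tau>_def)
  have S_sets: "S \<in> sets lebesgue" using closed_S by simp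
  have null: "S \<inter> cube s \<tau> \<in> null_sets lebesgue" if s: "s \<in> S" for s
  proof -
    define K where "K = (2 * (1 + 1)) ^ ?n * (5 ^ ?n * c2 / c1) * (1 + 1 + 2) powr d * \<tau> powr d"
    have K: "0 < K" unfolding K_def using c1_pos c2_pos \<tau> by simp
    have le: "emeasure lebesgue (S \<inter> cube s \<tau>) \<le> ennreal (K * \<rho> powr (real ?n - d))" if \<rho>: "0 < \<rho>" "\<rho> \<le> \<tau>" for \<rho>
    proof -
      have op: "{y. \<exists>s'\<in>S. infnorm (y - s') < 1 * \<rho>} = (\<Union>s'\<in>S. {y. infnorm (y - s') < 1 * \<rho>})" by blast
      have "open {y. \<exists>s'\<in>S. infnorm (y - s') < 1 * \<rho>}"
        unfolding op by (intro open_UN ballI open_Collect_less continuous_intros)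
      then have "{y. \<exists>s'\<in>S. infnorm (y - s') < 1 * \<rho>} \<in> sets lebesgue" by simp
      then have m: "cube s (1 * \<tau>) \<inter> {y. \<exists>s'\<in>S. infnorm (y - s') < 1 * \<rho>} \<in> sets lebesgue" by (intro sets.Int) auto
      have "S \<inter> cube s \<tau> \<subseteq> {y \<in> cube s (1 * \<tau>). \<exists>s'\<in>S. infnorm (y - s') < 1 * \<rho>}"
        using \<rho> by (auto intro!: bexI simp: infnorm_0)
      then have "emeasure lebesgue (S \<inter> cube s \<tau>) \<le> emeasure lebesgue {y \<in> cube s (1 * \<tau>). \<exists>s'\<in>S. infnorm (y - s') < 1 * \<rho>}"
        using m by (intro emeasure_mono) (simp_all add: Int_def)
      also have "\<dots> \<le> ennreal ((2 * (1 + 1)) ^ ?n * (5 ^ ?n * c2 / c1) * (1 + 1 + 2) powr d * (\<rho> powr (real ?n - d) * \<tau> powr d))"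
        by (rule volume_neighbourhood) (use s \<rho> \<tau> in auto)
      finally show ?thesis by (simp add: K_def mult_ac)
    qed
    have "emeasure lebesgue (S \<inter> cube s \<tau>) \<le> 0"
    proof (rule ennreal_le_epsilon)
      fix e :: real assume e: "0 < e"
      obtain \<rho> where "0 < \<rho>" "\<rho> \<le> \<tau>" "K * \<rho> powr (real ?n - d) \<le> e"
        by (rule powr_small_exists[of "real ?n - d" K e \<tau>]) (use d_lt K e \<tau> in auto)
      then show "emeasure lebesgue (S \<inter> cube s \<tau>) \<le> 0 + ennreal e"
        using le[of \<rho>] by (auto intro: order_trans ennreal_leI)
    qed
    then show ?thesis using S_sets by (intro null_setsI) auto
  qed
  have "S \<subseteq> (\<Union>z\<in>grid_index \<tau> ` S. S \<inter> cube (grid_point S \<tau> z) \<tau>)"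
    using grid_point_close[OF _ \<tau>(1)] by (force simp: cube_def)
  moreover have "(\<Union>z\<in>grid_index \<tau> ` S. S \<inter> cube (grid_point S \<tau> z) \<tau>) \<in> null_sets lebesgue"
    by (rule null_sets_UN'[OF countable_subset[OF subset_UNIV countableI_type]]) (rule null, rule grid_point(1))
  ultimately show ?thesis by (intro null_sets_subset[OF _ S_sets])
qed

end

section \<open>Whitney cubes\<close>

text \<open>The Whitney conditions in terms of the radius: the diameter is \<open>2 * snd Q\<close>;
  9 is 8 for the largest distance of Q from \<open>S\<close> plus 1 for the way from the centre to a
  point of Q. The derivative scale \<open>snd Q / 2\<close> is the radius of the cube around
  \<open>a Q\<close>, so that bounds for \<phi> and for monomials scaled to that cube combine in
  \<open>dbound_mult\<close>.\<close>

locale whitney =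
  fixes S :: "(real ^ 'n) set" and W :: "((real ^ 'n) \<times> real) set"
    and \<phi> :: "(real ^ 'n) \<times> real \<Rightarrow> real ^ 'n \<Rightarrow> real" and a :: "(real ^ 'n) \<times> real \<Rightarrow> real ^ 'n"
    and k :: nat and C\<^sub>\<phi> :: real
  assumes S_closed: "closed S"
    and dyadic: "Q \<in> W \<Longrightarrow> dyadic_cube Q"
    and W_far: "Q \<in> W \<Longrightarrow> q \<in> cube (fst Q) (snd Q) \<Longrightarrow> s \<in> S \<Longrightarrow> 2 * snd Q \<le> infnorm (q - s)"
    and a_in: "Q \<in> W \<Longrightarrow> a Q \<in> S"
    and a_near: "Q \<in> W \<Longrightarrow> infnorm (fst Q - a Q) \<le> 9 * snd Q"
    and \<phi>_range: "Q \<in> W \<Longrightarrow> 0 \<le> \<phi> Q x" "Q \<in> W \<Longrightarrow> \<phi> Q x \<le> 1"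
    and \<phi>_supp: "Q \<in> W \<Longrightarrow> \<phi> Q x \<noteq> 0 \<Longrightarrow> x \<in> cube (fst Q) (9 / 8 * snd Q)"
    and \<phi>_sum: "x \<notin> S \<Longrightarrow> ((\<lambda>Q. \<phi> Q x) has_sum 1) W"
    and \<phi>_dbound: "Q \<in> W \<Longrightarrow> dbound k (snd Q / 2) y C\<^sub>\<phi> (\<phi> Q)"
begin

lemma dyadicE:
  assumes "Q \<in> W"
  obtains i :: int and m :: "'n \<Rightarrow> int" where "snd Q = 2 powr real_of_int i"
    "fst Q = (\<chi> l. 2 * snd Q * real_of_int (m l) + snd Q)"
proof -
  obtain j m where jm: "fst Q = (\<chi> l. (real_of_int (m l) + 1 / 2) * 2 powi (- j))" "snd Q = 2 powi (- j) / 2"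
    using dyadic[OF assms] unfolding dyadic_cube_def by blast
  have e: "(2::real) powr real_of_int (- j) = 2 powi (- j)" by (rule powr_real_of_int') simp_all
  have "(2::real) powr real_of_int (- j - 1) = 2 powr real_of_int (- j) / 2" by (simp add: powr_diff)
  then have "snd Q = 2 powr real_of_int (- j - 1)" unfolding jm(2) e by simp
  moreover have "fst Q = (\<chi> l. 2 * snd Q * real_of_int (m l) + snd Q)"
    unfolding jm by (simp add: vec_eq_iff algebra_simps)
  ultimately show ?thesis using that by blast
qed

lemma snd_pos: "Q \<in> W \<Longrightarrow> 0 < snd Q"
  using dyadicE[of Q] by (metis powr_gt_zero zero_neq_numeral)

lemma countable_W: "countable W"
proof -
  have "W \<subseteq> range (\<lambda>(i :: int, m :: 'n \<Rightarrow> int). ((\<chi> l. 2 * 2 powr real_of_int i * real_of_int (m l) + 2 powr real_of_int i), 2 powr real_of_int i))"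
  proof
    fix Q assume "Q \<in> W"
    then obtain i m where Q: "snd Q = 2 powr real_of_int i" "fst Q = (\<chi> l. 2 * snd Q * real_of_int (m l) + snd Q)"
      by (rule dyadicE)
    then have "Q = ((\<chi> l. 2 * 2 powr real_of_int i * real_of_int (m l) + 2 powr real_of_int i), 2 powr real_of_int i)"
      by (simp add: prod_eq_iff)
    then show "Q \<in> range (\<lambda>(i :: int, m :: 'n \<Rightarrow> int). ((\<chi> l. 2 * 2 powr real_of_int i * real_of_int (m l) + 2 powr real_of_int i), 2 powr real_of_int i))"
      by (intro image_eqI[of _ _ "(i, m)"]) auto
  qed
  then show ?thesis by (rule countable_subset) simp
qed

text \<open>Dyadic cubes of radius \<rho> have centres in a shifted lattice of mesh
  \<open>2 * \<rho>\<close>, so \<open>10 * \<rho>\<close> is five meshes and each coordinate admits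
  at most 11 values.\<close>

lemma
  assumes \<rho>: "0 < \<rho>"
  shows finite_same_radius: "finite {Q \<in> W. snd Q = \<rho> \<and> infnorm (fst Q - s) \<le> 10 * \<rho>}"
    and card_same_radius: "card {Q \<in> W. snd Q = \<rho> \<and> infnorm (fst Q - s) \<le> 10 * \<rho>} \<le> 11 ^ CARD('n)"
proof -
  let ?A = "{Q \<in> W. snd Q = \<rho> \<and> infnorm (fst Q - s) \<le> 10 * \<rho>}"
  define M where "M = {m :: 'n \<Rightarrow> int. \<forall>l. \<bar>(2 * \<rho>) * real_of_int (m l) - (s $ l - \<rho>)\<bar> \<le> 5 * (2 * \<rho>)}"
  have M: "finite M" "card M \<le> (nat \<lfloor>2 * 5 :: real\<rfloor> + 1) ^ CARD('n)"
    unfolding M_def using \<rho> by (intro finite_int_box card_int_box; simp)+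
  have sub: "?A \<subseteq> (\<lambda>m. ((\<chi> l. 2 * \<rho> * real_of_int (m l) + \<rho>), \<rho>)) ` M"
  proof
    fix Q assume Q: "Q \<in> ?A"
    then obtain i m where im: "snd Q = 2 powr real_of_int i" "fst Q = (\<chi> l. 2 * snd Q * real_of_int (m l) + snd Q)"
      using dyadicE[of Q] by blast
    have "\<bar>(2 * \<rho>) * real_of_int (m l) - (s $ l - \<rho>)\<bar> \<le> 5 * (2 * \<rho>)" for l
    proof -
      have "\<bar>fst Q $ l - s $ l\<bar> \<le> 10 * \<rho>" using Q by (simp add: infnorm_le_iff)
      also have "fst Q $ l - s $ l = (2 * \<rho>) * real_of_int (m l) - (s $ l - \<rho>)" using im(2) Q by simp
      finally show ?thesis by simp
    qed
    then have "m \<in> M" by (simp add: M_def)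
    moreover have "Q = ((\<chi> l. 2 * \<rho> * real_of_int (m l) + \<rho>), \<rho>)" using im(2) Q by (simp add: prod_eq_iff)
    ultimately show "Q \<in> (\<lambda>m. ((\<chi> l. 2 * \<rho> * real_of_int (m l) + \<rho>), \<rho>)) ` M" by blast
  qed
  show "finite ?A" by (rule finite_subset[OF sub finite_imageI[OF M(1)]])
  have "card ?A \<le> card ((\<lambda>m. ((\<chi> l. 2 * \<rho> * real_of_int (m l) + \<rho>) :: real ^ 'n, \<rho>)) ` M)"
    by (rule card_mono[OF finite_imageI[OF M(1)] sub])
  also have "\<dots> \<le> card M" by (rule card_image_le[OF M(1)])
  also have "\<dots> \<le> 11 ^ CARD('n)" using M(2) by simp
  finally show "card ?A \<le> 11 ^ CARD('n)" .
qed

text \<open>Few Whitney cubes are close to a given point on their own scale; summing over the dyadic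
  scales below \<open>\<tau>\<close> gives a geometric series.\<close>

lemma whitney_sum_le:
  assumes e: "0 < e" and \<tau>: "0 < \<tau>"
  shows "(\<integral>\<^sup>+Q. (if snd Q \<le> \<tau> \<and> infnorm (fst Q - s) \<le> 10 * snd Q then ennreal (snd Q powr e) else 0) \<partial>count_space W)
     \<le> ennreal (11 ^ CARD('n) * \<tau> powr e / (1 - 2 powr (- e)))"
proof -
  \<comment> \<open>The exponent of the largest power of 2 not above \<tau>; all radii are powers of
    2, so those up to \<tau> are among the numbers \<open>\<rho> l\<close>.\<close>
  define i0 where "i0 = \<lfloor>log 2 \<tau>\<rfloor>"
  define \<rho> where "\<rho> l = 2 powr (real_of_int i0 - real l)" for l :: nat
  have \<rho>0: "0 < \<rho> l" for l by (simp add: \<rho>_def)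
  have "2 powr real_of_int i0 \<le> 2 powr log 2 \<tau>" by (intro powr_mono) (auto simp: i0_def)
  then have i0: "2 powr real_of_int i0 \<le> \<tau>" using \<tau> by simp
  have \<rho>_le: "\<rho> l powr e \<le> \<tau> powr e * (2 powr (- e)) ^ l" for l
  proof -
    have "\<rho> l powr e = (2 powr real_of_int i0) powr e * (2 powr (- e)) ^ l"
      by (simp add: \<rho>_def powr_diff powr_divide powr_powr powr_minus powr_realpow[symmetric] field_simps)
    also have "\<dots> \<le> \<tau> powr e * (2 powr (- e)) ^ l"
      using i0 e by (intro mult_right_mono powr_mono2) auto
    finally show ?thesis .
  qed
  define A where "A l = {Q \<in> W. snd Q = \<rho> l \<and> infnorm (fst Q - s) \<le> 10 * \<rho> l}" for l
  let ?g = "\<lambda>Q. if snd Q \<le> \<tau> \<and> infnorm (fst Q - s) \<le> 10 * snd Q then ennreal (snd Q powr e) else 0"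
  have pt: "?g Q \<le> (\<Sum>l. ennreal (\<rho> l powr e) * indicator (A l) Q)" if Q: "Q \<in> W" for Q
  proof (cases "snd Q \<le> \<tau> \<and> infnorm (fst Q - s) \<le> 10 * snd Q")
    case True
    obtain i m where i: "snd Q = 2 powr real_of_int i" using dyadicE[OF Q] by metis
    have "real_of_int i = log 2 (snd Q)" by (simp add: i)
    also have "\<dots> \<le> log 2 \<tau>" using True snd_pos[OF Q] by simp
    finally have "i \<le> i0" unfolding i0_def by (simp add: le_floor_iff)
    then have \<rho>i: "snd Q = \<rho> (nat (i0 - i))" by (simp add: i \<rho>_def)
    have "?g Q = (\<Sum>l\<in>{nat (i0 - i)}. ennreal (\<rho> l powr e) * indicator (A l) Q)"
      using True Q by (auto simp: A_def \<rho>i)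
    also have "\<dots> \<le> (\<Sum>l. ennreal (\<rho> l powr e) * indicator (A l) Q)" by (intro sum_le_suminf) auto
    finally show ?thesis .
  next
    case False
    then have "?g Q = 0" by (simp only: if_False)
    then show ?thesis by (simp only: zero_le)
  qed
  have fA: "finite (A l)" for l unfolding A_def by (rule finite_same_radius[OF \<rho>0])
  have cA: "card (A l) \<le> 11 ^ CARD('n)" for l unfolding A_def by (rule card_same_radius[OF \<rho>0])
  have "(\<integral>\<^sup>+Q. ?g Q \<partial>count_space W) \<le> (\<integral>\<^sup>+Q. (\<Sum>l. ennreal (\<rho> l powr e) * indicator (A l) Q) \<partial>count_space W)"
    by (intro nn_integral_mono pt) simp
  also have "\<dots> = (\<Sum>l. \<integral>\<^sup>+Q. ennreal (\<rho> l powr e) * indicator (A l) Q \<partial>count_space W)"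
    by (rule nn_integral_suminf) simp
  also have "\<dots> \<le> (\<Sum>l. ennreal (11 ^ CARD('n) * \<tau> powr e * (2 powr (- e)) ^ l))"
  proof (intro suminf_le summableI)
    fix l
    have "A l \<subseteq> W" by (auto simp: A_def)
    then have "(\<integral>\<^sup>+Q. ennreal (\<rho> l powr e) * indicator (A l) Q \<partial>count_space W) = ennreal (\<rho> l powr e) * of_nat (card (A l))"
      using fA by (subst nn_integral_cmult_indicator) (auto simp: emeasure_count_space)
    also have "\<dots> = ennreal (\<rho> l powr e * real (card (A l)))"
      by (simp add: ennreal_mult ennreal_of_nat_eq_real_of_nat)
    also have "\<dots> \<le> ennreal ((\<tau> powr e * (2 powr (- e)) ^ l) * 11 ^ CARD('n))"
      using cA[of l] \<rho>_le[of l] by (intro ennreal_leI mult_mono) (auto simp flip: of_nat_le_iff)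
    finally show "(\<integral>\<^sup>+Q. ennreal (\<rho> l powr e) * indicator (A l) Q \<partial>count_space W) \<le> ennreal (11 ^ CARD('n) * \<tau> powr e * (2 powr (- e)) ^ l)"
      by (simp add: mult_ac)
  qed
  also have "\<dots> = ennreal (11 ^ CARD('n) * \<tau> powr e * (1 / (1 - 2 powr (- e))))"
  proof (rule suminf_ennreal_eq)
    have "2 powr (- e) < 2 powr 0" using e by (intro powr_less_mono) auto
    then have "norm (2 powr (- e)) < 1" by simp
    then show "(\<lambda>l. 11 ^ CARD('n) * \<tau> powr e * (2 powr (- e)) ^ l) sums (11 ^ CARD('n) * \<tau> powr e * (1 / (1 - 2 powr (- e))))"
      by (intro sums_mult geometric_sums)
  qed simp
  finally show ?thesis by simp
qed

text \<open>\<open>whitney_sum_le\<close> with exponent 1, where the geometric constant is 2; each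
  counted cube contributes at least lo. An infinite family would make the sum infinite, so
  finiteness comes out of the same bound.\<close>

lemma
  fixes s :: "real ^ 'n"
  assumes lo: "0 < lo" and \<tau>: "0 < \<tau>"
  defines "A \<equiv> {Q \<in> W. lo \<le> snd Q \<and> snd Q \<le> \<tau> \<and> infnorm (fst Q - s) \<le> 10 * snd Q}"
  shows finite_whitney_near: "finite A" and card_whitney_near: "real (card A) * lo \<le> 2 * 11 ^ CARD('n) * \<tau>"
proof -
  have le: "ennreal lo * emeasure (count_space W) A \<le> ennreal (2 * 11 ^ CARD('n) * \<tau>)"
  proof -
    have "ennreal lo * emeasure (count_space W) A = (\<integral>\<^sup>+Q. ennreal lo * indicator A Q \<partial>count_space W)"
      by (rule nn_integral_cmult_indicator[symmetric]) (simp add: A_def)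
    also have "\<dots> \<le> (\<integral>\<^sup>+Q. (if snd Q \<le> \<tau> \<and> infnorm (fst Q - s) \<le> 10 * snd Q then ennreal (snd Q powr 1) else 0) \<partial>count_space W)"
      using lo by (intro nn_integral_mono) (auto simp: A_def indicator_def intro!: ennreal_leI)
    also have "\<dots> \<le> ennreal (11 ^ CARD('n) * \<tau> powr 1 / (1 - 2 powr (- 1)))" by (rule whitney_sum_le) (use \<tau> in auto)
    also have "11 ^ CARD('n) * \<tau> powr 1 / (1 - 2 powr (- 1)) = 2 * 11 ^ CARD('n) * \<tau>" using \<tau> by (simp add: powr_minus)
    finally show ?thesis .
  qed
  show fin: "finite A"
  proof (rule ccontr)
    assume "infinite A"
    then have "emeasure (count_space W) A = \<infinity>" by (simp add: A_def emeasure_count_space_infinite)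
    then show False using le lo by (simp add: ennreal_mult_top top_unique)
  qed
  have "emeasure (count_space W) A = of_nat (card A)" using fin by (simp add: A_def emeasure_count_space)
  then have "ennreal (lo * real (card A)) \<le> ennreal (2 * 11 ^ CARD('n) * \<tau>)"
    using le lo by (simp add: ennreal_mult ennreal_of_nat_eq_real_of_nat)
  then show "real (card A) * lo \<le> 2 * 11 ^ CARD('n) * \<tau>" using \<tau> by (subst (asm) ennreal_le_iff) (auto simp: mult.commute)
qed

text \<open>Shrinking y towards the centre by the factor 8/9 gives a point q of the cube itself,
  moved by at most an eighth of the radius; q is at distance \<open>2 * snd Q\<close> or more from
  \<open>S\<close>.\<close>

lemma dist_S_lower:
  assumes Q: "Q \<in> W" and y: "y \<in> cube (fst Q) (9 / 8 * snd Q)" and s: "s \<in> S"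
  shows "snd Q \<le> infnorm (y - s)"
proof -
  define q where "q = fst Q + (8 / 9) *\<^sub>R (y - fst Q)"
  have y': "infnorm (y - fst Q) \<le> 9 / 8 * snd Q" using y by (simp add: cube_def)
  have "infnorm (q - fst Q) \<le> snd Q" using y' by (simp add: q_def infnorm_mul)
  then have "2 * snd Q \<le> infnorm (q - s)" using W_far[OF Q _ s, of q] by (simp add: cube_def)
  also have "\<dots> \<le> infnorm (q - y) + infnorm (y - s)" by (rule infnorm_triangle_sub)
  also have "q - y = (- 1 / 9) *\<^sub>R (y - fst Q)" by (simp add: q_def vec_eq_iff field_simps)
  also have "infnorm \<dots> \<le> 1 / 8 * snd Q" unfolding infnorm_mul using y' by simp
  finally show ?thesis using snd_pos[OF Q] by simp
qed

lemma dist_a_upper: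
  assumes Q: "Q \<in> W" and y: "y \<in> cube (fst Q) (9 / 8 * snd Q)"
  shows "infnorm (y - a Q) \<le> 11 * snd Q"
  using infnorm_triangle_sub[of y "a Q" "fst Q"] a_near[OF Q] y snd_pos[OF Q] by (simp add: cube_def)

text \<open>An active cube has radius at most the distance of x to any point of \<open>S\<close>,
  and at least an eleventh of the distance of x to \<open>S\<close>, which is positive because
  \<open>S\<close> is closed. The root of the dimension converts the Euclidean ball into the
  supremum metric.\<close>

lemma finite_active:
  assumes x: "x \<notin> S" shows "finite {Q \<in> W. \<phi> Q x \<noteq> 0}"
proof (cases "S = {}")
  case True
  then have "{Q \<in> W. \<phi> Q x \<noteq> 0} = {}" using a_in by blast
  then show ?thesis by (simp only: finite.emptyI)
next
  case False
  then obtain s0 where s0: "s0 \<in> S" by blast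
  have "open (- S)" using S_closed by (simp add: open_Compl)
  then obtain e where e: "0 < e" "ball x e \<subseteq> - S" using x open_contains_ball by blast
  define lo where "lo = e / (11 * sqrt (real DIM(real ^ 'n)))"
  have dm: "0 < sqrt (real DIM(real ^ 'n))" by simp
  have lo: "0 < lo" using e dm unfolding lo_def by (intro divide_pos_pos mult_pos_pos) auto
  have far: "11 * lo \<le> infnorm (x - s)" if "s \<in> S" for s
  proof -
    have "e \<le> norm (x - s)" using e that by (auto simp: ball_def dist_norm not_less[symmetric])
    also have "\<dots> \<le> sqrt (real DIM(real ^ 'n)) * infnorm (x - s)" by (rule norm_le_infnorm)
    finally show ?thesis using dm by (simp add: lo_def field_simps)
  qed
  have "{Q \<in> W. \<phi> Q x \<noteq> 0} \<subseteq> {Q \<in> W. lo \<le> snd Q \<and> snd Q \<le> infnorm (x - s0) \<and> infnorm (fst Q - x) \<le> 10 * snd Q}"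
  proof
    fix Q assume "Q \<in> {Q \<in> W. \<phi> Q x \<noteq> 0}"
    then have Q: "Q \<in> W" and xQ: "x \<in> cube (fst Q) (9 / 8 * snd Q)" using \<phi>_supp by auto
    have "infnorm (fst Q - x) \<le> 10 * snd Q" using xQ snd_pos[OF Q] by (simp add: cube_def infnorm_sub)
    moreover have "lo \<le> snd Q" using far[OF a_in[OF Q]] dist_a_upper[OF Q xQ] by simp
    ultimately show "Q \<in> {Q \<in> W. lo \<le> snd Q \<and> snd Q \<le> infnorm (x - s0) \<and> infnorm (fst Q - x) \<le> 10 * snd Q}"
      using dist_S_lower[OF Q xQ s0] Q by blast
  qed
  moreover have "0 < infnorm (x - s0)" using x s0 by (auto simp: infnorm_pos_lt)
  ultimately show ?thesis by (rule finite_subset[OF _ finite_whitney_near[OF lo]])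
qed

text \<open>Off \<open>S\<close> the weights sum to 1, so a value c independent of the cube may be
  subtracted in every term. With \<open>c = P y\<close> the extension is compared with an arbitrary
  polynomial P.\<close>

lemma partition_diff:
  assumes x: "x \<notin> S" and A: "finite A" "A \<subseteq> W" "\<And>Q. Q \<in> W \<Longrightarrow> \<phi> Q x \<noteq> 0 \<Longrightarrow> Q \<in> A"
  shows "(\<Sum>\<^sub>\<infinity>Q\<in>W. \<phi> Q x * p Q) - c = (\<Sum>Q\<in>A. \<phi> Q x * (p Q - c))"
proof -
  have "(\<Sum>\<^sub>\<infinity>Q\<in>W. \<phi> Q x * p Q) = (\<Sum>\<^sub>\<infinity>Q\<in>A. \<phi> Q x * p Q)"
    by (rule infsum_cong_neutral) (use A in auto)
  also have "\<dots> = (\<Sum>Q\<in>A. \<phi> Q x * p Q)" using A by simp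
  finally have 1: "(\<Sum>\<^sub>\<infinity>Q\<in>W. \<phi> Q x * p Q) = (\<Sum>Q\<in>A. \<phi> Q x * p Q)" .
  have "((\<lambda>Q. \<phi> Q x) has_sum 1) A \<longleftrightarrow> ((\<lambda>Q. \<phi> Q x) has_sum 1) W"
    by (rule has_sum_cong_neutral) (use A in auto)
  then have "((\<lambda>Q. \<phi> Q x) has_sum 1) A" using \<phi>_sum[OF x] by blast
  then have "(\<Sum>Q\<in>A. \<phi> Q x) = 1" using has_sum_unique[OF has_sum_finite[OF A(1)]] by metis
  then have "(\<Sum>Q\<in>A. \<phi> Q x * c) = c" by (simp flip: sum_distrib_right)
  then show ?thesis unfolding 1 by (simp add: right_diff_distrib sum_subtractf)
qed

end

section \<open>The extension near and far from \<open>S\<close>\<close>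

text \<open>The cube \<open>Q\<close> has diameter \<open>2 * snd Q\<close>, so \<open>8000\<close> corresponds to the parameter \<open>\<Delta> = 16000\<close>.\<close>

definition wproj :: "(real ^ 'n) measure \<Rightarrow> ((real ^ 'n) \<times> real \<Rightarrow> real ^ 'n) \<Rightarrow> nat \<Rightarrow>
     (real ^ 'n) \<times> real \<Rightarrow> (real ^ 'n \<Rightarrow> real) \<Rightarrow> real ^ 'n \<Rightarrow> real" where
  "wproj N a m Q f x = (if snd Q \<le> 8000 then poly_proj N (cube (a Q) (snd Q / 2)) (int m) f x else 0)"

lemma sum_le_nn_integral_count_space:
  assumes "finite A" "A \<subseteq> W"
  shows "(\<Sum>Q\<in>A. f Q) \<le> (\<integral>\<^sup>+Q. f Q \<partial>count_space W)"
proof -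
  have "(\<Sum>Q\<in>A. f Q) = (\<integral>\<^sup>+Q. f Q * indicator A Q \<partial>count_space W)"
    using assms by (subst nn_integral_count_space'[of A]) auto
  also have "\<dots> \<le> (\<integral>\<^sup>+Q. f Q \<partial>count_space W)" by (intro nn_integral_mono) (auto simp: indicator_def)
  finally show ?thesis .
qed

section \<open>Comparison of the extension with polynomials\<close>

context regular_measure begin

definition err :: "(real ^ 'n \<Rightarrow> real) \<Rightarrow> (real ^ 'n \<Rightarrow> real) \<Rightarrow> real ^ 'n \<Rightarrow> real \<Rightarrow> ennreal" where
  "err f P w r = (\<integral>\<^sup>+x\<in>cube w r. ennreal \<bar>f x - P x\<bar> \<partial>N)"

definition loc_int :: "(real ^ 'n \<Rightarrow> real) \<Rightarrow> bool" where
  "loc_int f \<longleftrightarrow> f \<in> borel_measurable N \<and> (\<forall>w\<in>S. \<forall>r. 0 < r \<and> r \<le> R \<longrightarrow> set_integrable N (cube w r) f)"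

lemma err_mono: "cube w r \<subseteq> cube w' r' \<Longrightarrow> err f P w r \<le> err f P w' r'"
  unfolding err_def by (intro nn_integral_mono) (auto simp: indicator_def)

lemma indicator_cube_measurable: "(\<lambda>u. indicator (cube w r) u :: ennreal) \<in> borel_measurable N"
  by (rule measurable_compose[OF id_borel borel_measurable_indicator[OF cube_borel]])

lemma diff_measurable:
  assumes "loc_int f" "P \<in> poly_space (int m)"
  shows "(\<lambda>u. ennreal \<bar>f u - P u\<bar>) \<in> borel_measurable N"
proof -
  have [measurable]: "f \<in> borel_measurable N" "P \<in> borel_measurable N"
    using assms poly_borel_N by (auto simp: loc_int_def)
  show ?thesis by measurable
qed

lemma err_measurable:
  assumes "loc_int f" "P \<in> poly_space (int m)"
  shows "(\<lambda>u. ennreal \<bar>f u - P u\<bar> * indicator (cube w r) u) \<in> borel_measurable N"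
  by (intro borel_measurable_times_ennreal diff_measurable[OF assms] indicator_cube_measurable)

text \<open>On large cubes the projection is replaced by \<open>0\<close>; there only \<open>P = 0\<close> is compared with it.\<close>

lemma wproj_coefs:
  assumes R: "8000 \<le> R"
  obtains C where "0 < C" "\<And>Q a f P. a Q \<in> S \<Longrightarrow> 0 < snd Q \<Longrightarrow> loc_int f \<Longrightarrow> P \<in> poly_space (int m) \<Longrightarrow>
    snd Q \<le> 8000 \<or> P = (\<lambda>x. 0) \<Longrightarrow>
    \<exists>c. (\<forall>x. wproj N a m Q f x - P x = (\<Sum>\<beta>\<in>midx m. c \<beta> * smono (a Q) (snd Q / 2) \<beta> x)) \<and>
      ennreal (cnorm m c) \<le> ennreal (C * snd Q powr (- d)) * err f P (a Q) (snd Q / 2)"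
proof -
  obtain C0 where C0: "0 < C0" "\<And>w r f P. w \<in> S \<Longrightarrow> 0 < r \<Longrightarrow> 2 * r \<le> R \<Longrightarrow> set_integrable N (cube w r) f \<Longrightarrow>
    P \<in> poly_space (int m) \<Longrightarrow>
    \<exists>c. (\<forall>x. poly_proj N (cube w r) (int m) f x - P x = (\<Sum>\<beta>\<in>midx m. c \<beta> * smono w r \<beta> x)) \<and>
      r powr d * cnorm m c \<le> C0 * (LINT x:cube w r|N. \<bar>f x - P x\<bar>)"
    using poly_proj_bound[of m] by blast
  define C where "C = C0 * 2 powr d"
  have C: "0 < C" using C0 by (simp add: C_def)
  show ?thesis
  proof (rule that[OF C])
    fix Q :: "(real ^ 'n) \<times> real" and a :: "(real ^ 'n) \<times> real \<Rightarrow> real ^ 'n" and f P :: "real ^ 'n \<Rightarrow> real"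
    assume a: "a Q \<in> S" and r: "0 < snd Q" and f: "loc_int f" and P: "P \<in> poly_space (int m)"
      and alt: "snd Q \<le> 8000 \<or> P = (\<lambda>x. 0)"
    show "\<exists>c. (\<forall>x. wproj N a m Q f x - P x = (\<Sum>\<beta>\<in>midx m. c \<beta> * smono (a Q) (snd Q / 2) \<beta> x)) \<and>
      ennreal (cnorm m c) \<le> ennreal (C * snd Q powr (- d)) * err f P (a Q) (snd Q / 2)"
    proof (cases "snd Q \<le> 8000")
      case False
      then have "\<forall>x. wproj N a m Q f x - P x = 0" using alt by (auto simp: wproj_def)
      then show ?thesis by (intro exI[of _ "\<lambda>_. 0"]) (simp add: cnorm_def)
    next
      case True
      define r where "r = snd Q / 2"
      have r': "0 < r" "2 * r \<le> R" "r \<le> R" using True R r by (auto simp: r_def)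
      have fi: "set_integrable N (cube (a Q) r) f" using f a r' by (auto simp: loc_int_def)
      have fP: "set_integrable N (cube (a Q) r) (\<lambda>x. f x - P x)"
        by (rule set_integral_diff(1)[OF fi set_integrable_poly[OF a r'(1,3) P]])
      obtain c where c: "\<forall>x. poly_proj N (cube (a Q) r) (int m) f x - P x = (\<Sum>\<beta>\<in>midx m. c \<beta> * smono (a Q) r \<beta> x)"
        and cn: "r powr d * cnorm m c \<le> C0 * (LINT x:cube (a Q) r|N. \<bar>f x - P x\<bar>)"
        using C0(2)[OF a r'(1,2) fi P] by blast
      have J: "err f P (a Q) r = ennreal (LINT x:cube (a Q) r|N. \<bar>f x - P x\<bar>)"
        unfolding err_def by (rule nn_integral_eq_LINT[OF fP])
      have e: "snd Q powr d = 2 powr d * r powr d" using r by (simp add: r_def powr_divide)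
      have "snd Q powr d * cnorm m c \<le> C * (LINT x:cube (a Q) r|N. \<bar>f x - P x\<bar>)"
        using mult_left_mono[OF cn, of "2 powr d"] by (simp add: e C_def mult_ac)
      then have "cnorm m c \<le> C * snd Q powr (- d) * (LINT x:cube (a Q) r|N. \<bar>f x - P x\<bar>)"
        using r by (simp add: powr_minus field_simps)
      then have "ennreal (cnorm m c) \<le> ennreal (C * snd Q powr (- d)) * err f P (a Q) r"
        unfolding J using C by (subst ennreal_mult'[symmetric]) (auto intro: ennreal_leI)
      moreover have "\<forall>x. wproj N a m Q f x - P x = (\<Sum>\<beta>\<in>midx m. c \<beta> * smono (a Q) r \<beta> x)"
        using c True by (simp add: wproj_def r_def)
      ultimately show ?thesis unfolding r_def by blast
    qed
  qed
qed

text \<open>On Q a projection differs from P by at most a multiple of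
  \<open>snd Q powr (- d)\<close> times the error on the cube around \<open>a Q\<close>; integrating
  over Q leaves \<open>snd Q powr (n - d)\<close>. After exchanging the order of integration, a
  fixed point u of \<open>S\<close> sees boundedly many Whitney cubes per radius, and as the
  exponent is positive the radii up to \<open>(L + 1) * t\<close> sum to a multiple of
  \<open>t powr (n - d)\<close>.\<close>

lemma near_estimate:
  fixes L :: real
  assumes R: "8000 \<le> R" and L: "1 \<le> L"
  shows "\<exists>C>0. \<forall>W \<phi> a C\<^sub>\<phi> f F P x s t. whitney S W \<phi> a (Suc m) C\<^sub>\<phi> \<longrightarrow> loc_int f \<longrightarrow>
    (\<forall>y. y \<notin> S \<longrightarrow> F y = (\<Sum>\<^sub>\<infinity>Q\<in>W. \<phi> Q y * wproj N a m Q f y)) \<longrightarrow>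
    P \<in> poly_space (int m) \<longrightarrow> s \<in> S \<longrightarrow> infnorm (x - s) \<le> L * t \<longrightarrow> 0 < t \<longrightarrow>
    (L + 1) * t \<le> 8000 \<or> P = (\<lambda>x. 0) \<longrightarrow>
    (\<integral>\<^sup>+y\<in>cube x t. ennreal \<bar>F y - P y\<bar> \<partial>lebesgue) \<le> ennreal (C * t powr (real CARD('n) - d)) * err f P s (21 * (L + 1) * t)"
proof -
  let ?n = "CARD('n)"
  define e where "e = real ?n - d"
  have e: "0 < e" using d_lt by (simp add: e_def)
  obtain C1 where C1: "0 < C1" "\<And>Q a f P. a Q \<in> S \<Longrightarrow> 0 < snd Q \<Longrightarrow> loc_int f \<Longrightarrow> P \<in> poly_space (int m) \<Longrightarrow>
    snd Q \<le> 8000 \<or> P = (\<lambda>x. 0) \<Longrightarrow>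
    \<exists>c. (\<forall>x. wproj N a m Q f x - P x = (\<Sum>\<beta>\<in>midx m. c \<beta> * smono (a Q) (snd Q / 2) \<beta> x)) \<and>
      ennreal (cnorm m c) \<le> ennreal (C1 * snd Q powr (- d)) * err f P (a Q) (snd Q / 2)"
    using wproj_coefs[OF R, of m] by blast
  define K where "K = C1 * 22 ^ m * (9 / 4) ^ ?n"
  have K: "0 < K" using C1 by (simp add: K_def)
  have q1: "2 powr (- e) < 1" using powr_less_mono[of "- e" 0 2] e by simp
  define C where "C = K * (11 ^ ?n * (L + 1) powr e / (1 - 2 powr (- e)))"
  have C: "0 < C" unfolding C_def using K q1 L by (intro mult_pos_pos divide_pos_pos) auto
  have "(\<integral>\<^sup>+y\<in>cube x t. ennreal \<bar>F y - P y\<bar> \<partial>lebesgue) \<le> ennreal (C * t powr e) * err f P s (21 * (L + 1) * t)"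
    if wh: "whitney S W \<phi> a (Suc m) C\<^sub>\<phi>" and f: "loc_int f"
      and F: "\<forall>y. y \<notin> S \<longrightarrow> F y = (\<Sum>\<^sub>\<infinity>Q\<in>W. \<phi> Q y * wproj N a m Q f y)"
      and P: "P \<in> poly_space (int m)" and s: "s \<in> S" and xs: "infnorm (x - s) \<le> L * t" and t: "0 < t"
      and alt: "(L + 1) * t \<le> 8000 \<or> P = (\<lambda>x. 0)" for W \<phi> a C\<^sub>\<phi> f F P x s t
  proof -
    interpret whitney S W \<phi> a "Suc m" C\<^sub>\<phi> by (rule wh)
    define \<tau> where "\<tau> = (L + 1) * t"
    have \<tau>: "0 < \<tau>" using t L by (simp add: \<tau>_def)
    define W' where "W' = {Q \<in> W. snd Q \<le> \<tau> \<and> (\<exists>y\<in>cube x t. y \<in> cube (fst Q) (9 / 8 * snd Q))}"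
    have W'W: "W' \<subseteq> W" by (auto simp: W'_def)
    define M where "M Q = ennreal (22 ^ m * C1 * snd Q powr (- d)) * err f P (a Q) (snd Q / 2)" for Q
    have wM: "ennreal \<bar>wproj N a m Q f y - P y\<bar> \<le> M Q" if Q: "Q \<in> W'" and y: "y \<in> cube (fst Q) (9 / 8 * snd Q)" for Q y
    proof -
      have QW: "Q \<in> W" and r: "snd Q \<le> \<tau>" using Q by (auto simp: W'_def)
      have alt': "snd Q \<le> 8000 \<or> P = (\<lambda>x. 0)" using alt r by (auto simp: \<tau>_def)
      obtain c where c: "wproj N a m Q f y - P y = (\<Sum>\<beta>\<in>midx m. c \<beta> * smono (a Q) (snd Q / 2) \<beta> y)"
        and cn: "ennreal (cnorm m c) \<le> ennreal (C1 * snd Q powr (- d)) * err f P (a Q) (snd Q / 2)"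
        using C1(2)[of a Q f P, OF a_in[OF QW] snd_pos[OF QW] f P alt'] by blast
      \<comment> \<open>Distance \<open>11 * snd Q\<close> from \<open>a Q\<close> is 22 times the
        radius \<open>snd Q / 2\<close> to which the monomials are scaled.\<close>
      have yc: "y \<in> cube (a Q) (22 * (snd Q / 2))" using dist_a_upper[OF QW y] by (simp add: cube_def)
      have "\<bar>wproj N a m Q f y - P y\<bar> \<le> (\<Sum>\<beta>\<in>midx m. \<bar>c \<beta> * smono (a Q) (snd Q / 2) \<beta> y\<bar>)"
        unfolding c by (rule sum_abs)
      also have "\<dots> \<le> (\<Sum>\<beta>\<in>midx m. \<bar>c \<beta>\<bar> * 22 ^ m)"
        unfolding abs_mult using snd_pos[OF QW] by (intro sum_mono mult_left_mono abs_smono_le yc) auto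
      also have "\<dots> = 22 ^ m * cnorm m c" by (simp only: cnorm_def sum_distrib_left mult.commute[of _ "22 ^ m"])
      finally have "ennreal \<bar>wproj N a m Q f y - P y\<bar> \<le> ennreal (22 ^ m * cnorm m c)" by (rule ennreal_leI)
      also have "\<dots> = ennreal (22 ^ m) * ennreal (cnorm m c)" by (simp add: ennreal_mult cnorm_nonneg)
      also have "\<dots> \<le> ennreal (22 ^ m) * (ennreal (C1 * snd Q powr (- d)) * err f P (a Q) (snd Q / 2))"
        by (intro mult_left_mono cn) simp
      also have "\<dots> = M Q" using C1(1) by (simp add: M_def ennreal_mult mult_ac)
      finally show ?thesis .
    qed
    have pt: "ennreal \<bar>F y - P y\<bar> * indicator (cube x t) y
        \<le> (\<integral>\<^sup>+Q. M Q * indicator W' Q * indicator (cube (fst Q) (9 / 8 * snd Q)) y \<partial>count_space W)"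
      if y: "y \<notin> S" for y
    proof (cases "y \<in> cube x t")
      case True
      define A where "A = {Q \<in> W. \<phi> Q y \<noteq> 0}"
      have A: "finite A" "A \<subseteq> W" unfolding A_def using finite_active[OF y] by auto
      have A': "Q \<in> W' \<and> y \<in> cube (fst Q) (9 / 8 * snd Q)" if "Q \<in> A" for Q
      proof -
        have QW: "Q \<in> W" and yQ: "y \<in> cube (fst Q) (9 / 8 * snd Q)" using that \<phi>_supp by (auto simp: A_def)
        have "snd Q \<le> infnorm (y - s)" by (rule dist_S_lower[OF QW yQ s])
        also have "\<dots> \<le> infnorm (y - x) + infnorm (x - s)" by (rule infnorm_triangle_sub)
        also have "\<dots> \<le> \<tau>" using True xs by (simp add: cube_def \<tau>_def algebra_simps)
        finally show ?thesis using QW yQ True by (auto simp: W'_def)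
      qed
      have "F y - P y = (\<Sum>Q\<in>A. \<phi> Q y * (wproj N a m Q f y - P y))"
        using F y partition_diff[OF y A, of "\<lambda>Q. wproj N a m Q f y" "P y"] by (simp add: A_def)
      then have "\<bar>F y - P y\<bar> \<le> (\<Sum>Q\<in>A. \<bar>\<phi> Q y * (wproj N a m Q f y - P y)\<bar>)" by (simp add: sum_abs)
      also have "\<dots> \<le> (\<Sum>Q\<in>A. 1 * \<bar>wproj N a m Q f y - P y\<bar>)"
        unfolding abs_mult using A \<phi>_range by (intro sum_mono mult_right_mono) auto
      finally have "ennreal \<bar>F y - P y\<bar> \<le> ennreal (\<Sum>Q\<in>A. \<bar>wproj N a m Q f y - P y\<bar>)" by (intro ennreal_leI) simp
      also have "\<dots> = (\<Sum>Q\<in>A. ennreal \<bar>wproj N a m Q f y - P y\<bar>)" by (rule sum_ennreal[symmetric]) simp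
      also have "\<dots> \<le> (\<Sum>Q\<in>A. M Q * indicator W' Q * indicator (cube (fst Q) (9 / 8 * snd Q)) y)"
        using A' wM by (intro sum_mono) auto
      also have "\<dots> \<le> (\<integral>\<^sup>+Q. M Q * indicator W' Q * indicator (cube (fst Q) (9 / 8 * snd Q)) y \<partial>count_space W)"
        by (rule sum_le_nn_integral_count_space[OF A])
      finally show ?thesis using True by simp
    qed simp
    have "(\<integral>\<^sup>+y\<in>cube x t. ennreal \<bar>F y - P y\<bar> \<partial>lebesgue)
        \<le> (\<integral>\<^sup>+y. \<integral>\<^sup>+Q. M Q * indicator W' Q * indicator (cube (fst Q) (9 / 8 * snd Q)) y \<partial>count_space W \<partial>lebesgue)"
      by (rule nn_integral_mono_AE) (use AE_not_in[OF null_S] pt in \<open>auto elim: AE_mp\<close>)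
    also have "\<dots> = (\<integral>\<^sup>+Q. \<integral>\<^sup>+y. M Q * indicator W' Q * indicator (cube (fst Q) (9 / 8 * snd Q)) y \<partial>lebesgue \<partial>count_space W)"
      by (rule nn_integral_count_space_nn_integral[OF countable_W]) (intro borel_measurable_times_ennreal borel_measurable_const borel_measurable_indicator, simp)
    also have "\<dots> = (\<integral>\<^sup>+Q. \<integral>\<^sup>+u. ennreal \<bar>f u - P u\<bar> * (ennreal (K * snd Q powr e) * indicator W' Q * indicator (cube (a Q) (snd Q / 2)) u) \<partial>N \<partial>count_space W)"
    proof (rule nn_integral_cong)
      fix Q assume "Q \<in> space (count_space W)"
      then have r: "0 < snd Q" using snd_pos by simp
      have "(\<integral>\<^sup>+y. M Q * indicator W' Q * indicator (cube (fst Q) (9 / 8 * snd Q)) y \<partial>lebesgue)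
          = M Q * indicator W' Q * emeasure lebesgue (cube (fst Q) (9 / 8 * snd Q))"
        by (rule nn_integral_cmult_indicator) simp
      also have "emeasure lebesgue (cube (fst Q) (9 / 8 * snd Q)) = ennreal ((2 * (9 / 8 * snd Q)) ^ ?n)"
        using r by (intro emeasure_cube) simp
      also have "M Q * indicator W' Q * \<dots>
          = (ennreal (22 ^ m * C1 * snd Q powr (- d)) * ennreal ((2 * (9 / 8 * snd Q)) ^ ?n)) * indicator W' Q * err f P (a Q) (snd Q / 2)"
        by (simp add: M_def mult_ac)
      also have "ennreal (22 ^ m * C1 * snd Q powr (- d)) * ennreal ((2 * (9 / 8 * snd Q)) ^ ?n) = ennreal (K * snd Q powr e)"
      proof -
        have "(2 * (9 / 8 * snd Q)) ^ ?n = (9 / 4) ^ ?n * snd Q powr real ?n"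
          using r by (simp add: power_mult_distrib[symmetric] powr_realpow)
        moreover have "snd Q powr e = snd Q powr real ?n * snd Q powr (- d)"
          by (simp add: e_def powr_add[symmetric])
        ultimately show ?thesis using C1(1) by (subst ennreal_mult'[symmetric]) (auto simp: K_def mult_ac)
      qed
      also have "ennreal (K * snd Q powr e) * indicator W' Q * err f P (a Q) (snd Q / 2)
          = (\<integral>\<^sup>+u. (ennreal (K * snd Q powr e) * indicator W' Q) * (ennreal \<bar>f u - P u\<bar> * indicator (cube (a Q) (snd Q / 2)) u) \<partial>N)"
      proof -
        have "(\<lambda>u. ennreal \<bar>f u - P u\<bar> * indicator (cube (a Q) (snd Q / 2)) u) \<in> borel_measurable N"
          by (rule err_measurable[OF f P])
        then show ?thesis unfolding err_def by (rule nn_integral_cmult[symmetric])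
      qed
      finally show "(\<integral>\<^sup>+y. M Q * indicator W' Q * indicator (cube (fst Q) (9 / 8 * snd Q)) y \<partial>lebesgue)
        = (\<integral>\<^sup>+u. ennreal \<bar>f u - P u\<bar> * (ennreal (K * snd Q powr e) * indicator W' Q * indicator (cube (a Q) (snd Q / 2)) u) \<partial>N)"
        by (simp add: mult_ac)
    qed
    also have "\<dots> = (\<integral>\<^sup>+u. \<integral>\<^sup>+Q. ennreal \<bar>f u - P u\<bar> * (ennreal (K * snd Q powr e) * indicator W' Q * indicator (cube (a Q) (snd Q / 2)) u) \<partial>count_space W \<partial>N)"
    proof (rule nn_integral_count_space_nn_integral[OF countable_W, symmetric])
      fix Q
      show "(\<lambda>u. ennreal \<bar>f u - P u\<bar> * (ennreal (K * snd Q powr e) * indicator W' Q * indicator (cube (a Q) (snd Q / 2)) u)) \<in> borel_measurable N"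
        by (intro borel_measurable_times_ennreal borel_measurable_const diff_measurable[OF f P] indicator_cube_measurable)
    qed
    also have "\<dots> \<le> (\<integral>\<^sup>+u. ennreal (C * t powr e) * (ennreal \<bar>f u - P u\<bar> * indicator (cube s (21 * (L + 1) * t)) u) \<partial>N)"
    proof (rule nn_integral_mono)
      fix u assume "u \<in> space N"
      have uQ: "infnorm (fst Q - u) \<le> 10 * snd Q \<and> infnorm (u - s) \<le> 21 * \<tau>" if Q: "Q \<in> W'" and u: "u \<in> cube (a Q) (snd Q / 2)" for Q
      proof -
        have QW: "Q \<in> W" and r: "snd Q \<le> \<tau>" using Q by (auto simp: W'_def)
        obtain y where y: "y \<in> cube x t" "y \<in> cube (fst Q) (9 / 8 * snd Q)" using Q by (auto simp: W'_def)
        have ua: "infnorm (u - a Q) \<le> snd Q / 2" using u by (simp add: cube_def)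
        have 1: "infnorm (fst Q - u) \<le> 10 * snd Q"
          using infnorm_triangle_sub[of "fst Q" u "a Q"] a_near[OF QW] ua snd_pos[OF QW] infnorm_sub[of u "a Q"] by simp
        have "infnorm (u - s) \<le> infnorm (u - a Q) + infnorm (a Q - y) + infnorm (y - x) + infnorm (x - s)"
          using infnorm_triangle_sub[of u s "a Q"] infnorm_triangle_sub[of "a Q" s y] infnorm_triangle_sub[of y s x] by linarith
        also have "\<dots> \<le> snd Q / 2 + 11 * snd Q + t + L * t"
          using ua dist_a_upper[OF QW y(2)] y(1) xs infnorm_sub[of y "a Q"] by (intro add_mono) (auto simp: cube_def)
        also have "\<dots> = snd Q / 2 + 11 * snd Q + \<tau>" by (simp add: \<tau>_def algebra_simps)
        also have "\<dots> \<le> 21 * \<tau>" using r \<tau> by simp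
        finally show ?thesis using 1 by blast
      qed
      have "(\<integral>\<^sup>+Q. ennreal (K * snd Q powr e) * indicator W' Q * indicator (cube (a Q) (snd Q / 2)) u \<partial>count_space W)
          \<le> ennreal (C * t powr e) * indicator (cube s (21 * (L + 1) * t)) u"
      proof (cases "u \<in> cube s (21 * (L + 1) * t)")
        case True
        have "(\<integral>\<^sup>+Q. ennreal (K * snd Q powr e) * indicator W' Q * indicator (cube (a Q) (snd Q / 2)) u \<partial>count_space W)
            \<le> (\<integral>\<^sup>+Q. ennreal K * (if snd Q \<le> \<tau> \<and> infnorm (fst Q - u) \<le> 10 * snd Q then ennreal (snd Q powr e) else 0) \<partial>count_space W)"
          using K uQ by (intro nn_integral_mono) (auto simp: indicator_def W'_def ennreal_mult)
        also have "\<dots> = ennreal K * (\<integral>\<^sup>+Q. (if snd Q \<le> \<tau> \<and> infnorm (fst Q - u) \<le> 10 * snd Q then ennreal (snd Q powr e) else 0) \<partial>count_space W)"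
          by (rule nn_integral_cmult) simp
        also have "\<dots> \<le> ennreal K * ennreal (11 ^ ?n * \<tau> powr e / (1 - 2 powr (- e)))"
          by (intro mult_left_mono whitney_sum_le e \<tau>) simp
        also have "\<dots> = ennreal (C * t powr e)"
          using K t L by (subst ennreal_mult'[symmetric]) (auto simp: C_def \<tau>_def powr_mult mult.assoc)
        finally show ?thesis using True by simp
      next
        case False
        have "ennreal (K * snd Q powr e) * indicator W' Q * indicator (cube (a Q) (snd Q / 2)) u = 0" for Q
        proof (cases "Q \<in> W' \<and> u \<in> cube (a Q) (snd Q / 2)")
          case True
          have e21: "21 * (L + 1) * t = 21 * \<tau>" by (simp only: \<tau>_def mult.assoc)
          have "infnorm (u - s) \<le> 21 * \<tau>" using uQ[of Q] True by blast
          then show ?thesis using False unfolding e21 cube_def by blast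
        qed (auto simp: indicator_def)
        then have "(\<integral>\<^sup>+Q. ennreal (K * snd Q powr e) * indicator W' Q * indicator (cube (a Q) (snd Q / 2)) u \<partial>count_space W) = 0"
          by (simp only: nn_integral_const mult_zero_left)
        then show ?thesis by (simp only: zero_le)
      qed
      then have "ennreal \<bar>f u - P u\<bar> * (\<integral>\<^sup>+Q. ennreal (K * snd Q powr e) * indicator W' Q * indicator (cube (a Q) (snd Q / 2)) u \<partial>count_space W)
          \<le> ennreal \<bar>f u - P u\<bar> * (ennreal (C * t powr e) * indicator (cube s (21 * (L + 1) * t)) u)"
        by (intro mult_left_mono) auto
      then show "(\<integral>\<^sup>+Q. ennreal \<bar>f u - P u\<bar> * (ennreal (K * snd Q powr e) * indicator W' Q * indicator (cube (a Q) (snd Q / 2)) u) \<partial>count_space W)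
          \<le> ennreal (C * t powr e) * (ennreal \<bar>f u - P u\<bar> * indicator (cube s (21 * (L + 1) * t)) u)"
        by (subst nn_integral_cmult) (auto simp: mult_ac)
    qed
    also have "\<dots> = ennreal (C * t powr e) * err f P s (21 * (L + 1) * t)"
    proof -
      have "(\<lambda>u. ennreal \<bar>f u - P u\<bar> * indicator (cube s (21 * (L + 1) * t)) u) \<in> borel_measurable N"
        by (rule err_measurable[OF f P])
      then show ?thesis unfolding err_def by (rule nn_integral_cmult)
    qed
    finally show ?thesis .
  qed
  then show ?thesis using C unfolding e_def by (intro exI[of _ C]) blast
qed

text \<open>When the distance of x to \<open>S\<close> is comparable to \<tau>, so are the radii of
  all cubes active on \<open>cube x (\<tau> / 2)\<close>; hence their number is bounded and their
  coefficients are controlled by one error term. Both the smoothness estimate and the supremum bound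
  start from this.\<close>

lemma far_cubes:
  fixes L :: real
  assumes R: "8000 \<le> R" and L: "1 \<le> L"
  obtains C where "0 < C" "\<And>W \<phi> a k C\<^sub>\<phi> f P x s \<tau>. whitney S W \<phi> a k C\<^sub>\<phi> \<Longrightarrow> loc_int f \<Longrightarrow>
    P \<in> poly_space (int m) \<Longrightarrow> s \<in> S \<Longrightarrow> infnorm (x - s) \<le> L * \<tau> \<Longrightarrow> 0 < \<tau> \<Longrightarrow>
    (\<And>s'. s' \<in> S \<Longrightarrow> 2 * \<tau> \<le> infnorm (x - s')) \<Longrightarrow> (L + 1) * \<tau> \<le> 8000 \<or> P = (\<lambda>x. 0) \<Longrightarrow>
    \<exists>A c. finite A \<and> A \<subseteq> W \<and> real (card A) \<le> 22 * 11 ^ CARD('n) * (L + 1) \<and>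
      (\<forall>y Q. y \<in> cube x (\<tau> / 2) \<longrightarrow> Q \<in> W \<longrightarrow> \<phi> Q y \<noteq> 0 \<longrightarrow> Q \<in> A) \<and>
      (\<forall>Q\<in>A. \<tau> / 11 \<le> snd Q \<and> cube x (\<tau> / 2) \<subseteq> cube (a Q) (52 * (snd Q / 2)) \<and>
        (\<forall>y. wproj N a m Q f y - P y = (\<Sum>\<beta>\<in>midx m. c Q \<beta> * smono (a Q) (snd Q / 2) \<beta> y)) \<and>
        ennreal (cnorm m (c Q)) \<le> ennreal (C * \<tau> powr (- d)) * err f P s (21 * (L + 1) * \<tau>))"
proof -
  obtain C1 where C1: "0 < C1" "\<And>Q a f P. a Q \<in> S \<Longrightarrow> 0 < snd Q \<Longrightarrow> loc_int f \<Longrightarrow> P \<in> poly_space (int m) \<Longrightarrow>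
    snd Q \<le> 8000 \<or> P = (\<lambda>x. 0) \<Longrightarrow>
    \<exists>c. (\<forall>x. wproj N a m Q f x - P x = (\<Sum>\<beta>\<in>midx m. c \<beta> * smono (a Q) (snd Q / 2) \<beta> x)) \<and>
      ennreal (cnorm m c) \<le> ennreal (C1 * snd Q powr (- d)) * err f P (a Q) (snd Q / 2)"
    using wproj_coefs[OF R, of m] by blast
  define C where "C = C1 * 11 powr d"
  have C: "0 < C" using C1 by (simp add: C_def)
  show ?thesis
  proof (rule that[OF C])
    fix W \<phi> a k C\<^sub>\<phi> and f P :: "real ^ 'n \<Rightarrow> real" and x s \<tau>
    assume wh: "whitney S W \<phi> a k C\<^sub>\<phi>" and f: "loc_int f" and P: "P \<in> poly_space (int m)" and s: "s \<in> S"
      and xs: "infnorm (x - s) \<le> L * \<tau>" and \<tau>: "0 < \<tau>" and far: "\<And>s'. s' \<in> S \<Longrightarrow> 2 * \<tau> \<le> infnorm (x - s')"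
      and alt: "(L + 1) * \<tau> \<le> 8000 \<or> P = (\<lambda>x. 0)"
    interpret whitney S W \<phi> a k C\<^sub>\<phi> by (rule wh)
    define A where "A = {Q \<in> W. \<tau> / 11 \<le> snd Q \<and> snd Q \<le> (L + 1) * \<tau> \<and> infnorm (fst Q - x) \<le> 10 * snd Q}"
    have L\<tau>: "0 < (L + 1) * \<tau>" "0 < \<tau> / 11" using L \<tau> by auto
    have A: "finite A" "real (card A) * (\<tau> / 11) \<le> 2 * 11 ^ CARD('n) * ((L + 1) * \<tau>)"
      unfolding A_def using finite_whitney_near[OF L\<tau>(2,1)] card_whitney_near[OF L\<tau>(2,1)] by auto
    have "real (card A) * \<tau> \<le> (22 * 11 ^ CARD('n) * (L + 1)) * \<tau>" using A(2) by simp
    then have cA: "real (card A) \<le> 22 * 11 ^ CARD('n) * (L + 1)" using \<tau> by (simp only: mult_le_cancel_right_pos)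
    have act: "Q \<in> A" if y: "y \<in> cube x (\<tau> / 2)" and Q: "Q \<in> W" "\<phi> Q y \<noteq> 0" for y Q
    proof -
      have yQ: "y \<in> cube (fst Q) (9 / 8 * snd Q)" using \<phi>_supp Q by blast
      have yx: "infnorm (y - x) \<le> \<tau> / 2" using y by (simp add: cube_def)
      have "snd Q \<le> infnorm (y - s)" by (rule dist_S_lower[OF Q(1) yQ s])
      also have "\<dots> \<le> infnorm (y - x) + infnorm (x - s)" by (rule infnorm_triangle_sub)
      also have "\<dots> \<le> (L + 1) * \<tau>" using yx xs \<tau> by (simp add: algebra_simps)
      finally have 1: "snd Q \<le> (L + 1) * \<tau>" .
      have "2 * \<tau> \<le> infnorm (x - a Q)" by (rule far[OF a_in[OF Q(1)]])
      also have "\<dots> \<le> infnorm (x - y) + infnorm (y - a Q)" by (rule infnorm_triangle_sub)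
      also have "\<dots> \<le> \<tau> / 2 + 11 * snd Q"
        using yx dist_a_upper[OF Q(1) yQ] infnorm_sub[of x y] by simp
      finally have 2: "3 / 2 * \<tau> \<le> 11 * snd Q" by simp
      have "infnorm (fst Q - x) \<le> infnorm (fst Q - y) + infnorm (y - x)" by (rule infnorm_triangle_sub)
      also have "\<dots> \<le> 9 / 8 * snd Q + \<tau> / 2" using yQ yx by (simp add: cube_def infnorm_sub[of "fst Q" y])
      also have "\<dots> \<le> 10 * snd Q" using 2 snd_pos[OF Q(1)] by simp
      finally show ?thesis using 1 2 Q(1) \<tau> by (auto simp: A_def)
    qed
    have ex: "\<exists>c. (\<forall>y. wproj N a m Q f y - P y = (\<Sum>\<beta>\<in>midx m. c \<beta> * smono (a Q) (snd Q / 2) \<beta> y)) \<and>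
        ennreal (cnorm m c) \<le> ennreal (C * \<tau> powr (- d)) * err f P s (21 * (L + 1) * \<tau>)"
      and sub: "cube x (\<tau> / 2) \<subseteq> cube (a Q) (52 * (snd Q / 2))" if Q: "Q \<in> A" for Q
    proof -
      have QW: "Q \<in> W" and r: "\<tau> / 11 \<le> snd Q" "snd Q \<le> (L + 1) * \<tau>" and Qx: "infnorm (fst Q - x) \<le> 10 * snd Q"
        using Q by (auto simp: A_def)
      have alt': "snd Q \<le> 8000 \<or> P = (\<lambda>x. 0)" using alt r by auto
      have ax: "infnorm (a Q - x) \<le> 19 * snd Q"
        using infnorm_triangle_sub[of "a Q" x "fst Q"] a_near[OF QW] Qx infnorm_sub[of "a Q" "fst Q"] by simp
      \<comment> \<open>\<open>19 * snd Q\<close> for the distance of the centres plus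
        \<open>\<tau> / 2\<close>, which is at most \<open>11 / 2 * snd Q\<close>; in total below
        \<open>26 * snd Q\<close>, that is, 52 times the radius \<open>snd Q / 2\<close>.\<close>
      show "cube x (\<tau> / 2) \<subseteq> cube (a Q) (52 * (snd Q / 2))"
        by (rule cube_mono) (use ax r \<tau> infnorm_sub[of x "a Q"] in simp)
      have L\<tau>0: "0 \<le> L * \<tau>" using L \<tau> by simp
      have "infnorm (a Q - s) \<le> 19 * snd Q + L * \<tau>"
        using infnorm_triangle_sub[of "a Q" s x] ax xs by simp
      \<comment> \<open>The origin of 21: \<open>19 + 1 / 2\<close> radii of size at most
        \<open>(L + 1) * \<tau>\<close>, and one more such length for
        \<open>L * \<tau>\<close>.\<close>
      also have "\<dots> + snd Q / 2 \<le> 21 * (L + 1) * \<tau>" using r(2) \<tau> L\<tau>0 by (simp add: algebra_simps)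
      finally have "cube (a Q) (snd Q / 2) \<subseteq> cube s (21 * (L + 1) * \<tau>)" by (intro cube_mono) simp
      then have e: "err f P (a Q) (snd Q / 2) \<le> err f P s (21 * (L + 1) * \<tau>)" by (rule err_mono)
      obtain c where c: "\<forall>y. wproj N a m Q f y - P y = (\<Sum>\<beta>\<in>midx m. c \<beta> * smono (a Q) (snd Q / 2) \<beta> y)"
        and cn: "ennreal (cnorm m c) \<le> ennreal (C1 * snd Q powr (- d)) * err f P (a Q) (snd Q / 2)"
        using C1(2)[of a Q f P, OF a_in[OF QW] snd_pos[OF QW] f P alt'] by blast
      have "snd Q powr (- d) \<le> (\<tau> / 11) powr (- d)"
        using r(1) \<tau> d_pos by (intro powr_mono2') auto
      also have "\<dots> = 11 powr d * \<tau> powr (- d)" using \<tau> by (simp add: powr_divide powr_minus field_simps)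
      finally have "C1 * snd Q powr (- d) \<le> C * \<tau> powr (- d)" using C1(1) by (simp add: C_def)
      then have "ennreal (C1 * snd Q powr (- d)) * err f P (a Q) (snd Q / 2)
          \<le> ennreal (C * \<tau> powr (- d)) * err f P s (21 * (L + 1) * \<tau>)"
        by (intro mult_mono[OF ennreal_leI e]) auto
      then show "\<exists>c. (\<forall>y. wproj N a m Q f y - P y = (\<Sum>\<beta>\<in>midx m. c \<beta> * smono (a Q) (snd Q / 2) \<beta> y)) \<and>
        ennreal (cnorm m c) \<le> ennreal (C * \<tau> powr (- d)) * err f P s (21 * (L + 1) * \<tau>)"
        using c cn order_trans by blast
    qed
    have exA: "\<forall>Q\<in>A. \<exists>c. (\<forall>y. wproj N a m Q f y - P y = (\<Sum>\<beta>\<in>midx m. c \<beta> * smono (a Q) (snd Q / 2) \<beta> y)) \<and>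
        ennreal (cnorm m c) \<le> ennreal (C * \<tau> powr (- d)) * err f P s (21 * (L + 1) * \<tau>)"
      using ex by blast
    obtain c where c: "\<And>Q. Q \<in> A \<Longrightarrow> (\<forall>y. wproj N a m Q f y - P y = (\<Sum>\<beta>\<in>midx m. c Q \<beta> * smono (a Q) (snd Q / 2) \<beta> y)) \<and>
        ennreal (cnorm m (c Q)) \<le> ennreal (C * \<tau> powr (- d)) * err f P s (21 * (L + 1) * \<tau>)"
      using bchoice[OF exA] by blast
    have r: "\<tau> / 11 \<le> snd Q" if "Q \<in> A" for Q using that by (simp add: A_def)
    have "A \<subseteq> W" by (auto simp: A_def)
    show "\<exists>A c. finite A \<and> A \<subseteq> W \<and> real (card A) \<le> 22 * 11 ^ CARD('n) * (L + 1) \<and>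
      (\<forall>y Q. y \<in> cube x (\<tau> / 2) \<longrightarrow> Q \<in> W \<longrightarrow> \<phi> Q y \<noteq> 0 \<longrightarrow> Q \<in> A) \<and>
      (\<forall>Q\<in>A. \<tau> / 11 \<le> snd Q \<and> cube x (\<tau> / 2) \<subseteq> cube (a Q) (52 * (snd Q / 2)) \<and>
        (\<forall>y. wproj N a m Q f y - P y = (\<Sum>\<beta>\<in>midx m. c Q \<beta> * smono (a Q) (snd Q / 2) \<beta> y)) \<and>
        ennreal (cnorm m (c Q)) \<le> ennreal (C * \<tau> powr (- d)) * err f P s (21 * (L + 1) * \<tau>))"
      by (rule exI[of _ A], rule exI[of _ c]) (use A(1) \<open>A \<subseteq> W\<close> cA act sub c r in blast)
  qed
qed

lemma sum_ennreal_const_le: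
  assumes "finite A" "real (card A) \<le> K" "\<And>Q. Q \<in> A \<Longrightarrow> f Q \<le> (B :: ennreal)"
  shows "(\<Sum>Q\<in>A. f Q) \<le> ennreal K * B"
proof -
  have "(\<Sum>Q\<in>A. f Q) \<le> (\<Sum>Q\<in>A. B)" using assms(3) by (rule sum_mono)
  also have "\<dots> = ennreal (real (card A)) * B" by (simp add: ennreal_of_nat_eq_real_of_nat)
  also have "\<dots> \<le> ennreal K * B" using assms(2) by (intro mult_right_mono ennreal_leI) auto
  finally show ?thesis .
qed

lemma local_approx_le_sup:
  fixes x :: "real ^ 'n"
  assumes t: "0 < t" and T: "T \<in> poly_space (int m)"
    and le: "\<And>y. y \<in> cube x t \<Longrightarrow> ennreal \<bar>F y - T y\<bar> \<le> M"
  shows "local_approx (Suc m) lebesgue F (cube x t) \<le> (M :: ennreal)"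
proof -
  let ?e = "emeasure lebesgue (cube x t)"
  have e: "?e = ennreal ((2 * t) ^ CARD('n))" using t by (intro emeasure_cube) simp
  have e0: "?e \<noteq> 0" "?e < top" unfolding e using t by auto
  have "(\<integral>\<^sup>+y\<in>cube x t. ennreal \<bar>F y - T y\<bar> \<partial>lebesgue) \<le> (\<integral>\<^sup>+y. M * indicator (cube x t) y \<partial>lebesgue)"
    using le by (intro nn_integral_mono) (auto simp: indicator_def)
  also have "\<dots> = M * ?e" by (rule nn_integral_cmult_indicator) simp
  finally have "(\<integral>\<^sup>+y\<in>cube x t. ennreal \<bar>F y - T y\<bar> \<partial>lebesgue) / ?e \<le> M * ?e / ?e" by (rule divide_right_mono_ennreal)
  also have "\<dots> = M * (?e / ?e)" by (rule ennreal_times_divide[symmetric])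
  also have "?e / ?e = 1" using e0 by (rule ennreal_divide_self)
  finally have "(\<integral>\<^sup>+y\<in>cube x t. ennreal \<bar>F y - T y\<bar> \<partial>lebesgue) / ?e \<le> M" by simp
  then show ?thesis unfolding local_approx_def by (intro INF_lower2[of T]) (use T in auto)
qed

text \<open>The products of \<phi> with the differences \<open>wproj - P\<close> vary on the scale
  \<tau>, so on \<open>cube x t\<close> each is within a multiple of
  \<open>(t / \<tau>) ^ Suc m\<close> of its Taylor polynomial. P plus these Taylor polynomials
  competes in the infimum; degree m is exactly what \<open>local_approx (Suc m)\<close>
  admits.\<close>

lemma far_estimate:
  fixes L C\<^sub>\<phi> :: real
  assumes R: "8000 \<le> R" and L: "1 \<le> L" and C\<^sub>\<phi>: "0 < C\<^sub>\<phi>"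
  shows "\<exists>C>0. \<forall>W \<phi> a f F P x s t \<tau>. whitney S W \<phi> a (Suc m) C\<^sub>\<phi> \<longrightarrow> loc_int f \<longrightarrow>
    (\<forall>y. y \<notin> S \<longrightarrow> F y = (\<Sum>\<^sub>\<infinity>Q\<in>W. \<phi> Q y * wproj N a m Q f y)) \<longrightarrow>
    P \<in> poly_space (int m) \<longrightarrow> s \<in> S \<longrightarrow> infnorm (x - s) \<le> L * \<tau> \<longrightarrow> 0 < \<tau> \<longrightarrow>
    (\<forall>s'\<in>S. 2 * \<tau> \<le> infnorm (x - s')) \<longrightarrow> 0 < t \<longrightarrow> t \<le> \<tau> / 2 \<longrightarrow>
    (L + 1) * \<tau> \<le> 8000 \<or> P = (\<lambda>x. 0) \<longrightarrow>
    local_approx (Suc m) lebesgue F (cube x t)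
      \<le> ennreal (C * (t / \<tau>) ^ Suc m * \<tau> powr (- d)) * err f P s (21 * (L + 1) * \<tau>)"
proof -
  let ?n = "CARD('n)" and ?k = "Suc m"
  obtain C1 where C1: "0 < C1" and far_cubes: "\<And>W \<phi> a k C\<^sub>\<phi> f P x s \<tau>. whitney S W \<phi> a k C\<^sub>\<phi> \<Longrightarrow> loc_int f \<Longrightarrow>
    P \<in> poly_space (int m) \<Longrightarrow> s \<in> S \<Longrightarrow> infnorm (x - s) \<le> L * \<tau> \<Longrightarrow> 0 < \<tau> \<Longrightarrow>
    (\<And>s'. s' \<in> S \<Longrightarrow> 2 * \<tau> \<le> infnorm (x - s')) \<Longrightarrow> (L + 1) * \<tau> \<le> 8000 \<or> P = (\<lambda>x. 0) \<Longrightarrow>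
    \<exists>A c. finite A \<and> A \<subseteq> W \<and> real (card A) \<le> 22 * 11 ^ CARD('n) * (L + 1) \<and>
      (\<forall>y Q. y \<in> cube x (\<tau> / 2) \<longrightarrow> Q \<in> W \<longrightarrow> \<phi> Q y \<noteq> 0 \<longrightarrow> Q \<in> A) \<and>
      (\<forall>Q\<in>A. \<tau> / 11 \<le> snd Q \<and> cube x (\<tau> / 2) \<subseteq> cube (a Q) (52 * (snd Q / 2)) \<and>
        (\<forall>y. wproj N a m Q f y - P y = (\<Sum>\<beta>\<in>midx m. c Q \<beta> * smono (a Q) (snd Q / 2) \<beta> y)) \<and>
        ennreal (cnorm m (c Q)) \<le> ennreal (C1 * \<tau> powr (- d)) * err f P s (21 * (L + 1) * \<tau>))"
    using far_cubes[OF R L, of m] by blast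
  obtain K0 where K0: "0 \<le> K0" "\<And>w r y \<beta>. 0 < r \<Longrightarrow> y \<in> cube w (52 * r) \<Longrightarrow> \<beta> \<in> midx m \<Longrightarrow> dbound ?k r y K0 (smono w r \<beta> :: real ^ 'n \<Rightarrow> real)"
    using dbound_smono[of 52 m ?k] by (metis one_le_numeral)
  define K where "K = K0 + 1"
  have K: "0 < K" using K0 by (simp add: K_def)
  have Kb: "dbound ?k r y K (smono w r \<beta> :: real ^ 'n \<Rightarrow> real)" if "0 < r" "y \<in> cube w (52 * r)" "\<beta> \<in> midx m" for w r y \<beta>
    using K0(2)[OF that] by (rule dbound_mono) (use that in \<open>auto simp: K_def\<close>)
  \<comment> \<open>One factor \<open>2 ^ Suc m\<close> for coefficient times monomial, one for
    cutoff times polynomial; 22 because the derivative scale \<open>snd Q / 2\<close> is at least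
    \<open>\<tau> / 22\<close>.\<close>
  define D where "D = 2 ^ ?k * C\<^sub>\<phi> * (2 ^ ?k * K) * (22 * real ?n) ^ ?k"
  have D: "0 < D" using C\<^sub>\<phi> K by (simp add: D_def)
  define C where "C = (22 * 11 ^ ?n * (L + 1)) * D * C1"
  have C: "0 < C" using C1 D L by (simp add: C_def)
  have "local_approx ?k lebesgue F (cube x t)
      \<le> ennreal (C * (t / \<tau>) ^ ?k * \<tau> powr (- d)) * err f P s (21 * (L + 1) * \<tau>)"
    if wh: "whitney S W \<phi> a ?k C\<^sub>\<phi>" and f: "loc_int f"
      and F: "\<forall>y. y \<notin> S \<longrightarrow> F y = (\<Sum>\<^sub>\<infinity>Q\<in>W. \<phi> Q y * wproj N a m Q f y)"
      and P: "P \<in> poly_space (int m)" and s: "s \<in> S" and xs: "infnorm (x - s) \<le> L * \<tau>" and \<tau>: "0 < \<tau>"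
      and far: "\<forall>s'\<in>S. 2 * \<tau> \<le> infnorm (x - s')" and t: "0 < t" "t \<le> \<tau> / 2"
      and alt: "(L + 1) * \<tau> \<le> 8000 \<or> P = (\<lambda>x. 0)" for W \<phi> a f F P x s t \<tau>
  proof -
    interpret whitney S W \<phi> a ?k C\<^sub>\<phi> by (rule wh)
    define E where "E = err f P s (21 * (L + 1) * \<tau>)"
    have "\<exists>A c. finite A \<and> A \<subseteq> W \<and> real (card A) \<le> 22 * 11 ^ CARD('n) * (L + 1) \<and>
      (\<forall>y Q. y \<in> cube x (\<tau> / 2) \<longrightarrow> Q \<in> W \<longrightarrow> \<phi> Q y \<noteq> 0 \<longrightarrow> Q \<in> A) \<and>
      (\<forall>Q\<in>A. \<tau> / 11 \<le> snd Q \<and> cube x (\<tau> / 2) \<subseteq> cube (a Q) (52 * (snd Q / 2)) \<and>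
        (\<forall>y. wproj N a m Q f y - P y = (\<Sum>\<beta>\<in>midx m. c Q \<beta> * smono (a Q) (snd Q / 2) \<beta> y)) \<and>
        ennreal (cnorm m (c Q)) \<le> ennreal (C1 * \<tau> powr (- d)) * E)"
      unfolding E_def by (rule far_cubes[OF wh f P s xs \<tau> _ alt]) (use far in blast)
    then obtain A c where all: "finite A \<and> A \<subseteq> W \<and> real (card A) \<le> 22 * 11 ^ CARD('n) * (L + 1) \<and>
      (\<forall>y Q. y \<in> cube x (\<tau> / 2) \<longrightarrow> Q \<in> W \<longrightarrow> \<phi> Q y \<noteq> 0 \<longrightarrow> Q \<in> A) \<and>
      (\<forall>Q\<in>A. \<tau> / 11 \<le> snd Q \<and> cube x (\<tau> / 2) \<subseteq> cube (a Q) (52 * (snd Q / 2)) \<and>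
        (\<forall>y. wproj N a m Q f y - P y = (\<Sum>\<beta>\<in>midx m. c Q \<beta> * smono (a Q) (snd Q / 2) \<beta> y)) \<and>
        ennreal (cnorm m (c Q)) \<le> ennreal (C1 * \<tau> powr (- d)) * E)"
      by (elim exE) (erule that)
    note A = all[THEN conjunct1] all[THEN conjunct2, THEN conjunct1] all[THEN conjunct2, THEN conjunct2, THEN conjunct1]
    note act = all[THEN conjunct2, THEN conjunct2, THEN conjunct2, THEN conjunct1, rule_format]
    note each = bspec[OF all[THEN conjunct2, THEN conjunct2, THEN conjunct2, THEN conjunct2]]
    note r = each[THEN conjunct1] and sub = each[THEN conjunct2, THEN conjunct1]
      and c = each[THEN conjunct2, THEN conjunct2, THEN conjunct1, rule_format]
      and cn = each[THEN conjunct2, THEN conjunct2, THEN conjunct2]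
    have xt: "cube x t \<subseteq> cube x (\<tau> / 2)" using t by (intro cube_mono) (simp add: infnorm_0)
    define g where "g Q y = \<phi> Q y * (wproj N a m Q f y - P y)" for Q y
    have "\<exists>T\<in>poly_space (int m). \<forall>y\<in>cube x t. \<bar>g Q y - T y\<bar> \<le> D * (t / \<tau>) ^ ?k * cnorm m (c Q)" if Q: "Q \<in> A" for Q
    proof -
      have r0: "0 < snd Q / 2" using r[OF Q] \<tau> by simp
      have db: "dbound ?k (snd Q / 2) y (2 ^ ?k * C\<^sub>\<phi> * (2 ^ ?k * K * cnorm m (c Q))) (g Q)" if y: "y \<in> cube x t" for y
      proof -
        have yc: "y \<in> cube (a Q) (52 * (snd Q / 2))" using sub[OF Q] xt y by blast
        have "dbound ?k (snd Q / 2) y (\<Sum>\<beta>\<in>midx m. 2 ^ ?k * \<bar>c Q \<beta>\<bar> * K) (\<lambda>y. \<Sum>\<beta>\<in>midx m. c Q \<beta> * smono (a Q) (snd Q / 2) \<beta> y)"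
          by (intro dbound_sum finite_midx dbound_mult dbound_const Kb yc r0 order_refl)
        also have "(\<Sum>\<beta>\<in>midx m. 2 ^ ?k * \<bar>c Q \<beta>\<bar> * K) = 2 ^ ?k * K * cnorm m (c Q)"
          by (simp add: cnorm_def sum_distrib_left mult_ac)
        also have "(\<lambda>y. \<Sum>\<beta>\<in>midx m. c Q \<beta> * smono (a Q) (snd Q / 2) \<beta> y) = (\<lambda>y. wproj N a m Q f y - P y)"
          using c[OF Q] by simp
        finally show ?thesis unfolding g_def[abs_def] using Q A by (intro dbound_mult \<phi>_dbound) auto
      qed
      obtain T where T: "T \<in> poly_space (int (?k - 1))"
        "\<And>y. y \<in> cube x t \<Longrightarrow> \<bar>g Q y - T y\<bar> \<le> 2 ^ ?k * C\<^sub>\<phi> * (2 ^ ?k * K * cnorm m (c Q)) * (real ?n * t / (snd Q / 2)) ^ ?k"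
        by (rule taylor_poly[OF zero_less_Suc r0 less_imp_le[OF t(1)] db]) (assumption, blast)
      have "real ?n * t / (snd Q / 2) \<le> real ?n * t / (\<tau> / 22)"
        using r[OF Q] \<tau> t by (intro divide_left_mono) auto
      also have "\<dots> = 22 * real ?n * (t / \<tau>)" by simp
      finally have "(real ?n * t / (snd Q / 2)) ^ ?k \<le> (22 * real ?n * (t / \<tau>)) ^ ?k"
        using t r0 by (intro power_mono) auto
      then have "2 ^ ?k * C\<^sub>\<phi> * (2 ^ ?k * K * cnorm m (c Q)) * (real ?n * t / (snd Q / 2)) ^ ?k
          \<le> 2 ^ ?k * C\<^sub>\<phi> * (2 ^ ?k * K * cnorm m (c Q)) * (22 * real ?n * (t / \<tau>)) ^ ?k"
        using C\<^sub>\<phi> K cnorm_nonneg[of m "c Q"] by (intro mult_left_mono) auto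
      also have "\<dots> = D * (t / \<tau>) ^ ?k * cnorm m (c Q)"
        by (simp only: D_def power_mult_distrib mult_ac)
      finally have "\<bar>g Q y - T y\<bar> \<le> D * (t / \<tau>) ^ ?k * cnorm m (c Q)" if "y \<in> cube x t" for y
        using T(2)[OF that] by linarith
      then show ?thesis using T(1) by (intro bexI[of _ T]) auto
    qed
    then obtain T where T: "\<And>Q. Q \<in> A \<Longrightarrow> T Q \<in> poly_space (int m)"
      "\<And>Q y. Q \<in> A \<Longrightarrow> y \<in> cube x t \<Longrightarrow> \<bar>g Q y - T Q y\<bar> \<le> D * (t / \<tau>) ^ ?k * cnorm m (c Q)"
      by metis
    show ?thesis
    proof (rule local_approx_le_sup[OF t(1)])
      show "(\<lambda>y. P y + (\<Sum>Q\<in>A. T Q y)) \<in> poly_space (int m)"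
        by (intro poly_space_add P poly_space_sum T(1))
      fix y assume y: "y \<in> cube x t"
      have "y \<notin> S"
      proof
        assume "y \<in> S"
        then have "2 * \<tau> \<le> infnorm (x - y)" using far by blast
        then show False using y t infnorm_sub[of x y] by (simp add: cube_def)
      qed
      moreover have "Q \<in> A" if "Q \<in> W" "\<phi> Q y \<noteq> 0" for Q using act[OF _ that] xt y by blast
      ultimately have "F y - P y = (\<Sum>Q\<in>A. g Q y)"
        using F partition_diff[of y A "\<lambda>Q. wproj N a m Q f y" "P y"] A by (simp add: g_def)
      then have "F y - (P y + (\<Sum>Q\<in>A. T Q y)) = (\<Sum>Q\<in>A. g Q y - T Q y)" by (simp add: sum_subtractf)
      then have "\<bar>F y - (P y + (\<Sum>Q\<in>A. T Q y))\<bar> \<le> (\<Sum>Q\<in>A. \<bar>g Q y - T Q y\<bar>)" by simp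
      then have "ennreal \<bar>F y - (P y + (\<Sum>Q\<in>A. T Q y))\<bar> \<le> ennreal (\<Sum>Q\<in>A. \<bar>g Q y - T Q y\<bar>)" by (rule ennreal_leI)
      also have "\<dots> = (\<Sum>Q\<in>A. ennreal \<bar>g Q y - T Q y\<bar>)" by (rule sum_ennreal[symmetric]) simp
      also have "\<dots> \<le> ennreal (22 * 11 ^ ?n * (L + 1)) * (ennreal (D * (t / \<tau>) ^ ?k) * (ennreal (C1 * \<tau> powr (- d)) * E))"
      proof (rule sum_ennreal_const_le[OF A(1,3)])
        fix Q assume Q: "Q \<in> A"
        have "ennreal \<bar>g Q y - T Q y\<bar> \<le> ennreal (D * (t / \<tau>) ^ ?k * cnorm m (c Q))" by (rule ennreal_leI[OF T(2)[OF Q y]])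
        also have "\<dots> = ennreal (D * (t / \<tau>) ^ ?k) * ennreal (cnorm m (c Q))"
          by (rule ennreal_mult) (use D t \<tau> cnorm_nonneg in auto)
        also have "\<dots> \<le> ennreal (D * (t / \<tau>) ^ ?k) * (ennreal (C1 * \<tau> powr (- d)) * E)" by (intro mult_left_mono cn Q) simp
        finally show "ennreal \<bar>g Q y - T Q y\<bar> \<le> ennreal (D * (t / \<tau>) ^ ?k) * (ennreal (C1 * \<tau> powr (- d)) * E)" .
      qed
      also have "\<dots> = ennreal ((22 * 11 ^ ?n * (L + 1)) * (D * (t / \<tau>) ^ ?k) * (C1 * \<tau> powr (- d))) * E"
      proof -
        have p: "0 \<le> 22 * 11 ^ ?n * (L + 1)" "0 \<le> D * (t / \<tau>) ^ ?k" "0 \<le> C1 * \<tau> powr (- d)"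
          using L D t \<tau> C1 by auto
        have "ennreal ((22 * 11 ^ ?n * (L + 1)) * (D * (t / \<tau>) ^ ?k) * (C1 * \<tau> powr (- d)))
            = ennreal (22 * 11 ^ ?n * (L + 1)) * ennreal (D * (t / \<tau>) ^ ?k) * ennreal (C1 * \<tau> powr (- d))"
          using p by (simp only: ennreal_mult mult_nonneg_nonneg)
        then show ?thesis by (simp only: mult.assoc)
      qed
      also have "(22 * 11 ^ ?n * (L + 1)) * (D * (t / \<tau>) ^ ?k) * (C1 * \<tau> powr (- d)) = C * (t / \<tau>) ^ ?k * \<tau> powr (- d)"
        by (simp only: C_def mult_ac)
      finally show "ennreal \<bar>F y - (P y + (\<Sum>Q\<in>A. T Q y))\<bar> \<le> ennreal (C * (t / \<tau>) ^ ?k * \<tau> powr (- d)) * err f P s (21 * (L + 1) * \<tau>)"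
        unfolding E_def .
    qed
  qed
  then show ?thesis using C by (intro exI[of _ C]) blast
qed

text \<open>The case P = 0 without Taylor expansion, which controls the size of the extension
  itself. As P = 0 may be compared with truncated projections too, it covers all scales
  \<tau>.\<close>

lemma far_sup:
  fixes L :: real
  assumes R: "8000 \<le> R" and L: "1 \<le> L"
  shows "\<exists>C>0. \<forall>W \<phi> a k C\<^sub>\<phi> f F x s \<tau>. whitney S W \<phi> a k C\<^sub>\<phi> \<longrightarrow> loc_int f \<longrightarrow>
    (\<forall>y. y \<notin> S \<longrightarrow> F y = (\<Sum>\<^sub>\<infinity>Q\<in>W. \<phi> Q y * wproj N a m Q f y)) \<longrightarrow>
    s \<in> S \<longrightarrow> infnorm (x - s) \<le> L * \<tau> \<longrightarrow> 0 < \<tau> \<longrightarrow> (\<forall>s'\<in>S. 2 * \<tau> \<le> infnorm (x - s')) \<longrightarrow>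
    ennreal \<bar>F x\<bar> \<le> ennreal (C * \<tau> powr (- d)) * err f (\<lambda>x. 0) s (21 * (L + 1) * \<tau>)"
proof -
  obtain C1 where C1: "0 < C1" and far_cubes: "\<And>W \<phi> a k C\<^sub>\<phi> f P x s \<tau>. whitney S W \<phi> a k C\<^sub>\<phi> \<Longrightarrow> loc_int f \<Longrightarrow>
    P \<in> poly_space (int m) \<Longrightarrow> s \<in> S \<Longrightarrow> infnorm (x - s) \<le> L * \<tau> \<Longrightarrow> 0 < \<tau> \<Longrightarrow>
    (\<And>s'. s' \<in> S \<Longrightarrow> 2 * \<tau> \<le> infnorm (x - s')) \<Longrightarrow> (L + 1) * \<tau> \<le> 8000 \<or> P = (\<lambda>x. 0) \<Longrightarrow>
    \<exists>A c. finite A \<and> A \<subseteq> W \<and> real (card A) \<le> 22 * 11 ^ CARD('n) * (L + 1) \<and>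
      (\<forall>y Q. y \<in> cube x (\<tau> / 2) \<longrightarrow> Q \<in> W \<longrightarrow> \<phi> Q y \<noteq> 0 \<longrightarrow> Q \<in> A) \<and>
      (\<forall>Q\<in>A. \<tau> / 11 \<le> snd Q \<and> cube x (\<tau> / 2) \<subseteq> cube (a Q) (52 * (snd Q / 2)) \<and>
        (\<forall>y. wproj N a m Q f y - P y = (\<Sum>\<beta>\<in>midx m. c Q \<beta> * smono (a Q) (snd Q / 2) \<beta> y)) \<and>
        ennreal (cnorm m (c Q)) \<le> ennreal (C1 * \<tau> powr (- d)) * err f P s (21 * (L + 1) * \<tau>))"
    using far_cubes[OF R L, of m] by blast
  define C where "C = (22 * 11 ^ CARD('n) * (L + 1)) * 52 ^ m * C1"
  have C: "0 < C" using C1 L by (simp add: C_def)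
  have "ennreal \<bar>F x\<bar> \<le> ennreal (C * \<tau> powr (- d)) * err f (\<lambda>x. 0) s (21 * (L + 1) * \<tau>)"
    if wh: "whitney S W \<phi> a k C\<^sub>\<phi>" and f: "loc_int f"
      and F: "\<forall>y. y \<notin> S \<longrightarrow> F y = (\<Sum>\<^sub>\<infinity>Q\<in>W. \<phi> Q y * wproj N a m Q f y)"
      and s: "s \<in> S" and xs: "infnorm (x - s) \<le> L * \<tau>" and \<tau>: "0 < \<tau>"
      and far: "\<forall>s'\<in>S. 2 * \<tau> \<le> infnorm (x - s')" for W \<phi> a k C\<^sub>\<phi> f F x s \<tau>
  proof -
    interpret whitney S W \<phi> a k C\<^sub>\<phi> by (rule wh)
    define E where "E = err f (\<lambda>x. 0) s (21 * (L + 1) * \<tau>)"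
    have "\<exists>A c. finite A \<and> A \<subseteq> W \<and> real (card A) \<le> 22 * 11 ^ CARD('n) * (L + 1) \<and>
      (\<forall>y Q. y \<in> cube x (\<tau> / 2) \<longrightarrow> Q \<in> W \<longrightarrow> \<phi> Q y \<noteq> 0 \<longrightarrow> Q \<in> A) \<and>
      (\<forall>Q\<in>A. \<tau> / 11 \<le> snd Q \<and> cube x (\<tau> / 2) \<subseteq> cube (a Q) (52 * (snd Q / 2)) \<and>
        (\<forall>y. wproj N a m Q f y - (\<lambda>x. 0) y = (\<Sum>\<beta>\<in>midx m. c Q \<beta> * smono (a Q) (snd Q / 2) \<beta> y)) \<and>
        ennreal (cnorm m (c Q)) \<le> ennreal (C1 * \<tau> powr (- d)) * E)"
      unfolding E_def by (rule far_cubes[OF wh f poly_space_zero s xs \<tau>]) (use far in blast)+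
    then obtain A c where all: "finite A \<and> A \<subseteq> W \<and> real (card A) \<le> 22 * 11 ^ CARD('n) * (L + 1) \<and>
      (\<forall>y Q. y \<in> cube x (\<tau> / 2) \<longrightarrow> Q \<in> W \<longrightarrow> \<phi> Q y \<noteq> 0 \<longrightarrow> Q \<in> A) \<and>
      (\<forall>Q\<in>A. \<tau> / 11 \<le> snd Q \<and> cube x (\<tau> / 2) \<subseteq> cube (a Q) (52 * (snd Q / 2)) \<and>
        (\<forall>y. wproj N a m Q f y - (\<lambda>x. 0) y = (\<Sum>\<beta>\<in>midx m. c Q \<beta> * smono (a Q) (snd Q / 2) \<beta> y)) \<and>
        ennreal (cnorm m (c Q)) \<le> ennreal (C1 * \<tau> powr (- d)) * E)"
      by (elim exE) (erule that)
    note A = all[THEN conjunct1] all[THEN conjunct2, THEN conjunct1] all[THEN conjunct2, THEN conjunct2, THEN conjunct1]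
    note act = all[THEN conjunct2, THEN conjunct2, THEN conjunct2, THEN conjunct1, rule_format]
    note each = bspec[OF all[THEN conjunct2, THEN conjunct2, THEN conjunct2, THEN conjunct2]]
    note r = each[THEN conjunct1] and sub = each[THEN conjunct2, THEN conjunct1]
      and c = each[THEN conjunct2, THEN conjunct2, THEN conjunct1, rule_format]
      and cn = each[THEN conjunct2, THEN conjunct2, THEN conjunct2]
    have x: "x \<in> cube x (\<tau> / 2)" using \<tau> by (simp add: cube_def infnorm_0)
    have "x \<notin> S" using far \<tau> by (force simp: infnorm_0)
    then have "F x - 0 = (\<Sum>Q\<in>A. \<phi> Q x * (wproj N a m Q f x - 0))"
      using F partition_diff[of x A "\<lambda>Q. wproj N a m Q f x" 0] A act[OF x] by simp
    then have "\<bar>F x\<bar> \<le> (\<Sum>Q\<in>A. \<bar>\<phi> Q x * wproj N a m Q f x\<bar>)" by (simp add: sum_abs)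
    also have "\<dots> \<le> (\<Sum>Q\<in>A. 52 ^ m * cnorm m (c Q))"
    proof (rule sum_mono)
      fix Q assume Q: "Q \<in> A"
      have r0: "0 < snd Q / 2" using r[OF Q] \<tau> by simp
      have xc: "x \<in> cube (a Q) (52 * (snd Q / 2))" using sub[OF Q] x by blast
      have "\<bar>wproj N a m Q f x\<bar> \<le> (\<Sum>\<beta>\<in>midx m. \<bar>c Q \<beta> * smono (a Q) (snd Q / 2) \<beta> x\<bar>)"
        using c[OF Q, of x] by (simp add: sum_abs)
      also have "\<dots> \<le> (\<Sum>\<beta>\<in>midx m. \<bar>c Q \<beta>\<bar> * 52 ^ m)"
        unfolding abs_mult by (intro sum_mono mult_left_mono abs_smono_le xc r0) auto
      also have "\<dots> = 52 ^ m * cnorm m (c Q)" by (simp only: cnorm_def sum_distrib_left mult.commute[of _ "52 ^ m"])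
      finally have "\<bar>wproj N a m Q f x\<bar> \<le> 52 ^ m * cnorm m (c Q)" .
      moreover have "\<bar>\<phi> Q x\<bar> \<le> 1" using \<phi>_range[of Q x] Q A by auto
      ultimately have "\<bar>\<phi> Q x\<bar> * \<bar>wproj N a m Q f x\<bar> \<le> 1 * (52 ^ m * cnorm m (c Q))" by (intro mult_mono) auto
      then show "\<bar>\<phi> Q x * wproj N a m Q f x\<bar> \<le> 52 ^ m * cnorm m (c Q)" by (simp add: abs_mult)
    qed
    finally have "ennreal \<bar>F x\<bar> \<le> ennreal (\<Sum>Q\<in>A. 52 ^ m * cnorm m (c Q))" by (rule ennreal_leI)
    also have "\<dots> = (\<Sum>Q\<in>A. ennreal (52 ^ m * cnorm m (c Q)))" by (rule sum_ennreal[symmetric]) (simp add: cnorm_nonneg)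
    also have "\<dots> \<le> ennreal (22 * 11 ^ CARD('n) * (L + 1)) * (ennreal (52 ^ m) * (ennreal (C1 * \<tau> powr (- d)) * E))"
    proof (rule sum_ennreal_const_le[OF A(1,3)])
      fix Q assume Q: "Q \<in> A"
      have "ennreal (52 ^ m * cnorm m (c Q)) = ennreal (52 ^ m) * ennreal (cnorm m (c Q))"
        by (rule ennreal_mult) (use cnorm_nonneg in auto)
      also have "\<dots> \<le> ennreal (52 ^ m) * (ennreal (C1 * \<tau> powr (- d)) * E)" by (intro mult_left_mono cn Q) simp
      finally show "ennreal (52 ^ m * cnorm m (c Q)) \<le> ennreal (52 ^ m) * (ennreal (C1 * \<tau> powr (- d)) * E)" .
    qed
    also have "\<dots> = ennreal ((22 * 11 ^ CARD('n) * (L + 1)) * 52 ^ m * (C1 * \<tau> powr (- d))) * E"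
    proof -
      have p: "0 \<le> 22 * 11 ^ CARD('n) * (L + 1)" "0 \<le> (52 :: real) ^ m" "0 \<le> C1 * \<tau> powr (- d)"
        using L C1 by auto
      have "ennreal ((22 * 11 ^ CARD('n) * (L + 1)) * 52 ^ m * (C1 * \<tau> powr (- d)))
          = ennreal (22 * 11 ^ CARD('n) * (L + 1)) * ennreal (52 ^ m) * ennreal (C1 * \<tau> powr (- d))"
        using p by (simp only: ennreal_mult mult_nonneg_nonneg)
      then show ?thesis by (simp only: mult.assoc)
    qed
    finally show ?thesis by (simp only: C_def E_def mult.assoc)
  qed
  then show ?thesis using C by (intro exI[of _ C]) blast
qed

text \<open>The active cubes have radius at least 99999/11, which is above 8000, so their
  projections are replaced by 0. The distance 1 between x and y leaves room for the cubes in the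
  local approximations.\<close>

lemma far_zero:
  assumes wh: "whitney S W \<phi> a k C\<^sub>\<phi>"
    and F: "\<forall>y. y \<notin> S \<longrightarrow> F y = (\<Sum>\<^sub>\<infinity>Q\<in>W. \<phi> Q y * wproj N a m Q f y)"
    and far: "\<And>s. s \<in> S \<Longrightarrow> 100000 \<le> infnorm (x - s)" and y: "infnorm (y - x) \<le> 1"
  shows "F y = 0"
proof -
  interpret whitney S W \<phi> a k C\<^sub>\<phi> by (rule wh)
  have ys: "99999 \<le> infnorm (y - s)" if "s \<in> S" for s
    using far[OF that] infnorm_triangle_sub[of x s y] y infnorm_sub[of x y] by simp
  then have "y \<notin> S" by (force simp: infnorm_0)
  moreover have "\<phi> Q y * wproj N a m Q f y = 0" if Q: "Q \<in> W" for Q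
  proof (cases "\<phi> Q y = 0")
    case False
    then have "y \<in> cube (fst Q) (9 / 8 * snd Q)" by (rule \<phi>_supp[OF Q])
    then have "99999 \<le> 11 * snd Q" using ys[OF a_in[OF Q]] dist_a_upper[OF Q] by (meson order_trans)
    then show ?thesis by (simp add: wproj_def)
  qed simp
  ultimately show ?thesis using F by (simp add: infsum_0)
qed

end

section \<open>Powers and sums over grids\<close>

lemma ennreal_powr_ennreal: "0 \<le> x \<Longrightarrow> ennreal_powr (ennreal x) p = ennreal (x powr p)"
  by (simp add: ennreal_powr_def)

lemma ennreal_powr_top: "ennreal_powr top p = top"
  by (simp add: ennreal_powr_def)

lemma ennreal_powr_mono:
  assumes "x \<le> y" "0 < p" shows "ennreal_powr x p \<le> ennreal_powr y p"
proof (cases y)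
  case (real b)
  then obtain a where "0 \<le> a" "x = ennreal a" using assms(1) by (cases x) (auto simp: top_unique)
  then show ?thesis using real assms by (simp add: ennreal_powr_ennreal powr_mono2)
qed (simp add: ennreal_powr_top)

lemma ennreal_powr_mult:
  assumes "0 < p" shows "ennreal_powr (x * y) p = ennreal_powr x p * ennreal_powr y p"
proof -
  have top: "ennreal_powr (top * y) p = top * ennreal_powr y p" for y
  proof (cases y)
    case (real b)
    then show ?thesis
      by (cases "b = 0") (use assms in \<open>auto simp: ennreal_powr_ennreal ennreal_powr_top ennreal_top_mult ennreal_powr_ennreal[of 0, simplified]\<close>)
  qed (simp add: ennreal_powr_top ennreal_top_mult)
  show ?thesis
  proof (cases x)
    case (real a)
    show ?thesis
    proof (cases y)
      case (real b)
      then show ?thesis using \<open>x = ennreal a\<close> \<open>0 \<le> a\<close>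
        by (simp add: ennreal_mult[symmetric] ennreal_powr_ennreal powr_mult)
    next
      case y: top
      show ?thesis unfolding y ennreal_powr_top
        by (subst mult.commute[of x top], subst mult.commute[of "ennreal_powr x p" top]) (rule top)
    qed
  next
    case x: top
    show ?thesis unfolding x top ennreal_powr_top ..
  qed
qed

lemma ennreal_powr_inverse:
  assumes "0 < p" shows "ennreal_powr (ennreal_powr x p) (1 / p) = x"
  by (cases x) (use assms in \<open>auto simp: ennreal_powr_ennreal ennreal_powr_top powr_powr\<close>)

lemma ennreal_powr_measurable [measurable]:
  assumes [measurable]: "f \<in> borel_measurable M" shows "(\<lambda>x. ennreal_powr (f x) p) \<in> borel_measurable M"
  unfolding ennreal_powr_def by measurable

text \<open>No measurability is needed here: the integral is a supremum over simple functions.\<close>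

lemma nn_integral_cmult_le:
  assumes c: "0 < c" shows "(\<integral>\<^sup>+x. ennreal c * g x \<partial>M) \<le> ennreal c * (\<integral>\<^sup>+x. g x \<partial>M)"
  unfolding nn_integral_def[of M "\<lambda>x. ennreal c * g x"]
proof (rule SUP_least)
  fix s assume "s \<in> {s. simple_function M s \<and> s \<le> (\<lambda>x. ennreal c * g x)}"
  then have s: "simple_function M s" "\<And>x. s x \<le> ennreal c * g x" by (auto simp: le_fun_def)
  have cc: "ennreal c * ennreal (1 / c) = 1" using c by (simp add: ennreal_mult[symmetric])
  have "ennreal (1 / c) * s x \<le> ennreal (1 / c) * (ennreal c * g x)" for x using s(2) by (intro mult_left_mono) auto
  then have le: "ennreal (1 / c) * s x \<le> g x" for x using cc by (simp add: mult.assoc[symmetric] mult.commute)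
  have "integral\<^sup>S M s = (\<integral>\<^sup>+x. s x \<partial>M)" using s(1) by (rule nn_integral_eq_simple_integral[symmetric])
  also have "\<dots> = (\<integral>\<^sup>+x. ennreal c * (ennreal (1 / c) * s x) \<partial>M)" using cc by (simp add: mult.assoc[symmetric])
  also have "\<dots> = ennreal c * (\<integral>\<^sup>+x. ennreal (1 / c) * s x \<partial>M)"
    using borel_measurable_simple_function[OF s(1)] by (intro nn_integral_cmult borel_measurable_times_ennreal borel_measurable_const)
  also have "\<dots> \<le> ennreal c * (\<integral>\<^sup>+x. g x \<partial>M)" using le by (intro mult_left_mono nn_integral_mono) auto
  finally show "integral\<^sup>S M s \<le> ennreal c * (\<integral>\<^sup>+x. g x \<partial>M)" .
qed

text \<open>Above the level \<theta> one writes g as \<open>g powr (1 - p)\<close> times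
  \<open>g powr p\<close>, and the first factor is at most
  \<open>\<theta> powr (1 - p)\<close>.\<close>

lemma le_add_powr:
  assumes "0 < \<theta>" "1 \<le> p"
  shows "g \<le> ennreal \<theta> + ennreal (\<theta> powr (1 - p)) * ennreal_powr g p"
proof (cases g)
  case (real t)
  have "t \<le> \<theta> + \<theta> powr (1 - p) * t powr p"
  proof (cases "t \<le> \<theta>")
    case True
    have "0 \<le> \<theta> powr (1 - p) * t powr p" by simp
    then show ?thesis using True by linarith
  next
    case False
    then have t: "0 < t" "\<theta> \<le> t" using assms by auto
    have "t = t powr (1 - p) * t powr p" using t by (simp add: powr_add[symmetric])
    also have "\<dots> \<le> \<theta> powr (1 - p) * t powr p" using t assms by (intro mult_right_mono powr_mono2') auto
    finally show ?thesis using assms by linarith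
  qed
  then show ?thesis using real assms by (simp add: ennreal_powr_ennreal ennreal_mult[symmetric] ennreal_plus[symmetric] del: ennreal_plus)
next
  case top
  then show ?thesis using assms by (simp add: ennreal_powr_top ennreal_mult_top)
qed

text \<open>Optimising \<open>\<theta>\<close> in \<open>le_add_powr\<close> replaces Jensen's inequality.\<close>

lemma powr_nn_integral_le:
  assumes p: "1 \<le> p" and V: "0 < V" and A: "A \<in> sets M" "emeasure M A \<le> ennreal V"
    and g: "(\<lambda>x. g x * indicator A x) \<in> borel_measurable M"
  shows "ennreal_powr (\<integral>\<^sup>+x\<in>A. g x \<partial>M) p \<le> ennreal (2 powr p * V powr (p - 1)) * (\<integral>\<^sup>+x\<in>A. ennreal_powr (g x) p \<partial>M)"
proof -
  define I where "I = (\<integral>\<^sup>+x\<in>A. ennreal_powr (g x) p \<partial>M)"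
  have p0: "0 < p" using p by simp
  have gp: "(\<lambda>x. ennreal_powr (g x) p * indicator A x) \<in> borel_measurable M"
  proof -
    have "(\<lambda>x. ennreal_powr (g x) p * indicator A x) = (\<lambda>x. ennreal_powr (g x * indicator A x) p)"
      using p by (auto simp: indicator_def ennreal_powr_ennreal[of 0, simplified])
    then show ?thesis using ennreal_powr_measurable[OF g] by simp
  qed
  have le: "(\<integral>\<^sup>+x\<in>A. g x \<partial>M) \<le> ennreal (\<theta> * V) + ennreal (\<theta> powr (1 - p)) * I" if l: "0 < \<theta>" for \<theta>
  proof -
    have "(\<integral>\<^sup>+x\<in>A. g x \<partial>M) \<le> (\<integral>\<^sup>+x. ennreal \<theta> * indicator A x + ennreal (\<theta> powr (1 - p)) * (ennreal_powr (g x) p * indicator A x) \<partial>M)"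
      using le_add_powr[OF l p] by (intro nn_integral_mono) (auto simp: indicator_def)
    also have "\<dots> = (\<integral>\<^sup>+x. ennreal \<theta> * indicator A x \<partial>M) + (\<integral>\<^sup>+x. ennreal (\<theta> powr (1 - p)) * (ennreal_powr (g x) p * indicator A x) \<partial>M)"
      by (rule nn_integral_add[OF borel_measurable_times_ennreal[OF borel_measurable_const borel_measurable_indicator[OF A(1)]]
            borel_measurable_times_ennreal[OF borel_measurable_const gp]])
    also have "\<dots> = ennreal \<theta> * emeasure M A + ennreal (\<theta> powr (1 - p)) * I"
      unfolding I_def nn_integral_cmult[OF gp] nn_integral_cmult_indicator[OF A(1)] ..
    also have "\<dots> \<le> ennreal \<theta> * ennreal V + ennreal (\<theta> powr (1 - p)) * I" using A by (intro add_right_mono mult_left_mono) auto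
    finally show ?thesis using l V by (simp add: ennreal_mult)
  qed
  show ?thesis
  proof (cases I)
    case (real i)
    show ?thesis
    proof (cases "i = 0")
      \<comment> \<open>If the integral of the p-th power vanishes there is no optimal \<theta>;
        instead \<theta> tends to 0.\<close>
      case True
      have "(\<integral>\<^sup>+x\<in>A. g x \<partial>M) \<le> 0"
      proof (rule ennreal_le_epsilon)
        fix e :: real assume e: "0 < e"
        show "(\<integral>\<^sup>+x\<in>A. g x \<partial>M) \<le> 0 + ennreal e" using le[of "e / V"] e V real True by simp
      qed
      then have "(\<integral>\<^sup>+x\<in>A. g x \<partial>M) = 0" by simp
      then show ?thesis using p by (simp add: ennreal_powr_ennreal[of 0, simplified])
    next
      case False
      then have i: "0 < i" using real by simp
      \<comment> \<open>This \<theta> makes both summands equal to \<open>\<theta> * V\<close>,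
        hence the factor \<open>2 powr p\<close>.\<close>
      define \<theta> where "\<theta> = (i / V) powr (1 / p)"
      have l: "0 < \<theta>" using i V by (simp add: \<theta>_def)
      have lp: "\<theta> powr p = i / V" using i V p by (simp add: \<theta>_def powr_powr)
      have "\<theta> powr (1 - p) * i = \<theta> powr (1 - p) * (\<theta> powr p * V)" using lp V by simp
      also have "\<dots> = \<theta> * V" using l by (simp add: mult.assoc[symmetric] powr_add[symmetric])
      finally have "(\<integral>\<^sup>+x\<in>A. g x \<partial>M) \<le> ennreal (2 * (\<theta> * V))"
        using le[OF l] l V real by (simp add: ennreal_mult[symmetric] ennreal_plus[symmetric] mult.commute[of V] del: ennreal_plus)
      then have "ennreal_powr (\<integral>\<^sup>+x\<in>A. g x \<partial>M) p \<le> ennreal_powr (ennreal (2 * (\<theta> * V))) p" by (rule ennreal_powr_mono[OF _ p0])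
      also have "\<dots> = ennreal ((2 * (\<theta> * V)) powr p)" using l V by (intro ennreal_powr_ennreal) simp
      also have "(2 * (\<theta> * V)) powr p = 2 powr p * V powr (p - 1) * i"
        using l V lp by (simp add: powr_mult powr_diff field_simps)
      finally show ?thesis using real V by (simp add: I_def[symmetric] ennreal_mult)
    qed
  next
    case top
    then show ?thesis using V by (simp add: I_def[symmetric] ennreal_mult_top)
  qed
qed

section \<open>Sums over grid points\<close>

context regular_measure begin

lemma grid_overlap:
  assumes t: "0 < t" and B: "0 \<le> B"
  shows "(\<integral>\<^sup>+z. indicator (cube (grid_point S t z) (B * t)) u \<partial>count_space (grid_index t ` S)) \<le> ennreal (real ((nat \<lfloor>2 * (B + 1)\<rfloor> + 1) ^ CARD('n)))"
proof -
  define A where "A = {z \<in> grid_index t ` S. infnorm (grid_point S t z - u) \<le> B * t}"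
  have "(\<integral>\<^sup>+z. indicator (cube (grid_point S t z) (B * t)) u \<partial>count_space (grid_index t ` S)) = (\<Sum>z\<in>A. indicator (cube (grid_point S t z) (B * t)) u :: ennreal)"
    by (rule nn_integral_count_space') (use finite_grid_point[OF t B] in \<open>auto simp: A_def indicator_def cube_def infnorm_sub\<close>)
  also have "\<dots> \<le> ennreal (real ((nat \<lfloor>2 * (B + 1)\<rfloor> + 1) ^ CARD('n))) * 1"
    by (rule sum_ennreal_const_le) (use finite_grid_point[OF t B] card_grid_point[OF t B] in \<open>auto simp: A_def indicator_def simp del: of_nat_power of_nat_add\<close>)
  finally show ?thesis by simp
qed

lemma countable_grid_index: "countable (grid_index t ` A)"
  by (rule countable_subset[OF subset_UNIV countableI_type])

text \<open>Hoelder's inequality on each grid cube, in the form \<open>powr_nn_integral_le\<close>,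
  followed by the bounded overlap of these cubes.\<close>

lemma grid_sum_f:
  assumes p: "1 \<le> p" and f: "loc_int f" and t: "0 < t" and B: "0 < B" "B * t \<le> R"
  shows "(\<integral>\<^sup>+z. ennreal_powr (err f (\<lambda>x. 0) (grid_point S t z) (B * t)) p \<partial>count_space (grid_index t ` S))
    \<le> ennreal (2 powr p * (c2 * (B * t) powr d) powr (p - 1) * real ((nat \<lfloor>2 * (B + 1)\<rfloor> + 1) ^ CARD('n))) * (\<integral>\<^sup>+u. ennreal_powr (ennreal \<bar>f u\<bar>) p \<partial>N)"
proof -
  define V where "V = c2 * (B * t) powr d"
  have V: "0 < V" using c2_pos B t by (simp add: V_def)
  define K where "K = 2 powr p * V powr (p - 1)"
  have K: "0 < K" using V by (simp add: K_def)
  define h where "h u = ennreal_powr (ennreal \<bar>f u\<bar>) p" for u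
  have fm [measurable]: "f \<in> borel_measurable N" using f by (simp add: loc_int_def)
  have hm: "h \<in> borel_measurable N" unfolding h_def by measurable
  have ind: "(\<lambda>u. h u * indicator (cube w r) u) \<in> borel_measurable N" for w r
    by (intro borel_measurable_times_ennreal hm indicator_cube_measurable)
  have e: "ennreal_powr (err f (\<lambda>x. 0) (grid_point S t z) (B * t)) p \<le> ennreal K * (\<integral>\<^sup>+u. h u * indicator (cube (grid_point S t z) (B * t)) u \<partial>N)"
    if z: "z \<in> grid_index t ` S" for z
  proof -
    let ?Q = "cube (grid_point S t z) (B * t)"
    have eq: "(\<integral>\<^sup>+u\<in>?Q \<inter> S. g u \<partial>N) = (\<integral>\<^sup>+u\<in>?Q. g u \<partial>N)" for g :: "real ^ 'n \<Rightarrow> ennreal"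
      by (rule nn_integral_cong) (auto simp: indicator_def space_N)
    have "ennreal_powr (\<integral>\<^sup>+u\<in>?Q \<inter> S. ennreal \<bar>f u\<bar> \<partial>N) p \<le> ennreal (2 powr p * V powr (p - 1)) * (\<integral>\<^sup>+u\<in>?Q \<inter> S. h u \<partial>N)"
      unfolding h_def
    proof (rule powr_nn_integral_le[OF p V sets_N[OF cube_borel]])
      show "emeasure N (?Q \<inter> S) \<le> ennreal V" unfolding V_def using B t grid_point(1)[OF z] by (intro upper) auto
      show "(\<lambda>x. ennreal \<bar>f x\<bar> * indicator (?Q \<inter> S) x) \<in> borel_measurable N"
        by (intro borel_measurable_times_ennreal borel_measurable_indicator sets_N cube_borel) measurable
    qed
    then show ?thesis unfolding eq K_def err_def by simp
  qed
  have "(\<integral>\<^sup>+z. ennreal_powr (err f (\<lambda>x. 0) (grid_point S t z) (B * t)) p \<partial>count_space (grid_index t ` S))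
      \<le> (\<integral>\<^sup>+z. ennreal K * (\<integral>\<^sup>+u. h u * indicator (cube (grid_point S t z) (B * t)) u \<partial>N) \<partial>count_space (grid_index t ` S))"
    using e by (intro nn_integral_mono) simp
  also have "\<dots> = ennreal K * (\<integral>\<^sup>+z. \<integral>\<^sup>+u. h u * indicator (cube (grid_point S t z) (B * t)) u \<partial>N \<partial>count_space (grid_index t ` S))"
    by (rule nn_integral_cmult) simp
  also have "(\<integral>\<^sup>+z. \<integral>\<^sup>+u. h u * indicator (cube (grid_point S t z) (B * t)) u \<partial>N \<partial>count_space (grid_index t ` S))
      = (\<integral>\<^sup>+u. \<integral>\<^sup>+z. h u * indicator (cube (grid_point S t z) (B * t)) u \<partial>count_space (grid_index t ` S) \<partial>N)"
    by (rule nn_integral_count_space_nn_integral[OF countable_grid_index ind, symmetric])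
  also have "\<dots> \<le> (\<integral>\<^sup>+u. ennreal (real ((nat \<lfloor>2 * (B + 1)\<rfloor> + 1) ^ CARD('n))) * h u \<partial>N)"
  proof (rule nn_integral_mono)
    fix u
    have "(\<integral>\<^sup>+z. h u * indicator (cube (grid_point S t z) (B * t)) u \<partial>count_space (grid_index t ` S))
        = h u * (\<integral>\<^sup>+z. indicator (cube (grid_point S t z) (B * t)) u \<partial>count_space (grid_index t ` S))"
      by (rule nn_integral_cmult) simp
    also have "\<dots> \<le> h u * ennreal (real ((nat \<lfloor>2 * (B + 1)\<rfloor> + 1) ^ CARD('n)))"
      using B by (intro mult_left_mono grid_overlap t) auto
    finally show "(\<integral>\<^sup>+z. h u * indicator (cube (grid_point S t z) (B * t)) u \<partial>count_space (grid_index t ` S))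
        \<le> ennreal (real ((nat \<lfloor>2 * (B + 1)\<rfloor> + 1) ^ CARD('n))) * h u" by (simp only: mult.commute)
  qed
  also have "\<dots> = ennreal (real ((nat \<lfloor>2 * (B + 1)\<rfloor> + 1) ^ CARD('n))) * (\<integral>\<^sup>+u. h u \<partial>N)" by (rule nn_integral_cmult[OF hm])
  finally have "(\<integral>\<^sup>+z. ennreal_powr (err f (\<lambda>x. 0) (grid_point S t z) (B * t)) p \<partial>count_space (grid_index t ` S))
      \<le> ennreal K * (ennreal (real ((nat \<lfloor>2 * (B + 1)\<rfloor> + 1) ^ CARD('n))) * (\<integral>\<^sup>+u. h u \<partial>N))" by (simp add: mult_left_mono)
  then show ?thesis
    unfolding h_def K_def V_def using K by (subst ennreal_mult) (auto simp: mult.assoc)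
qed

text \<open>For u in \<open>S\<close> within t of the grid point, \<open>cube u T\<close> contains
  the grid cube, so the error at the grid point is at most V times the normalised one at u.
  Averaging over these u, a set of measure at least v, and counting overlaps gives the claim. The
  sum over the grid is measurable in u and lies below the integrand on the right, where
  \<open>nn_integral_cmult_le\<close> moves the constant out.\<close>

lemma grid_sum_approx:
  assumes p: "1 \<le> p" and t: "0 < t" and B: "0 \<le> B" "(B + 1) * t \<le> T" and T: "T \<le> R"
  shows "(\<integral>\<^sup>+z. ennreal_powr (INF P\<in>poly_space (int m). err f P (grid_point S t z) (B * t)) p \<partial>count_space (grid_index t ` S))
    \<le> ennreal ((c2 * T powr d) powr p * 5 ^ CARD('n) / (c1 * t powr d)) * (\<integral>\<^sup>+u. ennreal_powr (local_approx (Suc m) N f (cube u T \<inter> S)) p \<partial>N)"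
proof -
  have p0: "0 < p" using p by simp
  have "1 * t \<le> (B + 1) * t" using B t by (intro mult_right_mono) auto
  then have tT: "0 < T" "t \<le> R" using t B T by linarith+
  define V where "V = c2 * T powr d"
  have V: "0 < V" using c2_pos tT by (simp add: V_def)
  define v where "v = c1 * t powr d"
  have v: "0 < v" using c1_pos t by (simp add: v_def)
  define g where "g u = local_approx (Suc m) N f (cube u T \<inter> S)" for u
  define e where "e z = (INF P\<in>poly_space (int m). err f P (grid_point S t z) (B * t))" for z
  have eg: "e z \<le> ennreal V * g u" if u: "u \<in> S" "u \<in> cube (grid_point S t z) t" for u z
  proof -
    have sub: "cube (grid_point S t z) (B * t) \<subseteq> cube u T"
      by (rule cube_mono) (use u B infnorm_sub[of u "grid_point S t z"] in \<open>auto simp: cube_def algebra_simps\<close>)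
    have mu: "emeasure N (cube u T \<inter> S) \<le> ennreal V" unfolding V_def by (rule upper[OF u(1) tT(1) T])
    have "e z / ennreal V \<le> g u"
      unfolding g_def local_approx_def
    proof (rule INF_greatest)
      fix P :: "real ^ 'n \<Rightarrow> real" assume "P \<in> poly_space (int (Suc m) - 1)"
      then have P: "P \<in> poly_space (int m)" by simp
      have "e z \<le> err f P (grid_point S t z) (B * t)" unfolding e_def by (rule INF_lower[OF P])
      also have "\<dots> \<le> err f P u T" by (rule err_mono[OF sub])
      also have "\<dots> = (\<integral>\<^sup>+x\<in>cube u T \<inter> S. ennreal \<bar>f x - P x\<bar> \<partial>N)"
        unfolding err_def by (rule nn_integral_cong) (auto simp: indicator_def space_N)
      finally have "e z / ennreal V \<le> (\<integral>\<^sup>+x\<in>cube u T \<inter> S. ennreal \<bar>f x - P x\<bar> \<partial>N) / ennreal V" by (rule divide_right_mono_ennreal)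
      also have "\<dots> \<le> (\<integral>\<^sup>+x\<in>cube u T \<inter> S. ennreal \<bar>f x - P x\<bar> \<partial>N) / emeasure N (cube u T \<inter> S)"
      proof (rule divide_le_posI_ennreal)
        let ?X = "\<integral>\<^sup>+x\<in>cube u T \<inter> S. ennreal \<bar>f x - P x\<bar> \<partial>N" and ?\<mu> = "emeasure N (cube u T \<inter> S)"
        have "0 < ennreal (c1 * T powr d)" using c1_pos tT by simp
        then have "?\<mu> \<noteq> 0" using lower[OF u(1) tT(1) T] by auto
        moreover have "?\<mu> \<noteq> top" using mu by (auto simp: top_unique)
        ultimately have "?X = ?\<mu> * (?X / ?\<mu>)"
          by (simp add: ennreal_times_divide mult.commute[of ?\<mu>] ennreal_mult_divide_eq)
        also have "\<dots> \<le> ennreal V * (?X / ?\<mu>)" by (rule mult_right_mono[OF mu]) simp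
        finally show "?X \<le> ennreal V * (?X / ?\<mu>)" .
      qed (use V in simp)
      finally show "e z / ennreal V \<le> (\<integral>\<^sup>+x\<in>cube u T \<inter> S. ennreal \<bar>f x - P x\<bar> \<partial>N) / emeasure N (cube u T \<inter> S)" .
    qed
    then have "ennreal V * (e z / ennreal V) \<le> ennreal V * g u" by (rule mult_left_mono) simp
    moreover have "ennreal V * (e z / ennreal V) = e z"
      using V by (simp add: ennreal_times_divide mult.commute[of "ennreal V"] ennreal_mult_divide_eq)
    ultimately show ?thesis by simp
  qed
  have "(\<integral>\<^sup>+z. ennreal_powr (e z) p \<partial>count_space (grid_index t ` S)) * ennreal v = (\<integral>\<^sup>+z. ennreal_powr (e z) p * ennreal v \<partial>count_space (grid_index t ` S))"
    by (rule nn_integral_multc[symmetric]) simp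
  also have "\<dots> \<le> (\<integral>\<^sup>+z. \<integral>\<^sup>+u. ennreal_powr (e z) p * indicator (cube (grid_point S t z) t \<inter> S) u \<partial>N \<partial>count_space (grid_index t ` S))"
  proof (rule nn_integral_mono)
    fix z assume z: "z \<in> space (count_space (grid_index t ` S))"
    have "ennreal_powr (e z) p * ennreal v \<le> ennreal_powr (e z) p * emeasure N (cube (grid_point S t z) t \<inter> S)"
      unfolding v_def using z grid_point(1)[of z t S] t tT by (intro mult_left_mono lower) auto
    also have "\<dots> = (\<integral>\<^sup>+u. ennreal_powr (e z) p * indicator (cube (grid_point S t z) t \<inter> S) u \<partial>N)"
      by (rule nn_integral_cmult_indicator[symmetric, OF sets_N[OF cube_borel]])
    finally show "ennreal_powr (e z) p * ennreal v \<le> (\<integral>\<^sup>+u. ennreal_powr (e z) p * indicator (cube (grid_point S t z) t \<inter> S) u \<partial>N)" .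
  qed
  also have "\<dots> = (\<integral>\<^sup>+u. \<integral>\<^sup>+z. ennreal_powr (e z) p * indicator (cube (grid_point S t z) t \<inter> S) u \<partial>count_space (grid_index t ` S) \<partial>N)"
    by (rule nn_integral_count_space_nn_integral[OF countable_grid_index, symmetric])
       (intro borel_measurable_times_ennreal borel_measurable_const borel_measurable_indicator sets_N cube_borel)
  also have "\<dots> \<le> (\<integral>\<^sup>+u. ennreal (V powr p * 5 ^ CARD('n)) * ennreal_powr (g u) p \<partial>N)"
  proof (rule nn_integral_mono)
    fix u assume "u \<in> space N"
    then have u: "u \<in> S" by (simp add: space_N)
    have "(\<integral>\<^sup>+z. ennreal_powr (e z) p * indicator (cube (grid_point S t z) t \<inter> S) u \<partial>count_space (grid_index t ` S))
        \<le> (\<integral>\<^sup>+z. ennreal_powr (ennreal V * g u) p * indicator (cube (grid_point S t z) (1 * t)) u \<partial>count_space (grid_index t ` S))"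
      using eg[OF u] p0 by (intro nn_integral_mono) (auto simp: indicator_def intro: ennreal_powr_mono)
    also have "\<dots> = ennreal_powr (ennreal V * g u) p * (\<integral>\<^sup>+z. indicator (cube (grid_point S t z) (1 * t)) u \<partial>count_space (grid_index t ` S))"
      by (rule nn_integral_cmult) simp
    also have "\<dots> \<le> ennreal_powr (ennreal V * g u) p * ennreal (real ((nat \<lfloor>2 * (1 + 1) :: real\<rfloor> + 1) ^ CARD('n)))"
      by (intro mult_left_mono grid_overlap t) auto
    also have "nat \<lfloor>2 * (1 + 1) :: real\<rfloor> + 1 = 5" by simp
    also have "ennreal_powr (ennreal V * g u) p = ennreal (V powr p) * ennreal_powr (g u) p"
      using V p0 by (simp add: ennreal_powr_mult ennreal_powr_ennreal)
    also have "ennreal (V powr p) * ennreal_powr (g u) p * ennreal (real (5 ^ CARD('n))) = ennreal (V powr p * 5 ^ CARD('n)) * ennreal_powr (g u) p"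
      by (simp add: ennreal_mult mult_ac)
    finally show "(\<integral>\<^sup>+z. ennreal_powr (e z) p * indicator (cube (grid_point S t z) t \<inter> S) u \<partial>count_space (grid_index t ` S))
        \<le> ennreal (V powr p * 5 ^ CARD('n)) * ennreal_powr (g u) p" .
  qed
  also have "\<dots> \<le> ennreal (V powr p * 5 ^ CARD('n)) * (\<integral>\<^sup>+u. ennreal_powr (g u) p \<partial>N)"
    by (rule nn_integral_cmult_le) (use V in simp)
  finally have main: "(\<integral>\<^sup>+z. ennreal_powr (e z) p \<partial>count_space (grid_index t ` S)) * ennreal v
      \<le> ennreal (V powr p * 5 ^ CARD('n)) * (\<integral>\<^sup>+u. ennreal_powr (g u) p \<partial>N)" .
  have "(\<integral>\<^sup>+z. ennreal_powr (e z) p \<partial>count_space (grid_index t ` S))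
      = (\<integral>\<^sup>+z. ennreal_powr (e z) p \<partial>count_space (grid_index t ` S)) * ennreal v * ennreal (1 / v)"
    using v by (simp add: mult.assoc ennreal_mult[symmetric])
  also have "\<dots> \<le> ennreal (V powr p * 5 ^ CARD('n)) * (\<integral>\<^sup>+u. ennreal_powr (g u) p \<partial>N) * ennreal (1 / v)"
    by (intro mult_right_mono main) simp
  also have "\<dots> = ennreal (V powr p * 5 ^ CARD('n) * (1 / v)) * (\<integral>\<^sup>+u. ennreal_powr (g u) p \<partial>N)"
  proof -
    have "ennreal (V powr p * 5 ^ CARD('n) * (1 / v)) = ennreal (V powr p * 5 ^ CARD('n)) * ennreal (1 / v)"
      by (rule ennreal_mult) (use v in auto)
    then show ?thesis by (simp only: mult_ac)
  qed
  finally show ?thesis unfolding e_def g_def V_def v_def by simp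
qed

end

lemma measurable_count_space_sum:
  fixes f :: "'b \<Rightarrow> 'a \<Rightarrow> ennreal"
  assumes "countable I" "\<And>i. i \<in> I \<Longrightarrow> f i \<in> borel_measurable M"
  shows "(\<lambda>x. \<integral>\<^sup>+i. f i x \<partial>count_space I) \<in> borel_measurable M"
proof (cases "finite I")
  case True
  then show ?thesis using assms(2) by (simp add: nn_integral_count_space_finite borel_measurable_sum)
next
  case False
  have b: "bij_betw (from_nat_into I) UNIV I" by (rule bij_betw_from_nat_into[OF assms(1) False])
  have eq: "(\<integral>\<^sup>+i. f i x \<partial>count_space I) = (\<Sum>n. f (from_nat_into I n) x)" for x
    using nn_integral_bij_count_space[OF b, of "\<lambda>i. f i x"] by (simp add: nn_integral_count_space_nat)
  have "from_nat_into I n \<in> I" for n using b by (auto simp: bij_betw_def)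
  then show ?thesis unfolding eq by (intro borel_measurable_suminf_order assms(2))
qed

lemma le_cmult_INF:
  fixes X :: ennreal
  assumes c: "0 < c" and le: "\<And>P. P \<in> A \<Longrightarrow> X \<le> ennreal c * g P"
  shows "X \<le> ennreal c * (INF P\<in>A. g P)"
proof -
  have "X / ennreal c \<le> (INF P\<in>A. g P)"
    using c le by (intro INF_greatest divide_le_posI_ennreal) auto
  then have "ennreal c * (X / ennreal c) \<le> ennreal c * (INF P\<in>A. g P)" by (rule mult_left_mono) simp
  moreover have "ennreal c * (X / ennreal c) = X"
    using c by (simp add: ennreal_times_divide mult.commute[of "ennreal c"] ennreal_mult_divide_eq)
  ultimately show ?thesis by simp
qed

section \<open>Dyadic scales and strips around the set\<close>

definition scale :: "nat \<Rightarrow> real" where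
  "scale j = 2 powr (- real j)"

lemma scale_pos: "0 < scale j"
  by (simp add: scale_def)

lemma scale_le_1: "scale j \<le> 1"
  unfolding scale_def using powr_mono[of "- real j" 0 2] by simp

lemma scale_0: "scale 0 = 1"
  by (simp add: scale_def)

lemma scale_powr: "scale j powr a = 2 powr (- (real j * a))"
  by (simp add: scale_def powr_powr)

lemma scale_add: "scale (j + l) = scale j * scale l"
  by (simp add: scale_def powr_add[symmetric])

lemma scale_Suc: "scale (Suc j) = scale j / 2"
  using scale_add[of j 1] by (simp add: scale_def powr_minus)

lemma scale_mono: "j \<le> l \<Longrightarrow> scale l \<le> scale j"
  unfolding scale_def by (intro powr_mono) auto

text \<open>At these levels the relevant Whitney cubes are below the truncation radius 8000, so
  every P may be compared with the projections. The inequality holds from level 5 on; 23 is the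
  level from which \<open>4194304 * scale j\<close> fits into \<open>scale (j - 23)\<close>, as
  \<open>grid_sum_approx\<close> demands.\<close>

lemma scale_23: "23 \<le> j \<Longrightarrow> 131074 * scale j \<le> 8000"
proof -
  assume "23 \<le> j"
  then have "scale j \<le> scale 23" by (rule scale_mono)
  also have "scale 23 = 1 / 2 ^ 23" by (simp add: scale_def powr_minus inverse_eq_divide)
  finally show ?thesis by simp
qed

context regular_measure begin

text \<open>At distance \<open>131072 = 2 ^ 17\<close> or more from \<open>S\<close> all Whitney cubes have radius above \<open>8000\<close>, so the
  extension vanishes there.\<close>

definition strip :: "nat \<Rightarrow> nat \<Rightarrow> ('n \<Rightarrow> int) \<Rightarrow> (real ^ 'n) set" where
  "strip j l z = {y \<in> cube (grid_point S (scale j) z) (131073 * scale j). \<exists>s\<in>S. infnorm (y - s) < 131072 * scale (j + l)}"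

lemma strip_sets: "strip j l z \<in> sets lebesgue"
proof -
  let ?U = "{y. \<exists>s\<in>S. infnorm (y - s) < 131072 * scale (j + l)}"
  have op: "?U = (\<Union>s\<in>S. {y. infnorm (y - s) < 131072 * scale (j + l)})" by blast
  have "open ?U" unfolding op by (intro open_UN ballI open_Collect_less continuous_intros)
  then have "?U \<in> sets lebesgue" by simp
  then have "cube (grid_point S (scale j) z) (131073 * scale j) \<inter> ?U \<in> sets lebesgue" by (intro sets.Int) auto
  then show ?thesis by (simp add: strip_def Int_def)
qed

lemma strip_volume:
  assumes R: "4194304 \<le> R"
  obtains C where "0 < C" "\<And>j l z. z \<in> grid_index (scale j) ` S \<Longrightarrow>
    emeasure lebesgue (strip j l z) \<le> ennreal (C * (scale (j + l) powr (real CARD('n) - d) * scale j powr d))"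
proof -
  define C where "C = (2 * (131072 + 1)) ^ CARD('n) * (5 ^ CARD('n) * c2 / c1) * (131073 + 131072 + 2) powr d"
  have "0 < C" using c1_pos c2_pos by (simp add: C_def)
  moreover have "emeasure lebesgue (strip j l z) \<le> ennreal (C * (scale (j + l) powr (real CARD('n) - d) * scale j powr d))"
    if z: "z \<in> grid_index (scale j) ` S" for j l z
    unfolding strip_def C_def
    by (rule volume_neighbourhood) (use grid_point(1)[OF z] scale_pos scale_le_1[of j] R scale_mono[of j "j + l"] in auto)
  ultimately show ?thesis using that by blast
qed

text \<open>A pointwise majorant off the null set \<open>S\<close> is integrated by exchanging sums
  with the integral and inserting the volume of the strips. Weights and grid values are kept general
  because both norm estimates use this form.\<close>

lemma strip_integral:
  assumes R: "4194304 \<le> R"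
  obtains C where "0 < C" "\<And>H w E. (\<And>j l. 0 \<le> w j l) \<Longrightarrow>
    (\<And>x. x \<notin> S \<Longrightarrow> H x \<le> (\<Sum>j. \<Sum>l. \<integral>\<^sup>+z. ennreal (w j l) * E j z * indicator (strip j l z) x \<partial>count_space (grid_index (scale j) ` S))) \<Longrightarrow>
    (\<integral>\<^sup>+x. H x \<partial>lebesgue) \<le> (\<Sum>j. \<Sum>l. ennreal (w j l * C * (scale (j + l) powr (real CARD('n) - d) * scale j powr d)) *
       (\<integral>\<^sup>+z. E j z \<partial>count_space (grid_index (scale j) ` S)))"
proof -
  obtain C where C: "0 < C" and vol: "\<And>j l z. z \<in> grid_index (scale j) ` S \<Longrightarrow>
    emeasure lebesgue (strip j l z) \<le> ennreal (C * (scale (j + l) powr (real CARD('n) - d) * scale j powr d))"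
    using strip_volume[OF R] by blast
  show ?thesis
  proof (rule that[OF C])
    fix H :: "real ^ 'n \<Rightarrow> ennreal" and w :: "nat \<Rightarrow> nat \<Rightarrow> real" and E :: "nat \<Rightarrow> ('n \<Rightarrow> int) \<Rightarrow> ennreal"
    assume w: "\<And>j l. 0 \<le> w j l"
      and H: "\<And>x. x \<notin> S \<Longrightarrow> H x \<le> (\<Sum>j. \<Sum>l. \<integral>\<^sup>+z. ennreal (w j l) * E j z * indicator (strip j l z) x \<partial>count_space (grid_index (scale j) ` S))"
    let ?I = "\<lambda>j. count_space (grid_index (scale j) ` S)"
    have m0: "(\<lambda>x. ennreal (w j l) * E j z * indicator (strip j l z) x) \<in> borel_measurable lebesgue" for j l z
      by (intro borel_measurable_times_ennreal borel_measurable_const borel_measurable_indicator strip_sets)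
    have m1: "(\<lambda>x. \<integral>\<^sup>+z. ennreal (w j l) * E j z * indicator (strip j l z) x \<partial>?I j) \<in> borel_measurable lebesgue" for j l
      by (rule measurable_count_space_sum[OF countable_grid_index m0])
    have "(\<integral>\<^sup>+x. H x \<partial>lebesgue) \<le> (\<integral>\<^sup>+x. (\<Sum>j. \<Sum>l. \<integral>\<^sup>+z. ennreal (w j l) * E j z * indicator (strip j l z) x \<partial>?I j) \<partial>lebesgue)"
      by (rule nn_integral_mono_AE) (use AE_not_in[OF null_S] in eventually_elim, rule H)
    also have "\<dots> = (\<Sum>j. \<integral>\<^sup>+x. (\<Sum>l. \<integral>\<^sup>+z. ennreal (w j l) * E j z * indicator (strip j l z) x \<partial>?I j) \<partial>lebesgue)"
      by (rule nn_integral_suminf[OF borel_measurable_suminf_order[OF m1]])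
    also have "\<dots> = (\<Sum>j. \<Sum>l. \<integral>\<^sup>+x. \<integral>\<^sup>+z. ennreal (w j l) * E j z * indicator (strip j l z) x \<partial>?I j \<partial>lebesgue)"
      by (simp only: nn_integral_suminf[OF m1])
    also have "\<dots> \<le> (\<Sum>j. \<Sum>l. ennreal (w j l * C * (scale (j + l) powr (real CARD('n) - d) * scale j powr d)) * (\<integral>\<^sup>+z. E j z \<partial>?I j))"
    proof (intro suminf_le summableI)
      fix j l
      let ?v = "C * (scale (j + l) powr (real CARD('n) - d) * scale j powr d)"
      have "(\<integral>\<^sup>+x. \<integral>\<^sup>+z. ennreal (w j l) * E j z * indicator (strip j l z) x \<partial>?I j \<partial>lebesgue)
          = (\<integral>\<^sup>+z. \<integral>\<^sup>+x. ennreal (w j l) * E j z * indicator (strip j l z) x \<partial>lebesgue \<partial>?I j)"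
        by (rule nn_integral_count_space_nn_integral[OF countable_grid_index m0])
      also have "\<dots> = (\<integral>\<^sup>+z. ennreal (w j l) * E j z * emeasure lebesgue (strip j l z) \<partial>?I j)"
        by (simp only: nn_integral_cmult_indicator[OF strip_sets])
      also have "\<dots> \<le> (\<integral>\<^sup>+z. ennreal (w j l * ?v) * E j z \<partial>?I j)"
      proof (rule nn_integral_mono)
        fix z assume z: "z \<in> space (?I j)"
        have "ennreal (w j l) * E j z * emeasure lebesgue (strip j l z) \<le> ennreal (w j l) * E j z * ennreal ?v"
          using z by (intro mult_left_mono vol) auto
        also have "\<dots> = ennreal (w j l * ?v) * E j z"
          using C w scale_pos by (simp only: ennreal_mult'[OF w]) (simp only: mult_ac)
        finally show "ennreal (w j l) * E j z * emeasure lebesgue (strip j l z) \<le> ennreal (w j l * ?v) * E j z" .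
      qed
      also have "\<dots> = ennreal (w j l * ?v) * (\<integral>\<^sup>+z. E j z \<partial>?I j)" by (rule nn_integral_cmult) simp
      finally show "(\<integral>\<^sup>+x. \<integral>\<^sup>+z. ennreal (w j l) * E j z * indicator (strip j l z) x \<partial>?I j \<partial>lebesgue)
          \<le> ennreal (w j l * C * (scale (j + l) powr (real CARD('n) - d) * scale j powr d)) * (\<integral>\<^sup>+z. E j z \<partial>?I j)"
        by (simp only: mult.assoc)
    qed
    finally show "(\<integral>\<^sup>+x. H x \<partial>lebesgue) \<le> (\<Sum>j. \<Sum>l. ennreal (w j l * C * (scale (j + l) powr (real CARD('n) - d) * scale j powr d)) *
       (\<integral>\<^sup>+z. E j z \<partial>?I j))" .
  qed
qed

text \<open>A nonnegative series dominates each of its terms. This enters after a sum over scales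
  has been reduced to its largest term, whose index depends on x.\<close>

lemma strip_term_le:
  assumes "z \<in> grid_index (scale j) ` S" "x \<in> strip j l z"
  shows "ennreal (w j l) * E j z \<le> (\<Sum>j. \<Sum>l. \<integral>\<^sup>+z. ennreal (w j l) * E j z * indicator (strip j l z) x \<partial>count_space (grid_index (scale j) ` S))"
proof -
  let ?T = "\<lambda>j l. \<integral>\<^sup>+z. ennreal (w j l) * E j z * indicator (strip j l z) x \<partial>count_space (grid_index (scale j) ` S)"
  have "ennreal (w j l) * E j z = (\<Sum>z\<in>{z}. ennreal (w j l) * E j z * indicator (strip j l z) x)" using assms by simp
  also have "\<dots> \<le> ?T j l" using assms by (intro sum_le_nn_integral_count_space) auto
  also have "\<dots> = (\<Sum>l\<in>{l}. ?T j l)" by simp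
  also have "\<dots> \<le> (\<Sum>l. ?T j l)" by (intro sum_le_suminf summableI) auto
  also have "\<dots> = (\<Sum>j\<in>{j}. \<Sum>l. ?T j l)" by simp
  also have "\<dots> \<le> (\<Sum>j. \<Sum>l. ?T j l)" by (intro sum_le_suminf summableI) auto
  finally show ?thesis .
qed

text \<open>\<open>i\<close> is the last index for which \<open>x\<close> has distance less than \<open>131072 * scale i\<close> to \<open>S\<close>.\<close>

lemma layerE:
  assumes x: "x \<notin> S" and near: "s0 \<in> S" "infnorm (x - s0) < 131072"
  obtains i z where "\<And>j. j \<le> i \<Longrightarrow> z j \<in> grid_index (scale j) ` S"
    "\<And>j. j \<le> i \<Longrightarrow> x \<in> strip j (i - j) (z j)"
    "\<And>s. s \<in> S \<Longrightarrow> 65536 * scale i \<le> infnorm (x - s)"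
proof -
  define near_S where "near_S j \<longleftrightarrow> (\<exists>s\<in>S. infnorm (x - s) < 131072 * scale j)" for j
  have "open (- S)" using closed_S by (simp add: open_Compl)
  then obtain e where e: "0 < e" "ball x e \<subseteq> - S" using x open_contains_ball by blast
  define e' where "e' = e / sqrt (real DIM(real ^ 'n))"
  have dm: "0 < sqrt (real DIM(real ^ 'n))" by simp
  have e': "0 < e'" using e dm unfolding e'_def by (intro divide_pos_pos)
  have far: "e' \<le> infnorm (x - s)" if "s \<in> S" for s
  proof -
    have "e \<le> norm (x - s)" using e that by (auto simp: ball_def dist_norm not_less[symmetric])
    also have "\<dots> \<le> sqrt (real DIM(real ^ 'n)) * infnorm (x - s)" by (rule norm_le_infnorm)
    finally show ?thesis using dm by (simp add: e'_def field_simps)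
  qed
  obtain j1 where j1: "131072 / e' < 2 ^ j1" using real_arch_pow[of 2] by auto
  have "131072 * scale j1 \<le> e'"
    using j1 e' by (simp add: scale_def powr_minus powr_realpow field_simps)
  then have "\<not> near_S j1" using far by (force simp: near_S_def)
  define j0 where "j0 = (LEAST j. \<not> near_S j)"
  have nj0: "\<not> near_S j0" unfolding j0_def using \<open>\<not> near_S j1\<close> by (rule LeastI)
  have lj0: "near_S j" if "j < j0" for j using not_less_Least[of j "\<lambda>j. \<not> near_S j"] that by (auto simp: j0_def)
  have "near_S 0" using near by (auto simp: near_S_def scale_0)
  then obtain i where i: "j0 = Suc i" using nj0 by (cases j0) auto
  have T: "near_S j" if "j \<le> i" for j using lj0 that i by simp
  then have "\<forall>j. \<exists>s. j \<le> i \<longrightarrow> s \<in> S \<and> infnorm (x - s) < 131072 * scale j" by (auto simp: near_S_def)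
  then obtain s where s: "\<And>j. j \<le> i \<Longrightarrow> s j \<in> S" "\<And>j. j \<le> i \<Longrightarrow> infnorm (x - s j) < 131072 * scale j" by metis
  show ?thesis
  proof (rule that[of i "\<lambda>j. grid_index (scale j) (s j)"])
    fix j assume j: "j \<le> i"
    show "grid_index (scale j) (s j) \<in> grid_index (scale j) ` S" using s(1)[OF j] by blast
    have "infnorm (x - grid_point S (scale j) (grid_index (scale j) (s j))) \<le> 131073 * scale j"
      using infnorm_triangle_sub[of x "grid_point S (scale j) (grid_index (scale j) (s j))" "s j"] s(2)[OF j]
        grid_point_close[OF s(1)[OF j] scale_pos, of j] by simp
    moreover have "near_S (j + (i - j))" using T j by simp
    ultimately show "x \<in> strip j (i - j) (grid_index (scale j) (s j))" by (simp add: strip_def cube_def near_S_def)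
  next
    fix s assume "s \<in> S"
    \<comment> \<open>Level \<open>Suc i\<close> fails, and \<open>131072 * scale (Suc i)\<close> is
      \<open>65536 * scale i\<close>.\<close>
    then show "65536 * scale i \<le> infnorm (x - s)" using nj0 by (force simp: i near_S_def scale_Suc)
  qed
qed

end

section \<open>The two norm estimates\<close>

lemma suminf_geometric_ennreal:
  assumes "0 \<le> a" "0 \<le> r" "r < 1"
  shows "(\<Sum>l. ennreal (a * r ^ l)) = ennreal (a / (1 - r))"
proof -
  have "(\<lambda>l. a * r ^ l) sums (a * (1 / (1 - r)))" using assms by (intro sums_mult geometric_sums) auto
  then have "(\<Sum>l. ennreal (a * r ^ l)) = ennreal (a * (1 / (1 - r)))" by (rule suminf_ennreal_eq[rotated]) (use assms in auto)
  then show ?thesis by simp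
qed

definition ndist :: "nat \<Rightarrow> nat \<Rightarrow> nat" where
  "ndist l i = (if l \<le> i then i - l else l - i)"

lemma sum_power_ndist_le:
  fixes \<psi> :: real
  assumes "0 \<le> \<psi>" "\<psi> < 1"
  shows "(\<Sum>l<n. \<psi> ^ ndist l i) \<le> 2 / (1 - \<psi>)"
proof -
  have part: "(\<Sum>l\<in>A. \<psi> ^ g l) \<le> 1 / (1 - \<psi>)" if "finite A" "inj_on g A" for A and g :: "nat \<Rightarrow> nat"
  proof -
    have "(\<Sum>l\<in>A. \<psi> ^ g l) = (\<Sum>k\<in>g ` A. \<psi> ^ k)" using that by (simp add: sum.reindex)
    also have "\<dots> \<le> (\<Sum>k. \<psi> ^ k)" using assms that by (intro sum_le_suminf summable_geometric) auto
    also have "\<dots> = 1 / (1 - \<psi>)" using assms by (intro suminf_geometric) auto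
    finally show ?thesis .
  qed
  have "(\<Sum>l<n. \<psi> ^ ndist l i) \<le> (\<Sum>l\<in>{..i} \<union> {i<..<i + n}. \<psi> ^ ndist l i)"
    using assms by (intro sum_mono2) auto
  also have "\<dots> = (\<Sum>l\<in>{..i}. \<psi> ^ ndist l i) + (\<Sum>l\<in>{i<..<i + n}. \<psi> ^ ndist l i)"
    by (rule sum.union_disjoint) auto
  also have "\<dots> \<le> 1 / (1 - \<psi>) + 1 / (1 - \<psi>)"
    by (intro add_mono part) (auto simp: inj_on_def ndist_def)
  finally show ?thesis by simp
qed

text \<open>Separates the coarse levels, which will be controlled by the norm of f, from the fine
  ones, which are matched with the series of the theorem after a shift.\<close>

lemma suminf_shift_le:
  fixes g :: "nat \<Rightarrow> ennreal"
  assumes "\<And>j. j < k \<Longrightarrow> g j \<le> A" "\<And>i. g (k + i) \<le> h i"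
  shows "(\<Sum>j. g j) \<le> of_nat k * A + (\<Sum>i. h i)"
proof (rule suminf_le_const[OF summableI])
  fix n
  have split: "sum g {..<k + n} = sum g {..<k} + (\<Sum>i<n. g (k + i))" for n
    by (induction n) (simp_all add: add.assoc)
  have "sum g {..<n} \<le> sum g {..<k + n}" by (intro sum_mono2) auto
  also have "\<dots> \<le> (\<Sum>j<k. A) + (\<Sum>i<n. h i)" unfolding split using assms by (intro add_mono sum_mono) auto
  also have "\<dots> \<le> of_nat k * A + (\<Sum>i. h i)" by (intro add_mono sum_le_suminf summableI) auto
  finally show "sum g {..<n} \<le> of_nat k * A + (\<Sum>i. h i)" .
qed

lemma scale_powr_power: "scale j powr a = (2 powr (- a)) ^ j"
  by (simp add: scale_powr powr_realpow[symmetric] powr_powr mult.commute)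

lemma ennreal_powr_zero: "ennreal_powr 0 p = 0"
  by (simp add: ennreal_powr_def)

context regular_measure begin

text \<open>Here x is compared only with the last level i of \<open>layerE\<close>, the one
  comparable to its distance from \<open>S\<close>, where \<open>far_sup\<close> applies. Collecting
  powers of \<open>scale j\<close> leaves the positive exponent \<open>n - d\<close>, so the levels
  sum geometrically.\<close>

lemma ext_Lp_bound:
  assumes R: "4194304 \<le> R" and p: "1 \<le> p"
  obtains C where "0 < C" "\<And>W \<phi> a k C\<^sub>\<phi> f F. whitney S W \<phi> a k C\<^sub>\<phi> \<Longrightarrow> loc_int f \<Longrightarrow>
    (\<forall>y. y \<notin> S \<longrightarrow> F y = (\<Sum>\<^sub>\<infinity>Q\<in>W. \<phi> Q y * wproj N a m Q f y)) \<Longrightarrow>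
    (\<integral>\<^sup>+x. ennreal_powr (ennreal \<bar>F x\<bar>) p \<partial>lebesgue) \<le> ennreal C * (\<integral>\<^sup>+u. ennreal_powr (ennreal \<bar>f u\<bar>) p \<partial>N)"
proof -
  let ?n = "real CARD('n)"
  have p0: "0 < p" using p by simp
  have R': "8000 \<le> R" and L: "(1::real) \<le> 131073" using R by simp_all
  obtain CS where CS: "0 < CS" and sup: "\<And>W \<phi> a k C\<^sub>\<phi> f F x s \<tau>. whitney S W \<phi> a k C\<^sub>\<phi> \<Longrightarrow> loc_int f \<Longrightarrow>
    (\<forall>y. y \<notin> S \<longrightarrow> F y = (\<Sum>\<^sub>\<infinity>Q\<in>W. \<phi> Q y * wproj N a m Q f y)) \<Longrightarrow>
    s \<in> S \<Longrightarrow> infnorm (x - s) \<le> 131073 * \<tau> \<Longrightarrow> 0 < \<tau> \<Longrightarrow> (\<forall>s'\<in>S. 2 * \<tau> \<le> infnorm (x - s')) \<Longrightarrow>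
    ennreal \<bar>F x\<bar> \<le> ennreal (CS * \<tau> powr (- d)) * err f (\<lambda>x. 0) s (21 * (131073 + 1) * \<tau>)"
    using far_sup[OF R' L, of m] by blast
  obtain CV where CV: "0 < CV" and int: "\<And>H w E. (\<And>j l. 0 \<le> w j l) \<Longrightarrow>
    (\<And>x. x \<notin> S \<Longrightarrow> H x \<le> (\<Sum>j. \<Sum>l. \<integral>\<^sup>+z. ennreal (w j l) * E j z * indicator (strip j l z) x \<partial>count_space (grid_index (scale j) ` S))) \<Longrightarrow>
    (\<integral>\<^sup>+x. H x \<partial>lebesgue) \<le> (\<Sum>j. \<Sum>l. ennreal (w j l * CV * (scale (j + l) powr (?n - d) * scale j powr d)) *
       (\<integral>\<^sup>+z. E j z \<partial>count_space (grid_index (scale j) ` S)))"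
    using strip_integral[OF R] by blast
  define cnt where "cnt = real ((nat \<lfloor>2 * (4194304 + 1) :: real\<rfloor> + 1) ^ CARD('n))"
  have cnt: "0 < cnt" unfolding cnt_def by simp
  define G where "G = 2 powr p * (c2 * 4194304 powr d) powr (p - 1) * cnt"
  define K where "K = CS powr p * CV * G"
  have K: "0 < K" using CS CV cnt c2_pos by (simp add: K_def G_def)
  define r where "r = 2 powr (- (?n - d))"
  have r: "0 < r" "r < 1" using d_lt powr_less_mono[of "- (?n - d)" 0 2] by (auto simp: r_def)
  have "0 < K / (1 - r)" using K r by simp
  then show ?thesis
  proof (rule that)
    fix W \<phi> a k C\<^sub>\<phi> f and F :: "real ^ 'n \<Rightarrow> real"
    assume wh: "whitney S W \<phi> a k C\<^sub>\<phi>" and f: "loc_int f"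
      and F: "\<forall>y. y \<notin> S \<longrightarrow> F y = (\<Sum>\<^sub>\<infinity>Q\<in>W. \<phi> Q y * wproj N a m Q f y)"
    define Y where "Y = (\<integral>\<^sup>+u. ennreal_powr (ennreal \<bar>f u\<bar>) p \<partial>N)"
    define E where "E j z = ennreal_powr (err f (\<lambda>x. 0) (grid_point S (scale j) z) (4194304 * scale j)) p" for j z
    define w where "w j l = (if l = 0 then (CS * scale j powr (- d)) powr p else 0)" for j l :: nat
    have pt: "ennreal_powr (ennreal \<bar>F x\<bar>) p
      \<le> (\<Sum>j. \<Sum>l. \<integral>\<^sup>+z. ennreal (w j l) * E j z * indicator (strip j l z) x \<partial>count_space (grid_index (scale j) ` S))"
      if x: "x \<notin> S" for x
    proof (cases "\<exists>s0\<in>S. infnorm (x - s0) < 131072")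
      case True
      then obtain s0 where s0: "s0 \<in> S" "infnorm (x - s0) < 131072" by blast
      obtain i z where z: "\<And>j. j \<le> i \<Longrightarrow> z j \<in> grid_index (scale j) ` S" "\<And>j. j \<le> i \<Longrightarrow> x \<in> strip j (i - j) (z j)"
        and far: "\<And>s. s \<in> S \<Longrightarrow> 65536 * scale i \<le> infnorm (x - s)"
        using layerE[OF x s0] by blast
      have xs: "x \<in> strip i 0 (z i)" using z(2)[of i] by simp
      let ?s = "grid_point S (scale i) (z i)"
      have s: "?s \<in> S" using z(1)[of i] by (intro grid_point(1)) simp
      have xd: "infnorm (x - ?s) \<le> 131073 * scale i" using xs by (simp add: strip_def cube_def)
      have f2: "\<forall>s'\<in>S. 2 * scale i \<le> infnorm (x - s')" using far scale_pos[of i] by force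
      have "ennreal \<bar>F x\<bar> \<le> ennreal (CS * scale i powr (- d)) * err f (\<lambda>x. 0) ?s (21 * (131073 + 1) * scale i)"
        by (rule sup[OF wh f F s xd scale_pos f2])
      also have "\<dots> \<le> ennreal (CS * scale i powr (- d)) * err f (\<lambda>x. 0) ?s (4194304 * scale i)"
        by (intro mult_left_mono err_mono cube_mono) (simp_all add: infnorm_0 scale_pos less_imp_le)
      finally have "ennreal_powr (ennreal \<bar>F x\<bar>) p \<le> ennreal_powr (ennreal (CS * scale i powr (- d)) * err f (\<lambda>x. 0) ?s (4194304 * scale i)) p"
        by (rule ennreal_powr_mono[OF _ p0])
      also have "\<dots> = ennreal (w i 0) * E i (z i)"
        using CS by (simp add: ennreal_powr_mult[OF p0] ennreal_powr_ennreal w_def E_def)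
      also have "\<dots> \<le> (\<Sum>j. \<Sum>l. \<integral>\<^sup>+z. ennreal (w j l) * E j z * indicator (strip j l z) x \<partial>count_space (grid_index (scale j) ` S))"
        by (rule strip_term_le[OF z(1)[OF order_refl] xs])
      finally show ?thesis .
    next
      case False
      have "F x = 0"
      proof (rule far_zero[OF wh F])
        show "100000 \<le> infnorm (x - s)" if "s \<in> S" for s using False that by force
      qed (simp add: infnorm_0)
      then show ?thesis by (simp add: ennreal_powr_zero)
    qed
    have "(\<integral>\<^sup>+x. ennreal_powr (ennreal \<bar>F x\<bar>) p \<partial>lebesgue)
      \<le> (\<Sum>j. \<Sum>l. ennreal (w j l * CV * (scale (j + l) powr (?n - d) * scale j powr d)) * (\<integral>\<^sup>+z. E j z \<partial>count_space (grid_index (scale j) ` S)))"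
      by (rule int) (use pt in \<open>auto simp: w_def\<close>)
    also have "\<dots> \<le> (\<Sum>j. ennreal (K * r ^ j) * Y)"
    proof (intro suminf_le summableI)
      fix j
      have "(\<Sum>l. ennreal (w j l * CV * (scale (j + l) powr (?n - d) * scale j powr d)) * (\<integral>\<^sup>+z. E j z \<partial>count_space (grid_index (scale j) ` S)))
          = ennreal (w j 0 * CV * (scale (j + 0) powr (?n - d) * scale j powr d)) * (\<integral>\<^sup>+z. E j z \<partial>count_space (grid_index (scale j) ` S))"
        by (subst suminf_finite[of "{0}"]) (auto simp: w_def)
      also have "\<dots> \<le> ennreal (w j 0 * CV * (scale (j + 0) powr (?n - d) * scale j powr d)) *
          (ennreal (2 powr p * (c2 * (4194304 * scale j) powr d) powr (p - 1) * cnt) * Y)"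
      proof (rule mult_left_mono)
        have "4194304 * scale j \<le> R" using scale_le_1[of j] R by simp
        then show "(\<integral>\<^sup>+z. E j z \<partial>count_space (grid_index (scale j) ` S)) \<le> ennreal (2 powr p * (c2 * (4194304 * scale j) powr d) powr (p - 1) * cnt) * Y"
          unfolding E_def Y_def cnt_def by (intro grid_sum_f[OF p f scale_pos]) simp_all
      qed simp
      also have "\<dots> = ennreal (w j 0 * CV * (scale (j + 0) powr (?n - d) * scale j powr d) * (2 powr p * (c2 * (4194304 * scale j) powr d) powr (p - 1) * cnt)) * Y"
        using CV cnt by (subst ennreal_mult) (auto simp: w_def mult.assoc)
      also have "w j 0 * CV * (scale (j + 0) powr (?n - d) * scale j powr d) * (2 powr p * (c2 * (4194304 * scale j) powr d) powr (p - 1) * cnt) = K * r ^ j"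
      proof -
        have e1: "w j 0 = CS powr p * scale j powr (- d * p)" using CS by (simp add: w_def powr_mult powr_powr)
        have e2: "(c2 * (4194304 * scale j) powr d) powr (p - 1) = (c2 * 4194304 powr d) powr (p - 1) * scale j powr (d * (p - 1))"
          using c2_pos scale_pos[of j] by (simp add: powr_mult powr_powr)
        \<comment> \<open>The exponents: \<open>- d * p\<close> from \<open>far_sup\<close>,
          \<open>n\<close> from the volume, \<open>d * (p - 1)\<close> from Hoelder; their sum is
          \<open>n - d\<close>.\<close>
        have e3: "scale j powr (- d * p) * (scale j powr (?n - d) * scale j powr d) * scale j powr (d * (p - 1)) = r ^ j"
          using scale_pos[of j] by (simp only: powr_add[symmetric] r_def scale_powr_power[symmetric]) (simp add: algebra_simps)
        show ?thesis unfolding e1 e2 e3[symmetric] K_def G_def add_0_right by (simp only: mult_ac)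
      qed
      finally show "(\<Sum>l. ennreal (w j l * CV * (scale (j + l) powr (?n - d) * scale j powr d)) * (\<integral>\<^sup>+z. E j z \<partial>count_space (grid_index (scale j) ` S))) \<le> ennreal (K * r ^ j) * Y" .
    qed
    also have "\<dots> = (\<Sum>j. ennreal (K * r ^ j)) * Y" by (rule ennreal_suminf_multc)
    also have "(\<Sum>j. ennreal (K * r ^ j)) = ennreal (K / (1 - r))"
      by (rule suminf_geometric_ennreal) (use K r in auto)
    finally show "(\<integral>\<^sup>+x. ennreal_powr (ennreal \<bar>F x\<bar>) p \<partial>lebesgue) \<le> ennreal (K / (1 - r)) * (\<integral>\<^sup>+u. ennreal_powr (ennreal \<bar>f u\<bar>) p \<partial>N)"
      unfolding Y_def .
  qed
qed

text \<open>For \<open>j < 23\<close> the cubes of radius \<open>4194304 * scale j = 2 ^ (22 - j)\<close> are too large to be compared with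
  those of the theorem, whose radii are at most \<open>1\<close>; these finitely many terms are controlled by the
  norm of \<open>f\<close> itself.\<close>

definition grid_err :: "nat \<Rightarrow> (real ^ 'n \<Rightarrow> real) \<Rightarrow> nat \<Rightarrow> ('n \<Rightarrow> int) \<Rightarrow> ennreal" where
  "grid_err m f j z = (if j < 23 then err f (\<lambda>x. 0) (grid_point S (scale j) z) (4194304 * scale j)
     else INF P\<in>poly_space (int m). err f P (grid_point S (scale j) z) (4194304 * scale j))"

text \<open>The factor \<open>21 * (131073 + 1)\<close> is rounded up to \<open>2 ^ 22\<close>. From
  level 23 on every P is admissible and the infimum may be taken; on the coarser levels P = 0 is
  used, in accordance with \<open>grid_err\<close>.\<close>

lemma le_grid_err:
  assumes c: "0 < c" and le: "\<And>P. P \<in> poly_space (int m) \<Longrightarrow> (131073 + 1) * scale j \<le> 8000 \<or> P = (\<lambda>x. 0) \<Longrightarrow>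
    X \<le> ennreal c * err f P (grid_point S (scale j) z) (21 * (131073 + 1) * scale j)"
  shows "X \<le> ennreal c * grid_err m f j z"
proof -
  have mono: "err f P (grid_point S (scale j) z) (21 * (131073 + 1) * scale j) \<le> err f P (grid_point S (scale j) z) (4194304 * scale j)" for P
    by (intro err_mono cube_mono) (simp add: infnorm_0 scale_pos less_imp_le)
  have le': "X \<le> ennreal c * err f P (grid_point S (scale j) z) (4194304 * scale j)"
    if "P \<in> poly_space (int m)" "(131073 + 1) * scale j \<le> 8000 \<or> P = (\<lambda>x. 0)" for P
    using le[OF that] mult_left_mono[OF mono, of "ennreal c" P] by (rule order_trans) simp
  show ?thesis
  proof (cases "j < 23")
    case True
    then show ?thesis using le'[of "\<lambda>x. 0"] by (simp add: grid_err_def poly_space_zero)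
  next
    case False
    then have "(131073 + 1) * scale j \<le> 8000" using scale_23[of j] by simp
    then have "X \<le> ennreal c * (INF P\<in>poly_space (int m). err f P (grid_point S (scale j) z) (4194304 * scale j))"
      by (intro le_cmult_INF[OF c] le') auto
    then show ?thesis using False by (simp add: grid_err_def)
  qed
qed

lemma near_approx:
  assumes R: "4194304 \<le> R"
  obtains C where "0 < C" "\<And>W \<phi> a C\<^sub>\<phi> f F j z x. whitney S W \<phi> a (Suc m) C\<^sub>\<phi> \<Longrightarrow> loc_int f \<Longrightarrow>
    \<forall>y. y \<notin> S \<longrightarrow> F y = (\<Sum>\<^sub>\<infinity>Q\<in>W. \<phi> Q y * wproj N a m Q f y) \<Longrightarrow>
    z \<in> grid_index (scale j) ` S \<Longrightarrow> x \<in> cube (grid_point S (scale j) z) (131073 * scale j) \<Longrightarrow>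
    local_approx (Suc m) lebesgue F (cube x (scale j)) \<le> ennreal (C * scale j powr (- d)) * grid_err m f j z"
proof -
  let ?n = "CARD('n)"
  have R': "8000 \<le> R" and L: "(1::real) \<le> 131073" using R by simp_all
  obtain C0 where C0: "0 < C0" and near: "\<And>W \<phi> a C\<^sub>\<phi> f F P x s t. whitney S W \<phi> a (Suc m) C\<^sub>\<phi> \<Longrightarrow> loc_int f \<Longrightarrow>
    (\<forall>y. y \<notin> S \<longrightarrow> F y = (\<Sum>\<^sub>\<infinity>Q\<in>W. \<phi> Q y * wproj N a m Q f y)) \<Longrightarrow>
    P \<in> poly_space (int m) \<Longrightarrow> s \<in> S \<Longrightarrow> infnorm (x - s) \<le> 131073 * t \<Longrightarrow> 0 < t \<Longrightarrow>
    (131073 + 1) * t \<le> 8000 \<or> P = (\<lambda>x. 0) \<Longrightarrow>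
    (\<integral>\<^sup>+y\<in>cube x t. ennreal \<bar>F y - P y\<bar> \<partial>lebesgue) \<le> ennreal (C0 * t powr (real ?n - d)) * err f P s (21 * (131073 + 1) * t)"
    using near_estimate[OF R' L, of m] by blast
  define C where "C = C0 / 2 ^ ?n"
  have C: "0 < C" using C0 by (simp add: C_def)
  show ?thesis
  proof (rule that[OF C])
    fix W \<phi> a C\<^sub>\<phi> f and F :: "real ^ 'n \<Rightarrow> real" and j z x
    assume wh: "whitney S W \<phi> a (Suc m) C\<^sub>\<phi>" and f: "loc_int f"
      and F: "\<forall>y. y \<notin> S \<longrightarrow> F y = (\<Sum>\<^sub>\<infinity>Q\<in>W. \<phi> Q y * wproj N a m Q f y)"
      and z: "z \<in> grid_index (scale j) ` S" and x: "x \<in> cube (grid_point S (scale j) z) (131073 * scale j)"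
    have xs: "infnorm (x - grid_point S (scale j) z) \<le> 131073 * scale j" using x by (simp add: cube_def)
    have e: "emeasure lebesgue (cube x (scale j)) = ennreal ((2 * scale j) ^ ?n)"
      by (intro emeasure_cube less_imp_le scale_pos)
    have ev: "(2 * scale j) ^ ?n * (C * scale j powr (- d)) = C0 * scale j powr (real ?n - d)"
      using scale_pos[of j] by (simp add: C_def power_mult_distrib powr_diff powr_realpow powr_minus divide_inverse)
    show "local_approx (Suc m) lebesgue F (cube x (scale j)) \<le> ennreal (C * scale j powr (- d)) * grid_err m f j z"
    proof (rule le_grid_err)
      show "0 < C * scale j powr (- d)" using C scale_pos[of j] by simp
      fix P :: "real ^ 'n \<Rightarrow> real"
      assume P: "P \<in> poly_space (int m)" and alt: "(131073 + 1) * scale j \<le> 8000 \<or> P = (\<lambda>x. 0)"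
      let ?E = "err f P (grid_point S (scale j) z) (21 * (131073 + 1) * scale j)"
      have "(\<integral>\<^sup>+y\<in>cube x (scale j). ennreal \<bar>F y - P y\<bar> \<partial>lebesgue) / emeasure lebesgue (cube x (scale j)) \<le> ennreal (C * scale j powr (- d)) * ?E"
      proof (rule divide_le_posI_ennreal)
        show "0 < emeasure lebesgue (cube x (scale j))" unfolding e using scale_pos[of j] by simp
        have "(\<integral>\<^sup>+y\<in>cube x (scale j). ennreal \<bar>F y - P y\<bar> \<partial>lebesgue) \<le> ennreal (C0 * scale j powr (real ?n - d)) * ?E"
          by (rule near[OF wh f F P grid_point(1)[OF z] xs scale_pos alt])
        also have "ennreal (C0 * scale j powr (real ?n - d)) = emeasure lebesgue (cube x (scale j)) * ennreal (C * scale j powr (- d))"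
          unfolding e ev[symmetric] by (rule ennreal_mult) (use C scale_pos[of j] in auto)
        finally show "(\<integral>\<^sup>+y\<in>cube x (scale j). ennreal \<bar>F y - P y\<bar> \<partial>lebesgue)
           \<le> emeasure lebesgue (cube x (scale j)) * (ennreal (C * scale j powr (- d)) * ?E)" by (simp only: mult.assoc)
      qed
      then show "local_approx (Suc m) lebesgue F (cube x (scale j)) \<le> ennreal (C * scale j powr (- d)) * ?E"
        unfolding local_approx_def by (intro INF_lower2[of P]) (use P in simp_all)
    qed
  qed
qed

lemma far_approx:
  assumes R: "4194304 \<le> R" and C\<^sub>\<phi>: "0 < C\<^sub>\<phi>"
  obtains C where "0 < C" "\<And>W \<phi> a f F i l z x. whitney S W \<phi> a (Suc m) C\<^sub>\<phi> \<Longrightarrow> loc_int f \<Longrightarrow>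
    \<forall>y. y \<notin> S \<longrightarrow> F y = (\<Sum>\<^sub>\<infinity>Q\<in>W. \<phi> Q y * wproj N a m Q f y) \<Longrightarrow>
    z \<in> grid_index (scale i) ` S \<Longrightarrow> x \<in> cube (grid_point S (scale i) z) (131073 * scale i) \<Longrightarrow>
    (\<And>s. s \<in> S \<Longrightarrow> 65536 * scale i \<le> infnorm (x - s)) \<Longrightarrow> i < l \<Longrightarrow>
    local_approx (Suc m) lebesgue F (cube x (scale l)) \<le> ennreal (C * (scale l / scale i) ^ Suc m * scale i powr (- d)) * grid_err m f i z"
proof -
  have R': "8000 \<le> R" and L: "(1::real) \<le> 131073" using R by simp_all
  obtain C where C: "0 < C" and far: "\<And>W \<phi> a f F P x s t \<tau>. whitney S W \<phi> a (Suc m) C\<^sub>\<phi> \<Longrightarrow> loc_int f \<Longrightarrow>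
    (\<forall>y. y \<notin> S \<longrightarrow> F y = (\<Sum>\<^sub>\<infinity>Q\<in>W. \<phi> Q y * wproj N a m Q f y)) \<Longrightarrow>
    P \<in> poly_space (int m) \<Longrightarrow> s \<in> S \<Longrightarrow> infnorm (x - s) \<le> 131073 * \<tau> \<Longrightarrow> 0 < \<tau> \<Longrightarrow>
    (\<forall>s'\<in>S. 2 * \<tau> \<le> infnorm (x - s')) \<Longrightarrow> 0 < t \<Longrightarrow> t \<le> \<tau> / 2 \<Longrightarrow>
    (131073 + 1) * \<tau> \<le> 8000 \<or> P = (\<lambda>x. 0) \<Longrightarrow>
    local_approx (Suc m) lebesgue F (cube x t)
      \<le> ennreal (C * (t / \<tau>) ^ Suc m * \<tau> powr (- d)) * err f P s (21 * (131073 + 1) * \<tau>)"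
    using far_estimate[OF R' L C\<^sub>\<phi>, of m] by blast
  show ?thesis
  proof (rule that[OF C])
    fix W \<phi> a f and F :: "real ^ 'n \<Rightarrow> real" and i l z x
    assume wh: "whitney S W \<phi> a (Suc m) C\<^sub>\<phi>" and f: "loc_int f"
      and F: "\<forall>y. y \<notin> S \<longrightarrow> F y = (\<Sum>\<^sub>\<infinity>Q\<in>W. \<phi> Q y * wproj N a m Q f y)"
      and z: "z \<in> grid_index (scale i) ` S" and x: "x \<in> cube (grid_point S (scale i) z) (131073 * scale i)"
      and d: "\<And>s. s \<in> S \<Longrightarrow> 65536 * scale i \<le> infnorm (x - s)" and l: "i < l"
    have xs: "infnorm (x - grid_point S (scale i) z) \<le> 131073 * scale i" using x by (simp add: cube_def)
    have d2: "\<forall>s'\<in>S. 2 * scale i \<le> infnorm (x - s')" using d scale_pos[of i] by force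
    have "scale l \<le> scale (Suc i)" using l by (intro scale_mono) simp
    then have l2: "scale l \<le> scale i / 2" by (simp add: scale_Suc)
    show "local_approx (Suc m) lebesgue F (cube x (scale l)) \<le> ennreal (C * (scale l / scale i) ^ Suc m * scale i powr (- d)) * grid_err m f i z"
    proof (rule le_grid_err)
      show "0 < C * (scale l / scale i) ^ Suc m * scale i powr (- d)"
        using C scale_pos[of i] scale_pos[of l] by (intro mult_pos_pos zero_less_power divide_pos_pos) auto
    qed (rule far[OF wh f F _ grid_point(1)[OF z] xs scale_pos d2 scale_pos l2])
  qed
qed

text \<open>Levels up to i are estimated each at its own grid point, levels beyond i all at the grid
  point of level i. Instead of Hoelder's inequality for the sum over levels, the largest weighted
  term is singled out: its p-th power is one summand of the sum over strips, whatever level attains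
  it.\<close>

lemma ext_approx_bound:
  assumes R: "4194304 \<le> R" and p: "1 \<le> p" and \<alpha>: "0 < \<alpha>" "\<alpha> < real (Suc m)" and C\<^sub>\<phi>: "0 < C\<^sub>\<phi>"
  obtains C where "0 < C" "\<And>W \<phi> a f F. whitney S W \<phi> a (Suc m) C\<^sub>\<phi> \<Longrightarrow> loc_int f \<Longrightarrow>
    \<forall>y. y \<notin> S \<longrightarrow> F y = (\<Sum>\<^sub>\<infinity>Q\<in>W. \<phi> Q y * wproj N a m Q f y) \<Longrightarrow>
    (\<integral>\<^sup>+x. ennreal_powr (\<Sum>j. ennreal (2 powr (real j * \<alpha>)) * local_approx (Suc m) lebesgue F (cube x (scale j))) p \<partial>lebesgue)
    \<le> ennreal C * ((\<Sum>j. ennreal (2 powr (real j * (p * \<alpha> - (real CARD('n) - d)))) *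
          (\<integral>\<^sup>+u. ennreal_powr (local_approx (Suc m) N f (cube u (scale j) \<inter> S)) p \<partial>N))
        + (\<integral>\<^sup>+u. ennreal_powr (ennreal \<bar>f u\<bar>) p \<partial>N))"
proof -
  let ?n = "real CARD('n)"
  have p0: "0 < p" using p by simp
  define \<kappa> where "\<kappa> = ?n - d"
  have \<kappa>: "0 < \<kappa>" using d_lt by (simp add: \<kappa>_def)
  obtain CN where CN: "0 < CN" and near: "\<And>W \<phi> a C\<^sub>\<phi> f F j z x. whitney S W \<phi> a (Suc m) C\<^sub>\<phi> \<Longrightarrow> loc_int f \<Longrightarrow>
    \<forall>y. y \<notin> S \<longrightarrow> F y = (\<Sum>\<^sub>\<infinity>Q\<in>W. \<phi> Q y * wproj N a m Q f y) \<Longrightarrow>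
    z \<in> grid_index (scale j) ` S \<Longrightarrow> x \<in> cube (grid_point S (scale j) z) (131073 * scale j) \<Longrightarrow>
    local_approx (Suc m) lebesgue F (cube x (scale j)) \<le> ennreal (CN * scale j powr (- d)) * grid_err m f j z"
    using near_approx[OF R, of m] by blast
  obtain CF where CF: "0 < CF" and far: "\<And>W \<phi> a f F i l z x. whitney S W \<phi> a (Suc m) C\<^sub>\<phi> \<Longrightarrow> loc_int f \<Longrightarrow>
    \<forall>y. y \<notin> S \<longrightarrow> F y = (\<Sum>\<^sub>\<infinity>Q\<in>W. \<phi> Q y * wproj N a m Q f y) \<Longrightarrow>
    z \<in> grid_index (scale i) ` S \<Longrightarrow> x \<in> cube (grid_point S (scale i) z) (131073 * scale i) \<Longrightarrow>
    (\<And>s. s \<in> S \<Longrightarrow> 65536 * scale i \<le> infnorm (x - s)) \<Longrightarrow> i < l \<Longrightarrow>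
    local_approx (Suc m) lebesgue F (cube x (scale l)) \<le> ennreal (CF * (scale l / scale i) ^ Suc m * scale i powr (- d)) * grid_err m f i z"
    using far_approx[OF R C\<^sub>\<phi>, of m] by blast
  obtain CV where CV: "0 < CV" and int: "\<And>H w E. (\<And>j l. 0 \<le> w j l) \<Longrightarrow>
    (\<And>x. x \<notin> S \<Longrightarrow> H x \<le> (\<Sum>j. \<Sum>l. \<integral>\<^sup>+z. ennreal (w j l) * E j z * indicator (strip j l z) x \<partial>count_space (grid_index (scale j) ` S))) \<Longrightarrow>
    (\<integral>\<^sup>+x. H x \<partial>lebesgue) \<le> (\<Sum>j. \<Sum>l. ennreal (w j l * CV * (scale (j + l) powr (?n - d) * scale j powr d)) *
       (\<integral>\<^sup>+z. E j z \<partial>count_space (grid_index (scale j) ` S)))"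
    using strip_integral[OF R] by blast
  \<comment> \<open>\<delta> spends half of the volume gain \<kappa>:
    \<open>(\<theta> powr (- real l)) powr p\<close> grows like
    \<open>2 powr (\<kappa> / 2 * l)\<close>, against the decay
    \<open>2 powr (- \<kappa> * l)\<close> of the strips; the ratio r below is what remains.\<close>
  define \<delta> where "\<delta> = \<kappa> / (2 * p)"
  have \<delta>: "0 < \<delta>" using \<kappa> p0 by (simp add: \<delta>_def)
  define \<theta> :: real where "\<theta> = 2 powr (- \<delta>)"
  have \<theta>: "0 < \<theta>" "\<theta> < 1" using \<delta> powr_less_mono[of "- \<delta>" 0 2] by (auto simp: \<theta>_def)
  \<comment> \<open>Beyond level i each further level multiplies the bound by
    \<open>2 powr \<alpha>\<close> and by \<open>2 powr (- real (Suc m))\<close>.\<close>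
  define q :: real where "q = 2 powr (- (real (Suc m) - \<alpha>))"
  have q: "0 < q" "q < 1" using \<alpha> powr_less_mono[of "- (real (Suc m) - \<alpha>)" 0 2] by (auto simp: q_def)
  define \<psi> where "\<psi> = max \<theta> q"
  have \<psi>: "0 < \<psi>" "\<psi> < 1" using \<theta> q by (auto simp: \<psi>_def)
  define C0 where "C0 = max CN CF"
  have C0: "0 < C0" using CN by (simp add: C0_def)
  define K0 where "K0 = 2 * C0 / (1 - \<psi>)"
  have K0: "0 < K0" using C0 \<psi> by (simp add: K0_def)
  define r :: real where "r = 2 powr (- (\<kappa> / 2))"
  have r: "0 < r" "r < 1" using \<kappa> powr_less_mono[of "- (\<kappa> / 2)" 0 2] by (auto simp: r_def)
  \<comment> \<open>The power of \<open>scale j\<close> left after collecting: \<open>n\<close> from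
    the volume and \<open>- (\<alpha> + d) * p\<close> from the p-th power of the term.\<close>
  define e where "e = ?n - (\<alpha> + d) * p"
  define D where "D = K0 powr p * CV / (1 - r)"
  have D: "0 < D" using K0 CV r by (simp add: D_def)
  define cnt where "cnt = real ((nat \<lfloor>2 * (4194304 + 1) :: real\<rfloor> + 1) ^ CARD('n))"
  have cnt: "0 < cnt" unfolding cnt_def by simp
  define G where "G = 2 powr p * (c2 * 4194304 powr d) powr (p - 1) * cnt"
  \<comment> \<open>The exponent e may be negative; for the 23 coarse levels
    \<open>2 powr (23 * \<bar>e\<bar>)\<close> bounds \<open>scale j powr e\<close> in either
    case.\<close>
  define K1 where "K1 = D * 2 powr (23 * \<bar>e\<bar>) * G"
  have K1: "0 < K1" using D cnt c2_pos by (simp add: K1_def G_def)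
  define K2 where "K2 = D * scale 23 powr e * (c2 powr p * 5 ^ CARD('n)) / (c1 * scale 23 powr d)"
  have K2: "0 < K2" using D c1_pos c2_pos scale_pos[of 23] by (simp add: K2_def)
  have "0 < 23 * K1 + K2" using K1 K2 by simp
  then show ?thesis
  proof (rule that)
    fix W \<phi> a f and F :: "real ^ 'n \<Rightarrow> real"
    assume wh: "whitney S W \<phi> a (Suc m) C\<^sub>\<phi>" and f: "loc_int f"
      and F: "\<forall>y. y \<notin> S \<longrightarrow> F y = (\<Sum>\<^sub>\<infinity>Q\<in>W. \<phi> Q y * wproj N a m Q f y)"
    define Y where "Y = (\<integral>\<^sup>+u. ennreal_powr (ennreal \<bar>f u\<bar>) p \<partial>N)"
    define Z where "Z j = (\<integral>\<^sup>+u. ennreal_powr (local_approx (Suc m) N f (cube u (scale j) \<inter> S)) p \<partial>N)" for j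
    define X where "X = (\<Sum>j. ennreal (2 powr (real j * (p * \<alpha> - (?n - d)))) * Z j)"
    define LA where "LA x j = local_approx (Suc m) lebesgue F (cube x (scale j))" for x j
    define E where "E j z = ennreal_powr (grid_err m f j z) p" for j z
    define w where "w j l = K0 powr p * ((\<theta> powr (- real l)) powr p * (scale j powr (- (\<alpha> + d))) powr p)" for j l :: nat
    have pt: "ennreal_powr (\<Sum>j. ennreal (2 powr (real j * \<alpha>)) * LA x j) p
      \<le> (\<Sum>j. \<Sum>l. \<integral>\<^sup>+z. ennreal (w j l) * E j z * indicator (strip j l z) x \<partial>count_space (grid_index (scale j) ` S))"
      if x: "x \<notin> S" for x
    proof (cases "\<exists>s0\<in>S. infnorm (x - s0) < 131072")
      case True
      then obtain s0 where s0: "s0 \<in> S" "infnorm (x - s0) < 131072" by blast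
      obtain i z where z: "\<And>j. j \<le> i \<Longrightarrow> z j \<in> grid_index (scale j) ` S" "\<And>j. j \<le> i \<Longrightarrow> x \<in> strip j (i - j) (z j)"
        and dS: "\<And>s. s \<in> S \<Longrightarrow> 65536 * scale i \<le> infnorm (x - s)"
        using layerE[OF x s0] by blast
      have xc: "x \<in> cube (grid_point S (scale j) (z j)) (131073 * scale j)" if "j \<le> i" for j
        using z(2)[OF that] by (simp add: strip_def)
      \<comment> \<open>h is the contribution of level j at its own grid point; g enlarges it away
        from i by the factor that the geometric weights in \<theta> take back.\<close>
      define h where "h j = ennreal (scale j powr (- (\<alpha> + d))) * grid_err m f j (z j)" for j
      define g where "g j = ennreal (\<theta> powr (- real (i - j))) * h j" for j
      have "Max (g ` {..i}) \<in> g ` {..i}" by (rule Max_in) auto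
      then obtain j0 where j0: "j0 \<le> i" "Max (g ` {..i}) = g j0" by (metis imageE atMost_iff)
      have max: "g j \<le> g j0" if "j \<le> i" for j unfolding j0(2)[symmetric] using that by (intro Max_ge) auto
      have A: "ennreal (2 powr (real l * \<alpha>)) * LA x l \<le> ennreal (C0 * \<psi> ^ ndist l i) * g j0" for l
      proof (cases "l \<le> i")
        case True
        have c1: "2 powr (real l * \<alpha>) * (CN * scale l powr (- d)) = CN * \<theta> ^ (i - l) * (\<theta> powr (- real (i - l)) * scale l powr (- (\<alpha> + d)))"
        proof -
          have "\<theta> ^ (i - l) * \<theta> powr (- real (i - l)) = 1"
            using \<theta> by (simp add: powr_realpow[symmetric] powr_add[symmetric])
          moreover have "2 powr (real l * \<alpha>) * scale l powr (- d) = scale l powr (- (\<alpha> + d))"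
            by (simp add: scale_powr powr_add[symmetric] algebra_simps)
          ultimately show ?thesis by (simp only: mult_ac) (metis mult.assoc mult.commute mult.left_neutral)
        qed
        have "ennreal (2 powr (real l * \<alpha>)) * LA x l \<le> ennreal (2 powr (real l * \<alpha>)) * (ennreal (CN * scale l powr (- d)) * grid_err m f l (z l))"
          unfolding LA_def by (intro mult_left_mono near[OF wh f F z(1)[OF True] xc[OF True]]) simp
        also have "\<dots> = ennreal (CN * \<theta> ^ (i - l)) * g l"
        proof -
          have "ennreal (2 powr (real l * \<alpha>)) * ennreal (CN * scale l powr (- d))
              = ennreal (CN * \<theta> ^ (i - l)) * (ennreal (\<theta> powr (- real (i - l))) * ennreal (scale l powr (- (\<alpha> + d))))"
            using CN \<theta> by (simp only: ennreal_mult[symmetric] c1 powr_ge_zero mult_nonneg_nonneg less_imp_le zero_le_power)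
          then show ?thesis by (simp only: g_def h_def mult.assoc[symmetric])
        qed
        also have "\<dots> \<le> ennreal (C0 * \<psi> ^ ndist l i) * g j0"
        proof (rule mult_mono[OF ennreal_leI max[OF True]])
          show "CN * \<theta> ^ (i - l) \<le> C0 * \<psi> ^ ndist l i"
            using True CN \<theta> by (auto simp: ndist_def C0_def \<psi>_def intro!: mult_mono power_mono)
        qed auto
        finally show ?thesis .
      next
        case False
        then have il: "i < l" by simp
        have c1: "2 powr (real l * \<alpha>) * (CF * (scale l / scale i) ^ Suc m * scale i powr (- d)) = CF * q ^ (l - i) * scale i powr (- (\<alpha> + d))"
        proof -
          have sl: "scale l / scale i = scale (l - i)"
            using scale_add[of i "l - i"] il scale_pos[of i] by (simp add: field_simps)
          have "2 powr (real l * \<alpha>) = scale (l - i) powr (- \<alpha>) * scale i powr (- \<alpha>)"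
            using il by (simp add: scale_powr powr_add[symmetric] of_nat_diff algebra_simps)
          moreover have "scale (l - i) ^ Suc m = scale (l - i) powr real (Suc m)"
            using scale_pos by (simp only: powr_realpow)
          moreover have "scale (l - i) powr (- \<alpha>) * scale (l - i) powr real (Suc m) = q ^ (l - i)"
            unfolding q_def scale_powr_power[symmetric] by (simp only: powr_add[symmetric]) (simp add: algebra_simps)
          moreover have "scale i powr (- \<alpha>) * scale i powr (- d) = scale i powr (- (\<alpha> + d))"
            by (simp only: powr_add[symmetric]) simp
          ultimately show ?thesis unfolding sl by (metis mult.assoc mult.left_commute)
        qed
        have "ennreal (2 powr (real l * \<alpha>)) * LA x l
            \<le> ennreal (2 powr (real l * \<alpha>)) * (ennreal (CF * (scale l / scale i) ^ Suc m * scale i powr (- d)) * grid_err m f i (z i))"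
          unfolding LA_def by (intro mult_left_mono far[OF wh f F z(1) xc dS il]) auto
        also have "\<dots> = ennreal (CF * q ^ (l - i)) * h i"
        proof -
          have nn: "0 \<le> CF * (scale l / scale i) ^ Suc m * scale i powr (- d)" "0 \<le> CF * q ^ (l - i)"
            using CF q scale_pos[of i] scale_pos[of l] by (auto intro!: mult_nonneg_nonneg zero_le_power divide_nonneg_nonneg less_imp_le)
          have "ennreal (2 powr (real l * \<alpha>)) * ennreal (CF * (scale l / scale i) ^ Suc m * scale i powr (- d))
              = ennreal (CF * q ^ (l - i)) * ennreal (scale i powr (- (\<alpha> + d)))"
            by (simp only: ennreal_mult[symmetric] c1 powr_ge_zero nn)
          then show ?thesis by (simp only: h_def mult.assoc[symmetric])
        qed
        also have "\<dots> \<le> ennreal (C0 * \<psi> ^ ndist l i) * g j0"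
        proof (rule mult_mono[OF ennreal_leI])
          show "CF * q ^ (l - i) \<le> C0 * \<psi> ^ ndist l i"
            using il CF q by (auto simp: ndist_def C0_def \<psi>_def intro!: mult_mono power_mono)
          have "g i = h i" using \<theta> by (simp add: g_def)
          then show "h i \<le> g j0" using max[of i] by simp
        qed auto
        finally show ?thesis .
      qed
      have "(\<Sum>l. ennreal (2 powr (real l * \<alpha>)) * LA x l) \<le> ennreal K0 * g j0"
      proof (rule suminf_le_const[OF summableI])
        fix n
        have "(\<Sum>l<n. ennreal (2 powr (real l * \<alpha>)) * LA x l) \<le> (\<Sum>l<n. ennreal (C0 * \<psi> ^ ndist l i) * g j0)" by (rule sum_mono[OF A])
        also have "\<dots> = ennreal (\<Sum>l<n. C0 * \<psi> ^ ndist l i) * g j0"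
        proof -
          have "(\<Sum>l<n. ennreal (C0 * \<psi> ^ ndist l i)) = ennreal (\<Sum>l<n. C0 * \<psi> ^ ndist l i)"
            by (rule sum_ennreal) (use C0 \<psi> in auto)
          then show ?thesis by (simp only: sum_distrib_right[symmetric])
        qed
        also have "\<dots> \<le> ennreal K0 * g j0"
        proof (intro mult_right_mono ennreal_leI)
          have "(\<Sum>l<n. C0 * \<psi> ^ ndist l i) = C0 * (\<Sum>l<n. \<psi> ^ ndist l i)" by (rule sum_distrib_left[symmetric])
          also have "\<dots> \<le> C0 * (2 / (1 - \<psi>))" using C0 \<psi> by (intro mult_left_mono sum_power_ndist_le) auto
          finally show "(\<Sum>l<n. C0 * \<psi> ^ ndist l i) \<le> K0" by (simp add: K0_def mult.commute)
        qed simp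
        finally show "(\<Sum>l<n. ennreal (2 powr (real l * \<alpha>)) * LA x l) \<le> ennreal K0 * g j0" .
      qed
      then have "ennreal_powr (\<Sum>l. ennreal (2 powr (real l * \<alpha>)) * LA x l) p \<le> ennreal_powr (ennreal K0 * g j0) p"
        by (rule ennreal_powr_mono[OF _ p0])
      also have "\<dots> = ennreal (w j0 (i - j0)) * E j0 (z j0)"
      proof -
        have "ennreal_powr (ennreal K0 * g j0) p = ennreal (K0 powr p) * (ennreal ((\<theta> powr (- real (i - j0))) powr p) *
            (ennreal ((scale j0 powr (- (\<alpha> + d))) powr p) * E j0 (z j0)))"
          unfolding g_def h_def E_def ennreal_powr_mult[OF p0]
          by (simp only: ennreal_powr_ennreal[OF less_imp_le[OF K0]] ennreal_powr_ennreal[OF powr_ge_zero])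
        also have "\<dots> = ennreal (w j0 (i - j0)) * E j0 (z j0)"
          unfolding w_def by (simp only: ennreal_mult powr_ge_zero mult_nonneg_nonneg mult.assoc)
        finally show ?thesis .
      qed
      \<comment> \<open>By the choice of z, the point x lies in the strip with
        \<open>l = i - j0\<close> around the grid point of level j0.\<close>
      also have "\<dots> \<le> (\<Sum>j. \<Sum>l. \<integral>\<^sup>+z. ennreal (w j l) * E j z * indicator (strip j l z) x \<partial>count_space (grid_index (scale j) ` S))"
        by (rule strip_term_le[OF z[OF j0(1)]])
      finally show ?thesis .
    next
      case False
      \<comment> \<open>At distance 131072 or more from \<open>S\<close> the extension vanishes on
        all cubes of radius at most 1 around x, so the zero polynomial is exact.\<close>
      have d: "100000 \<le> infnorm (x - s)" if "s \<in> S" for s using False that by force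
      have "LA x j = 0" for j
      proof -
        have "LA x j \<le> 0" unfolding LA_def
        proof (rule local_approx_le_sup[OF scale_pos poly_space_zero])
          fix y assume y: "y \<in> cube x (scale j)"
          then have "infnorm (y - x) \<le> scale j" by (simp add: cube_def)
          then have "infnorm (y - x) \<le> 1" using scale_le_1[of j] by linarith
          then have "F y = 0" by (intro far_zero[OF wh F d])
          then show "ennreal \<bar>F y - 0\<bar> \<le> 0" by simp
        qed
        then show ?thesis by simp
      qed
      then show ?thesis by (simp add: ennreal_powr_zero)
    qed
    define Sj where "Sj j = (\<integral>\<^sup>+z. E j z \<partial>count_space (grid_index (scale j) ` S))" for j
    have "(\<integral>\<^sup>+x. ennreal_powr (\<Sum>j. ennreal (2 powr (real j * \<alpha>)) * LA x j) p \<partial>lebesgue)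
      \<le> (\<Sum>j. \<Sum>l. ennreal (w j l * CV * (scale (j + l) powr (?n - d) * scale j powr d)) * Sj j)"
      unfolding Sj_def by (rule int) (use pt in \<open>auto simp: w_def\<close>)
    also have "\<dots> = (\<Sum>j. ennreal (D * scale j powr e) * Sj j)"
    proof (rule suminf_cong)
      fix j
      have c: "w j l * CV * (scale (j + l) powr (?n - d) * scale j powr d) = (K0 powr p * CV * scale j powr e) * r ^ l" for l
      proof -
        have e1: "(\<theta> powr (- real l)) powr p * scale l powr \<kappa> = r ^ l"
        proof -
          have "(\<theta> powr (- real l)) powr p = 2 powr (\<kappa> / 2 * real l)"
            using p0 by (simp add: \<theta>_def \<delta>_def powr_powr mult_ac)
          then show ?thesis
            unfolding r_def scale_powr_power[symmetric] by (simp add: scale_powr powr_add[symmetric] algebra_simps)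
        qed
        have e2: "(scale j powr (- (\<alpha> + d))) powr p * scale j powr \<kappa> * scale j powr d = scale j powr e"
          unfolding powr_powr by (simp only: powr_add[symmetric]) (simp add: e_def \<kappa>_def algebra_simps)
        have e3: "scale (j + l) powr (?n - d) = scale j powr \<kappa> * scale l powr \<kappa>"
          using scale_pos[of j] scale_pos[of l] by (simp add: scale_add powr_mult \<kappa>_def)
        show ?thesis unfolding w_def e3 e1[symmetric] e2[symmetric] by (simp only: mult_ac)
      qed
      have "(\<Sum>l. ennreal (w j l * CV * (scale (j + l) powr (?n - d) * scale j powr d)) * Sj j)
          = (\<Sum>l. ennreal ((K0 powr p * CV * scale j powr e) * r ^ l)) * Sj j"
        unfolding c by (rule ennreal_suminf_multc)
      also have "(\<Sum>l. ennreal ((K0 powr p * CV * scale j powr e) * r ^ l)) = ennreal ((K0 powr p * CV * scale j powr e) / (1 - r))"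
        by (rule suminf_geometric_ennreal) (use K0 CV r in auto)
      also have "(K0 powr p * CV * scale j powr e) / (1 - r) = D * scale j powr e" by (simp add: D_def)
      finally show "(\<Sum>l. ennreal (w j l * CV * (scale (j + l) powr (?n - d) * scale j powr d)) * Sj j) = ennreal (D * scale j powr e) * Sj j" .
    qed
    also have "\<dots> \<le> of_nat 23 * (ennreal K1 * Y) + (\<Sum>i. ennreal K2 * (ennreal (2 powr (real i * (p * \<alpha> - (?n - d)))) * Z i))"
    proof (rule suminf_shift_le)
      fix j :: nat assume j: "j < 23"
      have sR: "4194304 * scale j \<le> R" using scale_le_1[of j] R by simp
      have "Sj j \<le> ennreal (2 powr p * (c2 * (4194304 * scale j) powr d) powr (p - 1) * cnt) * Y"
        unfolding Sj_def E_def grid_err_def Y_def cnt_def using j by (simp only: if_True) (intro grid_sum_f[OF p f scale_pos], simp_all add: sR)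
      also have "\<dots> \<le> ennreal G * Y"
      proof (intro mult_right_mono ennreal_leI)
        have "(4194304 * scale j) powr d \<le> 4194304 powr d"
          using scale_pos[of j] scale_le_1[of j] d_pos by (intro powr_mono2) auto
        then have "(c2 * (4194304 * scale j) powr d) powr (p - 1) \<le> (c2 * 4194304 powr d) powr (p - 1)"
          using c2_pos p by (intro powr_mono2[OF _ _ mult_left_mono]) auto
        then show "2 powr p * (c2 * (4194304 * scale j) powr d) powr (p - 1) * cnt \<le> G"
          unfolding G_def using cnt by (intro mult_right_mono mult_left_mono) auto
      qed simp
      finally have S: "Sj j \<le> ennreal G * Y" .
      have "- (real j * e) \<le> real j * \<bar>e\<bar>" by (metis abs_ge_minus_self abs_mult abs_of_nat)
      also have "\<dots> \<le> 23 * \<bar>e\<bar>" using j by (intro mult_right_mono) auto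
      finally have "scale j powr e \<le> 2 powr (23 * \<bar>e\<bar>)" unfolding scale_powr by (intro powr_mono) auto
      then have "ennreal (D * scale j powr e) * Sj j \<le> ennreal (D * 2 powr (23 * \<bar>e\<bar>)) * (ennreal G * Y)"
        using D S by (intro mult_mono[OF ennreal_leI S] mult_left_mono) auto
      also have "\<dots> = ennreal K1 * Y"
        unfolding K1_def using D by (subst ennreal_mult) (auto simp: G_def cnt_def mult.assoc)
      finally show "ennreal (D * scale j powr e) * Sj j \<le> ennreal K1 * Y" .
    next
      fix i
      have s23: "scale (23 + i) = scale 23 * scale i" by (rule scale_add)
      have "scale 23 = 1 / 8388608" by (simp add: scale_def powr_minus inverse_eq_divide)
      \<comment> \<open>Why the shift is by 23: a cube of radius
        \<open>2 ^ 22 * scale (23 + i)\<close> around a grid point, moved by one cell, fits into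
        radius \<open>scale i\<close>.\<close>
      then have le: "(4194304 + 1) * scale (23 + i) \<le> scale i" using scale_pos[of i] by (simp add: s23)
      have "Sj (23 + i) \<le> ennreal ((c2 * scale i powr d) powr p * 5 ^ CARD('n) / (c1 * scale (23 + i) powr d)) * Z i"
        unfolding Sj_def E_def grid_err_def Z_def
        using grid_sum_approx[OF p scale_pos _ le, where m = m and f = f] scale_le_1[of i] R by simp
      then have "ennreal (D * scale (23 + i) powr e) * Sj (23 + i)
          \<le> ennreal (D * scale (23 + i) powr e) * (ennreal ((c2 * scale i powr d) powr p * 5 ^ CARD('n) / (c1 * scale (23 + i) powr d)) * Z i)"
        by (rule mult_left_mono) simp
      also have "\<dots> = ennreal (D * scale (23 + i) powr e * ((c2 * scale i powr d) powr p * 5 ^ CARD('n) / (c1 * scale (23 + i) powr d))) * Z i"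
        using D c1_pos by (subst ennreal_mult[of "D * scale (23 + i) powr e"]) (auto simp: mult.assoc)
      also have "D * scale (23 + i) powr e * ((c2 * scale i powr d) powr p * 5 ^ CARD('n) / (c1 * scale (23 + i) powr d))
          = K2 * 2 powr (real i * (p * \<alpha> - (?n - d)))"
      proof -
        have a: "scale (23 + i) powr e = scale 23 powr e * scale i powr e" "scale (23 + i) powr d = scale 23 powr d * scale i powr d"
          unfolding s23 using scale_pos[of 23] scale_pos[of i] by (simp_all add: powr_mult)
        have b: "(c2 * scale i powr d) powr p = c2 powr p * scale i powr (d * p)" using c2_pos by (simp add: powr_mult powr_powr)
        \<comment> \<open>The exponents again: \<open>e + d * p - d\<close> is
          \<open>- (p * \<alpha> - (n - d))\<close>, the power that occurs in the theorem.\<close>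
        have c: "2 powr (real i * (p * \<alpha> - (?n - d))) = scale i powr e * scale i powr (d * p) / scale i powr d"
          by (simp add: scale_powr powr_add[symmetric] powr_diff[symmetric] e_def algebra_simps)
        show ?thesis unfolding a b c K2_def by (simp add: mult_ac)
      qed
      also have "ennreal (K2 * 2 powr (real i * (p * \<alpha> - (?n - d)))) = ennreal K2 * ennreal (2 powr (real i * (p * \<alpha> - (?n - d))))"
        by (rule ennreal_mult) (use K2 in auto)
      finally show "ennreal (D * scale (23 + i) powr e) * Sj (23 + i) \<le> ennreal K2 * (ennreal (2 powr (real i * (p * \<alpha> - (?n - d)))) * Z i)"
        by (simp only: mult.assoc)
    qed
    also have "(\<Sum>i. ennreal K2 * (ennreal (2 powr (real i * (p * \<alpha> - (?n - d)))) * Z i)) = ennreal K2 * X"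
      unfolding X_def by (rule ennreal_suminf_cmult)
    also have "of_nat 23 * (ennreal K1 * Y) = ennreal (23 * K1) * Y"
      using K1 by (simp add: ennreal_mult mult.assoc)
    also have "ennreal (23 * K1) * Y + ennreal K2 * X \<le> ennreal (23 * K1 + K2) * Y + ennreal (23 * K1 + K2) * X"
      using K1 K2 by (intro add_mono mult_right_mono ennreal_leI) auto
    also have "\<dots> = ennreal (23 * K1 + K2) * (X + Y)" by (simp add: distrib_left add.commute)
    finally show "(\<integral>\<^sup>+x. ennreal_powr (\<Sum>j. ennreal (2 powr (real j * \<alpha>)) * local_approx (Suc m) lebesgue F (cube x (scale j))) p \<partial>lebesgue)
    \<le> ennreal (23 * K1 + K2) * ((\<Sum>j. ennreal (2 powr (real j * (p * \<alpha> - (?n - d)))) *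
          (\<integral>\<^sup>+u. ennreal_powr (local_approx (Suc m) N f (cube u (scale j) \<inter> S)) p \<partial>N))
        + (\<integral>\<^sup>+u. ennreal_powr (ennreal \<bar>f u\<bar>) p \<partial>N))"
      unfolding X_def Y_def Z_def LA_def .
  qed
qed

end

section \<open>From Hausdorff measure to the abstract setting\<close>

lemma open_contains_cube:
  fixes x :: "real ^ 'n"
  assumes "open U" "x \<in> U" obtains e where "0 < e" "cube x e \<subseteq> U"
proof -
  obtain e where e: "0 < e" "ball x e \<subseteq> U" using assms open_contains_ball by blast
  define e' where "e' = e / (2 * sqrt (real DIM(real ^ 'n)))"
  have dm: "0 < sqrt (real DIM(real ^ 'n))" by simp
  have e': "0 < e'" using e dm unfolding e'_def by (intro divide_pos_pos mult_pos_pos) auto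
  have "cube x e' \<subseteq> ball x e"
  proof
    fix y assume "y \<in> cube x e'"
    then have "infnorm (y - x) \<le> e'" by (simp add: cube_def)
    then have "sqrt (real DIM(real ^ 'n)) * infnorm (y - x) \<le> sqrt (real DIM(real ^ 'n)) * e'"
      using dm by (intro mult_left_mono) auto
    also have "\<dots> = e / 2" using dm by (simp add: e'_def)
    finally have "norm (y - x) < e" using norm_le_infnorm[of "y - x"] e by simp
    then show "y \<in> ball x e" by (simp add: dist_norm norm_minus_commute)
  qed
  then show ?thesis using that e' e by blast
qed

text \<open>Every point of \<open>U\<close> in \<open>S\<close> lies in a cube of some dyadic scale
  around a grid point of \<open>S\<close> that stays inside \<open>U\<close>, and there are only
  countably many such cubes.\<close>

lemma sets_of_cubes:
  fixes S :: "(real ^ 'n) set"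
  assumes cubes: "\<And>w r. w \<in> S \<Longrightarrow> 0 < r \<Longrightarrow> r \<le> 1 \<Longrightarrow> cube w r \<inter> S \<in> sets M" and U: "open U"
  shows "U \<inter> S \<in> sets M"
proof -
  define I where "I j = {z \<in> grid_index (scale j) ` S. cube (grid_point S (scale j) z) (scale j) \<subseteq> U}" for j
  have "U \<inter> S = (\<Union>j. \<Union>z\<in>I j. cube (grid_point S (scale j) z) (scale j) \<inter> S)"
  proof (intro subset_antisym subsetI)
    fix x assume x: "x \<in> U \<inter> S"
    then obtain e where e: "0 < e" "cube x e \<subseteq> U" using open_contains_cube[OF U] by blast
    obtain j where j: "2 / e < 2 ^ j" using real_arch_pow[of 2] by auto
    have je: "2 * scale j \<le> e" using j e by (simp add: scale_def powr_minus powr_realpow field_simps)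
    let ?s = "grid_point S (scale j) (grid_index (scale j) x)"
    have xs: "infnorm (x - ?s) \<le> scale j" using x by (intro grid_point_close scale_pos) auto
    have "cube ?s (scale j) \<subseteq> cube x e"
      by (rule cube_mono) (use xs je infnorm_sub[of x ?s] in simp)
    then have "grid_index (scale j) x \<in> I j" using x e by (auto simp: I_def)
    then show "x \<in> (\<Union>j. \<Union>z\<in>I j. cube (grid_point S (scale j) z) (scale j) \<inter> S)"
      using xs x by (auto simp: cube_def)
  qed (auto simp: I_def)
  moreover have "(\<Union>j. \<Union>z\<in>I j. cube (grid_point S (scale j) z) (scale j) \<inter> S) \<in> sets M"
  proof -
    have "cube (grid_point S (scale j) z) (scale j) \<inter> S \<in> sets M" if "z \<in> I j" for j z
      using that by (intro cubes grid_point(1) scale_pos scale_le_1) (simp add: I_def)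
    then have "(\<Union>z\<in>I j. cube (grid_point S (scale j) z) (scale j) \<inter> S) \<in> sets M" for j
      by (intro sets.countable_UN'[OF countable_subset[OF subset_UNIV countableI_type]]) auto
    then show ?thesis by (intro sets.countable_UN) auto
  qed
  ultimately show ?thesis by simp
qed

text \<open>Beyond radius 1 the lower bound is inherited from the unit cube, and the upper bound
  from a cover by boundedly many unit cubes centred in \<open>S\<close>; both constants pay for the
  size of R.\<close>

lemma regular_measure_enlarge:
  assumes "regular_measure N S d c1 c2 1" and R: "1 \<le> R"
  obtains c1' c2' where "regular_measure N S d c1' c2' R"
proof -
  interpret regular_measure N S d c1 c2 1 by fact
  define cnt where "cnt = (nat \<lfloor>2 * ((R + 1) + 1)\<rfloor> + 1) ^ CARD('a)"
  define c1' where "c1' = c1 * R powr (- d)"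
  define c2' where "c2' = (real cnt + 1) * c2"
  have c1': "0 < c1'" "c1' \<le> c1"
  proof -
    have "R powr (- d) \<le> R powr 0" using R d_pos by (intro powr_mono) auto
    then show "0 < c1'" "c1' \<le> c1" using R c1_pos by (auto simp: c1'_def mult_left_le)
  qed
  have "0 \<le> real cnt * c2" using c2_pos by simp
  then have c2': "c2 \<le> c2'" by (simp add: c2'_def distrib_right)
  then have c2'_pos: "0 < c2'" using c2_pos by linarith
  have lo: "ennreal (c1' * r powr d) \<le> emeasure N (cube w r \<inter> S)" if w: "w \<in> S" and r: "0 < r" "r \<le> R" for w r
  proof (cases "r \<le> 1")
    case True
    have "ennreal (c1' * r powr d) \<le> ennreal (c1 * r powr d)" using c1' by (intro ennreal_leI mult_right_mono) auto
    also have "\<dots> \<le> emeasure N (cube w r \<inter> S)" by (rule lower[OF w r(1) True])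
    finally show ?thesis .
  next
    case False
    have "r powr d \<le> R powr d" using r d_pos by (intro powr_mono2) auto
    then have "c1' * r powr d \<le> c1' * R powr d" using c1' by (intro mult_left_mono) auto
    also have "\<dots> = c1 * 1 powr d" using R by (simp add: c1'_def powr_minus)
    finally have "ennreal (c1' * r powr d) \<le> ennreal (c1 * 1 powr d)" by (rule ennreal_leI)
    also have "\<dots> \<le> emeasure N (cube w 1 \<inter> S)" by (rule lower[OF w]) auto
    also have "\<dots> \<le> emeasure N (cube w r \<inter> S)"
      using False cube_mono[of w w 1 r] by (intro emeasure_mono sets_N cube_borel) (auto simp: infnorm_0)
    finally show ?thesis .
  qed
  have up: "emeasure N (cube w r \<inter> S) \<le> ennreal (c2' * r powr d)" if w: "w \<in> S" and r: "0 < r" "r \<le> R" for w r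
  proof (cases "r \<le> 1")
    case True
    have "emeasure N (cube w r \<inter> S) \<le> ennreal (c2 * r powr d)" by (rule upper[OF w r(1) True])
    also have "\<dots> \<le> ennreal (c2' * r powr d)" using c2' by (intro ennreal_leI mult_right_mono) auto
    finally show ?thesis .
  next
    case False
    define G where "G = {z \<in> grid_index 1 ` S. infnorm (grid_point S 1 z - w) \<le> (R + 1) * 1}"
    have G: "finite G" "card G \<le> cnt" unfolding G_def cnt_def using R by (intro finite_grid_point card_grid_point; simp)+
    have "cube w r \<inter> S \<subseteq> (\<Union>z\<in>G. cube (grid_point S 1 z) 1 \<inter> S)"
    proof
      fix x assume x: "x \<in> cube w r \<inter> S"
      have c: "infnorm (x - grid_point S 1 (grid_index 1 x)) \<le> 1" using x by (intro grid_point_close) auto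
      have "infnorm (grid_point S 1 (grid_index 1 x) - w) \<le> R + 1"
        using infnorm_triangle_sub[of "grid_point S 1 (grid_index 1 x)" w x] c x r infnorm_sub[of x "grid_point S 1 (grid_index 1 x)"] by (simp add: cube_def)
      then have "grid_index 1 x \<in> G" using x by (auto simp: G_def)
      then show "x \<in> (\<Union>z\<in>G. cube (grid_point S 1 z) 1 \<inter> S)" using c x by (auto simp: cube_def)
    qed
    then have "emeasure N (cube w r \<inter> S) \<le> emeasure N (\<Union>z\<in>G. cube (grid_point S 1 z) 1 \<inter> S)"
      using G by (intro emeasure_mono sets.finite_UN sets_N cube_borel) auto
    also have "\<dots> \<le> (\<Sum>z\<in>G. emeasure N (cube (grid_point S 1 z) 1 \<inter> S))"
      using G sets_N[OF cube_borel] by (intro emeasure_subadditive_finite) auto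
    also have "\<dots> \<le> ennreal (real cnt) * ennreal (c2 * 1 powr d)"
      using G by (intro sum_ennreal_const_le upper grid_point(1)) (auto simp: G_def)
    also have "\<dots> = ennreal (real cnt * c2)" using c2_pos by (simp add: ennreal_mult)
    also have "\<dots> \<le> ennreal (c2' * r powr d)"
    proof (rule ennreal_leI)
      have "1 powr d \<le> r powr d" using False d_pos by (intro powr_mono2) auto
      then have "c2' * 1 \<le> c2' * r powr d" using c2'_pos by (intro mult_left_mono) auto
      then show "real cnt * c2 \<le> c2' * r powr d" using c2_pos by (simp add: c2'_def algebra_simps)
    qed
    finally show ?thesis .
  qed
  have "regular_measure N S d c1' c2' R"
    by (rule regular_measure.intro[OF space_N id_borel closed_S S_nonempty d_gt d_lt R c1'(1) c2'_pos]) (fact lo, fact up)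
  then show ?thesis by (rule that)
qed

lemma space_hausdorff: "space (hausdorff_measure d) = UNIV"
  by (simp add: hausdorff_measure_def space_measure_of_conv)

lemma
  fixes S :: "(real ^ 'n) set"
  assumes dS: "d_set d S" and d: "real CARD('n) - 1 < d" "d < real CARD('n)"
  shows d_set_sets: "S \<in> sets (hausdorff_measure d)"
    and d_set_regular: "\<exists>c1 c2. regular_measure (restrict_space (hausdorff_measure d) S) S d c1 c2 1"
proof -
  let ?M = "hausdorff_measure d :: (real ^ 'n) measure" and ?N = "restrict_space (hausdorff_measure d) S"
  obtain c1 c2 where c: "0 < c1" "0 < c2" and
    lo: "\<And>w r. w \<in> S \<Longrightarrow> 0 < r \<Longrightarrow> r \<le> 1 \<Longrightarrow> ennreal (c1 * r powr d) \<le> emeasure ?M (cube w r \<inter> S)" and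
    up: "\<And>w r. w \<in> S \<Longrightarrow> 0 < r \<Longrightarrow> r \<le> 1 \<Longrightarrow> emeasure ?M (cube w r \<inter> S) \<le> ennreal (c2 * r powr d)"
    and S: "S \<noteq> {}" "closed S"
    using dS unfolding d_set_def by blast
  have "cube w r \<inter> S \<in> sets ?M" if "w \<in> S" "0 < r" "r \<le> 1" for w r
  proof (rule ccontr)
    assume "cube w r \<inter> S \<notin> sets ?M"
    \<comment> \<open>Outside its sigma-algebra \<open>emeasure\<close> takes the default value 0,
      which contradicts the positive lower bound.\<close>
    then have "emeasure ?M (cube w r \<inter> S) = 0" by (rule emeasure_notin_sets)
    moreover have "0 < ennreal (c1 * r powr d)" using c that by simp
    ultimately show False using lo[OF that] by (metis not_less)
  qed
  then have op: "U \<inter> S \<in> sets ?M" if "open U" for U using that by (rule sets_of_cubes)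
  show SM: "S \<in> sets ?M" using op[of UNIV] by simp
  have S_int: "S \<inter> space ?M \<in> sets ?M" using SM by (simp add: space_hausdorff)
  have sp: "space ?N = S" by (simp add: space_restrict_space space_hausdorff)
  have em: "emeasure ?N (cube w r \<inter> S) = emeasure ?M (cube w r \<inter> S)" for w r
    by (rule emeasure_restrict_space[OF S_int]) simp
  have id: "(\<lambda>x. x) \<in> borel_measurable ?N"
  proof (rule borel_measurableI)
    fix U :: "(real ^ 'n) set" assume U: "open U"
    have "U \<inter> S \<in> sets ?N" using op[OF U] by (subst sets_restrict_space_iff[OF S_int]) simp
    then show "(\<lambda>x. x) -` U \<inter> space ?N \<in> sets ?N" by (simp add: sp)
  qed
  have "regular_measure ?N S d c1 c2 1"
    by (rule regular_measure.intro[OF sp id S(2,1) d order_refl c]) (simp_all only: em lo up)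
  then show "\<exists>c1 c2. regular_measure ?N S d c1 c2 1" by blast
qed

lemma sup_diam_cube:
  fixes x :: "real ^ 'n"
  assumes r: "0 < r" shows "sup_diam (cube x r) = ennreal (2 * r)"
proof (rule antisym)
  show "sup_diam (cube x r) \<le> ennreal (2 * r)"
    unfolding sup_diam_def
  proof (intro SUP_least ennreal_leI)
    fix y z assume "y \<in> cube x r" "z \<in> cube x r"
    then show "infnorm (y - z) \<le> 2 * r"
      using infnorm_triangle_sub[of y z x] infnorm_sub[of x z] by (simp add: cube_def)
  qed
  define y z where "y = x + (\<chi> i. r)" and "z = x - (\<chi> i. r)"
  have "y \<in> cube x r" "z \<in> cube x r" using r by (simp_all add: y_def z_def mem_cube)
  moreover have "2 * r \<le> infnorm (y - z)"
    using component_le_infnorm_cart[of "y - z"] r by (simp add: y_def z_def)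
  then have "ennreal (2 * r) \<le> ennreal (infnorm (y - z))" by (rule ennreal_leI)
  ultimately show "ennreal (2 * r) \<le> sup_diam (cube x r)"
    unfolding sup_diam_def by (intro SUP_upper2[of y] SUP_upper2[of z]) auto
qed

lemma multi_index_order_count_list: "multi_index_order (count_list is) = length is"
proof (induction "is")
  case (Cons i "is")
  have "(\<Sum>j\<in>UNIV. count_list (i # is) j) = (\<Sum>j\<in>UNIV. count_list is j + (if j = i then 1 else 0))"
    by (rule sum.cong) auto
  then show ?case using Cons by (simp add: multi_index_order_def sum.distrib)
qed (simp add: multi_index_order_def)

text \<open>The constant is built from \<open>C\<close> and k alone, so the final bound is uniform
  over all decompositions, partitions of unity and nearest points. The summand 1 makes it
  positive.\<close>

lemma whitney_intro:
  fixes S :: "(real ^ 'n) set"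
  assumes S: "closed S" and W: "whitney_decomposition S W" and \<phi>: "whitney_partition_of_unity C S W \<phi>"
    and a: "nearest_points S W a"
  shows "whitney S W \<phi> a k (1 + (\<Sum>\<beta>\<in>midx k. \<bar>C \<beta>\<bar>))"
proof
  show "closed S" by (rule S)
  show dy: "dyadic_cube Q" if "Q \<in> W" for Q using W that by (simp add: whitney_decomposition_def)
  have pos: "0 < snd Q" if Q: "Q \<in> W" for Q
  proof -
    obtain j :: int where "snd Q = 2 powi (- j) / 2" using dy[OF Q] unfolding dyadic_cube_def by blast
    moreover have "(0 :: real) < 2 powi (- j)" by (rule zero_less_power_int) simp
    ultimately show ?thesis by linarith
  qed
  have diam: "sup_diam (cube (fst Q) (snd Q)) = ennreal (2 * snd Q)" if "Q \<in> W" for Q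
    by (rule sup_diam_cube[OF pos[OF that]])
  show "2 * snd Q \<le> infnorm (q - s)" if Q: "Q \<in> W" and q: "q \<in> cube (fst Q) (snd Q)" and s: "s \<in> S" for Q q s
  proof -
    have "ennreal (2 * snd Q) \<le> sup_dist (cube (fst Q) (snd Q)) S"
      using W Q diam[OF Q] by (auto simp: whitney_decomposition_def)
    also have "\<dots> \<le> ennreal (infnorm (q - s))"
      unfolding sup_dist_def by (rule INF_lower2[OF q], rule INF_lower[OF s])
    finally show ?thesis by (simp add: infnorm_pos_le)
  qed
  show "a Q \<in> S" if "Q \<in> W" for Q using a that by (simp add: nearest_points_def)
  show "infnorm (fst Q - a Q) \<le> 9 * snd Q" if Q: "Q \<in> W" for Q
  proof (rule field_le_epsilon)
    \<comment> \<open>The distance between Q and \<open>S\<close> is an infimum; a pair q, s that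
      attains it up to e replaces a minimising pair.\<close>
    fix e :: real assume e: "0 < e"
    have "sup_dist (cube (fst Q) (snd Q)) S \<le> 4 * ennreal (2 * snd Q)"
      using W Q diam[OF Q] by (auto simp: whitney_decomposition_def)
    also have "\<dots> = ennreal (8 * snd Q)" using pos[OF Q] by (simp add: ennreal_mult[symmetric] flip: ennreal_numeral)
    also have "\<dots> < ennreal (8 * snd Q + e)" using pos[OF Q] e by (simp add: ennreal_lessI)
    finally obtain q s where qs: "q \<in> cube (fst Q) (snd Q)" "s \<in> S" "ennreal (infnorm (q - s)) < ennreal (8 * snd Q + e)"
      unfolding sup_dist_def by (auto simp: INF_less_iff)
    then have "infnorm (q - s) < 8 * snd Q + e" using infnorm_pos_le[of "q - s"] by (simp add: ennreal_less_iff)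
    moreover have "infnorm (fst Q - q) \<le> snd Q" using qs(1) by (simp add: cube_def infnorm_sub)
    ultimately have "infnorm (fst Q - s) \<le> 9 * snd Q + e"
      using infnorm_triangle_sub[of "fst Q" s q] by simp
    moreover have "ennreal (infnorm (fst Q - a Q)) \<le> ennreal (infnorm (fst Q - s))"
    proof -
      have "ennreal (infnorm (fst Q - a Q)) = sup_dist {fst Q} S" using a Q by (simp add: nearest_points_def)
      also have "\<dots> \<le> ennreal (infnorm (fst Q - s))"
        unfolding sup_dist_def by (rule INF_lower2[of "fst Q"], simp, rule INF_lower[OF qs(2)])
      finally show ?thesis .
    qed
    then have "infnorm (fst Q - a Q) \<le> infnorm (fst Q - s)" by (simp add: infnorm_pos_le)
    ultimately show "infnorm (fst Q - a Q) \<le> 9 * snd Q + e" by simp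
  qed
  have \<phi>Q: "smooth (\<phi> Q)" "0 \<le> \<phi> Q x" "\<phi> Q x \<le> 1" "closure {x. \<phi> Q x \<noteq> 0} \<subseteq> cube (fst Q) (9 / 8 * snd Q)"
    "ennreal \<bar>mixed_partial is (\<phi> Q) x\<bar> \<le> ennreal (C (count_list is)) / sup_diam (cube (fst Q) (snd Q)) ^ length is"
    if "Q \<in> W" for Q x "is"
    using \<phi> that unfolding whitney_partition_of_unity_def by auto
  show "0 \<le> \<phi> Q x" "\<phi> Q x \<le> 1" if "Q \<in> W" for Q x using \<phi>Q[OF that] by auto
  show "x \<in> cube (fst Q) (9 / 8 * snd Q)" if "Q \<in> W" "\<phi> Q x \<noteq> 0" for Q x
    using \<phi>Q(4)[OF that(1)] closure_subset[of "{x. \<phi> Q x \<noteq> 0}"] that(2) by blast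
  show "((\<lambda>Q. \<phi> Q x) has_sum 1) W" if "x \<notin> S" for x
  proof -
    have "((\<lambda>Q. \<phi> Q x) has_sum indicat_real (- S) x) W" using \<phi> unfolding whitney_partition_of_unity_def by blast
    then show ?thesis using that by simp
  qed
  show "dbound k (snd Q / 2) y (1 + (\<Sum>\<beta>\<in>midx k. \<bar>C \<beta>\<bar>)) (\<phi> Q)" if Q: "Q \<in> W" for Q y
  proof (rule dbound_smooth[OF \<phi>Q(1)[OF Q]])
    fix "is" :: "'n list" assume l: "length is \<le> k"
    let ?r = "snd Q" and ?C = "1 + (\<Sum>\<beta>\<in>midx k. \<bar>C \<beta>\<bar>)"
    have r: "0 < ?r" by (rule pos[OF Q])
    have "count_list is \<in> midx k" using l by (simp add: midx_def multi_index_order_count_list)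
    then have "\<bar>C (count_list is)\<bar> \<le> (\<Sum>\<beta>\<in>midx k. \<bar>C \<beta>\<bar>)" by (intro member_le_sum) auto
    then have C: "C (count_list is) \<le> ?C" "0 < ?C" by linarith+
    have "ennreal \<bar>mixed_partial is (\<phi> Q) y\<bar> \<le> ennreal (C (count_list is)) / ennreal (2 * ?r) ^ length is"
      using \<phi>Q(5)[OF Q] by (simp only: diam[OF Q])
    also have "\<dots> \<le> ennreal ?C / ennreal (2 * ?r) ^ length is" by (intro divide_right_mono_ennreal ennreal_leI C)
    also have "\<dots> = ennreal (?C / (2 * ?r) ^ length is)" 
      using r C(2) by (simp only: ennreal_power divide_ennreal mult_nonneg_nonneg zero_le_numeral less_imp_le zero_less_power mult_pos_pos zero_less_numeral)
    finally have "\<bar>mixed_partial is (\<phi> Q) y\<bar> \<le> ?C / (2 * ?r) ^ length is"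
      using r C by (subst (asm) ennreal_le_iff) auto
    \<comment> \<open>The hypothesis is on the scale of the diameter \<open>2 * ?r\<close>; it is
      weakened to the scale \<open>?r / 2\<close> of the cube around \<open>a Q\<close>.\<close>
    also have "\<dots> \<le> ?C / (?r / 2) ^ length is"
      using r C by (intro divide_left_mono power_mono mult_pos_pos zero_less_power) auto
    finally show "\<bar>mixed_partial is (\<phi> Q) y\<bar> \<le> ?C / (?r / 2) ^ length is" .
  qed
qed

section \<open>The extension theorem\<close>

lemma (in regular_measure) loc_int_of_Lp:
  assumes f: "f \<in> borel_measurable N" and p: "1 \<le> p"
    and fin: "(\<integral>\<^sup>+u. ennreal_powr (ennreal \<bar>f u\<bar>) p \<partial>N) < \<infinity>"
  shows "loc_int f"
  unfolding loc_int_def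
proof (intro conjI ballI allI impI f)
  fix w r assume w: "w \<in> S" and r: "0 < r \<and> r \<le> R"
  have [measurable]: "f \<in> borel_measurable N" by (rule f)
  have [measurable]: "cube w r \<inter> S \<in> sets N" by (rule sets_N[OF cube_borel])
  have "(\<integral>\<^sup>+x. ennreal (norm (indicat_real (cube w r \<inter> S) x *\<^sub>R f x)) \<partial>N)
      \<le> (\<integral>\<^sup>+x. indicator (cube w r \<inter> S) x + ennreal_powr (ennreal \<bar>f x\<bar>) p \<partial>N)"
  proof (rule nn_integral_mono)
    fix x
    have "ennreal \<bar>f x\<bar> \<le> 1 + ennreal_powr (ennreal \<bar>f x\<bar>) p"
      using le_add_powr[of 1 p "ennreal \<bar>f x\<bar>"] p by simp
    then show "ennreal (norm (indicat_real (cube w r \<inter> S) x *\<^sub>R f x))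
        \<le> indicator (cube w r \<inter> S) x + ennreal_powr (ennreal \<bar>f x\<bar>) p"
      by (simp add: indicator_def)
  qed
  also have "\<dots> = emeasure N (cube w r \<inter> S) + (\<integral>\<^sup>+u. ennreal_powr (ennreal \<bar>f u\<bar>) p \<partial>N)"
    by (subst nn_integral_add) auto
  also have "\<dots> < \<infinity>"
    using le_less_trans[OF upper[OF w, of r] ennreal_less_top] r fin by (simp add: ennreal_add_less_top)
  finally have "integrable N (\<lambda>x. indicat_real (cube w r \<inter> S) x *\<^sub>R f x)" by (intro integrableI_bounded) auto
  moreover have "integrable N (\<lambda>x. indicat_real (cube w r \<inter> S) x *\<^sub>R f x) = integrable N (\<lambda>x. indicat_real (cube w r) x *\<^sub>R f x)"
    by (rule Bochner_Integration.integrable_cong) (auto simp: space_N indicator_def)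
  ultimately show "set_integrable N (cube w r) f" by (simp add: set_integrable_def)
qed

section \<open>Restriction of the measure to a subset\<close>

context
  fixes M :: "(real ^ 'n) measure" and S :: "(real ^ 'n) set"
  assumes S: "S \<inter> space M \<in> sets M"
begin

lemma set_LINT_restrict_space:
  fixes g :: "real ^ 'n \<Rightarrow> real"
  shows "(LINT x:K \<inter> S|M. g x) = (LINT x:K|restrict_space M S. g x)"
  unfolding set_lebesgue_integral_def integral_restrict_space[OF S]
  by (rule Bochner_Integration.integral_cong) (auto simp: indicator_def)

lemma set_nn_integral_restrict_space':
  "(\<integral>\<^sup>+x\<in>K \<inter> S. g x \<partial>M) = (\<integral>\<^sup>+x\<in>K. g x \<partial>restrict_space M S)"
  unfolding nn_integral_restrict_space[OF S] by (rule nn_integral_cong) (auto simp: indicator_def)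

lemma poly_proj_restrict_space: "poly_proj M (K \<inter> S) m f x = poly_proj (restrict_space M S) K m f x"
  unfolding poly_proj_def orthonormal_poly_basis_def set_LINT_restrict_space ..

lemma local_approx_restrict_space: "local_approx k M f (A \<inter> S) = local_approx k (restrict_space M S) f (A \<inter> S)"
proof -
  have "(\<integral>\<^sup>+x\<in>A \<inter> S. g x \<partial>M) = (\<integral>\<^sup>+x\<in>A \<inter> S. g x \<partial>restrict_space M S)" for g
    using set_nn_integral_restrict_space'[where K = "A \<inter> S"] by (simp add: Int_assoc)
  moreover have "emeasure (restrict_space M S) (A \<inter> S) = emeasure M (A \<inter> S)"
    by (rule emeasure_restrict_space[OF S]) simp
  ultimately show ?thesis by (simp only: local_approx_def)
qed

lemma Lp_norm_restrict_space:
  "Lp_norm p M S F = ennreal_powr (\<integral>\<^sup>+x. ennreal_powr (F x) p \<partial>restrict_space M S) (1 / p)"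
  using set_nn_integral_restrict_space'[where K = UNIV] by (simp add: Lp_norm_def)

end

text \<open>Twice the larger summand controls the sum. With exponent \<open>1 / p\<close> this
  separates the two parts of the right-hand side.\<close>

lemma ennreal_powr_add_le:
  assumes q: "0 < q"
  shows "ennreal_powr (x + y) q \<le> ennreal (2 powr q) * (ennreal_powr x q + ennreal_powr y q)"
proof -
  have "x + y \<le> ennreal 2 * max x y"
    using add_mono[of x "max x y" y "max x y"] by (simp add: mult_2)
  then have "ennreal_powr (x + y) q \<le> ennreal_powr (ennreal 2 * max x y) q" by (rule ennreal_powr_mono[OF _ q])
  also have "\<dots> = ennreal (2 powr q) * ennreal_powr (max x y) q"
    by (simp only: ennreal_powr_mult[OF q] ennreal_powr_ennreal zero_le_numeral)
  also have "\<dots> \<le> ennreal (2 powr q) * (ennreal_powr x q + ennreal_powr y q)"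
    by (intro mult_left_mono) (auto simp: max_def)
  finally show ?thesis .
qed

text \<open>The bounds \<open>C\<close> for the derivatives of the partition of unity are fixed
  before c, while \<open>W\<close>, \<phi> and a are quantified after it. So c is uniform over all
  choices in the construction that respect the same \<open>C\<close>.\<close>

theorem theorem6p7:
  fixes S :: "(real ^ 'n) set" and d p \<alpha> :: real and k :: nat
    and C :: "('n \<Rightarrow> nat) \<Rightarrow> real"
  assumes "d_set d S" and "real CARD('n) - 1 < d" and "d < real CARD('n)"
    and "1 < p" and "0 < \<alpha>" and "\<alpha> < real k"
  shows "\<exists>c::real. c > 0 \<and> (\<forall>W \<phi> a.
    whitney_decomposition S W \<and> whitney_partition_of_unity C S W \<phi> \<and> nearest_points S W a \<longrightarrow>
    (\<forall>f \<in> Lp_space p (hausdorff_measure d) S.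
      Lp_norm p lebesgue UNIV (\<lambda>x. \<Sum>j. ennreal (2 powr (real j * \<alpha>)) *
          local_approx k lebesgue (whitney_ext 16000 d S W \<phi> a k f) (cube x (2 powr (- real j))))
      + Lp_norm p lebesgue UNIV (\<lambda>x. ennreal \<bar>whitney_ext 16000 d S W \<phi> a k f x\<bar>)
      \<le> ennreal c *
        (ennreal_powr
           (\<Sum>j. ennreal_powr
              (ennreal (2 powr (real j * (\<alpha> - (real CARD('n) - d) / p))) *
               Lp_norm p (hausdorff_measure d) S
                 (\<lambda>x. local_approx k (hausdorff_measure d) f (cube x (2 powr (- real j)) \<inter> S)))
              p)
           (1 / p)
         + Lp_norm p (hausdorff_measure d) S (\<lambda>x. ennreal \<bar>f x\<bar>))))"
proof -
  let ?M = "hausdorff_measure d :: (real ^ 'n) measure"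
  define N where "N = restrict_space ?M S"
  define q where "q = 1 / p"
  have p: "1 \<le> p" "0 < p" and q: "0 < q" using assms(4) by (auto simp: q_def)
  obtain m where m: "k = Suc m" using assms(5,6) by (cases k) auto
  have k1: "int k - 1 = int m" by (simp add: m)
  have SM: "S \<inter> space ?M \<in> sets ?M"
    using d_set_sets[OF assms(1-3)] by (simp add: space_hausdorff)
  define C\<^sub>\<phi> where "C\<^sub>\<phi> = 1 + (\<Sum>\<beta>\<in>midx k. \<bar>C \<beta>\<bar>)"
  have C\<^sub>\<phi>: "0 < C\<^sub>\<phi>" 
    unfolding C\<^sub>\<phi>_def by (rule add_pos_nonneg[OF zero_less_one sum_nonneg]) simp
  obtain c1 c2 where "regular_measure N S d c1 c2 1"
    unfolding N_def using d_set_regular[OF assms(1-3)] by blast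
  \<comment> \<open>\<open>4194304 = 2 ^ 22\<close> bounds the radii of all comparison cubes on the
    grid, whose coarsest scale is 1.\<close>
  then obtain c1' c2' where rm: "regular_measure N S d c1' c2' 4194304"
    by (rule regular_measure_enlarge[where R = 4194304]) simp_all
  interpret regular_measure N S d c1' c2' 4194304 by (rule rm)
  obtain C1 where C1: "0 < C1" and approx: "\<And>W \<phi> a f F. whitney S W \<phi> a (Suc m) C\<^sub>\<phi> \<Longrightarrow> loc_int f \<Longrightarrow>
    \<forall>y. y \<notin> S \<longrightarrow> F y = (\<Sum>\<^sub>\<infinity>Q\<in>W. \<phi> Q y * wproj N a m Q f y) \<Longrightarrow>
    (\<integral>\<^sup>+x. ennreal_powr (\<Sum>j. ennreal (2 powr (real j * \<alpha>)) * local_approx (Suc m) lebesgue F (cube x (scale j))) p \<partial>lebesgue)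
    \<le> ennreal C1 * ((\<Sum>j. ennreal (2 powr (real j * (p * \<alpha> - (real CARD('n) - d)))) *
          (\<integral>\<^sup>+u. ennreal_powr (local_approx (Suc m) N f (cube u (scale j) \<inter> S)) p \<partial>N))
        + (\<integral>\<^sup>+u. ennreal_powr (ennreal \<bar>f u\<bar>) p \<partial>N))"
    by (rule ext_approx_bound[OF order_refl p(1) assms(5) assms(6)[unfolded m] C\<^sub>\<phi>]) (erule that)
  obtain C2 where C2: "0 < C2" and Lp: "\<And>W \<phi> a k C\<^sub>\<phi> f F. whitney S W \<phi> a k C\<^sub>\<phi> \<Longrightarrow> loc_int f \<Longrightarrow>
    (\<forall>y. y \<notin> S \<longrightarrow> F y = (\<Sum>\<^sub>\<infinity>Q\<in>W. \<phi> Q y * wproj N a m Q f y)) \<Longrightarrow>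
    (\<integral>\<^sup>+x. ennreal_powr (ennreal \<bar>F x\<bar>) p \<partial>lebesgue) \<le> ennreal C2 * (\<integral>\<^sup>+u. ennreal_powr (ennreal \<bar>f u\<bar>) p \<partial>N)"
    by (rule ext_Lp_bound[OF order_refl p(1), where m = m]) (erule that)
  \<comment> \<open>The factor \<open>2 powr q\<close> arises when the p-th root of
    \<open>X + Y\<close> is split.\<close>
  define c where "c = C1 powr q * 2 powr q + C2 powr q"
  have c: "0 < c" using C1 C2 by (simp add: c_def add_pos_pos)
  show ?thesis
  proof (intro exI[of _ c] conjI c allI impI ballI)
    fix W \<phi> a f
    assume h: "whitney_decomposition S W \<and> whitney_partition_of_unity C S W \<phi> \<and> nearest_points S W a"
      and f: "f \<in> Lp_space p ?M S"
    let ?F = "whitney_ext 16000 d S W \<phi> a k f"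
    have wh: "whitney S W \<phi> a k C\<^sub>\<phi>"
      unfolding C\<^sub>\<phi>_def using h by (intro whitney_intro[OF closed_S]) auto
    interpret whitney S W \<phi> a k C\<^sub>\<phi> by (rule wh)
    define X where "X = (\<Sum>j. ennreal (2 powr (real j * (p * \<alpha> - (real CARD('n) - d)))) *
          (\<integral>\<^sup>+u. ennreal_powr (local_approx k N f (cube u (scale j) \<inter> S)) p \<partial>N))"
    define Y where "Y = (\<integral>\<^sup>+u. ennreal_powr (ennreal \<bar>f u\<bar>) p \<partial>N)"
    have nf: "Lp_norm p ?M S (\<lambda>x. ennreal \<bar>f x\<bar>) = ennreal_powr Y q"
      unfolding Y_def N_def q_def by (rule Lp_norm_restrict_space[OF SM])
    have "Y < \<infinity>"
    proof (rule ccontr)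
      assume "\<not> Y < \<infinity>"
      then have "Y = top" by (simp add: not_less top_unique)
      then show False using f nf by (simp add: Lp_space_def ennreal_powr_top)
    qed
    then have lf: "loc_int f"
      using f p by (intro loc_int_of_Lp) (auto simp: Lp_space_def Y_def N_def)
    have proj: "whitney_proj 16000 d S a (int k - 1) Q f y = wproj N a m Q f y" if Q: "Q \<in> W" for Q y
    proof -
      have "(sup_diam (cube (fst Q) (snd Q)) \<le> ennreal 16000) = (snd Q \<le> 8000)"
        unfolding sup_diam_cube[OF snd_pos[OF Q]] by (subst ennreal_le_iff) auto
      then show ?thesis
        by (simp only: whitney_proj_def wproj_def k1 N_def poly_proj_restrict_space[OF SM])
    qed
    have F: "\<forall>y. y \<notin> S \<longrightarrow> ?F y = (\<Sum>\<^sub>\<infinity>Q\<in>W. \<phi> Q y * wproj N a m Q f y)"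
      by (auto simp: whitney_ext_def proj intro!: infsum_cong)
    have "Lp_norm p lebesgue UNIV (\<lambda>x. \<Sum>j. ennreal (2 powr (real j * \<alpha>)) * local_approx k lebesgue ?F (cube x (2 powr (- real j))))
        \<le> ennreal_powr (ennreal C1 * (X + Y)) q"
      unfolding Lp_norm_def q_def[symmetric]
      using approx[OF wh[unfolded m] lf F] q
      by (intro ennreal_powr_mono) (simp_all add: X_def Y_def m scale_def)
    also have "\<dots> \<le> ennreal (C1 powr q) * (ennreal (2 powr q) * (ennreal_powr X q + ennreal_powr Y q))"
      unfolding ennreal_powr_mult[OF q] ennreal_powr_ennreal[OF less_imp_le[OF C1]]
      by (intro mult_left_mono ennreal_powr_add_le q) simp
    also have "\<dots> = ennreal (C1 powr q * 2 powr q) * (ennreal_powr X q + ennreal_powr Y q)"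
      by (simp add: ennreal_mult mult.assoc)
    finally have A: "Lp_norm p lebesgue UNIV (\<lambda>x. \<Sum>j. ennreal (2 powr (real j * \<alpha>)) * local_approx k lebesgue ?F (cube x (2 powr (- real j))))
        \<le> ennreal (C1 powr q * 2 powr q) * (ennreal_powr X q + ennreal_powr Y q)" .
    have "Lp_norm p lebesgue UNIV (\<lambda>x. ennreal \<bar>?F x\<bar>) \<le> ennreal_powr (ennreal C2 * Y) q"
      unfolding Lp_norm_def q_def[symmetric]
      using Lp[OF wh lf F] q by (intro ennreal_powr_mono) (simp_all add: Y_def)
    also have "\<dots> = ennreal (C2 powr q) * ennreal_powr Y q"
      unfolding ennreal_powr_mult[OF q] ennreal_powr_ennreal[OF less_imp_le[OF C2]] ..
    also have "\<dots> \<le> ennreal (C2 powr q) * (ennreal_powr X q + ennreal_powr Y q)" by (intro mult_left_mono) auto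
    finally have B: "Lp_norm p lebesgue UNIV (\<lambda>x. ennreal \<bar>?F x\<bar>)
        \<le> ennreal (C2 powr q) * (ennreal_powr X q + ennreal_powr Y q)" .
    \<comment> \<open>Taking p-th powers undoes the root in \<open>Lp_norm\<close> and turns the
      weight exponent \<open>\<alpha> - (n - d) / p\<close> into
      \<open>p * \<alpha> - (n - d)\<close>, the form in which the scales were summed.\<close>
    have X: "(\<Sum>j. ennreal_powr
              (ennreal (2 powr (real j * (\<alpha> - (real CARD('n) - d) / p))) *
               Lp_norm p ?M S (\<lambda>x. local_approx k ?M f (cube x (2 powr (- real j)) \<inter> S))) p) = X"
      unfolding X_def
    proof (rule suminf_cong)
      fix j
      have "(2 powr (real j * (\<alpha> - (real CARD('n) - d) / p))) powr p = 2 powr (real j * (p * \<alpha> - (real CARD('n) - d)))"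
      proof -
        have "(\<alpha> - D / p) * p = p * \<alpha> - D" for D using p(2) by (simp add: left_diff_distrib)
        then show ?thesis by (simp only: powr_powr mult.assoc)
      qed
      moreover have "ennreal_powr (Lp_norm p ?M S (\<lambda>x. local_approx k ?M f (cube x (2 powr (- real j)) \<inter> S))) p
          = (\<integral>\<^sup>+u. ennreal_powr (local_approx k N f (cube u (scale j) \<inter> S)) p \<partial>N)"
        unfolding Lp_norm_restrict_space[OF SM] N_def local_approx_restrict_space[OF SM] scale_def
        using ennreal_powr_inverse[of "1 / p"] p by simp
      ultimately show "ennreal_powr (ennreal (2 powr (real j * (\<alpha> - (real CARD('n) - d) / p))) *
          Lp_norm p ?M S (\<lambda>x. local_approx k ?M f (cube x (2 powr (- real j)) \<inter> S))) p
          = ennreal (2 powr (real j * (p * \<alpha> - (real CARD('n) - d)))) *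
            (\<integral>\<^sup>+u. ennreal_powr (local_approx k N f (cube u (scale j) \<inter> S)) p \<partial>N)"
        by (simp only: ennreal_powr_mult[OF p(2)] ennreal_powr_ennreal powr_ge_zero)
    qed
    have "ennreal c = ennreal (C1 powr q * 2 powr q) + ennreal (C2 powr q)" by (simp add: c_def)
    then have "Lp_norm p lebesgue UNIV (\<lambda>x. \<Sum>j. ennreal (2 powr (real j * \<alpha>)) * local_approx k lebesgue ?F (cube x (2 powr (- real j))))
        + Lp_norm p lebesgue UNIV (\<lambda>x. ennreal \<bar>?F x\<bar>) \<le> ennreal c * (ennreal_powr X q + ennreal_powr Y q)"
      using add_mono[OF A B] by (simp only: distrib_right)
    then show "Lp_norm p lebesgue UNIV (\<lambda>x. \<Sum>j. ennreal (2 powr (real j * \<alpha>)) * local_approx k lebesgue ?F (cube x (2 powr (- real j))))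
      + Lp_norm p lebesgue UNIV (\<lambda>x. ennreal \<bar>?F x\<bar>)
      \<le> ennreal c * (ennreal_powr (\<Sum>j. ennreal_powr
              (ennreal (2 powr (real j * (\<alpha> - (real CARD('n) - d) / p))) *
               Lp_norm p ?M S (\<lambda>x. local_approx k ?M f (cube x (2 powr (- real j)) \<inter> S))) p) (1 / p)
         + Lp_norm p ?M S (\<lambda>x. ennreal \<bar>f x\<bar>))"
      unfolding X nf q_def .
  qed
qed

end
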